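(* Let $0<\alpha<2$. Then $$\frac{W_{\alpha,N}}{\mathbb{E}\left(W_{\alpha,N}\right)}\longrightarrow M_\alpha\quad\text{in probability as }N\to\infty .$$
   Context: Let $p_1<p_2<\cdots$ be the prime numbers in increasing order, and let $(\theta_p)_{p\text{ prime}}$ be independent random variables, each uniformly distributed on $[0,2\pi]$; $\mathbb{P}$ and $\mathbb{E}$ denote the associated probability and expectation. For $N\in\mathbb{N}$ define the random field $$X_N(x)=\sum_{j=1}^N\frac{1}{\sqrt{p_j}}\left(\cos(x\log p_j)\cos(\theta_{p_j})+\sin(x\log p_j)\sin(\theta_{p_j})\right),\qquad x\in[0,1].$$ With $\mathrm{Leb}$ denoting Lebesgue measure, set $$W_{\alpha,N}=\mathrm{Leb}\left\{x\in[0,1]:\ X_N(x)>\tfrac{\alpha}{2}\log\log N\right\}.$$ The random variable $M_\alpha$ is the almost sure limit $$M_\alpha=\lim_{N\to\infty}\int_0^1\frac{e^{\alpha X_N(x)}}{\mathbb{E}\,e^{\alpha X_N(x)}}\,dx ,$$ which exists almost surely (it is known to be non-trivial for $0<\alpha<2$). *)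

theory Defs
  imports "HOL-Probability.Probability" "HOL-Computational_Algebra.Primes"
begin

text \<open>
  \<^const>\<open>enumerate\<close> counts from 0, so \<open>p\<^sub>j\<close> is \<open>prime_seq j\<close> for \<open>j \<ge> 1\<close>;
  the junk value \<open>prime_seq 0 = 2\<close> is never used.
\<close>
definition prime_seq :: "nat \<Rightarrow> nat" where
  "prime_seq j = enumerate {p. prime p} (j - 1)"

definition field_X :: "(nat \<Rightarrow> 'a \<Rightarrow> real) \<Rightarrow> nat \<Rightarrow> real \<Rightarrow> 'a \<Rightarrow> real" where
  "field_X \<theta> N x \<omega> =
     (\<Sum>j=1..N. 1 / sqrt (real (prime_seq j)) *
        (cos (x * ln (real (prime_seq j))) * cos (\<theta> (prime_seq j) \<omega>) +
         sin (x * ln (real (prime_seq j))) * sin (\<theta> (prime_seq j) \<omega>)))"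

definition level_W :: "(nat \<Rightarrow> 'a \<Rightarrow> real) \<Rightarrow> real \<Rightarrow> nat \<Rightarrow> 'a \<Rightarrow> real" where
  "level_W \<theta> \<alpha> N \<omega> =
     measure lborel {x \<in> {0..1}. field_X \<theta> N x \<omega> > \<alpha> / 2 * ln (ln (real N))}"

definition chaos_M_approx ::
  "'a measure \<Rightarrow> (nat \<Rightarrow> 'a \<Rightarrow> real) \<Rightarrow> real \<Rightarrow> nat \<Rightarrow> 'a \<Rightarrow> real" where
  "chaos_M_approx P \<theta> \<alpha> N \<omega> =
     (LBINT x:{0..1}. exp (\<alpha> * field_X \<theta> N x \<omega>) /
        prob_space.expectation P (\<lambda>\<eta>. exp (\<alpha> * field_X \<theta> N x \<eta>)))"

text \<open>
  The limit exists almost surely; on the remaining null event \<^const>\<open>lim\<close> takes an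
  unspecified constant value.
\<close>
definition chaos_M ::
  "'a measure \<Rightarrow> (nat \<Rightarrow> 'a \<Rightarrow> real) \<Rightarrow> real \<Rightarrow> 'a \<Rightarrow> real" where
  "chaos_M P \<theta> \<alpha> \<omega> = lim (\<lambda>N. chaos_M_approx P \<theta> \<alpha> N \<omega>)"

text \<open>
  Measurability is part of the definition because \<^const>\<open>measure\<close> is 0 on
  non-measurable sets.
\<close>
definition converges_in_probability ::
  "'a measure \<Rightarrow> (nat \<Rightarrow> 'a \<Rightarrow> real) \<Rightarrow> ('a \<Rightarrow> real) \<Rightarrow> bool" where
  "converges_in_probability P Y Z \<longleftrightarrow>
     (\<forall>n. Y n \<in> borel_measurable P) \<and> Z \<in> borel_measurable P \<and>
     (\<forall>\<epsilon>>0. (\<lambda>n. measure P {\<omega> \<in> space P. \<bar>Y n \<omega> - Z \<omega>\<bar> > \<epsilon>}) \<longlonglongrightarrow> 0)"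

end

theory Submission
 imports Defs
begin

text \<open>
 Up to normalisation, \<open>W\<close> and the chaos approximation are the integrals over \<open>x\<close> of the indicator
 \<open>V(x)\<close> of \<open>X(x) > L\<close> and of the exponential \<open>A(x)\<close>, where \<open>L = (\<alpha> / 2) log log N\<close>. They differ by
 the factor \<open>g(X(x) - L)\<close> with \<open>g(y) = exp(- \<alpha> y)\<close> for \<open>y > 0\<close>. Under exponential tilting
 \<open>X - L\<close> obeys a local limit theorem, jointly at two points, so for almost every pair \<open>x \<noteq> y\<close> the
 moments \<open>E[V(x) V(y)]\<close>, \<open>E[V(x) A(y)]\<close> and \<open>E[A(x) A(y)]\<close> agree asymptotically and
 \<open>E[(V - A)(x) (V - A)(y)]\<close> tends to 0. A kernel whose Fourier transform has compact support
 reduces the local limit theorem to bounded frequencies.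

 Second moments may diverge, so points at which the field exceeds \<open>\<alpha> / 2 + \<eta>\<close> times the sum of
 \<open>1 / p\<close> at some scale \<open>exp (exp m)\<close> are discarded first. They contribute little to the first moment,
 and the remaining two-point function is dominated by \<open>|x - y|\<close> to a power greater than \<open>-1\<close> for
 every \<open>\<alpha> < 2\<close>. The pole of zeta at 1 compares the covariance with \<open>log (1 / |x - y|)\<close>. Finally
 the chaos approximation is a nonnegative martingale and so converges almost surely.
\<close>

section \<open>Sums over primes\<close>

text \<open>The second moment of the chaos is comparable to an integral of |x - y| to the power
  -\<alpha>^2/2, infinite once \<alpha>^2 >= 2. Truncation brings this exponent back above -1 while
  changing first moments by a geometrically small amount.

  The factor \<open>g\<close> has tilted mean of order 1 / \<open>sd N\<close>, so two-point moments
  are needed up to errors o(1 / \<open>S N\<close>). This is why a local limit theorem is used and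
  not a central one.

  The local limit at two points requires the cosine sum over primes to be o(\<open>sd N\<close>)
  from both sides. An upper bound, uniform in the cutoff, follows from the size of zeta near its
  pole. A lower bound at a fixed distance would amount to keeping zeta away from 0 near the line Re
  s = 1. Instead, positivity of a Fourier transform turns the upper bound into a bound in L^1. This
  gives smallness almost everywhere, but only along subsequences, and so convergence in probability
  is proved by contradiction along a subsequence.\<close>

lemma norm_one_plus_le_exp: "norm (1 + wt :: complex) \<le> exp (Re wt + (norm wt)^2 / 2)"
proof (rule power2_le_imp_le)
 have "(norm (1 + wt))^2 = 1 + (2 * Re wt + (norm wt)^2)"
  unfolding cmod_power2 by (simp add: power2_eq_square algebra_simps)
 also have "... \<le> exp (2 * Re wt + (norm wt)^2)" by (rule exp_ge_add_one_self)
 also have "... = (exp (Re wt + (norm wt)^2 / 2))^2"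
  by (simp add: power2_eq_square flip: exp_add)
 finally show "(norm (1 + wt))^2 \<le> (exp (Re wt + (norm wt)^2 / 2))^2" .
qed simp

definition prime_block :: "nat => nat set" where
 "prime_block k = {p. prime p \<and> 2 ^ k < p \<and> p \<le> 2 ^ Suc k}"

definition primes_upto :: "nat => nat set" where
 "primes_upto N = {p. prime p \<and> p \<le> N}"

lemma finite_prime_block [simp]: "finite (prime_block k)"
 by (rule finite_subset[of _ "{..2 ^ Suc k}"]) (auto simp: prime_block_def)

lemma finite_primes_upto [simp]: "finite (primes_upto N)"
 by (rule finite_subset[of _ "{..N}"]) (auto simp: primes_upto_def)

lemma prod_primes_dvd:
 fixes n :: nat
 assumes "finite A" "\<And>p. p \<in> A ==> prime p \<and> p dvd n"
 shows "\<Prod>A dvd n"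
 using assms
proof (induction A rule: finite_induct)
 case (insert p A)
 have "coprime p (\<Prod>A)"
  using insert by (intro prod_coprime_right) (metis insertCI primes_coprime)
 thus ?case using insert by (auto intro: divides_mult)
qed simp

text \<open>Chebyshev's argument with n = 2^k: every prime in (n, 2n] divides the central binomial
  coefficient, which is at most 4^n. Each such prime exceeds 2^k, so comparing exponents of 2 bounds
  their number.\<close>

lemma card_prime_block: "k * card (prime_block k) \<le> 2 * 2 ^ k"
proof -
 define n :: nat where "n = 2 ^ k"
 have "p dvd (2 * n choose n)" if p: "p \<in> prime_block k" for p
 proof -
  have pr: "prime p" "n < p" "p \<le> 2 * n" using p by (auto simp: prime_block_def n_def)
  have "fact n * fact n * (2 * n choose n) = (fact (2 * n) :: nat)"
   using binomial_fact_lemma[of n "2 * n"] by simp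
  moreover have "p dvd fact (2 * n)" using pr by (simp add: prime_dvd_fact_iff)
  moreover have "\<not> p dvd fact n" using pr by (simp add: prime_dvd_fact_iff)
  ultimately show ?thesis using pr(1) by (metis prime_dvd_mult_iff)
 qed
 hence "\<Prod>(prime_block k) dvd (2 * n choose n)"
  by (intro prod_primes_dvd) (auto simp: prime_block_def)
 hence "\<Prod>(prime_block k) \<le> (2 * n choose n)" by (intro dvd_imp_le) auto
 also have "... \<le> 2 ^ (2 * n)"
 proof -
  have "(2 * n choose n) \<le> (\<Sum>j\<le>2*n. (2 * n choose j))" by (rule member_le_sum) auto
  thus ?thesis by (simp add: choose_row_sum)
 qed
 finally have 1: "\<Prod>(prime_block k) \<le> 2 ^ (2 * n)" .
 have "(2 ^ k) ^ card (prime_block k) = (\<Prod>p\<in>prime_block k. 2 ^ k :: nat)" by simp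
 also have "... \<le> \<Prod>(prime_block k)" by (intro prod_mono) (auto simp: prime_block_def)
 finally have "(2::nat) ^ (k * card (prime_block k)) \<le> 2 ^ (2 * n)"
  using 1 by (simp add: power_mult)
 thus ?thesis unfolding n_def by (subst (asm) power_increasing_iff) auto
qed

text \<open>\<open>max 1 k\<close> takes care of \<open>k = 0\<close>, where the block is {2} while
  2 / 0 would be 0.\<close>

lemma sum_prime_block: "(\<Sum>p\<in>prime_block k. 1 / real p) \<le> 2 / real (max 1 k)"
proof (cases "k = 0")
 case True
 have "prime_block 0 \<subseteq> {2}" by (auto simp: prime_block_def)
 hence "(\<Sum>p\<in>prime_block 0. 1 / real p) \<le> (\<Sum>p\<in>{2}. 1 / real p)" by (intro sum_mono2) auto
 thus ?thesis using True by simp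
next
 case False
 have "(\<Sum>p\<in>prime_block k. 1 / real p) \<le> (\<Sum>p\<in>prime_block k. 1 / 2 ^ k)"
 proof (intro sum_mono divide_left_mono)
  fix p assume "p \<in> prime_block k"
  hence "2 ^ k < p" by (simp add: prime_block_def)
  hence "real (2 ^ k) < real p" by (rule of_nat_less_iff[THEN iffD2])
  thus "2 ^ k \<le> real p" "0 < real p * 2 ^ k" using \<open>2 ^ k < p\<close> by (simp_all add: zero_less_mult_iff)
 qed auto
 also have "... = real (card (prime_block k)) / 2 ^ k" by simp
 also have "... \<le> 2 / real k"
 proof -
  have "real (k * card (prime_block k)) \<le> real (2 * 2 ^ k)"
   using card_prime_block by (rule of_nat_mono)
  thus ?thesis using False by (simp add: field_simps)
 qed
 finally show ?thesis using False by (simp add: max_def)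
qed

lemma sum_primes_upto_pow2:
 fixes f :: "nat => 'b::comm_monoid_add"
 shows "(\<Sum>p\<in>primes_upto (2 ^ K). f p) = (\<Sum>k<K. \<Sum>p\<in>prime_block k. f p)"
proof (induction K)
 case 0
 have "primes_upto 1 = {}" by (auto simp: primes_upto_def dest: prime_gt_1_nat)
 thus ?case by simp
next
 case (Suc K)
 have "primes_upto (2 ^ Suc K) = primes_upto (2 ^ K) \<union> prime_block K"
  by (auto simp: primes_upto_def prime_block_def)
 moreover have "primes_upto (2 ^ K) \<inter> prime_block K = {}"
  by (auto simp: primes_upto_def prime_block_def)
 ultimately show ?case using Suc by (simp add: sum.union_disjoint)
qed

text \<open>The upper half of Mertens's first theorem. On block j the logarithm is at most (j + 1)
  ln 2 and the reciprocals sum to at most 2 / j, so each block contributes O(1), and the number of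
  blocks is comparable to ln N.\<close>

lemma sum_log_prime_le:
 assumes "N \<ge> 2"
 shows "(\<Sum>p\<in>primes_upto N. ln (real p) / real p) \<le> 8 * ln (real N)"
proof -
 obtain k where k: "2 ^ k \<le> N" "N < 2 ^ Suc k"
  using ex_power_ivl1[of 2 N] assms by auto
 have lnp: "ln (real p) \<le> real (Suc k) * ln 2" if "0 < p" "p \<le> 2 ^ Suc k" for p k :: nat
 proof -
  have "real p \<le> real (2 ^ Suc k)" using that(2) by (rule of_nat_mono)
  hence "ln (real p) \<le> ln (real (2 ^ Suc k))" using that by (subst ln_le_cancel_iff) auto
  also have "... = real (Suc k) * ln 2" by (simp add: ln_realpow del: power_Suc)
  finally show ?thesis .
 qed
 have k1: "k \<ge> 1" using k assms by (cases k) auto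
 have "(\<Sum>p\<in>primes_upto N. ln (real p) / real p) \<le> (\<Sum>p\<in>primes_upto (2 ^ Suc k). ln (real p) / real p)"
  using k by (intro sum_mono2) (auto simp: primes_upto_def intro!: divide_nonneg_nonneg dest: prime_gt_0_nat)
 also have "... = (\<Sum>j<Suc k. \<Sum>p\<in>prime_block j. ln (real p) / real p)"
  by (rule sum_primes_upto_pow2)
 also have "... \<le> (\<Sum>j<Suc k. 4 * ln 2)"
 proof (rule sum_mono)
  fix j
  have "(\<Sum>p\<in>prime_block j. ln (real p) / real p) \<le> (\<Sum>p\<in>prime_block j. real (Suc j) * ln 2 * (1 / real p))"
   by (rule sum_mono) (use lnp in \<open>auto simp: prime_block_def divide_right_mono dest: prime_gt_0_nat\<close>)
  also have "... \<le> real (Suc j) * ln 2 * (2 / real (max 1 j))"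
   unfolding sum_distrib_left[symmetric] by (intro mult_left_mono sum_prime_block) auto
  also have "... \<le> 4 * ln 2" by (cases "j = 0") (auto simp: field_simps)
  finally show "(\<Sum>p\<in>prime_block j. ln (real p) / real p) \<le> 4 * ln 2" .
 qed
 also have "... = 4 * ln 2 * real (Suc k)" by simp
 also have "... \<le> 8 * (real k * ln 2)" using k1 by (simp add: algebra_simps)
 also have "real k * ln 2 = ln (2 ^ k)" by (simp add: ln_realpow)
 also have "ln (2 ^ k) \<le> ln (real N)"
 proof -
  have "real (2 ^ k) \<le> real N" using k(1) by (rule of_nat_mono)
  thus ?thesis by (subst ln_le_cancel_iff) (use assms in auto)
 qed
 finally show ?thesis by simp
qed

text \<open>On dyadic block j the extra factor p^(-1/ln N) is at most q^j with q = exp(-ln 2 / ln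
  N), while the reciprocals sum to at most 2 / k for j >= k. The geometric series costs 1 / (1 - q),
  of order ln N, hence of order k, and the two factors cancel.\<close>

lemma sum_prime_powr_tail:
 assumes "N \<ge> 2" "N \<le> K"
 shows "(\<Sum>p\<in>primes_upto K - primes_upto N. real p powr (- (1 + 1 / ln (real N)))) \<le> 8"
proof -
 obtain k where k: "2 ^ k \<le> N" "N < 2 ^ Suc k"
  using ex_power_ivl1[of 2 N] assms by auto
 have k1: "k \<ge> 1" using k assms by (cases k) auto
 obtain m where m: "K \<le> 2 ^ m" using less_exp[of K] less_imp_le by blast
 have lnN: "ln (real N) > 0" using assms by simp
 define x where "x = ln 2 / ln (real N)"
 have x: "0 < x" "x \<le> 1" using assms lnN by (auto simp: x_def)
 define q where "q = exp (- x)"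
 have q: "0 < q" "q < 1" using x by (auto simp: q_def)
 have q1: "1 - q \<ge> x / 2"
 proof -
  have "exp (-x) \<le> 1 / (1 + x)"
   using exp_ge_add_one_self[of x] x by (simp add: exp_minus field_simps)
  also have "... \<le> 1 - x / 2" using x by (simp add: field_simps power2_eq_square)
  finally show ?thesis by (simp add: q_def)
 qed
 have kx: "2 / (real k * x) \<le> 4"
 proof -
  have "real N \<le> real (2 ^ Suc k)" using k(2) by (intro of_nat_mono) simp
  hence "ln (real N) \<le> ln (real (2 ^ Suc k))" using assms by (subst ln_le_cancel_iff) auto
  also have "... = real (Suc k) * ln 2" by (simp add: ln_realpow del: power_Suc)
  also have "... \<le> 2 * (real k * ln 2)" using k1 by (simp add: algebra_simps)
  finally show ?thesis using k1 lnN by (simp add: x_def field_simps)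
 qed
 have "(\<Sum>p\<in>primes_upto K - primes_upto N. real p powr (- (1 + 1 / ln (real N))))
   \<le> (\<Sum>p\<in>primes_upto (2 ^ m) - primes_upto (2 ^ k). real p powr (- (1 + 1 / ln (real N))))"
  using k m by (intro sum_mono2) (auto simp: primes_upto_def)
 also have "... \<le> (\<Sum>j\<in>{..<m} - {..<k}. \<Sum>p\<in>prime_block j. real p powr (- (1 + 1 / ln (real N))))"
 proof (cases "k \<le> m")
  case True
  have "(2::nat) ^ k \<le> 2 ^ m" using True by simp
  hence "primes_upto (2 ^ k) \<subseteq> primes_upto (2 ^ m)"
   unfolding primes_upto_def by (blast intro: order_trans)
  moreover have "{..<k} \<subseteq> {..<m}" using True by auto
  ultimately show ?thesis
   by (simp add: sum_diff sum_primes_upto_pow2 del: Diff_subset lessThan_minus_lessThan)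
 next
  case False
  hence "(2::nat) ^ m \<le> 2 ^ k" by simp
  hence "primes_upto (2 ^ m) - primes_upto (2 ^ k) = {}"
   unfolding primes_upto_def by (blast intro: order_trans)
  thus ?thesis by (simp only: sum.empty) (intro sum_nonneg, auto)
 qed
 also have "... \<le> (\<Sum>j\<in>{..<m} - {..<k}. 2 / real k * q ^ j)"
 proof (rule sum_mono)
  fix j assume j: "j \<in> {..<m} - {..<k}"
  have "real p powr (- (1 + 1 / ln (real N))) \<le> q ^ j * (1 / real p)" if p: "p \<in> prime_block j" for p
  proof -
   have p': "2 ^ j < p" "p > 0" using p by (auto simp: prime_block_def dest: prime_gt_0_nat)
   have "real (2 ^ j) < real p" using p'(1) by (rule of_nat_less_iff[THEN iffD2])
   hence "ln (real (2 ^ j)) \<le> ln (real p)" by (subst ln_le_cancel_iff) auto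
   hence "real j * ln 2 \<le> ln (real p)" by (simp add: ln_realpow)
   hence "exp (- (ln (real p) / ln (real N))) \<le> exp (- (real j * ln 2 / ln (real N)))"
    using lnN by (simp add: divide_right_mono)
   also have "... = q ^ j" by (simp add: q_def x_def flip: exp_of_nat_mult)
   finally have "real p powr (- (1 / ln (real N))) \<le> q ^ j" using p' by (simp add: powr_def)
   moreover have "real p powr (- (1 + 1 / ln (real N))) = real p powr (- (1 / ln (real N))) * (1 / real p)"
    using p' by (simp add: powr_diff powr_minus_divide algebra_simps)
   ultimately show ?thesis using p' by (simp add: divide_right_mono)
  qed
  hence "(\<Sum>p\<in>prime_block j. real p powr (- (1 + 1 / ln (real N)))) \<le> (\<Sum>p\<in>prime_block j. q ^ j * (1 / real p))"
   by (rule sum_mono)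
  also have "... \<le> q ^ j * (2 / real (max 1 j))"
   unfolding sum_distrib_left[symmetric] using q by (intro mult_left_mono sum_prime_block) auto
  also have "... \<le> q ^ j * (2 / real k)" using j k1 q by (intro mult_left_mono divide_left_mono) auto
  finally show "(\<Sum>p\<in>prime_block j. real p powr (- (1 + 1 / ln (real N)))) \<le> 2 / real k * q ^ j"
   by (simp add: mult.commute)
 qed
 also have "... \<le> (\<Sum>j<m. 2 / real k * q ^ j)" using q by (intro sum_mono2) auto
 also have "... = 2 / real k * ((1 - q ^ m) / (1 - q))"
  unfolding sum_distrib_left[symmetric] using q by (subst sum_gp_strict) auto
 also have "... \<le> 2 / real k * (1 / (x / 2))"
  using q q1 x by (intro mult_left_mono frac_le) auto
 also have "... = 2 * (2 / (real k * x))" by simp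
 also have "... \<le> 8" using kx by simp
 finally show ?thesis .
qed

section \<open>Euler product and pole of the zeta function\<close>

definition zeta_sum :: "complex => complex" where
 "zeta_sum s = infsum (\<lambda>n. of_nat n powr (- s)) {1::nat..}"

lemma norm_nat_powr: "norm (of_nat n powr (- s) :: complex) = real n powr (- Re s)"
 by (simp add: norm_powr_real_powr)

lemma nat_powr_abs_summable:
 assumes "Re s > 1"
 shows "(\<lambda>n::nat. norm (of_nat n powr (- s) :: complex)) summable_on A"
proof -
 have "summable (\<lambda>n. real n powr (- Re s))" using assms by (simp add: summable_real_powr_iff)
 hence "(\<lambda>n. real n powr (- Re s)) summable_on UNIV"
  by (intro iffD2[OF summable_on_UNIV_nonneg_real_iff]) auto
 hence "(\<lambda>n. real n powr (- Re s)) summable_on A" by (rule summable_on_subset_banach) auto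
 thus ?thesis by (simp add: norm_nat_powr)
qed

lemma nat_powr_summable:
 assumes "Re s > 1"
 shows "(\<lambda>n::nat. of_nat n powr (- s) :: complex) summable_on A"
 using nat_powr_abs_summable[OF assms] by (rule abs_summable_summable)

text \<open>Sieving out one prime after another leads from the series over all positive integers to
  the series over \<open>rough K\<close>. This yields the Euler product through finite products
  only.\<close>

definition rough :: "nat => nat set" where
 "rough K = {n. n > 0 \<and> (\<forall>p\<in>primes_upto K. \<not> p dvd n)}"

text \<open>The integers of \<open>rough K\<close> divisible by the next prime p are exactly p times
  an element of \<open>rough K\<close>, and the summand is multiplicative.\<close>

lemma infsum_rough_Suc:
 fixes s :: complex
 assumes s: "Re s > 1" and p: "prime (Suc K)"
 defines "f \<equiv> (\<lambda>n::nat. of_nat n powr (- s) :: complex)"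
 shows "infsum f (rough (Suc K)) = (1 - f (Suc K)) * infsum f (rough K)"
proof -
 let ?p = "Suc K"
 have up: "primes_upto (Suc K) = insert ?p (primes_upto K)"
  using p by (auto simp: primes_upto_def le_Suc_eq)
 have eq: "rough K = rough (Suc K) \<union> (*) ?p ` rough K"
 proof (intro equalityI subsetI)
  fix n assume n: "n \<in> rough K"
  show "n \<in> rough (Suc K) \<union> (*) ?p ` rough K"
  proof (cases "?p dvd n")
   case True
   then obtain m where m: "n = ?p * m" by (elim dvdE)
   have "m \<in> rough K" using n m by (auto simp: rough_def intro: dvd_mult)
   thus ?thesis using m by auto
  next
   case False
   thus ?thesis using n by (auto simp: rough_def up)
  qed
 next
  fix n assume "n \<in> rough (Suc K) \<union> (*) ?p ` rough K"
  thus "n \<in> rough K"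
  proof
   assume "n \<in> rough (Suc K)" thus ?thesis by (auto simp: rough_def up)
  next
   assume "n \<in> (*) ?p ` rough K"
   then obtain m where m: "n = ?p * m" "m \<in> rough K" by auto
   have "\<not> q dvd ?p * m" if q: "q \<in> primes_upto K" for q
   proof
    assume "q dvd ?p * m"
    moreover have "prime q" "q \<le> K" using q by (auto simp: primes_upto_def)
    ultimately have "q dvd ?p \<or> q dvd m" using prime_dvd_mult_iff by blast
    moreover have "\<not> q dvd ?p"
     using primes_dvd_imp_eq[OF \<open>prime q\<close> p] \<open>q \<le> K\<close> by linarith
    ultimately show False using m(2) q by (auto simp: rough_def)
   qed
   thus ?thesis using m by (auto simp: rough_def)
  qed
 qed
 have "\<not> ?p dvd n" if "n \<in> rough (Suc K)" for n
  using that by (auto simp: rough_def up simp del: mult_Suc)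
 hence disj: "rough (Suc K) \<inter> (*) ?p ` rough K = {}" by (metis (no_types) disjoint_iff dvd_triv_left imageE)
 have sm: "f summable_on A" for A unfolding f_def using s by (rule nat_powr_summable)
 have "infsum f (rough K) = infsum f (rough (Suc K)) + infsum f ((*) ?p ` rough K)"
  by (subst eq) (rule infsum_Un_disjoint[OF sm sm disj])
 also have "infsum f ((*) ?p ` rough K) = infsum (f \<circ> (*) ?p) (rough K)"
  by (rule infsum_reindex) (intro inj_onI, simp only: Suc_mult_cancel1)
 also have "... = infsum (\<lambda>n. f ?p * f n) (rough K)"
  by (intro infsum_cong) (simp only: f_def o_def of_nat_mult, subst powr_times_real, auto)
 also have "... = f ?p * infsum f (rough K)" by (rule infsum_cmult_right) (rule sm)
 finally have "infsum f (rough K) = infsum f (rough (Suc K)) + f ?p * infsum f (rough K)" .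
 thus ?thesis unfolding left_diff_distrib by (metis add_diff_cancel_right' mult_1)
qed

lemma infsum_rough:
 fixes s :: complex
 assumes s: "Re s > 1"
 shows "infsum (\<lambda>n::nat. of_nat n powr (- s)) (rough K) = (\<Prod>p\<in>primes_upto K. 1 - of_nat p powr (- s)) * zeta_sum s"
proof (induction K)
 case 0
 have "primes_upto 0 = {}" by (auto simp: primes_upto_def)
 moreover from this have "rough 0 = {1..}" by (auto simp: rough_def)
 ultimately show ?case by (simp add: zeta_sum_def)
next
 case (Suc K)
 show ?case
 proof (cases "prime (Suc K)")
  case True
  have up: "primes_upto (Suc K) = insert (Suc K) (primes_upto K)" "Suc K \<notin> primes_upto K"
   using True by (auto simp: primes_upto_def le_Suc_eq)
  show ?thesis using infsum_rough_Suc[OF s True] Suc up by (simp del: of_nat_Suc)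
 next
  case False
  hence "primes_upto (Suc K) = primes_upto K" by (auto simp: primes_upto_def le_Suc_eq)
  thus ?thesis using Suc by (simp add: rough_def)
 qed
qed

text \<open>Apart from 1, every element of \<open>rough K\<close> exceeds K, so the sieved series
  differs from 1 by at most a tail of an absolutely convergent series. Keeping zeta as a factor,
  with no division by it, makes its nonvanishing a consequence.\<close>

lemma euler_product:
 fixes s :: complex
 assumes s: "Re s > 1"
 shows "(\<lambda>K. (\<Prod>p\<in>primes_upto K. 1 - of_nat p powr (- s)) * zeta_sum s) \<longlonglongrightarrow> 1"
proof -
 define f where "f = (\<lambda>n::nat. of_nat n powr (- s) :: complex)"
 have sm: "f summable_on A" for A unfolding f_def using s by (rule nat_powr_summable)
 have sn: "(\<lambda>n. norm (f n)) summable_on A" for A unfolding f_def using s by (rule nat_powr_abs_summable)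
 have bnd: "norm (infsum f (rough K) - 1) \<le> infsum (\<lambda>n. norm (f n)) {K<..}" if "K \<ge> 1" for K
 proof -
  have "rough K = {1} \<union> (rough K - {1})" by (auto simp: rough_def primes_upto_def dest: prime_gt_1_nat)
  hence "infsum f (rough K) = infsum f ({1} \<union> (rough K - {1}))" by simp
  also have "... = infsum f {1} + infsum f (rough K - {1})" by (rule infsum_Un_disjoint[OF sm sm]) auto
  also have "infsum f {1} = 1" by (simp add: f_def)
  finally have "norm (infsum f (rough K) - 1) = norm (infsum f (rough K - {1}))" by simp
  also have "... \<le> infsum (\<lambda>n. norm (f n)) (rough K - {1})" by (rule norm_infsum_bound[OF sn])
  also have "... \<le> infsum (\<lambda>n. norm (f n)) {K<..}"
  proof (rule infsum_mono_neutral[OF sn sn])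
   fix n assume n: "n \<in> rough K - {1} - {K<..}"
   hence "n \<noteq> 1" "n > 0" "n \<le> K" by (auto simp: rough_def)
   then obtain q where "prime q" "q dvd n" using prime_factor_nat by blast
   moreover from this have "q \<le> K" using \<open>n \<le> K\<close> \<open>n > 0\<close> dvd_imp_le le_trans by blast
   ultimately have False using n by (auto simp: rough_def primes_upto_def)
   thus "norm (f n) \<le> 0" ..
  qed auto
  finally show ?thesis .
 qed
 have "(\<lambda>K. infsum (\<lambda>n. norm (f n)) {K<..}) \<longlonglongrightarrow> 0"
 proof -
  let ?T = "infsum (\<lambda>n. norm (f n)) UNIV"
  have eq: "infsum (\<lambda>n. norm (f n)) {K<..} = ?T - (\<Sum>n\<le>K. norm (f n))" for K
  proof -
   have "?T = infsum (\<lambda>n. norm (f n)) ({..K} \<union> {K<..})" by (rule arg_cong) auto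
   also have "... = infsum (\<lambda>n. norm (f n)) {..K} + infsum (\<lambda>n. norm (f n)) {K<..}"
    by (rule infsum_Un_disjoint[OF sn sn]) auto
   finally show ?thesis by simp
  qed
  have "((\<lambda>n. norm (f n)) has_sum ?T) UNIV" using sn by (rule has_sum_infsum)
  hence "(\<lambda>n. norm (f n)) sums ?T" by (rule has_sum_imp_sums)
  hence "(\<lambda>K. \<Sum>n\<le>K. norm (f n)) \<longlonglongrightarrow> ?T" by (simp add: sums_def_le)
  hence "(\<lambda>K. ?T - (\<Sum>n\<le>K. norm (f n))) \<longlonglongrightarrow> ?T - ?T" by (intro tendsto_intros)
  thus ?thesis by (simp add: eq)
 qed
 hence "(\<lambda>K. infsum f (rough K) - 1) \<longlonglongrightarrow> 0"
  by (rule Lim_null_comparison[rotated]) (use bnd in \<open>auto simp: eventually_sequentially\<close>)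
 hence "(\<lambda>K. infsum f (rough K)) \<longlonglongrightarrow> 1" by (simp add: LIM_zero_iff)
 thus ?thesis by (simp add: f_def infsum_rough[OF s])
qed

lemma zeta_sum_nonzero:
 assumes "Re s > 1"
 shows "zeta_sum s \<noteq> 0"
proof
 assume "zeta_sum s = 0"
 hence "(\<lambda>K::nat. 0::complex) \<longlonglongrightarrow> 1" using euler_product[OF assms] by simp
 thus False by (simp add: LIMSEQ_const_iff)
qed

lemma sum_inverse_squares_primes: "(\<Sum>p\<in>primes_upto K. 1 / (real p)^2) \<le> 1"
proof -
 have *: "(\<Sum>n\<in>{2..<K+2}. 1 / (real n)^2) \<le> 1 - 1 / (real K + 1)" for K
 proof (induction K)
  case (Suc K)
  define x where "x = real K + 1"
  have x: "x > 0" by (simp add: x_def)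
  have "1 / (x + 1)^2 \<le> 1 / (x * (x + 1))"
   unfolding power2_eq_square using x by (intro divide_left_mono mult_right_mono) auto
  also have "1 / (x * (x + 1)) = 1 / x - 1 / (x + 1)"
   using x by (simp add: field_simps)
  finally have "1 / (x + 1)^2 \<le> 1 / x - 1 / (x + 1)" .
  moreover have "{2..<Suc K + 2} = insert (K + 2) {2..<K + 2}" by auto
  ultimately show ?case using Suc by (simp add: x_def add.commute)
 qed simp
 have "(\<Sum>p\<in>primes_upto K. 1 / (real p)^2) \<le> (\<Sum>n\<in>{2..<K+2}. 1 / (real n)^2)"
  by (rule sum_mono2) (auto simp: primes_upto_def dest: prime_ge_2_nat)
 also have "... \<le> 1 - 1 / (real K + 1)" by (rule *)
 also have "... \<le> 1" by simp
 finally show ?thesis .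
qed

text \<open>Norms are taken in the Euler product: \<open>norm_one_plus_le_exp\<close> replaces each
  factor by an exponential, and the quadratic errors add up to at most 1. A bound holding for all
  large K takes the place of a limit of the prime sums and of a complex logarithm of zeta.\<close>

lemma sum_prime_powr_le_ln_zeta:
 fixes s :: complex
 assumes s: "Re s > 1" and B: "\<And>K. K \<ge> N ==> B \<le> (\<Sum>p\<in>primes_upto K. Re (of_nat p powr (- s)))"
 shows "B \<le> ln (norm (zeta_sum s)) + 1"
proof -
 let ?Z = "norm (zeta_sum s)"
 have "norm (\<Prod>p\<in>primes_upto K. 1 - of_nat p powr (- s)) * ?Z \<le> exp (1 - B) * ?Z" if "K \<ge> N" for K
 proof (rule mult_right_mono)
  have "norm (\<Prod>p\<in>primes_upto K. 1 - of_nat p powr (- s) :: complex) \<le>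
    (\<Prod>p\<in>primes_upto K. exp (- Re (of_nat p powr (- s)) + 1 / (real p)^2))"
   unfolding prod_norm[symmetric]
  proof (rule prod_mono, safe)
   fix p assume p: "p \<in> primes_upto K"
   hence p2: "real p \<ge> 2" by (auto simp: primes_upto_def dest: prime_ge_2_nat)
   have "norm (of_nat p powr (- s) :: complex) \<le> real p powr (- 1)"
    unfolding norm_nat_powr using p2 s by (intro powr_mono) auto
   hence "(norm (of_nat p powr (- s) :: complex))^2 \<le> (1 / real p)^2"
    using p2 by (intro power_mono) (auto simp: powr_minus_divide)
   hence *: "(norm (of_nat p powr (- s) :: complex))^2 / 2 \<le> 1 / (real p)^2"
    using zero_le_power2[of "norm (of_nat p powr (- s) :: complex)"] unfolding power_one_over by linarith
   have "norm (1 - of_nat p powr (- s) :: complex) \<le> exp (Re (- (of_nat p powr (- s))) + (norm (- (of_nat p powr (- s) :: complex)))^2 / 2)"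
    using norm_one_plus_le_exp[of "- (of_nat p powr (- s))"] by simp
   also have "... \<le> exp (- Re (of_nat p powr (- s)) + 1 / (real p)^2)" using * by simp
   finally show "norm (1 - of_nat p powr (- s) :: complex) \<le> exp (- Re (of_nat p powr (- s)) + 1 / (real p)^2)" .
  qed auto
  also have "... = exp (- (\<Sum>p\<in>primes_upto K. Re (of_nat p powr (- s))) + (\<Sum>p\<in>primes_upto K. 1 / (real p)^2))"
   by (simp only: sum_negf[symmetric] sum.distrib[symmetric]) (simp add: exp_sum)
  also have "... \<le> exp (1 - B)" using B[OF that] sum_inverse_squares_primes[of K] by simp
  finally show "norm (\<Prod>p\<in>primes_upto K. 1 - of_nat p powr (- s) :: complex) \<le> exp (1 - B)" .
 qed simp
 hence ev: "eventually (\<lambda>K. norm ((\<Prod>p\<in>primes_upto K. 1 - of_nat p powr (- s)) * zeta_sum s) \<le> exp (1 - B) * ?Z) sequentially"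
  by (auto simp: eventually_sequentially norm_mult)
 have "(\<lambda>K. norm ((\<Prod>p\<in>primes_upto K. 1 - of_nat p powr (- s)) * zeta_sum s)) \<longlonglongrightarrow> norm (1::complex)"
  by (intro tendsto_norm euler_product s)
 hence "1 \<le> exp (1 - B) * ?Z" using tendsto_upperbound[OF _ ev] by simp
 hence "ln 1 \<le> ln (exp (1 - B) * ?Z)" by (subst ln_le_cancel_iff) auto
 also have "... = 1 - B + ln ?Z" using zeta_sum_nonzero[OF s] by (subst ln_mult) auto
 finally show ?thesis by simp
qed

text \<open>The reverse inequality at real points, where each factor 1 - w with 0 <= w <= 1/2 is at
  least exp(-w - 2w^2). The quadratic terms account for the 2.\<close>

lemma ln_zeta_le_sum_prime_powr:
 fixes \<xi> :: real
 assumes s: "\<xi> > 1" and B: "\<And>K. K \<ge> N ==> (\<Sum>p\<in>primes_upto K. real p powr (- \<xi>)) \<le> B"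
 shows "ln (norm (zeta_sum (of_real \<xi>))) - 2 \<le> B"
proof -
 let ?Z = "norm (zeta_sum (of_real \<xi>))"
 have "exp (- B - 2) * ?Z \<le> norm (\<Prod>p\<in>primes_upto K. 1 - of_nat p powr (- of_real \<xi>) :: complex) * ?Z" if "K \<ge> N" for K
 proof (rule mult_right_mono)
  have "exp (- B - 2) \<le> exp (- (\<Sum>p\<in>primes_upto K. real p powr (- \<xi>)) - 2 * (\<Sum>p\<in>primes_upto K. 1 / (real p)^2))"
   using B[OF that] sum_inverse_squares_primes[of K] by simp
  also have "... = (\<Prod>p\<in>primes_upto K. exp (- (real p powr (- \<xi>)) - 2 * (1 / (real p)^2)))"
   by (simp only: sum_distrib_left sum_negf[symmetric] sum_subtractf[symmetric]) (simp add: exp_sum)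
  also have "... \<le> (\<Prod>p\<in>primes_upto K. norm (1 - of_nat p powr (- of_real \<xi>) :: complex))"
  proof (rule prod_mono, safe)
   fix p assume p: "p \<in> primes_upto K"
   hence p2: "real p \<ge> 2" by (auto simp: primes_upto_def dest: prime_ge_2_nat)
   define wt where "wt = real p powr (- \<xi>)"
   have "wt \<le> real p powr (- 1)" unfolding wt_def using p2 s by (intro powr_mono) auto
   hence w1: "wt \<le> 1 / real p" using p2 by (auto simp: powr_minus_divide)
   also have "... \<le> 1 / 2" using p2 by (simp add: field_simps)
   finally have wt: "0 \<le> wt" "wt \<le> 1/2" by (auto simp: wt_def)
   have w2: "wt^2 \<le> 1 / (real p)^2" using power_mono[OF w1 wt(1), of 2] by (simp add: power_one_over)
   have "exp (- wt - 2 * (1 / (real p)^2)) \<le> exp (- (wt + 2 * wt^2))" using w2 by simp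
   also have "... \<le> 1 / (1 + (wt + 2 * wt^2))"
    unfolding exp_minus inverse_eq_divide
    using exp_ge_add_one_self[of "wt + 2 * wt^2"] wt by (intro divide_left_mono mult_pos_pos add_pos_nonneg) auto
   also have "... \<le> 1 - wt"
   proof -
    have "(1 - wt) * (1 + (wt + 2 * wt^2)) = 1 + wt^2 * (1 - 2 * wt)"
     by (simp add: power2_eq_square algebra_simps)
    moreover have "wt^2 * (1 - 2 * wt) \<ge> 0" using wt by (intro mult_nonneg_nonneg) auto
    moreover have "1 + (wt + 2 * wt^2) > 0" using wt by (intro add_pos_nonneg) auto
    ultimately show ?thesis by (simp add: divide_le_eq)
   qed
   also have "... \<le> norm (1 - of_real wt :: complex)"
    using complex_Re_le_cmod[of "1 - of_real wt"] by simp
   also have "of_real wt = (of_nat p powr (- of_real \<xi>) :: complex)"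
    unfolding wt_def using powr_of_real[of "real p" "- \<xi>"] by simp
   finally show "exp (- (real p powr (- \<xi>)) - 2 * (1 / (real p)^2)) \<le> norm (1 - of_nat p powr (- of_real \<xi>) :: complex)"
    by (simp add: wt_def)
  qed auto
  also have "... = norm (\<Prod>p\<in>primes_upto K. 1 - of_nat p powr (- of_real \<xi>) :: complex)"
   by (rule prod_norm)
  finally show "exp (- B - 2) \<le> norm (\<Prod>p\<in>primes_upto K. 1 - of_nat p powr (- of_real \<xi>) :: complex)" .
 qed simp
 hence ev: "eventually (\<lambda>K. exp (- B - 2) * ?Z \<le> norm ((\<Prod>p\<in>primes_upto K. 1 - of_nat p powr (- of_real \<xi>)) * zeta_sum (of_real \<xi>))) sequentially"
  by (auto simp: eventually_sequentially norm_mult)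
 have "(\<lambda>K. norm ((\<Prod>p\<in>primes_upto K. 1 - of_nat p powr (- of_real \<xi>)) * zeta_sum (of_real \<xi>))) \<longlonglongrightarrow> norm (1::complex)"
  by (intro tendsto_norm euler_product) (use s in auto)
 hence "exp (- B - 2) * ?Z \<le> 1" using tendsto_lowerbound[OF _ ev] by simp
 moreover have Z: "?Z > 0" using zeta_sum_nonzero[of "of_real \<xi>"] s by auto
 ultimately have "ln (exp (- B - 2) * ?Z) \<le> ln 1" by (subst ln_le_cancel_iff) auto
 also have "ln (exp (- B - 2) * ?Z) = - B - 2 + ln ?Z" using Z by (subst ln_mult) auto
 finally show ?thesis by simp
qed

text \<open>\<open>G\<close> is a primitive of z^(-s), so this compares the integral over [n, n+1]
  with the left endpoint value. The mean value bound is applied twice, first to z^(-s) and then to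
  the primitive with its linear part removed.\<close>

lemma norm_powr_primitive_diff:
 fixes s :: complex
 assumes s: "Re s > 1" and n: "n \<ge> (1::nat)"
 defines "G \<equiv> (\<lambda>z::complex. z powr (1 - s) / (1 - s))"
 shows "norm (G (of_nat (Suc n)) - G (of_nat n) - of_nat n powr (- s)) \<le> norm s / (real n)^2"
proof -
 define S where "S = closed_segment (of_nat n :: complex) (of_nat (Suc n))"
 have seg: "\<exists>u\<ge>real n. u \<le> real n + 1 \<and> z = of_real u" if zS: "z \<in> S" for z
 proof -
  obtain t :: real where t: "0 \<le> t" "t \<le> 1" "z = (1 - t) *\<^sub>R of_nat n + t *\<^sub>R of_nat (Suc n)"
   using zS[unfolded S_def in_segment] by (elim exE conjE) (rule that, assumption+)
  hence "z = of_real (real n + t)" by (simp add: scaleR_conv_of_real algebra_simps)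
  thus ?thesis using t by (intro exI[of _ "real n + t"]) auto
 qed
 have nz: "z \<notin> \<real>\<^sub>\<le>\<^sub>0" "Re z > 0" "z \<noteq> 0" if "z \<in> S" for z
  using seg[OF that] n by auto
 have cS: "convex S" "of_nat n \<in> S" "of_nat (Suc n) \<in> S" by (simp_all add: S_def)
 have b1: "norm (z powr (- s) - of_nat n powr (- s)) \<le> norm s / (real n)^2" if z: "z \<in> S" for z
 proof -
  have "norm (z powr (- s) - of_nat n powr (- s)) \<le> norm s / (real n)^2 * norm (z - of_nat n)"
  proof (rule field_differentiable_bound[OF cS(1)])
   fix wt assume wt: "wt \<in> S"
   show "((\<lambda>wt. wt powr (- s)) has_field_derivative (- s * wt powr (- s - 1))) (at wt within S)"
    using has_field_derivative_powr[OF nz(1)[OF wt]] by (rule has_field_derivative_at_within)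
   obtain u where u: "u \<ge> real n" "wt = of_real u" using seg[OF wt] by blast
   have "norm (wt powr (- s - 1)) = u powr (- Re s - 1)"
    using u n by (simp add: norm_powr_real_powr)
   also have "... \<le> real n powr (- Re s - 1)" using u n s by (intro powr_mono2') auto
   also have "... \<le> real n powr (- 2)" using s n by (intro powr_mono) auto
   also have "... = 1 / (real n)^2" using n by (simp add: powr_minus_divide powr_numeral)
   finally have "norm s * norm (wt powr (- s - 1)) \<le> norm s * (1 / (real n)^2)"
    by (rule mult_left_mono) simp
   thus "norm (- s * wt powr (- s - 1)) \<le> norm s / (real n)^2" by (simp add: norm_mult)
  qed (use z cS in auto)
  also have "... \<le> norm s / (real n)^2 * 1"
  proof (intro mult_left_mono)
   obtain u where u: "u \<ge> real n" "u \<le> real n + 1" "z = of_real u" using seg[OF z] by blast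
   have "z - of_nat n = of_real (u - real n)" using u by simp
   thus "norm (z - of_nat n) \<le> 1" using u by (simp only: norm_of_real)
  qed auto
  finally show ?thesis by simp
 qed
 define H where "H = (\<lambda>z. G z - z * of_nat n powr (- s))"
 have "norm (H (of_nat (Suc n)) - H (of_nat n)) \<le> norm s / (real n)^2 * norm (of_nat (Suc n) - of_nat n :: complex)"
 proof (rule field_differentiable_bound[OF cS(1) _ _ cS(3) cS(2)])
  fix z assume z: "z \<in> S"
  have ne: "1 - s \<noteq> 0" using s by auto
  have "((\<lambda>wt. wt powr (1 - s)) has_field_derivative (1 - s) * z powr (1 - s - 1)) (at z within S)"
   using has_field_derivative_powr[OF nz(1)[OF z]] by (rule has_field_derivative_at_within)
  hence "(G has_field_derivative (1 - s) * z powr (1 - s - 1) / (1 - s)) (at z within S)"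
   unfolding G_def by (rule DERIV_cdivide)
  hence "(G has_field_derivative z powr (- s)) (at z within S)" using ne by simp
  thus "(H has_field_derivative z powr (- s) - of_nat n powr (- s)) (at z within S)"
   unfolding H_def by (auto intro!: derivative_eq_intros)
  show "norm (z powr (- s) - of_nat n powr (- s)) \<le> norm s / (real n)^2" by (rule b1[OF z])
 qed
 also have "H (of_nat (Suc n)) - H (of_nat n) = G (of_nat (Suc n)) - G (of_nat n) - of_nat n powr (- s)"
  by (simp add: H_def algebra_simps)
 finally show ?thesis by simp
qed

text \<open>Summed over n, the primitives telescope to 1 / (s - 1) and the errors to |s| times pi^2
  / 6, which is below 3.\<close>

lemma zeta_sum_pole:
 fixes s :: complex
 assumes s: "Re s > 1"
 shows "norm (zeta_sum s - 1 / (s - 1)) \<le> 3 * norm s"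
proof -
 define f where "f = (\<lambda>n::nat. of_nat n powr (- s) :: complex)"
 define G where "G = (\<lambda>z::complex. z powr (1 - s) / (1 - s))"
 have "(f has_sum zeta_sum s) {1..}"
  unfolding zeta_sum_def f_def
  using abs_summable_summable[OF nat_powr_abs_summable[OF s]] by (rule has_sum_infsum)
 moreover have "range Suc = {1..}" using not0_implies_Suc by (fastforce simp: image_iff)
 ultimately have "(f has_sum zeta_sum s) (range Suc)" by simp
 hence "((f \<circ> Suc) has_sum zeta_sum s) UNIV" by (subst (asm) has_sum_reindex) auto
 hence "(f \<circ> Suc) sums zeta_sum s" by (rule has_sum_imp_sums)
 hence fs: "(\<lambda>n. f (Suc n)) sums zeta_sum s" by (simp only: o_def)
 have "(\<lambda>n. G (of_nat (Suc n))) \<longlonglongrightarrow> 0"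
 proof (rule tendsto_norm_zero_cancel)
  have "(\<lambda>n. real n powr (1 - Re s)) \<longlonglongrightarrow> 0"
   using s by (intro tendsto_neg_powr filterlim_real_sequentially) auto
  hence "(\<lambda>n. real (Suc n) powr (1 - Re s)) \<longlonglongrightarrow> 0" by (rule LIMSEQ_Suc)
  hence "(\<lambda>n. real (Suc n) powr (1 - Re s) / norm (1 - s)) \<longlonglongrightarrow> 0 / norm (1 - s)"
   using s by (intro tendsto_intros) auto
  moreover have "norm (G (of_nat (Suc n))) = real (Suc n) powr (1 - Re s) / norm (1 - s)" for n
   unfolding G_def norm_divide by (subst norm_powr_real_powr) auto
  ultimately show "(\<lambda>n. norm (G (of_nat (Suc n)))) \<longlonglongrightarrow> 0" by simp
 qed
 hence "(\<lambda>n. G (of_nat (Suc (Suc n))) - G (of_nat (Suc n))) sums (0 - G (of_nat (Suc 0)))"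
  by (rule telescope_sums)
 hence gs: "(\<lambda>n. G (of_nat (Suc (Suc n))) - G (of_nat (Suc n))) sums (1 / (s - 1))"
  using minus_divide_right[of 1 "1 - s"] by (simp add: G_def)
 have "(\<lambda>n. (G (of_nat (Suc (Suc n))) - G (of_nat (Suc n))) - f (Suc n)) sums (1 / (s - 1) - zeta_sum s)"
  by (rule sums_diff[OF gs fs])
 hence "1 / (s - 1) - zeta_sum s = (\<Sum>n. (G (of_nat (Suc (Suc n))) - G (of_nat (Suc n))) - f (Suc n))"
  by (simp add: sums_iff)
 also have "norm ... \<le> (\<Sum>n. norm s * (1 / (real (Suc n))^2))"
 proof (rule norm_suminf_le)
  show "norm ((G (of_nat (Suc (Suc n))) - G (of_nat (Suc n))) - f (Suc n)) \<le> norm s * (1 / (real (Suc n))^2)" for n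
   using norm_powr_primitive_diff[OF s, of "Suc n"] by (simp add: G_def f_def)
  show "summable (\<lambda>n. norm s * (1 / (real (Suc n))^2))"
   by (intro summable_mult) (use inverse_squares_sums in \<open>simp add: sums_iff add.commute\<close>)
 qed
 also have "... = norm s * (pi^2 / 6)"
  using inverse_squares_sums by (subst suminf_mult) (simp_all add: sums_iff add.commute)
 also have "... \<le> norm s * 3"
 proof (intro mult_left_mono)
  have "pi^2 \<le> 4^2" using pi_less_4 by (intro power_mono) auto
  thus "pi^2 / 6 \<le> 3" by simp
 qed auto
 finally show ?thesis by (simp add: norm_minus_commute mult.commute)
qed

section \<open>Cosine sums over primes from zeta near 1\<close>

lemma Re_nat_powr:
 assumes "p > 0"
 shows "Re (of_nat p powr (- Complex \<xi> t)) = real p powr (- \<xi>) * cos (t * ln (real p))"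
proof -
 have "(of_nat p :: complex) powr (- Complex \<xi> t) = exp (- Complex \<xi> t * of_real (ln (real p)))"
  using assms by (simp add: powr_def flip: Ln_of_nat)
 thus ?thesis using assms by (simp add: Re_exp powr_def)
qed

text \<open>A sharp cutoff at N is exchanged for the exponent 1 + 1 / ln N. The primes beyond N cost
  8 by \<open>sum_prime_powr_tail\<close>. For p <= N the factor p^(-1/ln N) is within ln p / ln N
  of 1, which costs another 8 by \<open>sum_log_prime_le\<close>. The last unit comes from the Euler
  product.\<close>

lemma sum_cos_prime_le_ln_zeta:
 assumes "N \<ge> 3"
 shows "(\<Sum>p\<in>primes_upto N. cos (t * ln (real p)) / real p)
  \<le> ln (norm (zeta_sum (Complex (1 + 1 / ln (real N)) t))) + 17"
proof -
 define \<xi> where "\<xi> = 1 + 1 / ln (real N)"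
 have lnN: "ln (real N) > 0" using assms by simp
 have "(\<Sum>p\<in>primes_upto N. cos (t * ln (real p)) / real p) - 16 \<le> ln (norm (zeta_sum (Complex \<xi> t))) + 1"
 proof (rule sum_prime_powr_le_ln_zeta[of _ N])
  show "Re (Complex \<xi> t) > 1" using lnN by (simp add: \<xi>_def)
  fix K assume K: "K \<ge> N"
  define g where "g = (\<lambda>p. real p powr (- \<xi>) * cos (t * ln (real p)))"
  have sub: "primes_upto N \<subseteq> primes_upto K" using K by (auto simp: primes_upto_def)
  have "(\<Sum>p\<in>primes_upto K. Re (of_nat p powr (- Complex \<xi> t))) = (\<Sum>p\<in>primes_upto K. g p)"
   unfolding g_def by (intro sum.cong refl Re_nat_powr) (auto simp: primes_upto_def dest: prime_gt_0_nat)
  also have "... = (\<Sum>p\<in>primes_upto K - primes_upto N. g p) + (\<Sum>p\<in>primes_upto N. g p)"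
   by (rule sum.subset_diff[OF sub]) simp
  also have "... \<ge> - 8 + ((\<Sum>p\<in>primes_upto N. cos (t * ln (real p)) / real p) - 8)"
  proof (rule add_mono)
   have "- (\<Sum>p\<in>primes_upto K - primes_upto N. g p) = (\<Sum>p\<in>primes_upto K - primes_upto N. - g p)"
    by (simp add: sum_negf)
   also have "... \<le> (\<Sum>p\<in>primes_upto K - primes_upto N. real p powr (- \<xi>))"
   proof (rule sum_mono)
    fix p
    have "real p powr (- \<xi>) * (- cos (t * ln (real p))) \<le> real p powr (- \<xi>) * 1"
     using cos_ge_minus_one[of "t * ln (real p)"] by (intro mult_left_mono) (linarith, simp)
    thus "- g p \<le> real p powr (- \<xi>)" by (simp add: g_def)
   qed
   also have "... \<le> 8" unfolding \<xi>_def using sum_prime_powr_tail[of N K] assms K by simp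
   finally show "- 8 \<le> (\<Sum>p\<in>primes_upto K - primes_upto N. g p)" by simp
   have "(\<Sum>p\<in>primes_upto N. cos (t * ln (real p)) / real p) - (\<Sum>p\<in>primes_upto N. g p)
    = (\<Sum>p\<in>primes_upto N. cos (t * ln (real p)) / real p - g p)"
    by (simp add: sum_subtractf)
   also have "... \<le> (\<Sum>p\<in>primes_upto N. (1 / ln (real N)) * (ln (real p) / real p))"
   proof (rule sum_mono)
    fix p assume p: "p \<in> primes_upto N"
    hence p1: "p > 1" by (auto simp: primes_upto_def dest: prime_gt_1_nat)
    define e where "e = real p powr (- (1 / ln (real N)))"
    have e: "0 < e" "e \<le> 1"
     using p1 lnN powr_mono[of "- (1 / ln (real N))" 0 "real p"] by (auto simp: e_def)
    have e2: "1 - e \<le> ln (real p) / ln (real N)"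
     using exp_ge_add_one_self[of "- (ln (real p) / ln (real N))"] p1 by (simp add: e_def powr_def)
    have g: "g p = e * cos (t * ln (real p)) / real p"
     using p1 by (simp add: g_def e_def \<xi>_def powr_diff powr_minus_divide)
    have "cos (t * ln (real p)) * (1 - e) \<le> 1 * (1 - e)"
     using e by (intro mult_right_mono) auto
    hence "cos (t * ln (real p)) * (1 - e) \<le> ln (real p) / ln (real N)" using e2 by simp
    hence "cos (t * ln (real p)) * (1 - e) / real p \<le> ln (real p) / ln (real N) / real p"
     by (rule divide_right_mono) simp
    thus "cos (t * ln (real p)) / real p - g p \<le> (1 / ln (real N)) * (ln (real p) / real p)"
     by (simp add: g diff_divide_distrib algebra_simps)
   qed
   also have "... = (1 / ln (real N)) * (\<Sum>p\<in>primes_upto N. ln (real p) / real p)"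
    by (simp add: sum_distrib_left)
   also have "... \<le> (1 / ln (real N)) * (8 * ln (real N))"
    using assms lnN by (intro mult_left_mono sum_log_prime_le) auto
   also have "... = 8" using lnN by simp
   finally show "(\<Sum>p\<in>primes_upto N. cos (t * ln (real p)) / real p) - 8 \<le> (\<Sum>p\<in>primes_upto N. g p)" by simp
  qed
  finally show "(\<Sum>p\<in>primes_upto N. cos (t * ln (real p)) / real p) - 16 \<le> (\<Sum>p\<in>primes_upto K. Re (of_nat p powr (- Complex \<xi> t)))"
   by simp
 qed
 thus ?thesis by (simp add: \<xi>_def)
qed

lemma ln_gt_1: "N \<ge> (3::nat) ==> ln (real N) > 1"
proof -
 assume N: "N \<ge> 3"
 have "exp 1 < real N" using N e_less_272 by linarith
 hence "ln (exp 1) < ln (real N)" by (subst ln_less_cancel_iff) (use N in auto)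
 thus ?thesis by simp
qed

lemma norm_zeta_sum_near_one:
 assumes "N \<ge> 3" "\<bar>t\<bar> \<le> 2"
 defines "s \<equiv> Complex (1 + 1 / ln (real N)) t"
 shows "Re s > 1" "norm s \<le> 4" "norm (zeta_sum s) \<le> norm (1 / (s - 1)) + 12"
  "norm (zeta_sum s) \<ge> norm (1 / (s - 1)) - 12"
proof -
 have lnN: "ln (real N) > 1" using ln_gt_1[OF assms(1)] .
 hence l: "1 / ln (real N) \<le> 1" by simp
 show 1: "Re s > 1" using lnN by (simp add: s_def)
 have "norm s \<le> \<bar>Re s\<bar> + \<bar>Im s\<bar>" by (rule cmod_le)
 also have "... \<le> 4"
 proof -
  have "0 < 1 / ln (real N)" using lnN by simp
  thus ?thesis unfolding s_def complex.sel using l assms(2) by linarith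
 qed
 finally show 2: "norm s \<le> 4" .
 have 3: "norm (zeta_sum s - 1 / (s - 1)) \<le> 12" using zeta_sum_pole[OF 1] 2 by simp
 show "norm (zeta_sum s) \<le> norm (1 / (s - 1)) + 12" 
  using 3 norm_triangle_ineq2[of "zeta_sum s" "1 / (s - 1)"] by linarith
 show "norm (zeta_sum s) \<ge> norm (1 / (s - 1)) - 12"
  using 3 norm_triangle_ineq3[of "zeta_sum s" "1 / (s - 1)"] by linarith
qed

text \<open>The imaginary part alone bounds |1 / (s - 1)| by 1 / t, independently of N. Since t <=
  2, the additive 12 is at most 24 / t, so zeta is at most 25 / t. Then ln 25 <= 24 and 24 + 17 =
  41.\<close>

lemma sum_cos_prime_le:
 assumes "0 < t" "t \<le> 2"
 shows "(\<Sum>p\<in>primes_upto N. cos (t * ln (real p)) / real p) \<le> ln (1 / t) + 41"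
proof (cases "N \<ge> 3")
 case True
 define s where "s = Complex (1 + 1 / ln (real N)) t"
 have s: "Re s > 1" "norm (zeta_sum s) \<le> norm (1 / (s - 1)) + 12"
  using norm_zeta_sum_near_one[of N t] True assms by (auto simp: s_def)
 have "norm (s - 1) \<ge> \<bar>Im (s - 1)\<bar>" by (rule abs_Im_le_cmod)
 hence "norm (1 / (s - 1)) \<le> 1 / t" using assms by (simp add: s_def norm_divide frac_le)
 moreover have "12 \<le> 24 * (1 / t)" using assms by (simp add: field_simps)
 ultimately have "norm (zeta_sum s) \<le> 25 * (1 / t)" using s(2) by linarith
 moreover have "norm (zeta_sum s) > 0" using zeta_sum_nonzero[OF s(1)] by simp
 ultimately have "ln (norm (zeta_sum s)) \<le> ln (25 * (1 / t))" using assms by (subst ln_le_cancel_iff) auto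
 also have "... = ln 25 + ln (1 / t)" using assms by (subst ln_mult) auto
 also have "ln (25::real) \<le> 24" using ln_le_minus_one[of 25] by simp
 finally show ?thesis using sum_cos_prime_le_ln_zeta[OF True, of t] by (simp add: s_def)
next
 case False
 hence "primes_upto N \<subseteq> {2}" by (auto simp: primes_upto_def dest: prime_ge_2_nat)
 hence "primes_upto N = {} \<or> primes_upto N = {2}" by blast
 moreover have "ln (1 / t) \<ge> ln (1 / 2)" using assms by (subst ln_le_cancel_iff) (auto intro: divide_left_mono)
 moreover have "ln (1 / 2 :: real) \<ge> -1" using ln_le_minus_one[of 2] by (simp add: ln_div)
 moreover have "cos (t * ln 2) / 2 \<le> 1" using cos_le_one[of "t * ln 2"] by linarith
 ultimately show ?thesis by auto
qed

text \<open>Mertens's second theorem up to a bounded error: at s = 1 + 1 / ln N the pole term has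
  modulus exactly ln N.\<close>

lemma sum_inverse_primes_bounds:
 assumes "N \<ge> 3"
 shows "\<bar>(\<Sum>p\<in>primes_upto N. 1 / real p) - ln (ln (real N))\<bar> \<le> 40"
proof -
 define s where "s = Complex (1 + 1 / ln (real N)) 0"
 have lnN: "ln (real N) > 1" using ln_gt_1[OF assms] .
 have s: "Re s > 1" "norm (zeta_sum s) \<le> norm (1 / (s - 1)) + 12" "norm (zeta_sum s) \<ge> norm (1 / (s - 1)) - 12"
  using norm_zeta_sum_near_one[of N 0] assms by (auto simp: s_def)
 have Z: "norm (zeta_sum s) > 0" using zeta_sum_nonzero[OF s(1)] by simp
 have sr: "s = of_real (1 + 1 / ln (real N))" by (simp add: s_def complex_eq_iff)
 have "s - 1 = of_real (1 / ln (real N))" by (simp add: sr)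
 hence n1: "norm (1 / (s - 1)) = ln (real N)" using lnN by (simp add: norm_divide)
 have "norm (zeta_sum s) \<le> 13 * ln (real N)" using s(2) n1 lnN by linarith
 hence "ln (norm (zeta_sum s)) \<le> ln (13 * ln (real N))" using Z lnN by (subst ln_le_cancel_iff) auto
 also have "... = ln 13 + ln (ln (real N))" using lnN by (subst ln_mult) auto
 also have "ln (13::real) \<le> 12" using ln_le_minus_one[of 13] by simp
 finally have up: "(\<Sum>p\<in>primes_upto N. 1 / real p) \<le> ln (ln (real N)) + 29"
  using sum_cos_prime_le_ln_zeta[OF assms, of 0] by (simp add: s_def)
 \<comment> \<open>If ln N >= 24, subtracting the error 12 leaves at least half of the pole term.
   Otherwise ln ln N is below 23 and nonnegativity of the sum is enough.\<close>
 have lo: "(\<Sum>p\<in>primes_upto N. 1 / real p) \<ge> ln (ln (real N)) - 30"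
 proof (cases "ln (real N) \<ge> 24")
  case True
  have "ln (real N) / 2 \<le> norm (zeta_sum s)" using s(3) n1 True by linarith
  hence "ln (ln (real N) / 2) \<le> ln (norm (zeta_sum s))" using Z lnN by (subst ln_le_cancel_iff) auto
  moreover have "ln (ln (real N) / 2) = ln (ln (real N)) - ln 2" using lnN by (subst ln_div) auto
  moreover have "ln 2 \<le> (1::real)" using ln_le_minus_one[of 2] by simp
  moreover have "ln (norm (zeta_sum s)) - 2 \<le> (\<Sum>p\<in>primes_upto N. 1 / real p) + 8"
   unfolding sr
  proof (rule ln_zeta_le_sum_prime_powr)
   show "1 < 1 + 1 / ln (real N)" using lnN by simp
   fix K assume K: "K \<ge> N"
   have sub: "primes_upto N \<subseteq> primes_upto K" using K by (auto simp: primes_upto_def)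
   have "(\<Sum>p\<in>primes_upto K. real p powr (- (1 + 1 / ln (real N))))
    = (\<Sum>p\<in>primes_upto K - primes_upto N. real p powr (- (1 + 1 / ln (real N)))) + (\<Sum>p\<in>primes_upto N. real p powr (- (1 + 1 / ln (real N))))"
    by (rule sum.subset_diff[OF sub]) simp
   also have "... \<le> 8 + (\<Sum>p\<in>primes_upto N. 1 / real p)"
   proof (rule add_mono)
    show "(\<Sum>p\<in>primes_upto K - primes_upto N. real p powr (- (1 + 1 / ln (real N)))) \<le> 8"
     using sum_prime_powr_tail[of N K] assms K by simp
    show "(\<Sum>p\<in>primes_upto N. real p powr (- (1 + 1 / ln (real N)))) \<le> (\<Sum>p\<in>primes_upto N. 1 / real p)"
    proof (rule sum_mono)
     fix p assume "p \<in> primes_upto N"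
     hence p1: "p > 1" by (auto simp: primes_upto_def dest: prime_gt_1_nat)
     have "real p powr (- (1 + 1 / ln (real N))) \<le> real p powr (- 1)" using p1 lnN by (intro powr_mono) auto
     thus "real p powr (- (1 + 1 / ln (real N))) \<le> 1 / real p" using p1 by (simp add: powr_minus_divide)
    qed
   qed
   finally show "(\<Sum>p\<in>primes_upto K. real p powr (- (1 + 1 / ln (real N)))) \<le> (\<Sum>p\<in>primes_upto N. 1 / real p) + 8" by simp
  qed
  ultimately show ?thesis by linarith
 next
  case False
  have "ln (ln (real N)) \<le> ln (real N) - 1" using lnN by (intro ln_le_minus_one) auto
  moreover have "(\<Sum>p\<in>primes_upto N. 1 / real p) \<ge> 0" by (intro sum_nonneg) auto
  ultimately show ?thesis using False by linarith
 qed
 from up lo show ?thesis by linarith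
qed

text \<open>Up to distance 2 / ln N the two points are not yet separated by primes up to N: 1 - cos
  u <= u for u >= 0 reduces the difference to Mertens's first sum.\<close>

lemma sum_one_minus_cos_prime_le:
 assumes "N \<ge> 2" "0 \<le> t" "t * ln (real N) \<le> 2"
 shows "(\<Sum>p\<in>primes_upto N. 1 / real p) - (\<Sum>p\<in>primes_upto N. cos (t * ln (real p)) / real p) \<le> 16"
proof -
 have "1 - cos u \<le> u" if "u \<ge> 0" for u :: real
 proof -
  have "\<bar>sin (u / 2)\<bar> \<le> u / 2" using abs_sin_x_le_abs_x[of "u / 2"] that by simp
  moreover have "(sin (u / 2))^2 \<le> \<bar>sin (u / 2)\<bar>"
   using mult_left_le[of "\<bar>sin (u / 2)\<bar>" "\<bar>sin (u / 2)\<bar>"] by (simp add: power2_eq_square flip: abs_mult)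
  moreover have "cos u = 1 - 2 * (sin (u / 2))^2" using cos_double_sin[of "u / 2"] by simp
  ultimately show ?thesis by linarith
 qed
 hence "(\<Sum>p\<in>primes_upto N. 1 / real p - cos (t * ln (real p)) / real p) \<le> (\<Sum>p\<in>primes_upto N. t * (ln (real p) / real p))"
 proof (intro sum_mono)
  fix p assume *: "\<And>u::real. u \<ge> 0 ==> 1 - cos u \<le> u" and "p \<in> primes_upto N"
  hence p: "p > 1" by (auto simp: primes_upto_def dest: prime_gt_1_nat)
  have "(1 - cos (t * ln (real p))) / real p \<le> t * ln (real p) / real p"
   using *[of "t * ln (real p)"] p assms by (intro divide_right_mono) auto
  thus "1 / real p - cos (t * ln (real p)) / real p \<le> t * (ln (real p) / real p)" by (simp add: diff_divide_distrib)
 qed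
 also have "... = t * (\<Sum>p\<in>primes_upto N. ln (real p) / real p)" by (simp add: sum_distrib_left)
 also have "... \<le> t * (8 * ln (real N))" using assms by (intro mult_left_mono sum_log_prime_le) auto
 also have "... \<le> 16" using assms(3) by simp
 finally show ?thesis by (simp add: sum_subtractf)
qed

section \<open>Passage from primes up to N to the first N primes\<close>

lemma infinite_primes_set: "infinite {p::nat. prime p}"
 by (rule primes_infinite)

lemma enumerate_primes_ge: "enumerate {p::nat. prime p} n \<ge> n + 2"
proof (induction n)
 case 0
 have "enumerate {p::nat. prime p} 0 \<in> {p. prime p}" by (rule enumerate_in_set[OF infinite_primes_set])
 thus ?case by (auto dest: prime_ge_2_nat)
next
 case (Suc n)
 have "enumerate {p::nat. prime p} n < enumerate {p::nat. prime p} (Suc n)"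
  by (rule enumerate_step[OF infinite_primes_set])
 thus ?case using Suc by simp
qed

lemma prime_prime_seq: "prime (prime_seq j)"
 using enumerate_in_set[OF infinite_primes_set, of "j - 1"] by (simp add: prime_seq_def)

lemma prime_seq_gt: "j \<ge> 1 ==> prime_seq j > j"
 using enumerate_primes_ge[of "j - 1"] by (simp add: prime_seq_def)

lemma inj_on_prime_seq: "inj_on prime_seq {1..}"
proof (rule inj_onI)
 fix i j assume ij: "i \<in> {1..}" "j \<in> {1..}" "prime_seq i = prime_seq j"
 have "inj (enumerate {p::nat. prime p})"
  by (rule strict_mono_imp_inj_on, rule strict_mono_enumerate, rule infinite_primes_set)
 hence "i - 1 = j - 1" using ij(3) by (simp add: prime_seq_def inj_eq)
 thus "i = j" using ij by auto
qed

lemma primes_upto_subset: "primes_upto N \<subseteq> prime_seq ` {1..N}"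
proof
 fix p assume p: "p \<in> primes_upto N"
 then obtain n where n: "p = enumerate {p::nat. prime p} n"
  using range_enumerate[OF infinite_primes_set] by (auto simp: primes_upto_def)
 have "n + 2 \<le> N" using enumerate_primes_ge[of n] p n by (simp add: primes_upto_def)
 thus "p \<in> prime_seq ` {1..N}" using n by (intro image_eqI[of _ _ "n + 1"]) (auto simp: prime_seq_def)
qed

text \<open>The first N primes contain all primes up to N. The remaining ones are at most N in
  number and each exceeds N, so together they contribute at most N * (1 / N).\<close>

lemma sum_prime_seq_diff:
 fixes f :: "nat => real"
 assumes "\<And>p. prime p ==> \<bar>f p\<bar> \<le> 1 / real p"
 shows "\<bar>(\<Sum>j=1..N. f (prime_seq j)) - (\<Sum>p\<in>primes_upto N. f p)\<bar> \<le> 1"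
proof -
 have "(\<Sum>j=1..N. f (prime_seq j)) = (\<Sum>p\<in>prime_seq ` {1..N}. f p)"
  by (subst sum.reindex) (auto intro: inj_on_subset[OF inj_on_prime_seq])
 also have "... = (\<Sum>p\<in>prime_seq ` {1..N} - primes_upto N. f p) + (\<Sum>p\<in>primes_upto N. f p)"
  by (rule sum.subset_diff[OF primes_upto_subset]) simp
 finally have "\<bar>(\<Sum>j=1..N. f (prime_seq j)) - (\<Sum>p\<in>primes_upto N. f p)\<bar> = \<bar>\<Sum>p\<in>prime_seq ` {1..N} - primes_upto N. f p\<bar>"
  by simp
 also have "... \<le> (\<Sum>p\<in>prime_seq ` {1..N} - primes_upto N. \<bar>f p\<bar>)" by (rule sum_abs)
 also have "... \<le> (\<Sum>p\<in>prime_seq ` {1..N} - primes_upto N. 1 / real N)"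
 proof (rule sum_mono)
  fix p assume p: "p \<in> prime_seq ` {1..N} - primes_upto N"
  hence pr: "prime p" using prime_prime_seq by auto
  hence "p > N" using p by (auto simp: primes_upto_def)
  moreover have "N > 0" using p by auto
  ultimately have "1 / real p \<le> 1 / real N" by (intro divide_left_mono) auto
  thus "\<bar>f p\<bar> \<le> 1 / real N" using assms[OF pr] by simp
 qed
 also have "... \<le> (\<Sum>p\<in>prime_seq ` {1..N}. 1 / real N)" by (rule sum_mono2) auto
 also have "... \<le> 1"
 proof -
  have "card (prime_seq ` {1..N}) \<le> N" using card_image_le[of "{1..N}" prime_seq] by simp
  thus ?thesis by (cases "N = 0") (auto simp: divide_le_eq)
 qed
 finally show ?thesis .
qed

lemma sum_cos_prime_seq_diff:
 "\<bar>(\<Sum>j=1..N. (1 / sqrt (real (prime_seq j)))^2 * cos (t * ln (real (prime_seq j))))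
  - (\<Sum>p\<in>primes_upto N. cos (t * ln (real p)) / real p)\<bar> \<le> 1"
proof -
 have "\<bar>cos (t * ln (real p)) / real p\<bar> \<le> 1 / real p" for p
  using abs_cos_le_one[of "t * ln (real p)"] by (simp add: divide_right_mono)
 from sum_prime_seq_diff[of "\<lambda>p. cos (t * ln (real p)) / real p", OF this] show ?thesis
  by (simp add: power_divide)
qed

lemma sum_sqrt_prime_seq_diff:
 "\<bar>(\<Sum>j=1..N. (1 / sqrt (real (prime_seq j)))^2) - (\<Sum>p\<in>primes_upto N. 1 / real p)\<bar> \<le> 1"
 using sum_cos_prime_seq_diff[where N=N and t=0] by simp

text \<open>The value 6000 is a generous common constant for this and the next two estimates; the
  bounds obtained are 41, 42 and 18.\<close>

lemma prime_seq_S_bound: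
 assumes "N \<ge> 3"
 shows "\<bar>(\<Sum>j=1..N. (1 / sqrt (real (prime_seq j)))^2) - ln (ln (real N))\<bar> \<le> 6000"
 using sum_sqrt_prime_seq_diff[of N] sum_inverse_primes_bounds[OF assms] by linarith

lemma prime_seq_D_upper:
 assumes "0 < t" "t \<le> 2"
 shows "(\<Sum>j=1..N. (1 / sqrt (real (prime_seq j)))^2 * cos (t * ln (real (prime_seq j)))) \<le> ln (1 / t) + 6000"
 using sum_cos_prime_seq_diff[where N=N and t=t] sum_cos_prime_le[OF assms, of N] by linarith

lemma prime_seq_D_lower:
 assumes "N \<ge> 3" "0 \<le> t" "t * ln (real N) \<le> 2"
 shows "(\<Sum>j=1..N. (1 / sqrt (real (prime_seq j)))^2)
  - (\<Sum>j=1..N. (1 / sqrt (real (prime_seq j)))^2 * cos (t * ln (real (prime_seq j)))) \<le> 6000"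
 using sum_cos_prime_seq_diff[where N=N and t=t] sum_sqrt_prime_seq_diff[of N]
  sum_one_minus_cos_prime_le[of N t] assms by linarith

text \<open>Third-order Taylor errors, one for each prime, will be summed against these weights. The
  j-th prime exceeds j, which leaves a convergent series of j^(-3/2).\<close>

lemma summable_prime_seq_cube: "summable (\<lambda>j. (1 / sqrt (real (prime_seq j))) ^ 3)"
proof (rule summable_comparison_test_ev)
 show "summable (\<lambda>j. real j powr (- (3 / 2)))" by (subst summable_real_powr_iff) simp
 show "\<forall>\<^sub>F j in sequentially. norm ((1 / sqrt (real (prime_seq j))) ^ 3) \<le> real j powr (- (3 / 2))"
 proof (rule eventually_mono[OF eventually_ge_at_top[of 1]])
  fix j :: nat assume j: "j \<ge> 1"
  have "(1 / sqrt (real (prime_seq j))) ^ 3 \<le> (1 / sqrt (real j)) ^ 3"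
   using prime_seq_gt[OF j] j
   by (intro power_mono divide_left_mono real_sqrt_le_mono mult_pos_pos) auto
  also have "... = (real j powr (- (1/2))) ^ 3"
   using j by (simp add: powr_half_sqrt[symmetric] powr_minus_divide)
  also have "... = real j powr (- (1/2) + - (1/2) + - (1/2))"
   by (simp only: power3_eq_cube powr_add)
  also have "- (1/2) + - (1/2) + - (1/2) = - (3 / 2 :: real)" by simp
  finally show "norm ((1 / sqrt (real (prime_seq j))) ^ 3) \<le> real j powr (- (3 / 2))" by simp
 qed
qed

section \<open>A kernel with compactly supported Fourier transform\<close>

text \<open>The Fejer kernel, normalised as the Fourier integral of the triangle max(0, 1 - |u|) /
  2. The value at 0 is the continuous extension.\<close>

definition fejer :: "real => real" where
 "fejer y = (if y = 0 then 1 / 2 else (1 - cos y) / y^2)"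

text \<open>The Fejer kernel vanishes at the nonzero multiples of 2 pi. Adding a translate by 1
  removes all zeros, so that functions may be divided by \<open>kern\<close>, and multiplies the
  transform by 1 + exp(i u) without enlarging its support.\<close>

definition kern :: "real => real" where
 "kern y = fejer y + fejer (y + 1)"

definition kern_ft :: "real => complex" where
 "kern_ft u = of_real (max 0 (1 - \<bar>u\<bar>) / 2) * (1 + iexp u)"

lemma fejer_measurable [measurable]: "fejer \<in> borel_measurable borel"
 unfolding fejer_def by measurable

lemma kern_measurable [measurable]: "kern \<in> borel_measurable borel"
 unfolding kern_def by measurable

lemma kern_ft_measurable [measurable]: "kern_ft \<in> borel_measurable borel"
 unfolding kern_ft_def by measurable

lemma kern_ft_eq_0: "\<bar>u\<bar> \<ge> 1 ==> kern_ft u = 0"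
 by (simp add: kern_ft_def)

lemma norm_kern_ft_le: "norm (kern_ft u) \<le> 1"
proof -
 have "norm (1 + iexp u) \<le> norm (1::complex) + norm (iexp u)" by (rule norm_triangle_ineq)
 hence "norm (1 + iexp u) \<le> 2" by simp
 hence "max 0 (1 - \<bar>u\<bar>) / 2 * norm (1 + iexp u) \<le> 1 / 2 * 2"
  by (intro mult_mono) auto
 thus ?thesis unfolding kern_ft_def norm_mult norm_of_real by simp
qed

lemma isCont_kern_ft: "isCont kern_ft u"
 unfolding kern_ft_def by (intro continuous_intros) auto

lemma integral_triangle_iexp:
 "has_bochner_integral lborel (\<lambda>u. of_real (max 0 (1 - \<bar>u\<bar>) / 2) * iexp (u * z)) (of_real (fejer z))"
proof (cases "z = 0")
 case True
 let ?F = "\<lambda>u::real. (u + u^2 / 2) / 2" and ?G = "\<lambda>u::real. (u - u\<^sup>2 / 2) / 2"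
 have 1: "has_bochner_integral lborel (\<lambda>u. (1 + u) / 2 * indicator {-1..0} u) (?F 0 - ?F (-1))"
  by (rule has_bochner_integral_FTC_Icc_real)
    (auto intro!: derivative_eq_intros continuous_intros simp: field_simps)
 have 2: "has_bochner_integral lborel (\<lambda>u. (1 - u) / 2 * indicator {0..1} u) (?G 1 - ?G 0)"
  by (rule has_bochner_integral_FTC_Icc_real)
    (auto intro!: derivative_eq_intros continuous_intros simp: field_simps)
 have "has_bochner_integral lborel (\<lambda>u. (1 + u) / 2 * indicator {-1..0} u + (1 - u) / 2 * indicator {0..1} u) (fejer z)"
  using has_bochner_integral_add[OF 1 2] by (simp add: fejer_def True)
 hence "has_bochner_integral lborel (\<lambda>u. complex_of_real ((1 + u) / 2 * indicator {-1..0} u + (1 - u) / 2 * indicator {0..1} u)) (of_real (fejer z))"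
  by (rule has_bochner_integral_of_real)
 moreover have "AE u in lborel. u \<noteq> (0::real)" by (rule AE_lborel_singleton)
 hence "AE u in lborel. complex_of_real ((1 + u) / 2 * indicator {-1..0} u + (1 - u) / 2 * indicator {0..1} u) = of_real (max 0 (1 - \<bar>u\<bar>) / 2) * iexp (u * z)"
  by eventually_elim (auto simp: True indicator_def max_def)
 ultimately show ?thesis
  by (subst (asm) has_bochner_integral_cong_AE) auto
next
 case False
 let ?wt = "\<i> * complex_of_real z"
 have wt: "?wt \<noteq> 0" using False by simp
 let ?F = "\<lambda>u::real. ((1 + of_real u) * iexp (u * z) / ?wt - iexp (u * z) / ?wt^2) / 2"
 let ?G = "\<lambda>u::real. ((1 - of_real u) * iexp (u * z) / ?wt + iexp (u * z) / ?wt^2) / 2"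
 have ee: "iexp (u * z) = exp (?wt * of_real u)" for u by (simp add: mult_ac)
 have cF: "((\<lambda>v. ((1 + v) * exp (?wt * v) / ?wt - exp (?wt * v) / ?wt^2) / 2) has_field_derivative
   ((1 + v) / 2 * exp (?wt * v))) (at v)" for v
  using wt by (auto intro!: derivative_eq_intros simp: power2_eq_square divide_simps) ((simp add: algebra_simps)?)
 have cG: "((\<lambda>v. ((1 - v) * exp (?wt * v) / ?wt + exp (?wt * v) / ?wt^2) / 2) has_field_derivative
   ((1 - v) / 2 * exp (?wt * v))) (at v)" for v
  using wt by (auto intro!: derivative_eq_intros simp: power2_eq_square divide_simps) ((simp add: algebra_simps)?)
 have dF: "(?F has_vector_derivative ((1 + of_real x) / 2 * iexp (x * z))) (at x within S)" for x S
  unfolding ee by (rule has_vector_derivative_real_field[OF cF])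
 have dG: "(?G has_vector_derivative ((1 - of_real x) / 2 * iexp (x * z))) (at x within S)" for x S
  unfolding ee by (rule has_vector_derivative_real_field[OF cG])
 have 1: "has_bochner_integral lborel (\<lambda>u. indicator {-1..0} u *\<^sub>R ((1 + of_real u) / 2 * iexp (u * z))) (?F 0 - ?F (-1))"
  by (rule has_bochner_integral_FTC_Icc[OF _ dF]) (auto intro!: continuous_intros)
 have 2: "has_bochner_integral lborel (\<lambda>u. indicator {0..1} u *\<^sub>R ((1 - of_real u) / 2 * iexp (u * z))) (?G 1 - ?G 0)"
  by (rule has_bochner_integral_FTC_Icc[OF _ dG]) (auto intro!: continuous_intros)
 have "iexp z + iexp (- z) = 2 * complex_of_real (cos z)"
  by (simp add: complex_eq_iff Re_exp Im_exp)
 hence "(?F 0 - ?F (-1)) + (?G 1 - ?G 0) = of_real (fejer z)"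
 proof -
  assume *: "iexp z + iexp (- z) = 2 * complex_of_real (cos z)"
  have "(?F 0 - ?F (-1)) + (?G 1 - ?G 0) = (iexp z + iexp (- z) - 2) / (2 * ?wt^2)"
   by (simp add: add_divide_distrib diff_divide_distrib) (simp add: mult.commute add.commute)
  also have "... = of_real ((1 - cos z) / z^2)"
   unfolding * using False by (simp add: power_mult_distrib divide_simps)
  finally show ?thesis using False by (simp add: fejer_def)
 qed
 hence "has_bochner_integral lborel (\<lambda>u. indicator {-1..0} u *\<^sub>R ((1 + of_real u) / 2 * iexp (u * z)) + indicator {0..1} u *\<^sub>R ((1 - of_real u) / 2 * iexp (u * z))) (of_real (fejer z))"
  using has_bochner_integral_add[OF 1 2] by simp
 moreover have "AE u in lborel. u \<noteq> (0::real)" by (rule AE_lborel_singleton)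
 hence "AE u in lborel. indicator {-1..0} u *\<^sub>R ((1 + of_real u) / 2 * iexp (u * z)) + indicator {0..1} u *\<^sub>R ((1 - of_real u) / 2 * iexp (u * z)) = of_real (max 0 (1 - \<bar>u\<bar>) / 2) * iexp (u * z)"
  by eventually_elim (auto simp: indicator_def max_def)
 ultimately show ?thesis
  by (subst (asm) has_bochner_integral_cong_AE) auto
qed

lemma kern_fourier: "has_bochner_integral lborel (\<lambda>u. kern_ft u * iexp (u * y)) (of_real (kern y))"
proof -
 have "(\<lambda>u. kern_ft u * iexp (u * y)) = (\<lambda>u. of_real (max 0 (1 - \<bar>u\<bar>) / 2) * iexp (u * y) + of_real (max 0 (1 - \<bar>u\<bar>) / 2) * iexp (u * (y + 1)))"
  by (auto simp: kern_ft_def algebra_simps exp_add)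
 thus ?thesis
  using has_bochner_integral_add[OF integral_triangle_iexp[of y] integral_triangle_iexp[of "y + 1"]]
  by (simp add: kern_def)
qed

lemma fejer_nonneg: "fejer y \<ge> 0" by (simp add: fejer_def)

lemma fejer_le_half: "fejer y \<le> 1 / 2"
proof (cases "y = 0")
 case False
 have "\<bar>sin (y / 2)\<bar> \<le> \<bar>y / 2\<bar>" by (rule abs_sin_x_le_abs_x)
 hence "(sin (y / 2))^2 \<le> (y / 2)^2" by (rule abs_le_square_iff[THEN iffD1])
 moreover have "cos y = 1 - 2 * (sin (y / 2))^2" using cos_double_sin[of "y / 2"] by simp
 ultimately have "1 - cos y \<le> y^2 / 2" by (simp add: power_divide)
 thus ?thesis using False by (simp add: fejer_def divide_le_eq)
qed (simp add: fejer_def)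

lemma fejer_le: "fejer y \<le> 4 / (1 + y^2)"
proof (cases "\<bar>y\<bar> \<le> 1")
 case True
 have y2: "y^2 \<le> 1" using True by (simp add: abs_square_le_1)
 have "1 / 2 \<le> 4 / (1 + y^2)" using y2 by (simp add: field_simps add_pos_nonneg)
 thus ?thesis using fejer_le_half[of y] by linarith
next
 case False
 hence y: "y^2 > 1" "y \<noteq> 0" by (auto simp: one_less_power abs_square_le_1 not_le[symmetric])
 have "fejer y \<le> 2 / y^2" using y cos_ge_minus_one[of y] by (simp add: fejer_def divide_right_mono)
 also have "... \<le> 4 / (1 + y^2)" using y by (simp add: field_simps)
 finally show ?thesis .
qed

lemma integrable_inverse_1_plus_sq: "integrable lborel (\<lambda>y::real. 1 / (1 + y^2))"
 using integrable_inverse_1_plus_square by (simp add: set_integrable_def einterval_def inverse_eq_divide)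

lemma integrable_fejer: "integrable lborel fejer"
proof (rule Bochner_Integration.integrable_bound)
 show "integrable lborel (\<lambda>y::real. 4 * (1 / (1 + y^2)))" by (intro integrable_mult_right integrable_inverse_1_plus_sq)
 show "AE y in lborel. norm (fejer y) \<le> norm (4 * (1 / (1 + y^2)))"
  using fejer_le fejer_nonneg by auto
qed auto

lemma integrable_kern: "integrable lborel kern"
proof -
 have "integrable lborel (\<lambda>y. fejer (1 + 1 * y))"
  by (rule lborel_integrable_real_affine[OF integrable_fejer]) simp
 thus ?thesis unfolding kern_def using integrable_fejer by (simp add: add.commute)
qed

lemma kern_lower: "kern y \<ge> (2 - 2 * cos (1/2)) / (1 + \<bar>y\<bar>)^2"
proof -
 have f: "fejer z \<ge> (1 - cos z) / (1 + \<bar>y\<bar>)^2" if "\<bar>z\<bar> \<le> 1 + \<bar>y\<bar>" for z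
 proof (cases "z = 0")
  case False
  have "\<bar>z\<bar>^2 \<le> (1 + \<bar>y\<bar>)^2" using that by (intro power_mono) auto
  thus ?thesis using False by (simp add: fejer_def) (intro divide_left_mono mult_pos_pos, auto)
 qed (simp add: fejer_def)
 have "cos y + cos (y + 1) = 2 * cos (y + 1/2) * cos (1/2)"
  using cos_plus_cos[of "y + 1" y] by (simp add: add.commute add_divide_distrib)
 moreover have "cos (y + 1/2) * cos (1/2) \<le> 1 * cos (1/2)"
  using cos_ge_zero[of "1/2"] pi_gt3 by (intro mult_right_mono) auto
 ultimately have "cos y + cos (y + 1) \<le> 2 * cos (1/2)" by simp
 hence "(2 - 2 * cos (1/2)) / (1 + \<bar>y\<bar>)^2 \<le> ((1 - cos y) + (1 - cos (y + 1))) / (1 + \<bar>y\<bar>)^2"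
  by (intro divide_right_mono) auto
 also have "... = (1 - cos y) / (1 + \<bar>y\<bar>)^2 + (1 - cos (y + 1)) / (1 + \<bar>y\<bar>)^2" by (rule add_divide_distrib)
 also have "... \<le> kern y" unfolding kern_def by (intro add_mono f) auto
 finally show ?thesis .
qed

lemma kern_lower_const_pos: "2 - 2 * cos (1/2 :: real) > 0"
 using cos_monotone_0_pi[of 0 "1/2"] pi_gt3 by simp

lemma kern_pos: "kern y > 0"
proof -
 have "(2 - 2 * cos (1/2 :: real)) / (1 + \<bar>y\<bar>)^2 > 0"
  using kern_lower_const_pos by (intro divide_pos_pos zero_less_power) auto
 thus ?thesis using kern_lower[of y] by linarith
qed

lemma kern_le: "kern y \<le> 1"
 using fejer_le_half[of y] fejer_le_half[of "y + 1"] by (simp add: kern_def)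

lemma isCont_fejer:
 assumes "y \<noteq> 0"
 shows "isCont fejer y"
proof -
 have "eventually (\<lambda>z. z \<noteq> 0) (nhds y)" using assms by (rule t1_space_nhds)
 hence "eventually (\<lambda>z. fejer z = (1 - cos z) / z^2) (nhds y)"
  by eventually_elim (simp add: fejer_def)
 moreover have "isCont (\<lambda>z. (1 - cos z) / z^2) y" using assms by (intro continuous_intros) auto
 ultimately show ?thesis by (subst isCont_cong)
qed

lemma isCont_kern:
 assumes "y \<noteq> 0" "y \<noteq> - 1"
 shows "isCont kern y"
proof -
 have "isCont (\<lambda>y. fejer (y + 1)) y"
  by (rule isCont_o2[of y "\<lambda>y. y + 1" fejer]) (use isCont_fejer[of "y + 1"] assms in auto)
 thus ?thesis unfolding kern_def using isCont_fejer[OF assms(1)] by (intro continuous_intros)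
qed

text \<open>This makes the truncated exponential \<open>gtail\<close> an admissible test function
  for the local limit theorems: exponential decay beats the quadratic decay of
  \<open>kern\<close>.\<close>

lemma exp_tail_le_kern:
 assumes "\<alpha> > 0"
 obtains C where "C > 0" "\<And>y. indicator {0<..} y * exp (- \<alpha> * y) \<le> C * kern y"
proof -
 \<comment> \<open>With this m, m (1 + y) <= 1 + \<alpha> y / 2 <= exp(\<alpha> y / 2). Squaring
   produces both the full exponential and the decay of \<open>kern_lower\<close>.\<close>
 define m where "m = min 1 (\<alpha> / 2)"
 define c where "c = 2 - 2 * cos (1/2 :: real)"
 have m: "m > 0" "m \<le> 1" "m \<le> \<alpha> / 2" using assms by (auto simp: m_def)
 have c: "c > 0" unfolding c_def by (rule kern_lower_const_pos)
 have "indicator {0<..} y * exp (- \<alpha> * y) \<le> 1 / (m^2 * c) * kern y" for y :: real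
 proof (cases "y > 0")
  case True
  have "m * (1 + y) \<le> 1 + \<alpha> / 2 * y" using m True by (simp add: distrib_left add_mono mult_right_mono)
  also have "... \<le> exp (\<alpha> / 2 * y)" by (rule exp_ge_add_one_self)
  finally have "(m * (1 + y))^2 \<le> (exp (\<alpha> / 2 * y))^2" using m True by (intro power_mono) auto
  also have "... = exp (\<alpha> * y)" by (simp add: power2_eq_square flip: exp_add)
  finally have "exp (- \<alpha> * y) \<le> 1 / (m * (1 + y))^2"
   using m True by (simp add: exp_minus inverse_eq_divide) (intro divide_left_mono mult_pos_pos, auto)
  also have "... = 1 / (m^2 * c) * (c / (1 + \<bar>y\<bar>)^2)" using c True by (simp add: power_mult_distrib)
  also have "... \<le> 1 / (m^2 * c) * kern y"
   using kern_lower[of y] c by (intro mult_left_mono) (auto simp: c_def)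
  finally show ?thesis using True by simp
 next
  case False
  thus ?thesis using kern_pos[of y] c by (simp add: less_imp_le)
 qed
 thus ?thesis using m c by (intro that[of "1 / (m^2 * c)"]) auto
qed

lemma integral_kern_pos: "(LBINT y. kern y) > 0"
proof -
 have "(LBINT y. kern y) \<noteq> 0"
 proof
  assume "(LBINT y. kern y) = 0"
  hence "AE y in lborel. kern y = 0"
   using integral_nonneg_eq_0_iff_AE[OF integrable_kern] kern_pos by (auto simp: less_imp_le)
  hence "AE y in (lborel :: real measure). False" using kern_pos by (auto simp: less_le)
  thus False by (simp add: eventually_False ae_filter_eq_bot_iff)
 qed
 moreover have "(LBINT y. kern y) \<ge> 0" using kern_pos by (intro integral_nonneg_AE) (auto simp: less_imp_le)
 ultimately show ?thesis by simp
qed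

lemma integrable_kern_mult_bounded:
 fixes f :: "real => 'b::{banach, second_countable_topology}"
 assumes [measurable]: "f \<in> borel_measurable borel" and B: "\<And>y. norm (f y) \<le> B * kern y"
 shows "integrable lborel f"
proof (rule Bochner_Integration.integrable_bound)
 show "integrable lborel (\<lambda>y. B * kern y)" by (intro integrable_mult_right integrable_kern)
 show "AE y in lborel. norm (f y) \<le> norm (B * kern y)"
  unfolding real_norm_def by (intro AE_I2 order_trans[OF B abs_ge_self])
qed simp

text \<open>
 Convergence of the Fourier transforms of the finite measures with density \<^term>\<open>kern\<close> gives
 vague convergence, through Levy's continuity theorem.
\<close>
lemma weighted_levy_continuity:
 fixes W Y :: "nat => 'a => real" and f :: "real => real"
 assumes [measurable]: "\<And>n. W n \<in> borel_measurable M" "\<And>n. Y n \<in> borel_measurable M"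
  and W0: "\<And>n w. W n w \<ge> 0"
  and int: "\<And>n. integrable M (\<lambda>w. W n w * kern (Y n w))"
  and c: "c \<ge> 0"
  and lim: "\<And>a. (\<lambda>n. CLINT w|M. of_real (W n w * kern (Y n w)) * iexp (a * Y n w))
    \<longlonglongrightarrow> of_real c * (CLBINT y. of_real (kern y) * iexp (a * y))"
  and f [measurable]: "f \<in> borel_measurable borel" and B: "\<And>y. \<bar>f y\<bar> \<le> B * kern y"
  and cont: "AE y in lborel. isCont f y"
 shows "(\<lambda>n. LINT w|M. W n w * f (Y n w)) \<longlonglongrightarrow> c * (LBINT y. f y)"
proof -
 define I where "I = (LBINT y. kern y)"
 define m where "m = (\<lambda>n. LINT w|M. W n w * kern (Y n w))"
 have I: "I > 0" unfolding I_def by (rule integral_kern_pos)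
 have "(\<lambda>n. Re (of_real (m n))) \<longlonglongrightarrow> Re (of_real (c * I) :: complex)"
  using lim[of 0] unfolding m_def I_def by (intro tendsto_Re) (simp del: of_real_mult flip: of_real_mult)
 hence mlim: "m \<longlonglongrightarrow> c * I" by simp
 have kp: "kern y \<ge> 0" for y using kern_pos[of y] by simp
 have intf: "integrable M (\<lambda>w. W n w * f (Y n w))" for n
 proof (rule Bochner_Integration.integrable_bound)
  show "integrable M (\<lambda>w. B * (W n w * kern (Y n w)))" using int by simp
  have "\<bar>W n w * f (Y n w)\<bar> \<le> B * (W n w * kern (Y n w))" for w
   using mult_left_mono[OF B[of "Y n w"] W0[of n w]] W0[of n w] by (simp add: abs_mult mult_ac)
  thus "AE w in M. norm (W n w * f (Y n w)) \<le> norm (B * (W n w * kern (Y n w)))"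
   unfolding real_norm_def by (intro AE_I2 order_trans[OF _ abs_ge_self])
 qed simp
 \<comment> \<open>A vanishing limit mass cannot be normalised to a probability measure. In that
   case the bound \<open>B * m n\<close>, which tends to 0, already suffices.\<close>
 show ?thesis
 proof (cases "c = 0")
  case True
  have bnd: "\<bar>LINT w|M. W n w * f (Y n w)\<bar> \<le> B * m n" for n
  proof -
   have "\<bar>LINT w|M. W n w * f (Y n w)\<bar> \<le> (LINT w|M. \<bar>W n w * f (Y n w)\<bar>)" by (rule integral_abs_bound)
   also have "... \<le> (LINT w|M. B * (W n w * kern (Y n w)))"
   proof (rule integral_mono)
    show "\<bar>W n w * f (Y n w)\<bar> \<le> B * (W n w * kern (Y n w))" for w
     using mult_left_mono[OF B[of "Y n w"] W0[of n w]] W0[of n w] by (simp add: abs_mult mult_ac)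
   qed (use intf int in auto)
   finally show ?thesis by (simp add: m_def)
  qed
  have bz: "(\<lambda>n. B * m n) \<longlonglongrightarrow> 0" using tendsto_mult_left[OF mlim, of B] True by simp
  have "(\<lambda>n. LINT w|M. W n w * f (Y n w)) \<longlonglongrightarrow> 0"
  proof (rule Lim_null_comparison[OF _ bz])
   show "\<forall>\<^sub>F n in sequentially. norm (LINT w|M. W n w * f (Y n w)) \<le> B * m n"
    unfolding real_norm_def by (intro always_eventually allI bnd)
  qed
  thus ?thesis using True by simp
 next
  case False
  hence cp: "c > 0" using c by simp
  hence "eventually (\<lambda>n. m n > 0) sequentially" using order_tendstoD(1)[OF mlim, of 0] I by simp
  \<comment> \<open>The first \<open>n0\<close> terms are dropped so that every remaining mass is
    positive and can be divided out.\<close>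
  then obtain n0 where n0: "\<And>n. n \<ge> n0 ==> m n > 0" by (auto simp: eventually_sequentially)
  define D where "D = (\<lambda>n w. W (n + n0) w * kern (Y (n + n0) w) / m (n + n0))"
  define \<nu> where "\<nu> = (\<lambda>n. distr (density M (\<lambda>w. ennreal (D n w))) borel (Y (n + n0)))"
  define \<mu> where "\<mu> = density lborel (\<lambda>y. ennreal (kern y / I))"
  have mp: "m (n + n0) > 0" for n using n0 by simp
  have D0: "D n w \<ge> 0" for n w unfolding D_def using W0 kp mp[of n] by (simp add: less_imp_le)
  have Dm [measurable]: "D n \<in> borel_measurable M" for n unfolding D_def by measurable
  have Dint: "integrable M (D n)" for n unfolding D_def using int by simp
  have D1: "(LINT w|M. D n w) = 1" for n unfolding D_def using mp[of n] by (simp add: m_def)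
  have "emeasure (density M (\<lambda>w. ennreal (D n w))) (space M) = 1" for n
   using D0 Dint D1 by (subst emeasure_density) (auto simp: nn_integral_eq_integral cong: nn_integral_cong_simp)
  hence "prob_space (density M (\<lambda>w. ennreal (D n w)))" for n by (intro prob_spaceI) simp
  hence "prob_space (\<nu> n)" for n unfolding \<nu>_def by (intro prob_space.prob_space_distr) auto
  hence rd: "real_distribution (\<nu> n)" for n
   unfolding real_distribution_def real_distribution_axioms_def by (auto simp: \<nu>_def)
  have "emeasure \<mu> (space \<mu>) = ennreal (LBINT y. kern y / I)"
   unfolding \<mu>_def using kp I integrable_kern
   by (subst emeasure_density) (auto simp: nn_integral_eq_integral less_imp_le)
  also have "... = 1" using I by (simp add: I_def)
  finally have "prob_space \<mu>" by (rule prob_spaceI)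
  hence rdm: "real_distribution \<mu>"
   unfolding real_distribution_def real_distribution_axioms_def by (auto simp: \<mu>_def)
  have "(\<lambda>n. char (\<nu> n) a) \<longlonglongrightarrow> char \<mu> a" for a
  proof -
   have e1: "char (\<nu> n) a = (CLINT w|M. of_real (W (n + n0) w * kern (Y (n + n0) w)) * iexp (a * Y (n + n0) w)) / of_real (m (n + n0))" for n
   proof -
    have "char (\<nu> n) a = (CLINT w|density M (\<lambda>w. ennreal (D n w)). iexp (a * Y (n + n0) w))"
     unfolding char_def \<nu>_def by (rule integral_distr) auto
    also have "... = (CLINT w|M. D n w *\<^sub>R iexp (a * Y (n + n0) w))"
     using D0 by (intro integral_density) auto
    also have "... = (CLINT w|M. of_real (W (n + n0) w * kern (Y (n + n0) w)) * iexp (a * Y (n + n0) w) / of_real (m (n + n0)))"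
     by (intro Bochner_Integration.integral_cong) (auto simp: D_def scaleR_conv_of_real)
    also have "... = (CLINT w|M. of_real (W (n + n0) w * kern (Y (n + n0) w)) * iexp (a * Y (n + n0) w)) / of_real (m (n + n0))"
     by (rule integral_divide_zero)
    finally show ?thesis .
   qed
   have e2: "char \<mu> a = (CLBINT y. of_real (kern y) * iexp (a * y)) / of_real I"
   proof -
    have "char \<mu> a = (CLBINT y. (kern y / I) *\<^sub>R iexp (a * y))"
     unfolding char_def \<mu>_def using kp I by (intro integral_density) (auto simp: less_imp_le)
    also have "... = (CLBINT y. of_real (kern y) * iexp (a * y) / of_real I)"
     by (intro Bochner_Integration.integral_cong) (auto simp: scaleR_conv_of_real)
    also have "... = (CLBINT y. of_real (kern y) * iexp (a * y)) / of_real I"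
     by (rule integral_divide_zero)
    finally show ?thesis .
   qed
   have "(\<lambda>n. (CLINT w|M. of_real (W (n + n0) w * kern (Y (n + n0) w)) * iexp (a * Y (n + n0) w)) / of_real (m (n + n0)))
    \<longlonglongrightarrow> of_real c * (CLBINT y. of_real (kern y) * iexp (a * y)) / of_real (c * I)"
    using cp I by (intro tendsto_divide LIMSEQ_ignore_initial_segment[OF lim] tendsto_of_real LIMSEQ_ignore_initial_segment[OF mlim]) auto
   thus ?thesis unfolding e1 e2 using cp by simp
  qed
  hence wc: "weak_conv_m \<nu> \<mu>" by (intro levy_continuity rd rdm) auto
  \<comment> \<open>The kernel is part of the density of the measures, so the test function becomes
    f / kern, which is bounded and almost everywhere continuous.\<close>
  define g where "g = (\<lambda>y. f y / kern y)"
  have gm [measurable]: "g \<in> borel_measurable borel" unfolding g_def by measurable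
  have gB: "norm (g y) \<le> B" for y using B[of y] kern_pos[of y] by (simp add: g_def divide_le_eq)
  have fg: "kern y * g y = f y" for y using kern_pos[of y] by (simp add: g_def)
  have disc: "emeasure \<mu> {x. \<not> isCont g x} = 0"
  proof -
   have "AE y in lborel. y \<noteq> (0::real)" "AE y in lborel. y \<noteq> (-1::real)" by (rule AE_lborel_singleton)+
   with cont have "AE y in lborel. isCont g y"
   proof eventually_elim
    case (elim y)
    thus ?case unfolding g_def using kern_pos[of y] isCont_kern[of y] by (intro continuous_intros) auto
   qed
   hence "AE y in \<mu>. isCont g y" unfolding \<mu>_def by (subst AE_density) auto
   hence "AE y in \<mu>. \<not> \<not> isCont g y" by simp
   hence "emeasure \<mu> {y \<in> space \<mu>. \<not> isCont g y} = 0" by (rule emeasure_eq_0_AE)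
   thus ?thesis by (simp add: \<mu>_def)
  qed
  have "(\<lambda>n. integral\<^sup>L (\<nu> n) g) \<longlonglongrightarrow> integral\<^sup>L \<mu> g"
   using rd rdm wc disc gB gm by (rule weak_conv_imp_bdd_ae_continuous_conv)
  moreover have "integral\<^sup>L (\<nu> n) g = (LINT w|M. W (n + n0) w * f (Y (n + n0) w)) / m (n + n0)" for n
  proof -
   have "integral\<^sup>L (\<nu> n) g = (LINT w|density M (\<lambda>w. ennreal (D n w)). g (Y (n + n0) w))"
    unfolding \<nu>_def by (rule integral_distr) auto
   also have "... = (LINT w|M. D n w * g (Y (n + n0) w))"
    using D0 by (subst integral_density) auto
   also have "... = (LINT w|M. W (n + n0) w * f (Y (n + n0) w) / m (n + n0))"
    by (intro Bochner_Integration.integral_cong) (auto simp: D_def mult.assoc fg)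
   finally show ?thesis by simp
  qed
  moreover have "integral\<^sup>L \<mu> g = (LBINT y. f y) / I"
  proof -
   have "integral\<^sup>L \<mu> g = (LBINT y. kern y / I * g y)"
    unfolding \<mu>_def using kp I by (subst integral_density) (auto simp: less_imp_le)
   thus ?thesis by (simp add: fg)
  qed
  ultimately have "(\<lambda>n. (LINT w|M. W (n + n0) w * f (Y (n + n0) w)) / m (n + n0)) \<longlonglongrightarrow> (LBINT y. f y) / I" by simp
  from tendsto_mult[OF this LIMSEQ_ignore_initial_segment[OF mlim, of n0]]
  have "(\<lambda>n. (LINT w|M. W (n + n0) w * f (Y (n + n0) w))) \<longlonglongrightarrow> (LBINT y. f y) / I * (c * I)"
   using mp by (simp add: less_imp_neq[symmetric] order_less_imp_not_eq2)
  hence "(\<lambda>n. (LINT w|M. W (n + n0) w * f (Y (n + n0) w))) \<longlonglongrightarrow> c * (LBINT y. f y)"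
   using I by (simp add: mult.commute)
  thus ?thesis by (rule LIMSEQ_offset)
 qed
qed

section \<open>Scaling limits of smoothed Gaussian transforms\<close>

lemma integrable_gauss:
 assumes "c > 0"
 shows "integrable lborel (\<lambda>x::real. exp (- c * x^2))"
proof -
 define \<xi> where "\<xi> = sqrt (1 / (2 * c))"
 have s: "\<xi> > 0" "\<xi>^2 = 1 / (2 * c)" using assms by (auto simp: \<xi>_def)
 have "integrable lborel (\<lambda>x. sqrt (2 * pi * \<xi>^2) * normal_density 0 \<xi> x)"
  using s by (intro integrable_mult_right integrable_normal_density) auto
 also have "(\<lambda>x. sqrt (2 * pi * \<xi>^2) * normal_density 0 \<xi> x) = (\<lambda>x. exp (- c * x^2))"
  using s assms by (auto simp: normal_density_def fun_eq_iff)
 finally show ?thesis .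
qed

lemma integral_gauss_half: "(LBINT x. exp (- (x^2 / 2))) = sqrt (2 * pi)"
proof -
 have "(LBINT x. sqrt (2 * pi) * std_normal_density x) = sqrt (2 * pi)" by simp
 thus ?thesis by (simp add: std_normal_density_def)
qed

lemma integral_scale:
 fixes f :: "real => 'b::{banach, second_countable_topology}"
 assumes "s > 0"
 shows "s *\<^sub>R (LBINT x. f x) = (LBINT x. f (x / s))"
 using lborel_integral_real_affine[of "1 / s" f 0] assms by (simp add: field_simps)

text \<open>\<Psi> stands for a characteristic function concentrated at frequencies of order 1 / s.
  After the substitution v = s (u + a), the factor \<open>kern_ft (v / s - a)\<close> tends to its
  value at -a and the rest to a Gaussian. The compact support of \<open>kern_ft\<close> confines u +
  a to the range where the Gaussian majorant is assumed.\<close>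

lemma kern_scaling_limit:
 fixes \<Psi> :: "nat => real => complex" and s :: "nat => real"
 assumes [measurable]: "\<And>n. \<Psi> n \<in> borel_measurable borel"
  and s: "filterlim s at_top sequentially" and s0: "\<And>n. s n > 0" and c: "c > 0"
  and bound: "eventually (\<lambda>n. \<forall>u. \<bar>u\<bar> \<le> 1 + \<bar>a\<bar> \<longrightarrow> norm (\<Psi> n u) \<le> K * exp (- c * (s n)^2 * u^2)) sequentially"
  and lim: "\<And>u. (\<lambda>n. \<Psi> n (u / s n)) \<longlonglongrightarrow> E * of_real (exp (- (u^2 / 2)))"
 shows "(\<lambda>n. of_real (s n) * (CLBINT u. kern_ft u * \<Psi> n (u + a))) \<longlonglongrightarrow> E * kern_ft (- a) * of_real (sqrt (2 * pi))"
proof -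
 have eq: "of_real (s n) * (CLBINT u. kern_ft u * \<Psi> n (u + a)) = (CLBINT v. kern_ft (v / s n - a) * \<Psi> n (v / s n))" for n
 proof -
  have "(CLBINT v. kern_ft (v - a) * \<Psi> n v) = (CLBINT u. kern_ft u * \<Psi> n (u + a))"
   using lborel_integral_real_affine[of 1 "\<lambda>v. kern_ft (v - a) * \<Psi> n v" a] by (simp add: add.commute)
  thus ?thesis using integral_scale[OF s0[of n], of "\<lambda>v. kern_ft (v - a) * \<Psi> n v"] by (simp add: scaleR_conv_of_real)
 qed
 have K0: "K \<ge> 0"
 proof -
  obtain n where "\<forall>u. \<bar>u\<bar> \<le> 1 + \<bar>a\<bar> \<longrightarrow> norm (\<Psi> n u) \<le> K * exp (- c * (s n)^2 * u^2)"
   using bound by (auto simp: eventually_sequentially)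
  from this[rule_format, of 0] have "norm (\<Psi> n 0) \<le> K" by simp
  thus ?thesis using norm_ge_zero[of "\<Psi> n 0"] by linarith
 qed
 obtain n0 where n0: "\<And>n u. n \<ge> n0 ==> \<bar>u\<bar> \<le> 1 + \<bar>a\<bar> ==> norm (\<Psi> n u) \<le> K * exp (- c * (s n)^2 * u^2)"
  using bound by (auto simp: eventually_sequentially)
 have "(\<lambda>n. CLBINT v. kern_ft (v / s (n + n0) - a) * \<Psi> (n + n0) (v / s (n + n0))) \<longlonglongrightarrow> (CLBINT v. kern_ft (- a) * (E * of_real (exp (- (v^2 / 2)))))"
 proof (rule integral_dominated_convergence[where w = "\<lambda>v. K * exp (- c * v^2)"])
  show "integrable lborel (\<lambda>v. K * exp (- c * v^2))" by (intro integrable_mult_right integrable_gauss c)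
  show "AE v in lborel. (\<lambda>n. kern_ft (v / s (n + n0) - a) * \<Psi> (n + n0) (v / s (n + n0))) \<longlonglongrightarrow> kern_ft (- a) * (E * of_real (exp (- (v^2 / 2))))"
  proof (intro AE_I2 tendsto_mult)
   fix v :: real
   have "(\<lambda>n. v / s n) \<longlonglongrightarrow> 0" by (intro tendsto_divide_0[OF tendsto_const] filterlim_at_top_imp_at_infinity s)
   hence "(\<lambda>n. v / s n - a) \<longlonglongrightarrow> 0 - a" by (intro tendsto_intros)
   hence "(\<lambda>n. v / s (n + n0) - a) \<longlonglongrightarrow> - a" using LIMSEQ_ignore_initial_segment[of "\<lambda>n. v / s n - a" "- a" n0] by simp
   thus "(\<lambda>n. kern_ft (v / s (n + n0) - a)) \<longlonglongrightarrow> kern_ft (- a)" by (rule isCont_tendsto_compose[OF isCont_kern_ft])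
   show "(\<lambda>n. \<Psi> (n + n0) (v / s (n + n0))) \<longlonglongrightarrow> E * of_real (exp (- (v^2 / 2)))"
    by (rule LIMSEQ_ignore_initial_segment[OF lim])
  qed
  show "AE v in lborel. norm (kern_ft (v / s (n + n0) - a) * \<Psi> (n + n0) (v / s (n + n0))) \<le> K * exp (- c * v^2)" for n
  proof (intro AE_I2)
   fix v :: real
   let ?s = "s (n + n0)"
   show "norm (kern_ft (v / ?s - a) * \<Psi> (n + n0) (v / ?s)) \<le> K * exp (- c * v^2)"
   proof (cases "\<bar>v / ?s - a\<bar> \<ge> 1")
    case True
    thus ?thesis using K0 by (simp add: kern_ft_eq_0)
   next
    case False
    hence "\<bar>v / ?s\<bar> \<le> 1 + \<bar>a\<bar>" by linarith
    hence "norm (\<Psi> (n + n0) (v / ?s)) \<le> K * exp (- c * ?s^2 * (v / ?s)^2)" by (intro n0) auto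
    also have "... = K * exp (- c * v^2)" using s0[of "n + n0"] by (simp add: power_divide)
    finally have "norm (kern_ft (v / ?s - a)) * norm (\<Psi> (n + n0) (v / ?s)) \<le> 1 * (K * exp (- c * v^2))"
     using norm_kern_ft_le by (intro mult_mono) auto
    thus ?thesis by (simp add: norm_mult)
   qed
  qed
 qed auto
 hence "(\<lambda>n. CLBINT v. kern_ft (v / s n - a) * \<Psi> n (v / s n)) \<longlonglongrightarrow> (CLBINT v. kern_ft (- a) * (E * of_real (exp (- (v^2 / 2)))))"
  by (rule LIMSEQ_offset)
 also have "(CLBINT v. kern_ft (- a) * (E * of_real (exp (- (v^2 / 2))))) = kern_ft (- a) * (E * of_real (LBINT v. exp (- (v^2 / 2))))"
  by (simp only: integral_mult_right_zero integral_complex_of_real)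
 finally show ?thesis by (simp add: eq integral_gauss_half mult_ac)
qed

lemma kern_ft_integrable_bounded:
 fixes f :: "real => complex"
 assumes [measurable]: "f \<in> borel_measurable borel" and B: "\<And>u. \<bar>u\<bar> \<le> 1 ==> norm (f u) \<le> B"
 shows "integrable lborel (\<lambda>u. kern_ft u * f u)"
proof (rule Bochner_Integration.integrable_bound[of _ "\<lambda>u. B * indicator {-1..1::real} u"])
 show "AE u in lborel. norm (kern_ft u * f u) \<le> norm (B * indicator {-1..1} u)"
 proof (intro AE_I2)
  fix u :: real
  show "norm (kern_ft u * f u) \<le> norm (B * indicator {-1..1} u)"
  proof (cases "\<bar>u\<bar> \<le> 1")
   case True
   have "norm (kern_ft u) * norm (f u) \<le> 1 * B" using norm_kern_ft_le B[OF True] by (intro mult_mono) auto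
   thus ?thesis using True by (auto simp: norm_mult indicator_def)
  qed (simp add: kern_ft_eq_0)
 qed
qed auto

text \<open>The one-variable limit is used twice. The inner integral, multiplied by one factor s,
  again satisfies the hypotheses of \<open>kern_scaling_limit\<close> as a function of u.\<close>

lemma kern_scaling_limit2:
 fixes \<Psi> :: "nat => real => real => complex" and s :: "nat => real"
 assumes [measurable]: "\<And>n. (\<lambda>(u, v). \<Psi> n u v) \<in> borel_measurable (borel \<Otimes>\<^sub>M borel)"
  and s: "filterlim s at_top sequentially" and s0: "\<And>n. s n > 0" and c: "c > 0"
  and bound: "eventually (\<lambda>n. \<forall>u v. \<bar>u\<bar> \<le> 1 + \<bar>a\<bar> \<longrightarrow> \<bar>v\<bar> \<le> 1 + \<bar>b\<bar> \<longrightarrow> norm (\<Psi> n u v) \<le> K * exp (- c * (s n)^2 * (u^2 + v^2))) sequentially"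
  and lim: "\<And>u v. (\<lambda>n. \<Psi> n (u / s n) (v / s n)) \<longlonglongrightarrow> E * of_real (exp (- ((u^2 + v^2) / 2)))"
 shows "(\<lambda>n. of_real ((s n)^2) * (CLBINT u. kern_ft u * (CLBINT v. kern_ft v * \<Psi> n (u + a) (v + b)))) \<longlonglongrightarrow> E * kern_ft (- a) * kern_ft (- b) * of_real (2 * pi)"
proof -
 define \<Phi> where "\<Phi> = (\<lambda>n u. of_real (s n) * (CLBINT v. kern_ft v * \<Psi> n u (v + b)))"
 have [measurable]: "(\<lambda>v. \<Psi> n u v) \<in> borel_measurable borel" for n u
 proof -
  have "(\<lambda>v. case (u, v) of (u, v) => \<Psi> n u v) \<in> borel_measurable borel" by measurable
  thus ?thesis by simp
 qed
 have [measurable]: "\<Phi> n \<in> borel_measurable borel" for n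
 proof -
  have [measurable]: "(\<lambda>(u, v). \<Psi> n u (v + b)) \<in> borel_measurable (borel \<Otimes>\<^sub>M lborel)"
  proof -
   have "(\<lambda>p. case (fst p, snd p + b) of (u, v) => \<Psi> n u v) \<in> borel_measurable (borel \<Otimes>\<^sub>M lborel)" by measurable
   thus ?thesis by (simp add: case_prod_beta')
  qed
  have "(\<lambda>u. CLBINT v. kern_ft v * \<Psi> n u (v + b)) \<in> borel_measurable borel"
   by (rule lborel.borel_measurable_lebesgue_integral) measurable
  thus ?thesis unfolding \<Phi>_def by measurable
 qed
 obtain n0 where n0: "\<And>n u v. n \<ge> n0 ==> \<bar>u\<bar> \<le> 1 + \<bar>a\<bar> ==> \<bar>v\<bar> \<le> 1 + \<bar>b\<bar> ==> norm (\<Psi> n u v) \<le> K * exp (- c * (s n)^2 * (u^2 + v^2))"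
  using bound by (auto simp: eventually_sequentially)
 have "norm (\<Psi> n0 0 0) \<le> K" using n0[of n0 0 0] by simp
 hence K0: "K \<ge> 0" using norm_ge_zero[of "\<Psi> n0 0 0"] by linarith
 \<comment> \<open>After rescaling by s the inner Gaussian integral equals this constant for every
   n, so the majorant for the outer step is \<open>K * G\<close>.\<close>
 define G where "G = (LBINT v::real. exp (- c * v^2))"
 have "norm (\<Phi> n u) \<le> K * G * exp (- c * (s n)^2 * u^2)" if n: "n \<ge> n0" and u: "\<bar>u\<bar> \<le> 1 + \<bar>a\<bar>" for n u
 proof -
  have sc: "c * (s n)^2 > 0" using c s0[of n] by simp
  have "norm (CLBINT v. kern_ft v * \<Psi> n u (v + b)) \<le> (LBINT v. K * exp (- c * (s n)^2 * u^2) * exp (- (c * (s n)^2) * (v + b)^2))"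
  proof (rule order_trans[OF integral_norm_bound integral_mono])
   show "integrable lborel (\<lambda>v. norm (kern_ft v * \<Psi> n u (v + b)))"
   proof (intro integrable_norm kern_ft_integrable_bounded)
    fix v :: real assume "\<bar>v\<bar> \<le> 1"
    hence "norm (\<Psi> n u (v + b)) \<le> K * exp (- c * (s n)^2 * (u^2 + (v + b)^2))" by (intro n0 n u) linarith
    also have "... \<le> K * 1" using K0 sc by (intro mult_left_mono) (auto simp: mult_nonneg_nonneg less_imp_le)
    finally show "norm (\<Psi> n u (v + b)) \<le> K" by simp
   qed measurable
   show "integrable lborel (\<lambda>v. K * exp (- c * (s n)^2 * u^2) * exp (- (c * (s n)^2) * (v + b)^2))"
   proof (rule integrable_mult_right)
    have "integrable lborel (\<lambda>v. exp (- (c * (s n)^2) * (b + 1 * v)^2))"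
     by (rule lborel_integrable_real_affine[OF integrable_gauss[OF sc]]) simp
    thus "integrable lborel (\<lambda>v. exp (- (c * (s n)^2) * (v + b)^2))" by (simp add: add.commute)
   qed
   fix v :: real
   show "norm (kern_ft v * \<Psi> n u (v + b)) \<le> K * exp (- c * (s n)^2 * u^2) * exp (- (c * (s n)^2) * (v + b)^2)"
   proof (cases "\<bar>v\<bar> \<ge> 1")
    case True thus ?thesis using K0 by (simp add: kern_ft_eq_0)
   next
    case False
    hence "norm (\<Psi> n u (v + b)) \<le> K * exp (- c * (s n)^2 * (u^2 + (v + b)^2))" by (intro n0 n u) linarith
    also have "... = K * exp (- c * (s n)^2 * u^2) * exp (- (c * (s n)^2) * (v + b)^2)"
     by (simp add: distrib_left flip: exp_add)
    finally have "norm (kern_ft v) * norm (\<Psi> n u (v + b)) \<le> 1 * (K * exp (- c * (s n)^2 * u^2) * exp (- (c * (s n)^2) * (v + b)^2))"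
     using norm_kern_ft_le by (intro mult_mono) auto
    thus ?thesis by (simp add: norm_mult)
   qed
  qed
  also have "... = K * exp (- c * (s n)^2 * u^2) * (LBINT v. exp (- (c * (s n)^2) * (v + b)^2))" by simp
  also have "(LBINT v. exp (- (c * (s n)^2) * (v + b)^2)) = (LBINT v. exp (- (c * (s n)^2) * v^2))"
   using lborel_integral_real_affine[of 1 "\<lambda>v. exp (- (c * (s n)^2) * v^2)" b] by (simp add: add.commute)
  finally have "s n * norm (CLBINT v. kern_ft v * \<Psi> n u (v + b)) \<le> s n * (K * exp (- c * (s n)^2 * u^2) * (LBINT v. exp (- (c * (s n)^2) * v^2)))"
   using s0[of n] by (intro mult_left_mono) auto
  also have "... = K * exp (- c * (s n)^2 * u^2) * (s n *\<^sub>R (LBINT v. exp (- (c * (s n)^2) * v^2)))" by simp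
  also have "s n *\<^sub>R (LBINT v. exp (- (c * (s n)^2) * v^2)) = (LBINT v. exp (- (c * (s n)^2) * (v / s n)^2))"
   by (rule integral_scale[OF s0])
  also have "... = G" unfolding G_def using s0[of n] by (simp add: power_divide)
  finally show ?thesis using s0[of n] by (simp add: \<Phi>_def norm_mult mult_ac)
 qed
 hence b1: "eventually (\<lambda>n. \<forall>u. \<bar>u\<bar> \<le> 1 + \<bar>a\<bar> \<longrightarrow> norm (\<Phi> n u) \<le> K * G * exp (- c * (s n)^2 * u^2)) sequentially"
  by (auto simp: eventually_sequentially)
 have l1: "(\<lambda>n. \<Phi> n (u / s n)) \<longlonglongrightarrow> E * kern_ft (- b) * of_real (sqrt (2 * pi)) * of_real (exp (- (u^2 / 2)))" for u
 proof -
  have ev: "eventually (\<lambda>n. \<bar>u / s n\<bar> \<le> 1 + \<bar>a\<bar>) sequentially"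
  proof -
   have "(\<lambda>n. u / s n) \<longlonglongrightarrow> 0" by (intro tendsto_divide_0[OF tendsto_const] filterlim_at_top_imp_at_infinity s)
   hence "eventually (\<lambda>n. \<bar>u / s n\<bar> < 1) sequentially" using tendstoD[of _ 0 _ 1] by fastforce
   thus ?thesis by eventually_elim linarith
  qed
  have "(\<lambda>n. of_real (s n) * (CLBINT v. kern_ft v * \<Psi> n (u / s n) (v + b))) \<longlonglongrightarrow> (E * of_real (exp (- (u^2 / 2)))) * kern_ft (- b) * of_real (sqrt (2 * pi))"
  proof (rule kern_scaling_limit[where \<Psi> = "\<lambda>n v. \<Psi> n (u / s n) v", OF _ s s0 c])
   show "\<forall>\<^sub>F n in sequentially. \<forall>v. \<bar>v\<bar> \<le> 1 + \<bar>b\<bar> \<longrightarrow> norm (\<Psi> n (u / s n) v) \<le> K * exp (- c * (s n)^2 * v^2)"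
    using ev eventually_ge_at_top[of n0]
   proof eventually_elim
    case (elim n)
    have "norm (\<Psi> n (u / s n) v) \<le> K * exp (- c * (s n)^2 * v^2)" if "\<bar>v\<bar> \<le> 1 + \<bar>b\<bar>" for v
    proof -
     have "norm (\<Psi> n (u / s n) v) \<le> K * exp (- c * (s n)^2 * ((u / s n)^2 + v^2))" using elim that by (intro n0)
     also have "... \<le> K * exp (- c * (s n)^2 * v^2)"
      using K0 c by (intro mult_left_mono) (auto simp: distrib_left)
     finally show ?thesis .
    qed
    thus ?case by simp
   qed
   show "(\<lambda>n. \<Psi> n (u / s n) (v / s n)) \<longlonglongrightarrow> E * of_real (exp (- (u^2 / 2))) * of_real (exp (- (v^2 / 2)))" for v
   proof -
    have "exp (- ((u^2 + v^2) / 2)) = exp (- (u^2 / 2)) * exp (- (v^2 / 2))"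
     by (simp add: add_divide_distrib flip: exp_add)
    thus ?thesis using lim[of u v] by (simp only: of_real_mult mult.assoc)
   qed
  qed measurable
  thus ?thesis by (simp add: \<Phi>_def mult_ac)
 qed
 have "(\<lambda>n. of_real (s n) * (CLBINT u. kern_ft u * \<Phi> n (u + a))) \<longlonglongrightarrow> E * kern_ft (- b) * of_real (sqrt (2 * pi)) * kern_ft (- a) * of_real (sqrt (2 * pi))"
  by (rule kern_scaling_limit[OF _ s s0 c b1 l1]) measurable
 moreover have "of_real (s n) * (CLBINT u. kern_ft u * \<Phi> n (u + a)) = of_real ((s n)^2) * (CLBINT u. kern_ft u * (CLBINT v. kern_ft v * \<Psi> n (u + a) (v + b)))" for n
 proof -
  have "(\<lambda>u. kern_ft u * \<Phi> n (u + a)) = (\<lambda>u. of_real (s n) * (kern_ft u * (CLBINT v. kern_ft v * \<Psi> n (u + a) (v + b))))"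
   by (auto simp: \<Phi>_def mult_ac)
  thus ?thesis by (simp add: power2_eq_square)
 qed
 moreover have "complex_of_real (sqrt (2 * pi)) * of_real (sqrt (2 * pi)) = of_real (2 * pi)"
  by (simp only: of_real_mult[symmetric]) simp
 ultimately show ?thesis by (simp add: mult_ac)
qed

text \<open>Fourier inversion at this kernel follows from the scaling limit of centred Gaussians.\<close>
lemma integral_kern_iexp: "(CLBINT y. of_real (kern y) * iexp (a * y)) = of_real (2 * pi) * kern_ft (- a)"
proof -
 define s where "s = (\<lambda>n::nat. real n + 1)"
 define I where "I = (CLBINT y. of_real (kern y) * iexp (a * y))"
 have s0: "s n > 0" for n by (simp add: s_def)
 have s: "filterlim s at_top sequentially"
  unfolding s_def by (intro filterlim_tendsto_add_at_top[OF tendsto_const] filterlim_real_sequentially | subst add.commute)+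
 let ?\<phi> = std_normal_density
 have kp: "\<bar>kern y\<bar> = kern y" for y using kern_pos[of y] by simp
 have "(\<lambda>n. of_real (s n) * (CLBINT u. kern_ft u * of_real (exp (- (s n * (u + a))\<^sup>2 / 2)))) \<longlonglongrightarrow> 1 * kern_ft (- a) * of_real (sqrt (2 * pi))"
 proof (rule kern_scaling_limit[where \<Psi> = "\<lambda>n u. of_real (exp (- (s n * u)\<^sup>2 / 2))" and c = "1/2" and K = 1])
  show "(\<lambda>n. complex_of_real (exp (- (s n * (u / s n))\<^sup>2 / 2))) \<longlonglongrightarrow> 1 * of_real (exp (- (u^2 / 2)))" for u
   using s0 by (simp add: less_imp_neq[symmetric] order_less_imp_not_eq2)
  show "\<forall>\<^sub>F n in sequentially. \<forall>u. \<bar>u\<bar> \<le> 1 + \<bar>a\<bar> \<longrightarrow> norm (complex_of_real (exp (- (s n * u)\<^sup>2 / 2))) \<le> 1 * exp (- (1 / 2) * (s n)^2 * u^2)"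
   by (intro always_eventually allI impI) (simp add: power_mult_distrib)
 qed (use s s0 in auto)
 moreover have "of_real (s n) * (CLBINT u. kern_ft u * of_real (exp (- (s n * (u + a))\<^sup>2 / 2))) = (CLBINT y. of_real (?\<phi> (y / s n) * kern y) * iexp (a * y))" for n
 proof -
  \<comment> \<open>The Gaussian is the characteristic function of a standard normal at
    \<open>s n * (u + a)\<close>. Exchanging the two integrals turns the u-integral into
    \<open>kern\<close> by \<open>kern_fourier\<close>.\<close>
  define f where "f = (\<lambda>u z. kern_ft u * (of_real (?\<phi> z) * iexp (s n * (u + a) * z)))"
  have fm [measurable]: "(\<lambda>(u, z). f u z) \<in> borel_measurable (lborel \<Otimes>\<^sub>M lborel)"
   unfolding f_def by measurable
  have char: "(CLBINT z. of_real (?\<phi> z) * iexp (t * z)) = of_real (exp (- t\<^sup>2 / 2))" for t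
  proof -
   have "complex_of_real (exp (- t\<^sup>2 / 2)) = char std_normal_distribution t" by (simp add: char_std_normal_distribution)
   also have "... = (CLBINT z. ?\<phi> z *\<^sub>R iexp (t * z))" unfolding char_def by (rule integral_density) auto
   finally show ?thesis by (simp add: scaleR_conv_of_real)
  qed
  have nf: "norm (f u z) = norm (kern_ft u) * ?\<phi> z" for u z by (simp add: f_def norm_mult)
  have kin: "integrable lborel (\<lambda>u. norm (kern_ft u))"
   using kern_ft_integrable_bounded[of "\<lambda>_. 1" 1] by (intro integrable_norm) simp
  have int: "integrable (lborel \<Otimes>\<^sub>M lborel) (\<lambda>(u, z). f u z)"
  proof (rule lborel_pair.Fubini_integrable[OF fm])
   show "integrable lborel (\<lambda>u. LBINT z. norm (case (u, z) of (u, z) => f u z))" by (simp add: nf kin)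
   show "AE u in lborel. integrable lborel (\<lambda>z. case (u, z) of (u, z) => f u z)"
   proof (intro AE_I2)
    fix u
    have [measurable]: "f u \<in> borel_measurable lborel" unfolding f_def by measurable
    have "integrable lborel (\<lambda>z. norm (kern_ft u) * ?\<phi> z)" by simp
    thus "integrable lborel (\<lambda>z. case (u, z) of (u, z) => f u z)"
     unfolding prod.case by (rule Bochner_Integration.integrable_bound) (auto simp: nf abs_mult)
   qed
  qed
  have inner: "(CLBINT u. f u z) = of_real (?\<phi> z * kern (s n * z)) * iexp (a * (s n * z))" for z
  proof -
   have "(CLBINT u. f u z) = (CLBINT u. (of_real (?\<phi> z) * iexp (a * (s n * z))) * (kern_ft u * iexp (u * (s n * z))))"
    unfolding f_def by (intro Bochner_Integration.integral_cong) (auto simp: exp_add[symmetric] algebra_simps)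
   also have "... = (of_real (?\<phi> z) * iexp (a * (s n * z))) * of_real (kern (s n * z))"
    by (subst integral_mult_right_zero) (simp only: has_bochner_integral_integral_eq[OF kern_fourier])
   finally show ?thesis by (simp add: mult_ac)
  qed
  have "(CLBINT u. kern_ft u * of_real (exp (- (s n * (u + a))\<^sup>2 / 2))) = (CLBINT u. CLBINT z. f u z)"
   unfolding f_def integral_mult_right_zero char ..
  also have "... = (CLBINT z. CLBINT u. f u z)" by (rule lborel_pair.Fubini_integral[OF int, symmetric])
  also have "... = (CLBINT z. of_real (?\<phi> z * kern (s n * z)) * iexp (a * (s n * z)))" by (simp only: inner)
  finally have "(CLBINT u. kern_ft u * of_real (exp (- (s n * (u + a))\<^sup>2 / 2))) = (CLBINT z. of_real (?\<phi> z * kern (s n * z)) * iexp (a * (s n * z)))" .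
  hence "of_real (s n) * (CLBINT u. kern_ft u * of_real (exp (- (s n * (u + a))\<^sup>2 / 2))) = s n *\<^sub>R (CLBINT z. of_real (?\<phi> z * kern (s n * z)) * iexp (a * (s n * z)))"
   by (simp add: scaleR_conv_of_real)
  also have "... = (CLBINT y. of_real (?\<phi> (y / s n) * kern (s n * (y / s n))) * iexp (a * (s n * (y / s n))))"
   by (rule integral_scale[OF s0])
  also have "... = (CLBINT y. of_real (?\<phi> (y / s n) * kern y) * iexp (a * y))"
   using s0[of n] by simp
  finally show ?thesis .
 qed
 ultimately have l1: "(\<lambda>n. CLBINT y. of_real (?\<phi> (y / s n) * kern y) * iexp (a * y)) \<longlonglongrightarrow> kern_ft (- a) * of_real (sqrt (2 * pi))" by simp
 \<comment> \<open>The same integrals also converge by dominated convergence, since the normal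
   density flattens to its value at 0. Comparing the two limits determines the transform.\<close>
 have "(\<lambda>n. CLBINT y. of_real (?\<phi> (y / s n) * kern y) * iexp (a * y)) \<longlonglongrightarrow> (CLBINT y. of_real (?\<phi> 0 * kern y) * iexp (a * y))"
 proof (rule integral_dominated_convergence[where w = kern])
  show "AE y in lborel. (\<lambda>n. of_real (?\<phi> (y / s n) * kern y) * iexp (a * y)) \<longlonglongrightarrow> of_real (?\<phi> 0 * kern y) * iexp (a * y)"
  proof (intro AE_I2 tendsto_mult tendsto_of_real tendsto_const)
   fix y
   have "(\<lambda>n. y / s n) \<longlonglongrightarrow> 0" by (intro tendsto_divide_0[OF tendsto_const] filterlim_at_top_imp_at_infinity s)
   moreover have "isCont ?\<phi> 0" unfolding std_normal_density_def by (intro continuous_intros) auto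
   ultimately show "(\<lambda>n. ?\<phi> (y / s n)) \<longlonglongrightarrow> ?\<phi> 0" by (rule isCont_tendsto_compose[rotated])
  qed
  show "AE y in lborel. norm (of_real (?\<phi> (y / s n) * kern y) * iexp (a * y)) \<le> kern y" for n
  proof (intro AE_I2)
   fix y
   have "1 \<le> sqrt (2 * pi)" using pi_gt3 by simp
   hence "1 / sqrt (2 * pi) * exp (- (y / s n)\<^sup>2 / 2) \<le> 1 * 1" by (intro mult_mono) auto
   hence "?\<phi> (y / s n) \<le> 1" by (simp add: std_normal_density_def)
   hence "?\<phi> (y / s n) * kern y \<le> 1 * kern y" using kern_pos[of y] by (intro mult_right_mono) auto
   thus "norm (of_real (?\<phi> (y / s n) * kern y) * iexp (a * y)) \<le> kern y"
    using kern_pos[of y] by (simp add: norm_mult abs_mult)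
  qed
 qed (use integrable_kern in auto)
 also have "(CLBINT y. of_real (?\<phi> 0 * kern y) * iexp (a * y)) = of_real (1 / sqrt (2 * pi)) * I"
  by (simp add: I_def std_normal_density_def mult.assoc)
 finally have "of_real (1 / sqrt (2 * pi)) * I = kern_ft (- a) * of_real (sqrt (2 * pi))"
  by (rule LIMSEQ_unique[OF _ l1])
 hence "of_real (sqrt (2 * pi)) * (of_real (1 / sqrt (2 * pi)) * I) = of_real (sqrt (2 * pi)) * of_real (sqrt (2 * pi)) * kern_ft (- a)"
  by (simp add: mult_ac)
 moreover have "complex_of_real (sqrt (2 * pi)) * of_real (sqrt (2 * pi)) = of_real (2 * pi)"
  by (simp only: of_real_mult[symmetric]) simp
 moreover have "complex_of_real (sqrt (2 * pi)) * of_real (1 / sqrt (2 * pi)) = 1"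
  by (simp only: of_real_mult[symmetric]) simp
 ultimately show ?thesis by (simp add: I_def mult.assoc[symmetric])
qed

section \<open>Nonnegative martingales\<close>

context prob_space
begin

text \<open>Kolmogorov's inequality. The martingale property is expressed as orthogonality of
  increments to bounded functions measurable with respect to the past, which avoids conditional
  expectations. By induction on k, L^2 times the probability of an exceedance by time k is at most
  the squared increment integrated over that event.\<close>

lemma martingale_maximal_inequality:
 fixes Y :: "nat => 'a => real" and F :: "nat => 'a measure"
 assumes sub: "\<And>n. subalgebra M (F n)" and mono: "\<And>n. sets (F n) \<subseteq> sets (F (Suc n))"
  and ad: "\<And>n. Y n \<in> borel_measurable (F n)" and bd: "\<And>n w. w \<in> space M ==> \<bar>Y n w\<bar> \<le> C"
  and mart: "\<And>n f. f \<in> borel_measurable (F n) ==> (\<exists>B. \<forall>w\<in>space M. \<bar>f w\<bar> \<le> B) ==> expectation (\<lambda>w. f w * (Y (Suc n) w - Y n w)) = 0"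
  and L: "L > 0"
 shows "L^2 * prob {w \<in> space M. \<exists>k\<le>n. \<bar>Y (m + k) w - Y m w\<bar> \<ge> L} \<le> expectation (\<lambda>w. (Y (m + n) w - Y m w)^2)"
proof -
 have F_mono: "sets (F i) \<subseteq> sets (F j)" if "i \<le> j" for i j
  using that by (induction rule: dec_induct) (use mono in auto)
 have spF: "space (F n) = space M" for n using sub[of n] by (simp add: subalgebra_def)
 have F_meas: "f \<in> borel_measurable (F j)" if "f \<in> borel_measurable (F i)" "i \<le> j" for f :: "'a => real" and i j
  using that(1) by (rule measurable_mono[THEN subsetD, rotated -1]) (use F_mono[OF that(2)] spF in auto)
 have M_meas: "f \<in> borel_measurable M" if "f \<in> borel_measurable (F i)" for f :: "'a => real" and i
  using that sub[of i] by (rule measurable_from_subalg[rotated])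
 define Z where "Z = (\<lambda>k w. (Y (m + k) w - Y m w)^2)"
 define H where "H = (\<lambda>k. {w \<in> space M. \<exists>j\<le>k. \<bar>Y (m + j) w - Y m w\<bar> \<ge> L})"
 have Yad: "Y (m + j) \<in> borel_measurable (F (m + k))" "Y m \<in> borel_measurable (F (m + k))" if "j \<le> k" for j k
  using F_meas[OF ad, of "m + j" "m + k"] F_meas[OF ad, of m "m + k"] that by auto
 have HF: "H k \<in> sets (F (m + k))" for k
 proof -
  have "{w \<in> space (F (m + k)). \<bar>Y (m + j) w - Y m w\<bar> \<ge> L} \<in> sets (F (m + k))" if "j \<le> k" for j
   using Yad[OF that] by measurable
  hence "(\<Union>j\<in>{..k}. {w \<in> space (F (m + k)). \<bar>Y (m + j) w - Y m w\<bar> \<ge> L}) \<in> sets (F (m + k))" by auto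
  also have "(\<Union>j\<in>{..k}. {w \<in> space (F (m + k)). \<bar>Y (m + j) w - Y m w\<bar> \<ge> L}) = H k"
   by (auto simp: H_def spF)
  finally show ?thesis .
 qed
 have HM [measurable]: "H k \<in> events" for k using HF[of k] sub[of "m + k"] by (auto simp: subalgebra_def)
 have Ym [measurable]: "Y k \<in> borel_measurable M" for k by (rule M_meas[OF ad])
 have C0: "C \<ge> 0" using bd[of _ 0] not_empty by fastforce
 have d_le: "\<bar>Y i w - Y j w\<bar> \<le> 2 * C" if "w \<in> space M" for i j w
  using bd[OF that, of i] bd[OF that, of j] by linarith
 have Zb: "Z k w \<le> (2 * C)^2" if "w \<in> space M" for k w
  unfolding Z_def using d_le[OF that, of "m + k" m] by (rule abs_le_square_iff[THEN iffD1, OF order_trans]) simp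
 have Zm [measurable]: "Z k \<in> borel_measurable M" for k unfolding Z_def by measurable
 have Zi: "integrable M (\<lambda>w. Z k w * indicator A w)" if [measurable]: "A \<in> events" for k A
  by (rule integrable_const_bound[of _ "(2 * C)^2"])
    (use Zb in \<open>auto simp: Z_def indicator_def\<close>)
 have main: "L^2 * prob (H k) \<le> expectation (\<lambda>w. Z k w * indicator (H k) w)" for k
 proof (induction k)
  case 0
  have "H 0 = {}" using L by (auto simp: H_def)
  thus ?case by simp
 next
  case (Suc k)
  define J where "J = H (Suc k) - H k"
  have J [measurable]: "J \<in> events" unfolding J_def by measurable
  have HS: "H (Suc k) = H k \<union> J" "H k \<inter> J = {}" by (auto simp: J_def H_def le_Suc_eq)
  let ?n = "m + k"
  \<comment> \<open>This is the coefficient of the next increment in the expanded square, restricted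
    to the event of a past exceedance. It is measurable with respect to the past, so the cross term
    integrates to 0.\<close>
  define f where "f = (\<lambda>w. 2 * (Y ?n w - Y m w) * indicator (H k) w)"
  have f0: "expectation (\<lambda>w. f w * (Y (Suc ?n) w - Y ?n w)) = 0"
  proof (rule mart)
   show "f \<in> borel_measurable (F ?n)" unfolding f_def using HF[of k] Yad[of k k] by measurable
   have "\<bar>f w\<bar> \<le> 4 * C" if "w \<in> space M" for w
    using d_le[OF that, of ?n m] C0 by (auto simp: f_def indicator_def)
   thus "\<exists>B. \<forall>w\<in>space M. \<bar>f w\<bar> \<le> B" by blast
  qed
  have fi: "integrable M (\<lambda>w. f w * (Y (Suc ?n) w - Y ?n w))"
  proof (rule integrable_const_bound[of _ "4 * C * (2 * C)"])
   show "AE w in M. norm (f w * (Y (Suc ?n) w - Y ?n w)) \<le> 4 * C * (2 * C)"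
   proof (rule AE_I2)
    fix w assume wt: "w \<in> space M"
    have "\<bar>f w\<bar> \<le> 4 * C" using d_le[OF wt, of ?n m] C0 by (auto simp: f_def indicator_def)
    thus "norm (f w * (Y (Suc ?n) w - Y ?n w)) \<le> 4 * C * (2 * C)"
     unfolding real_norm_def abs_mult using d_le[OF wt] C0 by (intro mult_mono) auto
   qed
  qed (simp add: f_def)
  have "L^2 * prob (H (Suc k)) = L^2 * prob (H k) + L^2 * prob J"
   unfolding HS(1) using HS(2) by (subst finite_measure_Union) (auto simp: distrib_left)
  also have "... \<le> expectation (\<lambda>w. Z k w * indicator (H k) w) + expectation (\<lambda>w. Z (Suc k) w * indicator J w)"
  proof (rule add_mono[OF Suc])
   have "L^2 * prob J = expectation (\<lambda>w. L^2 * indicator J w)" by simp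
   also have "... \<le> expectation (\<lambda>w. Z (Suc k) w * indicator J w)"
   proof (rule integral_mono)
    fix w assume "w \<in> space M"
    show "L^2 * indicator J w \<le> Z (Suc k) w * indicator J w"
    proof (cases "w \<in> J")
     case True
     hence "\<bar>Y (m + Suc k) w - Y m w\<bar> \<ge> L" by (auto simp: J_def H_def le_Suc_eq)
     hence "L^2 \<le> \<bar>Y (m + Suc k) w - Y m w\<bar>^2" using L by (intro power_mono) auto
     thus ?thesis using True by (simp add: Z_def)
    qed simp
   qed (use Zi integrable_real_indicator[of J M] in \<open>auto simp: less_top[symmetric]\<close>)
   finally show "L^2 * prob J \<le> expectation (\<lambda>w. Z (Suc k) w * indicator J w)" .
  qed
  also have "expectation (\<lambda>w. Z k w * indicator (H k) w) = expectation (\<lambda>w. Z k w * indicator (H k) w) + expectation (\<lambda>w. f w * (Y (Suc ?n) w - Y ?n w))"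
   using f0 by simp
  also have "... = expectation (\<lambda>w. Z k w * indicator (H k) w + f w * (Y (Suc ?n) w - Y ?n w))"
   by (rule Bochner_Integration.integral_add[symmetric]) (use Zi fi in auto)
  also have "... \<le> expectation (\<lambda>w. Z (Suc k) w * indicator (H k) w)"
  proof (rule integral_mono)
   fix w assume "w \<in> space M"
   have "0 \<le> (Y (Suc ?n) w - Y ?n w)^2" by simp
   thus "Z k w * indicator (H k) w + f w * (Y (Suc ?n) w - Y ?n w) \<le> Z (Suc k) w * indicator (H k) w"
    by (auto simp: Z_def f_def indicator_def power2_eq_square algebra_simps)
  qed (use Zi fi in auto)
  also have "expectation (\<lambda>w. Z (Suc k) w * indicator (H k) w) + expectation (\<lambda>w. Z (Suc k) w * indicator J w)
    = expectation (\<lambda>w. Z (Suc k) w * indicator (H k) w + Z (Suc k) w * indicator J w)"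
   by (rule Bochner_Integration.integral_add[symmetric]) (use Zi in auto)
  also have "... = expectation (\<lambda>w. Z (Suc k) w * indicator (H (Suc k)) w)"
   unfolding HS(1) using HS(2) by (intro Bochner_Integration.integral_cong) (auto simp: indicator_def)
  finally show ?case by simp
 qed
 have "expectation (\<lambda>w. Z n w * indicator (H n) w) \<le> expectation (Z n)"
 proof (rule integral_mono)
  show "integrable M (Z n)" using Zi[of "space M" n] by (simp cong: Bochner_Integration.integrable_cong)
 qed (use Zi in \<open>auto simp: Z_def indicator_def\<close>)
 with main[of n] show ?thesis by (simp add: H_def Z_def)
qed

text \<open>Second moments increase to a finite limit, and the squared norm of an increment is the
  difference of second moments. The maximal inequality therefore bounds the whole future oscillation
  after time m by a quantity tending to 0, so almost every path is Cauchy.\<close>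

lemma bounded_martingale_AE_convergent:
 fixes Y :: "nat => 'a => real" and F :: "nat => 'a measure"
 assumes sub: "\<And>n. subalgebra M (F n)" and mono: "\<And>n. sets (F n) \<subseteq> sets (F (Suc n))"
  and ad: "\<And>n. Y n \<in> borel_measurable (F n)" and bd: "\<And>n w. w \<in> space M ==> \<bar>Y n w\<bar> \<le> C"
  and mart: "\<And>n f. f \<in> borel_measurable (F n) ==> (\<exists>B. \<forall>w\<in>space M. \<bar>f w\<bar> \<le> B) ==> expectation (\<lambda>w. f w * (Y (Suc n) w - Y n w)) = 0"
 shows "AE w in M. convergent (\<lambda>n. Y n w)"
proof -
 have F_mono: "sets (F i) \<subseteq> sets (F j)" if "i \<le> j" for i j
  using that by (induction rule: dec_induct) (use mono in auto)
 have spF: "space (F n) = space M" for n using sub[of n] by (simp add: subalgebra_def)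
 have Ym [measurable]: "Y k \<in> borel_measurable M" for k
  using ad[of k] sub[of k] by (rule measurable_from_subalg[rotated])
 have C0: "C \<ge> 0" using bd[of _ 0] not_empty by fastforce
 have int2: "integrable M (\<lambda>w. Y i w * Y j w)" for i j
  by (rule integrable_const_bound[of _ "C * C"])
    (use bd C0 in \<open>auto simp: abs_mult intro!: AE_I2 mult_mono\<close>)
 define q where "q = (\<lambda>n. expectation (\<lambda>w. (Y n w)^2))"
 have step: "expectation (\<lambda>w. Y m w * (Y (m + k) w - Y m w)) = 0" for m k
 proof (induction k)
  case (Suc k)
  have "Y m \<in> borel_measurable (F (m + k))"
   using ad[of m] by (rule measurable_mono[THEN subsetD, rotated -1]) (use F_mono[of m "m + k"] spF in auto)
  hence "expectation (\<lambda>w. Y m w * (Y (Suc (m + k)) w - Y (m + k) w)) = 0" by (rule mart) (use bd in blast)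
  moreover have "expectation (\<lambda>w. Y m w * (Y (m + Suc k) w - Y m w)) = expectation (\<lambda>w. Y m w * (Y (m + k) w - Y m w) + Y m w * (Y (Suc (m + k)) w - Y (m + k) w))"
   by (intro Bochner_Integration.integral_cong) (auto simp: algebra_simps)
  moreover have "... = expectation (\<lambda>w. Y m w * (Y (m + k) w - Y m w)) + expectation (\<lambda>w. Y m w * (Y (Suc (m + k)) w - Y (m + k) w))"
   by (rule Bochner_Integration.integral_add) (auto simp: right_diff_distrib int2)
  ultimately show ?case using Suc by simp
 qed simp
 have inc: "expectation (\<lambda>w. (Y (m + k) w - Y m w)^2) = q (m + k) - q m" for m k
 proof -
  have "expectation (\<lambda>w. (Y (m + k) w - Y m w)^2) = expectation (\<lambda>w. ((Y (m + k) w)^2 - (Y m w)\<^sup>2) - 2 * (Y m w * (Y (m + k) w - Y m w)))"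
   by (intro Bochner_Integration.integral_cong) (auto simp: power2_eq_square algebra_simps)
  also have "... = expectation (\<lambda>w. ((Y (m + k) w)^2 - (Y m w)\<^sup>2)) - expectation (\<lambda>w. 2 * (Y m w * (Y (m + k) w - Y m w)))"
   by (rule Bochner_Integration.integral_diff) (auto simp: power2_eq_square right_diff_distrib int2)
  also have "... = q (m + k) - q m"
   using step[of m k] unfolding q_def by (subst Bochner_Integration.integral_diff) (auto simp: power2_eq_square int2)
  finally show ?thesis .
 qed
 have qle: "q n \<le> C * C" for n
 proof -
  have "q n \<le> expectation (\<lambda>_. C * C)" unfolding q_def
  proof (rule integral_mono)
   fix w assume "w \<in> space M"
   hence "\<bar>Y n w\<bar> * \<bar>Y n w\<bar> \<le> C * C" using bd C0 by (intro mult_mono) auto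
   thus "(Y n w)^2 \<le> C * C" by (simp add: power2_eq_square)
  qed (auto simp: power2_eq_square int2)
  thus ?thesis by (simp add: prob_space)
 qed
 have "incseq q"
 proof (rule incseq_SucI)
  fix n
  have "0 \<le> expectation (\<lambda>w. (Y (n + 1) w - Y n w)^2)" by (intro integral_nonneg_AE) auto
  thus "q n \<le> q (Suc n)" unfolding inc by simp
 qed
 then obtain ql where ql: "q \<longlonglongrightarrow> ql" "\<And>n. q n \<le> ql" using incseq_convergent[of q "C * C"] qle by blast
 have small: "prob {w \<in> space M. \<exists>k. \<bar>Y (m + k) w - Y m w\<bar> \<ge> L} \<le> (ql - q m) / L^2" if L: "L > 0" for m L
 proof -
  define H where "H = (\<lambda>n. {w \<in> space M. \<exists>k\<le>n. \<bar>Y (m + k) w - Y m w\<bar> \<ge> L})"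
  have "(\<lambda>n. prob (H n)) \<longlonglongrightarrow> prob (\<Union>n. H n)"
  proof (rule finite_Lim_measure_incseq)
   show "range H \<subseteq> events" unfolding H_def by auto
   show "incseq H" unfolding H_def incseq_def by (auto intro: order_trans)
  qed
  moreover have "prob (H n) \<le> (ql - q m) / L^2" for n
  proof -
   have "L^2 * prob (H n) \<le> q (m + n) - q m"
    unfolding H_def inc[symmetric] using sub mono ad bd mart L by (rule martingale_maximal_inequality)
   also have "... \<le> ql - q m" using ql(2) by simp
   finally show ?thesis using L by (simp add: field_simps)
  qed
  ultimately have "prob (\<Union>n. H n) \<le> (ql - q m) / L^2" by (intro LIMSEQ_le_const2) auto
  moreover have "(\<Union>n. H n) = {w \<in> space M. \<exists>k. \<bar>Y (m + k) w - Y m w\<bar> \<ge> L}" by (auto simp: H_def)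
  ultimately show ?thesis by simp
 qed
 have "AE w in M. \<exists>m. \<forall>k. \<bar>Y (m + k) w - Y m w\<bar> < L" if L: "L > 0" for L
 proof -
  define N where "N = {w \<in> space M. \<forall>m. \<exists>k. \<bar>Y (m + k) w - Y m w\<bar> \<ge> L}"
  have Nm: "N \<in> events" unfolding N_def by measurable
  have "prob N \<le> (ql - q m) / L^2" for m
   by (rule order_trans[OF finite_measure_mono small[OF L]]) (auto simp: N_def)
  moreover have "(\<lambda>m. (ql - q m) / L^2) \<longlonglongrightarrow> (ql - ql) / L^2" using L by (intro tendsto_intros ql) auto
  ultimately have "prob N \<le> 0" by (intro LIMSEQ_le_const) auto
  hence "prob N = 0" by (simp add: measure_le_0_iff)
  hence "emeasure M N = 0" by (simp add: emeasure_eq_measure)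
  hence "AE w in M. w \<notin> N" using Nm by (intro AE_not_in) (auto intro: null_setsI)
  thus ?thesis using AE_space by eventually_elim (auto simp: N_def not_le)
 qed
 hence "AE w in M. \<forall>j::nat. \<exists>m. \<forall>k. \<bar>Y (m + k) w - Y m w\<bar> < 1 / real (Suc j)"
  by (subst AE_all_countable) auto
 thus ?thesis
 proof eventually_elim
  case (elim w)
  have "Cauchy (\<lambda>n. Y n w)"
  proof (rule metric_CauchyI)
   fix e :: real assume "e > 0"
   then obtain j where j: "1 / real (Suc j) < e / 2" using nat_approx_posE[of "e / 2"] by auto
   obtain m where m: "\<And>k. \<bar>Y (m + k) w - Y m w\<bar> < 1 / real (Suc j)" using elim by blast
   have "dist (Y i w) (Y i' w) < e" if "i \<ge> m" "i' \<ge> m" for i i'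
    using m[of "i - m"] m[of "i' - m"] that j by (simp add: dist_real_def)
   thus "\<exists>M. \<forall>i\<ge>M. \<forall>i'\<ge>M. dist (Y i w) (Y i' w) < e" by blast
  qed
  thus ?case by (simp add: Cauchy_convergent_iff)
 qed
qed

text \<open>
 The martingale is stopped when it first exceeds a level \<open>K\<close>; the growth condition keeps the
 stopped martingale bounded by \<open>C * K\<close>.
\<close>
lemma nonneg_martingale_AE_convergent:
 fixes A :: "nat => 'a => real" and F :: "nat => 'a measure"
 assumes sub: "\<And>n. subalgebra M (F n)" and mono: "\<And>n. sets (F n) \<subseteq> sets (F (Suc n))"
  and ad: "\<And>n. A n \<in> borel_measurable (F n)"
  and nn: "\<And>n w. w \<in> space M ==> 0 \<le> A n w"
  and C: "C \<ge> 1" and A0: "\<And>w. w \<in> space M ==> A 0 w \<le> C"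
  and grow: "\<And>n w. w \<in> space M ==> A (Suc n) w \<le> C * A n w"
  and mart: "\<And>n f. f \<in> borel_measurable (F n) ==> (\<exists>B. \<forall>w\<in>space M. \<bar>f w\<bar> \<le> B) ==> expectation (\<lambda>w. f w * (A (Suc n) w - A n w)) = 0"
 shows "AE w in M. convergent (\<lambda>n. A n w)"
proof -
 have F_mono: "sets (F i) \<subseteq> sets (F j)" if "i \<le> j" for i j
  using that by (induction rule: dec_induct) (use mono in auto)
 have spF: "space (F n) = space M" for n using sub[of n] by (simp add: subalgebra_def)
 have F_meas: "f \<in> borel_measurable (F j)" if "f \<in> borel_measurable (F i)" "i \<le> j" for f :: "'a => real" and i j
  using that(1) by (rule measurable_mono[THEN subsetD, rotated -1]) (use F_mono[OF that(2)] spF in auto)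
 define S where "S = (\<lambda>K n. {w \<in> space M. \<forall>i<n. A i w \<le> K})"
 define Y where "Y = (\<lambda>K n w. A 0 w + (\<Sum>i<n. indicator (S K (Suc i)) w * (A (Suc i) w - A i w)))"
 have SF: "S K (Suc n) \<in> sets (F n)" for K n
 proof -
  have "{w \<in> space (F n). A i w \<le> K} \<in> sets (F n)" if "i \<le> n" for i
   using F_meas[OF ad that] by measurable
  hence "(\<Inter>i\<in>{..n}. {w \<in> space (F n). A i w \<le> K}) \<in> sets (F n)" by (intro sets.finite_INT) auto
  also have "(\<Inter>i\<in>{..n}. {w \<in> space (F n). A i w \<le> K}) = S K (Suc n)"
   by (auto simp: S_def spF less_Suc_eq_le)
  finally show ?thesis .
 qed
 have Yad: "Y K n \<in> borel_measurable (F n)" for K n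
 proof -
  have [measurable]: "A i \<in> borel_measurable (F n)" if "i \<le> n" for i using F_meas[OF ad that] .
  have [measurable]: "S K (Suc i) \<in> sets (F n)" if "i < n" for i using SF[of K i] F_mono[of i n] that by auto
  show ?thesis unfolding Y_def by (intro borel_measurable_add borel_measurable_sum) measurable
 qed
 \<comment> \<open>Until the level is passed the stopped process equals \<open>A\<close>. The step
   that passes it overshoots by at most the factor C, and afterwards the process is frozen above
   K.\<close>
 have Yinv: "0 \<le> Y K n w \<and> Y K n w \<le> C * K \<and> (w \<in> S K n \<longrightarrow> Y K n w = A n w) \<and> (w \<notin> S K n \<longrightarrow> Y K n w > K)"
  if wt: "w \<in> space M" and K: "K \<ge> C" for K n w
 proof (induction n)
  case 0
  have "C * 1 \<le> C * K" using K C by (intro mult_left_mono) auto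
  thus ?case using A0[OF wt] nn[OF wt, of 0] wt by (simp add: Y_def S_def)
 next
  case (Suc n)
  have YS: "Y K (Suc n) w = Y K n w + indicator (S K (Suc n)) w * (A (Suc n) w - A n w)"
   unfolding Y_def by (simp only: sum.lessThan_Suc add.assoc)
  show ?case
  proof (cases "w \<in> S K (Suc n)")
   case True
   hence "w \<in> S K n" "A n w \<le> K" by (auto simp: S_def)
   moreover from this have "C * A n w \<le> C * K" using C by (intro mult_left_mono) auto
   ultimately show ?thesis using Suc True grow[OF wt, of n] nn[OF wt, of "Suc n"] by (simp add: YS)
  next
   case False
   have "Y K n w > K"
   proof (cases "w \<in> S K n")
    case True
    hence "A n w > K" using False wt by (auto simp: S_def less_Suc_eq not_le)
    thus ?thesis using Suc True by simp
   qed (use Suc in simp)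
   thus ?thesis using Suc False by (simp add: YS)
  qed
 qed
 have conv: "AE w in M. convergent (\<lambda>n. Y K n w)" if K: "K \<ge> C" for K
 proof (rule bounded_martingale_AE_convergent[where Y = "Y K" and F = F, OF sub mono Yad])
  show "\<bar>Y K n w\<bar> \<le> C * K" if "w \<in> space M" for n w using Yinv[OF that K, of n] by simp
  fix n and f :: "'a => real" assume f: "f \<in> borel_measurable (F n)" "\<exists>B. \<forall>w\<in>space M. \<bar>f w\<bar> \<le> B"
  then obtain B where B: "\<And>w. w \<in> space M ==> \<bar>f w\<bar> \<le> B" by blast
  have "expectation (\<lambda>w. (f w * indicator (S K (Suc n)) w) * (A (Suc n) w - A n w)) = 0"
  proof (rule mart)
   show "(\<lambda>w. f w * indicator (S K (Suc n)) w) \<in> borel_measurable (F n)" using f(1) SF[of K n] by measurable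
   have "\<bar>f w * indicator (S K (Suc n)) w\<bar> \<le> B" if "w \<in> space M" for w
    using B[OF that] by (auto simp: indicator_def)
   thus "\<exists>B. \<forall>w\<in>space M. \<bar>f w * indicator (S K (Suc n)) w\<bar> \<le> B" by blast
  qed
  moreover have "(\<lambda>w. f w * (Y K (Suc n) w - Y K n w)) = (\<lambda>w. (f w * indicator (S K (Suc n)) w) * (A (Suc n) w - A n w))"
   by (rule ext) (simp only: Y_def sum.lessThan_Suc add.assoc[symmetric] add_diff_cancel_left' mult.assoc)
  ultimately show "expectation (\<lambda>w. f w * (Y K (Suc n) w - Y K n w)) = 0" by simp
 qed
 have Am [measurable]: "A k \<in> borel_measurable M" for k
  using ad[of k] sub[of k] by (rule measurable_from_subalg[rotated])
 have Ym [measurable]: "Y K n \<in> borel_measurable M" for K n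
  using Yad[of K n] sub[of n] by (rule measurable_from_subalg[rotated])
 have Sm [measurable]: "S K n \<in> events" for K n unfolding S_def by measurable
 have EY: "expectation (Y K n) \<le> C" if K: "K \<ge> C" for K n
 proof (induction n)
  case 0
  have "expectation (Y K 0) \<le> expectation (\<lambda>_. C)"
   by (intro integral_mono integrable_const_bound[of _ "C"]) (use A0 nn C in \<open>auto simp: Y_def\<close>)
  thus ?case by (simp add: prob_space)
 next
  case (Suc n)
  have Yi: "integrable M (Y K n)" for n
   by (rule integrable_const_bound[of _ "C * K"]) (use Yinv[OF _ K, of _ n] in auto)
  have "expectation (\<lambda>w. indicator (S K (Suc n)) w * (A (Suc n) w - A n w)) = 0"
  proof (rule mart)
   show "indicator (S K (Suc n)) \<in> borel_measurable (F n)" using SF[of K n] by measurable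
   show "\<exists>B. \<forall>w\<in>space M. \<bar>indicator (S K (Suc n)) w :: real\<bar> \<le> B" by (intro exI[of _ 1]) (auto simp: indicator_def)
  qed
  moreover have "(\<lambda>w. indicator (S K (Suc n)) w * (A (Suc n) w - A n w)) = (\<lambda>w. Y K (Suc n) w - Y K n w)"
   by (rule ext) (simp only: Y_def sum.lessThan_Suc add.assoc[symmetric] add_diff_cancel_left')
  ultimately have "expectation (Y K (Suc n)) - expectation (Y K n) = 0" using Yi by simp
  thus ?case using Suc by simp
 qed
 \<comment> \<open>A path that has passed the level keeps a stopped value above K, so Markov's
   inequality for the stopped process bounds the probability of passing.\<close>
 have PS: "prob (space M - S K n) \<le> C / K" if K: "K \<ge> C" for K n
 proof -
  have Kp: "K > 0" using K C by linarith
  have "K * prob (space M - S K n) = expectation (\<lambda>w. K * indicator (space M - S K n) w)" by simp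
  also have "... \<le> expectation (Y K n)"
  proof (rule integral_mono)
   show "integrable M (Y K n)"
    by (rule integrable_const_bound[of _ "C * K"]) (use Yinv[OF _ K, of _ n] in auto)
   show "K * indicator (space M - S K n) w \<le> Y K n w" if "w \<in> space M" for w
    using Yinv[OF that K, of n] that by (auto simp: indicator_def)
  qed (use integrable_real_indicator[of "space M - S K n" M] in \<open>auto simp: less_top[symmetric]\<close>)
  also have "... \<le> C" by (rule EY[OF K])
  finally show ?thesis using Kp by (simp add: field_simps)
 qed
 define U where "U = (\<lambda>K. \<Inter>n. S K n)"
 have Um [measurable]: "U K \<in> events" for K unfolding U_def by measurable
 have PU: "prob (space M - U K) \<le> C / K" if K: "K \<ge> C" for K
 proof -
  have "(\<lambda>n. prob (space M - S K n)) \<longlonglongrightarrow> prob (\<Union>n. space M - S K n)"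
  proof (rule finite_Lim_measure_incseq)
   show "incseq (\<lambda>n. space M - S K n)" unfolding incseq_def S_def by force
  qed auto
  hence "prob (\<Union>n. space M - S K n) \<le> C / K" using PS[OF K] by (intro LIMSEQ_le_const2) auto
  moreover have "(\<Union>n. space M - S K n) = space M - U K" by (auto simp: U_def)
  ultimately show ?thesis by simp
 qed
 define N where "N = space M - (\<Union>j::nat. U (C + real j))"
 have Nm: "N \<in> events" unfolding N_def by measurable
 have "prob N \<le> C / (C + real j)" for j :: nat
  by (rule order_trans[OF finite_measure_mono PU]) (auto simp: N_def)
 moreover have "(\<lambda>j. C / (C + real j)) \<longlonglongrightarrow> 0"
  by (intro tendsto_divide_0[OF tendsto_const] filterlim_at_top_imp_at_infinity filterlim_tendsto_add_at_top[OF tendsto_const] filterlim_real_sequentially)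
 ultimately have "prob N \<le> 0" by (intro LIMSEQ_le_const) auto
 hence "prob N = 0" by (simp add: measure_le_0_iff)
 hence "emeasure M N = 0" by (simp add: emeasure_eq_measure)
 hence nN: "AE w in M. w \<notin> N" using Nm by (intro AE_not_in) (auto intro: null_setsI)
 have "AE w in M. \<forall>j::nat. convergent (\<lambda>n. Y (C + real j) n w)"
  by (subst AE_all_countable) (auto intro: conv)
 with nN AE_space show ?thesis
 proof eventually_elim
  case (elim w)
  then obtain j :: nat where j: "w \<in> U (C + real j)" by (auto simp: N_def)
  have "Y (C + real j) n w = A n w" for n using Yinv[of w "C + real j" n] elim j by (auto simp: U_def)
  thus ?case using elim(3) by (metis (no_types, lifting) ext)
 qed
qed

end

section \<open>Taylor estimates for the complex exponential, and integrals over a period\<close>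

lemma norm_exp_minus_one_le: "norm (exp wt - 1 :: complex) \<le> norm wt * exp (norm wt)"
proof -
 have "norm (exp wt - exp 0) \<le> exp (norm wt) * norm (wt - 0)"
 proof (rule field_differentiable_bound[of "cball 0 (norm wt)"])
  fix z :: complex assume z: "z \<in> cball 0 (norm wt)"
  show "(exp has_field_derivative exp z) (at z within cball 0 (norm wt))" by (auto intro!: derivative_eq_intros)
  show "norm (exp z) \<le> exp (norm wt)" using z complex_Re_le_cmod[of z] by (simp add: norm_exp_eq_Re)
 qed auto
 thus ?thesis by (simp add: mult.commute)
qed

lemma norm_exp_minus_linear_le: "norm (exp wt - 1 - wt :: complex) \<le> (norm wt)^2 * exp (norm wt)"
proof -
 have "norm ((exp wt - wt) - (exp 0 - 0)) \<le> (norm wt * exp (norm wt)) * norm (wt - 0)"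
 proof (rule field_differentiable_bound[of "cball 0 (norm wt)"])
  fix z :: complex assume z: "z \<in> cball 0 (norm wt)"
  show "((\<lambda>z. exp z - z) has_field_derivative exp z - 1) (at z within cball 0 (norm wt))" by (auto intro!: derivative_eq_intros)
  have "norm (exp z - 1) \<le> norm z * exp (norm z)" by (rule norm_exp_minus_one_le)
  also have "... \<le> norm wt * exp (norm wt)" using z by (intro mult_mono) auto
  finally show "norm (exp z - 1) \<le> norm wt * exp (norm wt)" .
 qed auto
 thus ?thesis by (simp add: power2_eq_square algebra_simps)
qed

text \<open>The estimate is for a difference so that the error carries the factor |w - v|. At
  arguments differing by a frequency of order 1 / \<open>sd N\<close>, this makes the total error
  over all primes vanish.\<close>

lemma norm_exp_taylor2_diff_le:
 fixes wt v :: complex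
 assumes "norm wt \<le> m" "norm v \<le> m"
 shows "norm ((exp wt - exp v) - (wt - v) - (wt^2 - v\<^sup>2) / 2) \<le> norm (wt - v) * (m^2 * exp m)"
proof -
 have "norm ((exp wt - wt - wt\<^sup>2 / 2) - (exp v - v - v\<^sup>2 / 2)) \<le> (m^2 * exp m) * norm (wt - v)"
 proof (rule field_differentiable_bound[of "cball 0 m"])
  fix z :: complex assume z: "z \<in> cball 0 m"
  show "((\<lambda>z. exp z - z - z\<^sup>2 / 2) has_field_derivative exp z - 1 - z) (at z within cball 0 m)"
   by (auto intro!: derivative_eq_intros)
  have "norm (exp z - 1 - z) \<le> (norm z)^2 * exp (norm z)" by (rule norm_exp_minus_linear_le)
  also have "... \<le> m^2 * exp m" using z by (intro mult_mono power_mono) auto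
  finally show "norm (exp z - 1 - z) \<le> m^2 * exp m" .
 qed (use assms in auto)
 also have "(exp wt - wt - wt\<^sup>2 / 2) - (exp v - v - v\<^sup>2 / 2) = (exp wt - exp v) - (wt - v) - (wt^2 - v\<^sup>2) / 2"
  by (simp add: diff_divide_distrib)
 finally show ?thesis by (simp add: mult.commute)
qed

text \<open>The integral over the shifted period is G(\<xi>) - G(\<xi> - 2 pi) for a primitive G,
  and its derivative in \<xi> vanishes by periodicity.\<close>

lemma periodic_integral_shift:
 fixes f :: "real => complex"
 assumes c: "continuous_on UNIV f" and p: "\<And>x. f (x - 2 * pi) = f x"
 shows "(CLBINT t:{0..2*pi}. f (\<tau> - t)) = (CLBINT t:{0..2*pi}. f (- t))"
proof -
 \<comment> \<open>The margin 8 exceeds 2 pi, which keeps all evaluation points inside the interval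
   on which the primitive \<open>G\<close> is differentiable.\<close>
 define R where "R = \<bar>\<tau>\<bar> + 8"
 define G where "G = (\<lambda>x. integral {- R - 8..x} f)"
 have dG: "(G has_vector_derivative f x) (at x)" if x: "\<bar>x\<bar> < R + 8" for x
 proof -
  have "(G has_vector_derivative f x) (at x within {- R - 8..R + 8})"
   unfolding G_def using x by (intro integral_has_vector_derivative continuous_on_subset[OF c]) auto
  hence "(G has_vector_derivative f x) (at x within {- R - 8<..<R + 8})"
   by (rule has_vector_derivative_within_subset) auto
  thus ?thesis using x by (subst (asm) at_within_open) auto
 qed
 have pi4: "2 * pi < 8" using pi_less_4 by simp
 have int: "(CLBINT t:{0..2*pi}. f (\<xi> - t)) = G \<xi> - G (\<xi> - 2 * pi)" if s: "\<bar>\<xi>\<bar> < R" for \<xi>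
 proof -
  have "(CLBINT t:{0..2*pi}. f (\<xi> - t)) = (- G (\<xi> - 2 * pi)) - (- G (\<xi> - 0))"
   unfolding set_lebesgue_integral_def
  proof (rule integral_FTC_atLeastAtMost)
   fix t assume t: "0 \<le> t" "t \<le> 2 * pi"
   have "\<bar>\<xi> - t\<bar> < R + 8" using s t pi4 by linarith
   hence g: "(G has_vector_derivative f (\<xi> - t)) (at (\<xi> - t))" by (rule dG)
   have "((\<lambda>t. \<xi> - t) has_vector_derivative - 1) (at t within {0..2*pi})" by (auto intro!: derivative_eq_intros)
   from vector_diff_chain_within[OF this has_vector_derivative_at_within[OF g]]
   have "((\<lambda>t. G (\<xi> - t)) has_vector_derivative - f (\<xi> - t)) (at t within {0..2*pi})" by (simp add: o_def)
   from has_vector_derivative_minus[OF this]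
   show "((\<lambda>t. - G (\<xi> - t)) has_vector_derivative f (\<xi> - t)) (at t within {0..2*pi})" by simp
  next
   show "continuous_on {0..2*pi} (\<lambda>t. f (\<xi> - t))"
    by (intro continuous_on_compose2[OF c] continuous_intros) auto
  qed auto
  thus ?thesis by simp
 qed
 define h where "h = (\<lambda>\<xi>. G \<xi> - G (\<xi> - 2 * pi))"
 have "(h has_vector_derivative 0) (at \<xi> within {-\<bar>\<tau>\<bar>..\<bar>\<tau>\<bar>})" if s: "\<xi> \<in> {-\<bar>\<tau>\<bar>..\<bar>\<tau>\<bar>}" for \<xi>
 proof -
  have "\<bar>\<xi>\<bar> \<le> \<bar>\<tau>\<bar>" using s by auto
  hence "\<bar>\<xi>\<bar> < R + 8" "\<bar>\<xi> - 2 * pi\<bar> < R + 8"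
   unfolding R_def using pi4 pi_gt_zero by linarith+
  note d = this[THEN dG]
  have "((\<lambda>t. t - 2 * pi) has_vector_derivative 1) (at \<xi>)" by (auto intro!: derivative_eq_intros)
  from vector_diff_chain_at[OF this d(2)]
  have "((\<lambda>t. G (t - 2 * pi)) has_vector_derivative f (\<xi> - 2 * pi)) (at \<xi>)" by (simp add: o_def)
  hence "(h has_vector_derivative f \<xi> - f (\<xi> - 2 * pi)) (at \<xi>)"
   unfolding h_def using d(1) by (intro has_vector_derivative_diff)
  thus ?thesis by (simp add: p has_vector_derivative_at_within)
 qed
 note d0 = this
 have "\<exists>k. \<forall>\<xi>\<in>{-\<bar>\<tau>\<bar>..\<bar>\<tau>\<bar>}. h \<xi> = k"
  by (rule has_vector_derivative_zero_constant[OF convex_real_interval(5) d0]) auto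
 hence "h \<tau> = h 0" by (metis abs_ge_minus_self abs_ge_self abs_ge_zero atLeastAtMost_iff neg_le_0_iff_le minus_le_iff)
 moreover have "(CLBINT t:{0..2*pi}. f (\<tau> - t)) = h \<tau>" unfolding h_def by (rule int) (simp add: R_def)
 moreover have "(CLBINT t:{0..2*pi}. f (0 - t)) = h 0" unfolding h_def by (rule int) (simp add: R_def)
 ultimately show ?thesis by simp
qed

section \<open>The random field\<close>

text \<open>What is retained of the primes: \<open>a j\<close> stands for p^(-1/2),
  \<open>l j\<close> for log p and \<open>T j\<close> for the random phase. The covariance is
  controlled from above at all distances up to 2 by \<open>D_upper\<close>, and from below by
  \<open>D_lower\<close> only at distances where the primes have not yet separated the two
  points.\<close>

locale log_field = prob_space M for M :: "'a measure" +
 fixes T :: "nat => 'a => real" and l a :: "nat => real" and C\<^sub>0 \<alpha> :: real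
 assumes T_indep: "indep_vars (\<lambda>_. borel) T {1..}"
  and T_distr: "\<And>j. j \<ge> 1 ==> distr M lborel (T j) = uniform_measure lborel {0..2 * pi}"
  and a_pos: "\<And>j. 0 < a j" and a_le_1: "\<And>j. a j \<le> 1" and a_cube: "summable (\<lambda>j. a j ^ 3)"
  and S_approx: "\<And>N. N \<ge> 3 ==> \<bar>(\<Sum>j=1..N. (a j)^2) - ln (ln (real N))\<bar> \<le> C\<^sub>0"
  and D_upper: "\<And>N t. 0 < t ==> t \<le> 2 ==> (\<Sum>j=1..N. (a j)^2 * cos (t * l j)) \<le> ln (1 / t) + C\<^sub>0"
  and D_lower: "\<And>N t. N \<ge> 3 ==> 0 \<le> t ==> t * ln (real N) \<le> 2 ==>
    (\<Sum>j=1..N. (a j)^2) - (\<Sum>j=1..N. (a j)^2 * cos (t * l j)) \<le> C\<^sub>0"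
  and alpha: "0 < \<alpha>" "\<alpha> < 2"
begin

text \<open>By independence and \<open>expectation_cos_cos\<close>, \<open>X N x\<close> has
  variance \<open>S N / 2\<close>, and its covariance with \<open>X N y\<close> is
  \<open>D N (x - y) / 2\<close>.\<close>

definition S :: "nat => real" where "S N = (\<Sum>j=1..N. (a j)^2)"
definition D :: "nat => real => real" where "D N t = (\<Sum>j=1..N. (a j)^2 * cos (t * l j))"
definition X :: "nat => real => 'a => real" where "X N x w = (\<Sum>j=1..N. a j * cos (x * l j - T j w))"
definition Fs :: "nat => 'a measure" where
 "Fs K = vimage_algebra (space M) (\<lambda>w. \<lambda>j\<in>{1..K}. T j w) (PiM {1..K} (\<lambda>_. borel))"

lemma T_measurable [measurable]: "j \<ge> 1 ==> T j \<in> borel_measurable M"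
 using T_indep[unfolded indep_vars_def2] by simp

lemma T_integral:
 fixes f :: "real => 'b::{banach, second_countable_topology}"
 assumes "j \<ge> 1" and [measurable]: "f \<in> borel_measurable borel"
 shows "(LINT w|M. f (T j w)) = (1 / (2 * pi)) *\<^sub>R (LBINT t:{0..2*pi}. f t)"
proof -
 have [measurable]: "T j \<in> measurable M lborel" using T_measurable[OF assms(1)] by simp
 have "(LINT w|M. f (T j w)) = (LINT t|distr M lborel (T j). f t)"
  using T_measurable[OF assms(1)] by (subst integral_distr) auto
 also have "... = (LINT t|density lborel (\<lambda>t. ennreal (indicator {0..2*pi} t / (2 * pi))). f t)"
  unfolding T_distr[OF assms(1)] uniform_measure_def
  by (intro arg_cong2[where f = "integral\<^sup>L"] density_cong refl)
    (use divide_ennreal[of 1 "2 * pi"] in \<open>auto simp: indicator_def intro!: AE_I2\<close>)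
 also have "... = (LBINT t. (indicator {0..2*pi} t / (2 * pi)) *\<^sub>R f t)"
  by (rule integral_density) auto
 also have "... = (LBINT t. (1 / (2 * pi)) *\<^sub>R (indicator {0..2*pi} t *\<^sub>R f t))"
  by (intro Bochner_Integration.integral_cong) auto
 also have "... = (1 / (2 * pi)) *\<^sub>R (LBINT t:{0..2*pi}. f t)"
  unfolding set_lebesgue_integral_def by (rule integral_scaleR_right)
 finally show ?thesis .
qed

lemma expectation_cos: "j \<ge> 1 ==> expectation (\<lambda>w. cos (\<tau> - T j w)) = 0"
proof -
 assume j: "j \<ge> 1"
 have "(LBINT t:{0..2*pi}. cos (\<tau> - t)) = - sin (\<tau> - 2 * pi) - - sin (\<tau> - 0)"
  unfolding set_lebesgue_integral_def
  by (rule integral_FTC_atLeastAtMost)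
    (auto intro!: derivative_eq_intros continuous_intros simp: has_real_derivative_iff_has_vector_derivative[symmetric])
 thus ?thesis by (subst T_integral[OF j]) (auto simp: sin_diff)
qed

lemma expectation_cos_cos:
 "j \<ge> 1 ==> expectation (\<lambda>w. cos (\<tau> - T j w) * cos (\<xi> - T j w)) = cos (\<tau> - \<xi>) / 2"
proof -
 assume j: "j \<ge> 1"
 have "(LBINT t:{0..2*pi}. cos (\<tau> - t) * cos (\<xi> - t))
  = (cos (\<tau> - \<xi>) * (2 * pi) / 2 - sin (\<tau> + \<xi> - 2 * (2 * pi)) / 4) - (cos (\<tau> - \<xi>) * 0 / 2 - sin (\<tau> + \<xi> - 2 * 0) / 4)"
  unfolding set_lebesgue_integral_def
 proof (rule integral_FTC_atLeastAtMost)
  fix t assume "0 \<le> t" "t \<le> 2 * pi"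
  have "cos (\<tau> - t) * cos (\<xi> - t) = (cos (\<tau> - \<xi>) + cos (\<tau> + \<xi> - 2 * t)) / 2"
   using cos_times_cos[of "\<tau> - t" "\<xi> - t"] by (simp add: algebra_simps)
  thus "((\<lambda>t. cos (\<tau> - \<xi>) * t / 2 - sin (\<tau> + \<xi> - 2 * t) / 4) has_vector_derivative cos (\<tau> - t) * cos (\<xi> - t)) (at t within {0..2*pi})"
   unfolding has_real_derivative_iff_has_vector_derivative[symmetric]
   by (auto intro!: derivative_eq_intros simp: field_simps)
 qed (auto intro!: continuous_intros)
 also have "... = cos (\<tau> - \<xi>) * pi"
  using sin_periodic[of "\<tau> + \<xi> - 2 * (2 * pi)"] sin_periodic[of "\<tau> + \<xi> - 2 * pi"] by (simp add: algebra_simps)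
 finally show ?thesis by (subst T_integral[OF j]) auto
qed

text \<open>Rotation invariance of a uniform phase; it makes the law of the field independent of the
  point.\<close>

lemma expectation_exp_cos_rotate:
 "j \<ge> 1 ==> (CLINT w|M. exp (z * of_real (cos (\<tau> - T j w)))) = (CLINT w|M. exp (z * of_real (cos (T j w))))"
proof -
 assume j: "j \<ge> 1"
 have "(CLBINT t:{0..2*pi}. exp (z * of_real (cos (\<tau> - t)))) = (CLBINT t:{0..2*pi}. exp (z * of_real (cos (- t))))"
  by (rule periodic_integral_shift) (auto intro!: continuous_intros simp: cos_diff)
 thus ?thesis
  using T_integral[OF j, of "\<lambda>t. exp (z * of_real (cos (\<tau> - t)))"] T_integral[OF j, of "\<lambda>t. exp (z * of_real (cos t))"] by simp
qed

lemma space_Fs [simp]: "space (Fs K) = space M" by (simp add: Fs_def)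

lemma restrict_T_measurable:
 "A \<subseteq> {1..} ==> (\<lambda>w. \<lambda>j\<in>A. T j w) \<in> measurable M (PiM A (\<lambda>_. borel))"
 by (rule measurable_restrict) (rule T_measurable, auto)

lemma T_measurable_Fs: "1 \<le> j ==> j \<le> K ==> T j \<in> borel_measurable (Fs K)"
proof -
 assume j: "1 \<le> j" "j \<le> K"
 have "(\<lambda>w. \<lambda>j\<in>{1..K}. T j w) \<in> measurable (Fs K) (PiM {1..K} (\<lambda>_. borel))"
  unfolding Fs_def by (rule measurable_vimage_algebra1) (rule Pi_I, rule measurable_space[OF restrict_T_measurable], auto)
 hence "(\<lambda>w. (\<lambda>j\<in>{1..K}. T j w) j) \<in> borel_measurable (Fs K)"
  by (rule measurable_compose) (use j in auto)
 thus ?thesis using j by simp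
qed

lemma subalgebra_Fs: "subalgebra M (Fs K)"
proof -
 have "sets (Fs K) \<subseteq> sets M"
  unfolding Fs_def sets_vimage_algebra
  using restrict_T_measurable[of "{1..K}"] by (intro sets.sigma_sets_subset) (auto simp: measurable_sets)
 thus ?thesis by (simp add: subalgebra_def)
qed

lemma sets_Fs_mono: "K \<le> K' ==> sets (Fs K) \<subseteq> sets (Fs K')"
proof -
 assume K: "K \<le> K'"
 have "(\<lambda>w. \<lambda>j\<in>{1..K}. T j w) \<in> measurable (Fs K') (PiM {1..K} (\<lambda>_. borel))"
  by (rule measurable_restrict) (use K T_measurable_Fs in auto)
 hence "{(\<lambda>w. \<lambda>j\<in>{1..K}. T j w) -` A \<inter> space M |A. A \<in> sets (PiM {1..K} (\<lambda>_. borel))} \<subseteq> sets (Fs K')"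
  by (auto dest: measurable_sets)
 thus ?thesis
  unfolding Fs_def[of K] sets_vimage_algebra using sets.sigma_sets_subset[of _ "Fs K'"] by simp
qed

lemma measurable_Fs_mono: "f \<in> measurable (Fs K) N ==> K \<le> K' ==> f \<in> measurable (Fs K') N"
 using sets_Fs_mono[of K K'] unfolding measurable_def by simp blast

lemma measurable_Fs_M: "f \<in> measurable (Fs K) N ==> f \<in> measurable M N"
 using subalgebra_Fs by (rule measurable_from_subalg)

text \<open>Integrating out the phases after K while a function of the first K phases is held fixed.
  This plays the part of a conditional expectation throughout.\<close>

lemma indep_prod_T:
 fixes f :: "'a => complex" and g :: "nat => real => complex"
 assumes f: "f \<in> borel_measurable (Fs K)" "integrable M f"
  and g [measurable]: "\<And>j. g j \<in> borel_measurable borel" and B: "\<And>j t. norm (g j t) \<le> B"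
 shows "(CLINT w|M. f w * (\<Prod>j\<in>{K<..N}. g j (T j w))) = (CLINT w|M. f w) * (\<Prod>j\<in>{K<..N}. CLINT w|M. g j (T j w))"
  and "integrable M (\<lambda>w. f w * (\<Prod>j\<in>{K<..N}. g j (T j w)))"
proof -
 let ?A = "{1..K}" and ?B = "{K<..N}"
 define G where "G = (\<lambda>w. \<Prod>j\<in>?B. g j (T j w))"
 have Gm: "(\<lambda>h. \<Prod>j\<in>?B. g j (h j)) \<in> borel_measurable (PiM ?B (\<lambda>_. borel))" by measurable
 have iv: "indep_var (PiM ?A (\<lambda>_. borel)) (\<lambda>w. \<lambda>j\<in>?A. T j w) (PiM ?B (\<lambda>_. borel)) (\<lambda>w. \<lambda>j\<in>?B. T j w)"
  by (rule indep_var_restrict[OF T_indep]) auto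
 have fM [measurable]: "f \<in> borel_measurable M" using f(1) by (rule measurable_Fs_M)
 have GM [measurable]: "G \<in> borel_measurable M" unfolding G_def by measurable
 have "indep_var borel f borel G"
  unfolding indep_var_eq
 proof (intro conjI fM GM)
  have "indep_set (sigma_sets (space M) {(\<lambda>w. \<lambda>j\<in>?A. T j w) -` A \<inter> space M |A. A \<in> sets (PiM ?A (\<lambda>_. borel))})
   (sigma_sets (space M) {(\<lambda>w. \<lambda>j\<in>?B. T j w) -` A \<inter> space M |A. A \<in> sets (PiM ?B (\<lambda>_. borel))})"
   using iv unfolding indep_var_eq by simp
  moreover have "sigma_sets (space M) {f -` A \<inter> space M |A. A \<in> sets borel} \<subseteq>
    sigma_sets (space M) {(\<lambda>w. \<lambda>j\<in>?A. T j w) -` A \<inter> space M |A. A \<in> sets (PiM ?A (\<lambda>_. borel))}"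
  proof -
   have "{f -` A \<inter> space M |A. A \<in> sets borel} \<subseteq> sets (Fs K)"
    using f(1) by (auto dest: measurable_sets)
   hence "sigma_sets (space (Fs K)) {f -` A \<inter> space M |A. A \<in> sets borel} \<subseteq> sets (Fs K)"
    by (rule sets.sigma_sets_subset)
   thus ?thesis by (simp add: Fs_def sets_vimage_algebra)
  qed
  moreover have "sigma_sets (space M) {G -` A \<inter> space M |A. A \<in> sets borel} \<subseteq>
    sigma_sets (space M) {(\<lambda>w. \<lambda>j\<in>?B. T j w) -` A \<inter> space M |A. A \<in> sets (PiM ?B (\<lambda>_. borel))}"
  proof (rule sigma_sets_mono', safe)
   fix A :: "complex set" assume A: "A \<in> sets borel"
   let ?h = "\<lambda>h. \<Prod>j\<in>?B. g j (h j)"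
   have "G -` A \<inter> space M = (\<lambda>w. \<lambda>j\<in>?B. T j w) -` (?h -` A \<inter> space (PiM ?B (\<lambda>_. borel))) \<inter> space M"
    by (auto simp: G_def space_PiM)
   moreover have "?h -` A \<inter> space (PiM ?B (\<lambda>_. borel)) \<in> sets (PiM ?B (\<lambda>_. borel))"
    using Gm A by (rule measurable_sets)
   ultimately show "\<exists>A'. G -` A \<inter> space M = (\<lambda>w. \<lambda>j\<in>?B. T j w) -` A' \<inter> space M \<and> A' \<in> sets (PiM ?B (\<lambda>_. borel))"
    by blast
  qed
  ultimately show "indep_set (sigma_sets (space M) {f -` A \<inter> space M |A. A \<in> sets borel})
    (sigma_sets (space M) {G -` A \<inter> space M |A. A \<in> sets borel})"
   unfolding indep_sets2_eq by blast
 qed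
 moreover have gint: "integrable M (\<lambda>w. g j (T j w))" if "j \<in> ?B" for j
  using that B by (intro integrable_const_bound[of _ B]) auto
 have iT: "indep_vars (\<lambda>_. borel) (\<lambda>j w. g j (T j w)) ?B"
  by (rule indep_vars_compose2[OF indep_vars_subset[OF T_indep]]) auto
 have Gi: "integrable M G"
  unfolding G_def by (rule indep_vars_integrable[OF _ iT gint]) auto
 ultimately have "indep_var borel f borel G" "integrable M G" by simp_all
 note iG = this
 have PG: "(CLINT w|M. G w) = (\<Prod>j\<in>{K<..N}. CLINT w|M. g j (T j w))"
  unfolding G_def by (rule indep_vars_lebesgue_integral[OF _ iT gint]) auto
 show "(CLINT w|M. f w * (\<Prod>j\<in>{K<..N}. g j (T j w))) = (CLINT w|M. f w) * (\<Prod>j\<in>{K<..N}. CLINT w|M. g j (T j w))"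
  using indep_var_lebesgue_integral[OF iG(1) f(2) iG(2)] by (simp only: PG[symmetric]) (simp only: G_def)
 show "integrable M (\<lambda>w. f w * (\<Prod>j\<in>{K<..N}. g j (T j w)))"
  using indep_var_integrable[OF iG(1) f(2) iG(2)] unfolding G_def .
qed

end

section \<open>Laplace transforms of the contributions of single primes\<close>

context log_field
begin

text \<open>The joint Laplace transform of the j-th summand of the field at the two points. Real
  parts of the arguments tilt the measure, and imaginary parts are Fourier frequencies.\<close>

definition F :: "nat => real => real => complex => complex => complex" where
 "F j x y z1 z2 = (CLINT w|M. exp (of_real (a j) * (z1 * of_real (cos (x * l j - T j w)) + z2 * of_real (cos (y * l j - T j w)))))"

text \<open>Half the second moment of the exponent in \<open>F\<close>. The first moment vanishes,
  so this is the leading term of \<open>F\<close> - 1 and of its logarithm.\<close>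

definition Q :: "nat => real => complex => complex => complex" where
 "Q j t z1 z2 = of_real ((a j)^2 / 4) * (z1^2 + z2^2 + 2 * z1 * z2 * of_real (cos (t * l j)))"

definition Fp :: "nat => nat => real => real => complex => complex => complex" where
 "Fp K N x y z1 z2 = (\<Prod>j\<in>{K<..N}. F j x y z1 z2)"

definition taylor_const :: "real => real" where
 "taylor_const B = (2 * B)^2 * exp (2 * B)"

lemma taylor_const_nonneg: "taylor_const B \<ge> 0" by (simp add: taylor_const_def)

lemma a_nonneg: "0 \<le> a j" using a_pos[of j] by simp

text \<open>Means of uniform phases vanish and second moments give exactly \<open>Q\<close>. What
  remains is the third-order error of \<open>norm_exp_taylor2_diff_le\<close>, proportional to the
  change of the arguments.\<close>

lemma F_taylor:
 assumes j: "j \<ge> 1" and B: "norm z1 \<le> B" "norm z2 \<le> B" "norm w1 \<le> B" "norm w2 \<le> B"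
 shows "norm ((F j x y z1 z2 - F j x y w1 w2) - (Q j (x - y) z1 z2 - Q j (x - y) w1 w2))
  \<le> taylor_const B * (norm (z1 - w1) + norm (z2 - w2)) * a j ^ 3"
proof -
 define c d where "c = (\<lambda>w. cos (x * l j - T j w))" and "d = (\<lambda>w. cos (y * l j - T j w))"
 note [measurable] = T_measurable[OF j]
 have [measurable]: "c \<in> borel_measurable M" "d \<in> borel_measurable M" unfolding c_def d_def by measurable
 have cd: "\<bar>c w\<bar> \<le> 1" "\<bar>d w\<bar> \<le> 1" for w by (auto simp: c_def d_def)
 define W where "W = (\<lambda>z1 z2 w. of_real (a j) * (z1 * of_real (c w) + z2 * of_real (d w)) :: complex)"
 have [measurable]: "W z1 z2 \<in> borel_measurable M" for z1 z2 unfolding W_def by measurable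
 have Wn: "norm (W z1 z2 w) \<le> a j * (norm z1 + norm z2)" for z1 z2 w
 proof -
  have "norm (z1 * of_real (c w) + z2 * of_real (d w)) \<le> norm z1 * \<bar>c w\<bar> + norm z2 * \<bar>d w\<bar>"
   by (rule order_trans[OF norm_triangle_ineq]) (simp add: norm_mult)
  also have "... \<le> norm z1 * 1 + norm z2 * 1" using cd by (intro add_mono mult_left_mono) auto
  finally show ?thesis unfolding W_def norm_mult using a_nonneg[of j] by (auto intro: mult_left_mono)
 qed
 have Wi: "integrable M (W z1 z2)" for z1 z2
  by (rule integrable_const_bound[OF AE_I2[OF Wn]]) simp
 have W2i: "integrable M (\<lambda>w. (W z1 z2 w)^2)" for z1 z2
 proof (rule integrable_const_bound)
  show "AE w in M. norm ((W z1 z2 w)^2) \<le> (a j * (norm z1 + norm z2))^2"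
   unfolding norm_power using Wn by (intro AE_I2 power_mono) auto
 qed simp
 have Ei: "integrable M (\<lambda>w. exp (W z1 z2 w))" for z1 z2
 proof (rule integrable_const_bound)
  show "AE w in M. norm (exp (W z1 z2 w)) \<le> exp (a j * (norm z1 + norm z2))"
   using Wn[of z1 z2] complex_Re_le_cmod order_trans by (intro AE_I2) (auto simp: norm_exp_eq_Re intro: order_trans[OF complex_Re_le_cmod])
 qed simp
 have ci: "integrable M c" "integrable M d" "integrable M (\<lambda>w. c w * c w)" "integrable M (\<lambda>w. d w * d w)" "integrable M (\<lambda>w. c w * d w)"
 proof -
  have cc: "\<bar>c w * c w\<bar> \<le> 1" "\<bar>d w * d w\<bar> \<le> 1" "\<bar>c w * d w\<bar> \<le> 1" for w
   unfolding abs_mult by (intro mult_le_one cd abs_ge_zero)+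
  show "integrable M c" "integrable M d" "integrable M (\<lambda>w. c w * c w)" "integrable M (\<lambda>w. d w * d w)" "integrable M (\<lambda>w. c w * d w)"
   by (rule integrable_const_bound[of _ 1], use cd cc in simp, measurable)+
 qed
 have EW: "(CLINT w|M. W z1 z2 w) = 0" for z1 z2
 proof -
  have "(CLINT w|M. W z1 z2 w) = of_real (a j) * (z1 * (CLINT w|M. of_real (c w)) + z2 * (CLINT w|M. of_real (d w)))"
   unfolding W_def using ci by (simp add: integrable_of_real del: integral_complex_of_real)
  also have "... = 0" using expectation_cos[OF j] by (simp add: c_def d_def)
  finally show ?thesis .
 qed
 have EW2: "(CLINT w|M. (W z1 z2 w)^2) = 2 * Q j (x - y) z1 z2" for z1 z2
 proof -
  have "(\<lambda>w. (W z1 z2 w)^2) = (\<lambda>w. (of_real (a j))^2 * (z1^2 * of_real (c w * c w) + z2^2 * of_real (d w * d w) + 2 * z1 * z2 * of_real (c w * d w)))"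
   by (auto simp: W_def power2_eq_square algebra_simps)
  hence "(CLINT w|M. (W z1 z2 w)^2) = (of_real (a j))^2 * (z1^2 * (CLINT w|M. of_real (c w * c w)) + z2^2 * (CLINT w|M. of_real (d w * d w)) + 2 * z1 * z2 * (CLINT w|M. of_real (c w * d w)))"
   using ci by (simp add: integrable_of_real del: integral_complex_of_real of_real_mult)
  also have "... = 2 * Q j (x - y) z1 z2"
  proof -
   have e: "expectation (\<lambda>w. c w * c w) = 1 / 2" "expectation (\<lambda>w. d w * d w) = 1 / 2"
    "expectation (\<lambda>w. c w * d w) = cos ((x - y) * l j) / 2"
    unfolding c_def d_def by (simp_all add: expectation_cos_cos[OF j] left_diff_distrib)
   show ?thesis unfolding integral_complex_of_real e by (simp add: Q_def algebra_simps)
  qed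
  finally show ?thesis .
 qed
 have FW: "F j x y z1 z2 = (CLINT w|M. exp (W z1 z2 w))" for z1 z2
  by (simp add: F_def W_def c_def d_def)
 let ?m = "a j * (2 * B)"
 have B0: "B \<ge> 0" using B(1) norm_ge_zero order_trans by blast
 have "(F j x y z1 z2 - F j x y w1 w2) - (Q j (x - y) z1 z2 - Q j (x - y) w1 w2)
  = (CLINT w|M. (exp (W z1 z2 w) - exp (W w1 w2 w)) - (W z1 z2 w - W w1 w2 w) - ((W z1 z2 w)^2 - (W w1 w2 w)\<^sup>2) / 2)"
  using Ei Wi W2i by (simp add: FW EW EW2 diff_divide_distrib)
 also have "norm ... \<le> (LINT w|M. (a j * (norm (z1 - w1) + norm (z2 - w2))) * (?m^2 * exp ?m))"
 proof (rule order_trans[OF integral_norm_bound], rule integral_mono)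
  fix w
  have b: "norm (W z1 z2 w) \<le> ?m" "norm (W w1 w2 w) \<le> ?m"
   using B a_nonneg[of j] by (auto intro!: order_trans[OF Wn] mult_left_mono)
  have "norm ((exp (W z1 z2 w) - exp (W w1 w2 w)) - (W z1 z2 w - W w1 w2 w) - ((W z1 z2 w)^2 - (W w1 w2 w)\<^sup>2) / 2)
   \<le> norm (W z1 z2 w - W w1 w2 w) * (?m^2 * exp ?m)"
   using b by (rule norm_exp_taylor2_diff_le)
  also have "norm (W z1 z2 w - W w1 w2 w) * (?m^2 * exp ?m) \<le> (a j * (norm (z1 - w1) + norm (z2 - w2))) * (?m^2 * exp ?m)"
  proof -
   have "W z1 z2 w - W w1 w2 w = W (z1 - w1) (z2 - w2) w" by (simp add: W_def algebra_simps)
   thus ?thesis using Wn[of "z1 - w1" "z2 - w2" w] by (simp only:) (intro mult_right_mono, auto)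
  qed
  finally show "norm ((exp (W z1 z2 w) - exp (W w1 w2 w)) - (W z1 z2 w - W w1 w2 w) - ((W z1 z2 w)^2 - (W w1 w2 w)\<^sup>2) / 2)
   \<le> (a j * (norm (z1 - w1) + norm (z2 - w2))) * (?m^2 * exp ?m)" .
 qed (use Ei Wi W2i in auto)
 also have "... = (a j * (norm (z1 - w1) + norm (z2 - w2))) * (?m^2 * exp ?m)"
  unfolding lebesgue_integral_const prob_space by (rule scaleR_one)
 also have "... \<le> (a j * (norm (z1 - w1) + norm (z2 - w2))) * ((a j)^2 * taylor_const B)"
 proof (intro mult_left_mono)
  have "?m \<le> 1 * (2 * B)" using a_le_1[of j] B0 by (intro mult_right_mono) auto
  hence "exp ?m \<le> exp (2 * B)" by simp
  hence "(a j)^2 * (2 * B)^2 * exp ?m \<le> (a j)^2 * (2 * B)^2 * exp (2 * B)" by (intro mult_left_mono) auto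
  thus "?m^2 * exp ?m \<le> (a j)^2 * taylor_const B" by (simp add: taylor_const_def power_mult_distrib mult.assoc)
 qed (use a_nonneg in auto)
 also have "... = taylor_const B * (norm (z1 - w1) + norm (z2 - w2)) * (a j * (a j)^2)" by (simp only: mult_ac)
 also have "a j * (a j)^2 = a j ^ 3" by (simp add: power2_eq_square power3_eq_cube)
 finally show ?thesis .
qed

lemma F_0: "F j x y 0 0 = 1" by (simp add: F_def prob_space)

lemma Q_0: "Q j t 0 0 = 0" by (simp add: Q_def)

lemma F_approx:
 assumes "j \<ge> 1" "norm z1 \<le> B" "norm z2 \<le> B"
 shows "norm (F j x y z1 z2 - 1 - Q j (x - y) z1 z2) \<le> 2 * B * taylor_const B * a j ^ 3"
proof -
 have B: "B \<ge> 0" using assms(2) norm_ge_zero order_trans by blast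
 have "norm (F j x y z1 z2 - 1 - Q j (x - y) z1 z2) \<le> taylor_const B * (norm z1 + norm z2) * a j ^ 3"
  using F_taylor[OF assms(1,2,3), of 0 0 x y] B by (simp add: F_0 Q_0)
 also have "... \<le> taylor_const B * (2 * B) * a j ^ 3"
  using assms a_nonneg[of j] taylor_const_nonneg by (intro mult_right_mono mult_left_mono) auto
 finally show ?thesis by (simp add: mult_ac)
qed

lemma norm_Q_le:
 assumes "norm z1 \<le> B" "norm z2 \<le> B"
 shows "norm (Q j t z1 z2) \<le> (a j)^2 * B^2"
proof -
 have B: "B \<ge> 0" using assms(1) norm_ge_zero order_trans by blast
 have "norm (z1^2 + z2^2 + 2 * z1 * z2 * of_real (cos (t * l j))) \<le> norm (z1^2) + norm (z2^2) + norm (2 * z1 * z2 * of_real (cos (t * l j)))"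
  by (intro order_trans[OF norm_triangle_ineq] add_mono norm_triangle_ineq order_refl)
 also have "... = (norm z1)^2 + (norm z2)^2 + 2 * norm z1 * norm z2 * \<bar>cos (t * l j)\<bar>"
  by (simp add: norm_mult norm_power)
 also have "... \<le> B^2 + B^2 + 2 * B * B * 1"
  using assms B by (intro add_mono power_mono mult_mono) auto
 finally have "norm (z1^2 + z2^2 + 2 * z1 * z2 * of_real (cos (t * l j))) \<le> 4 * B^2" by (simp add: power2_eq_square)
 hence "(a j)^2 / 4 * norm (z1^2 + z2^2 + 2 * z1 * z2 * of_real (cos (t * l j))) \<le> (a j)^2 / 4 * (4 * B^2)"
  by (intro mult_left_mono) auto
 thus ?thesis unfolding Q_def norm_mult norm_of_real by simp
qed

lemma a_pow4_le: "(a j)^2 * (a j)^2 \<le> a j ^ 3"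
proof -
 have "a j ^ 3 * a j \<le> a j ^ 3 * 1" using a_le_1[of j] a_nonneg[of j] by (intro mult_left_mono) auto
 thus ?thesis by (simp add: power2_eq_square power3_eq_cube mult.assoc)
qed

text \<open>\<open>norm_one_plus_le_exp\<close> is applied to w = \<open>F\<close> - 1. Its
  quadratic term is of order a^4 <= a^3, so it joins the Taylor error in one summable
  correction.\<close>

lemma norm_F_le:
 obtains C where "C \<ge> 0" "\<And>j x y z1 z2. j \<ge> 1 ==> norm z1 \<le> B ==> norm z2 \<le> B ==>
  norm (F j x y z1 z2) \<le> exp (Re (Q j (x - y) z1 z2) + C * a j ^ 3)"
proof -
 define K where "K = \<bar>2 * B * taylor_const B\<bar>"
 define C where "C = K + (B^2 + K)^2 / 2"
 have K0: "K \<ge> 0" by (simp add: K_def)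
 have "norm (F j x y z1 z2) \<le> exp (Re (Q j (x - y) z1 z2) + C * a j ^ 3)"
  if j: "j \<ge> 1" and z: "norm z1 \<le> B" "norm z2 \<le> B" for j x y z1 z2
 proof -
  define wt where "wt = F j x y z1 z2 - 1"
  have a3: "a j ^ 3 \<ge> 0" using a_nonneg[of j] by simp
  have a32: "a j ^ 3 \<le> (a j)^2" using a_le_1[of j] a_nonneg[of j] by (intro power_decreasing) auto
  have e: "norm (wt - Q j (x - y) z1 z2) \<le> K * a j ^ 3"
   unfolding wt_def K_def by (rule order_trans[OF F_approx[OF j z] mult_right_mono[OF abs_ge_self a3]])
  have "Re (wt - Q j (x - y) z1 z2) \<le> K * a j ^ 3" using e complex_Re_le_cmod order_trans by blast
  hence re: "Re wt \<le> Re (Q j (x - y) z1 z2) + K * a j ^ 3" by simp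
  have "norm wt \<le> norm (wt - Q j (x - y) z1 z2) + norm (Q j (x - y) z1 z2)" by (metis diff_add_cancel norm_triangle_ineq)
  also have "... \<le> K * (a j)^2 + (a j)^2 * B^2"
   using e norm_Q_le[OF z, of j "x - y"] mult_left_mono[OF a32 K0] by linarith
  finally have "norm wt \<le> (B^2 + K) * (a j)^2" by (simp add: algebra_simps)
  hence "(norm wt)^2 \<le> ((B^2 + K) * (a j)^2)^2" by (intro power_mono) auto
  also have "... = (B^2 + K)^2 * ((a j)^2 * (a j)^2)" by (simp add: power_mult_distrib power2_eq_square)
  also have "... \<le> (B^2 + K)^2 * a j ^ 3" by (intro mult_left_mono a_pow4_le) auto
  finally have w2: "(norm wt)^2 / 2 \<le> (B^2 + K)^2 / 2 * a j ^ 3" by simp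
  have "norm (1 + wt) \<le> exp (Re wt + (norm wt)^2 / 2)" by (rule norm_one_plus_le_exp)
  also have "... \<le> exp (Re (Q j (x - y) z1 z2) + C * a j ^ 3)"
   using re w2 by (simp add: C_def distrib_right)
  finally show ?thesis by (simp add: wt_def)
 qed
 moreover have "C \<ge> 0" using K0 by (simp add: C_def)
 ultimately show ?thesis by (rule that[rotated])
qed

text \<open>At real arguments the exponent is real with mean 0, and exp z >= 1 + z gives a transform
  of at least 1. All later denominators are products of such factors.\<close>

lemma F_of_real:
 assumes j: "j \<ge> 1"
 shows "F j x y (of_real r1) (of_real r2) = of_real (expectation (\<lambda>w. exp (a j * (r1 * cos (x * l j - T j w) + r2 * cos (y * l j - T j w)))))"
  and "expectation (\<lambda>w. exp (a j * (r1 * cos (x * l j - T j w) + r2 * cos (y * l j - T j w)))) \<ge> 1"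
proof -
 define W where "W = (\<lambda>w. a j * (r1 * cos (x * l j - T j w) + r2 * cos (y * l j - T j w)))"
 note [measurable] = T_measurable[OF j]
 show "F j x y (of_real r1) (of_real r2) = of_real (expectation (\<lambda>w. exp (a j * (r1 * cos (x * l j - T j w) + r2 * cos (y * l j - T j w)))))"
  unfolding F_def integral_complex_of_real[symmetric] by (simp flip: of_real_mult of_real_add exp_of_real)
 have [measurable]: "W \<in> borel_measurable M" unfolding W_def by measurable
 have Wb: "\<bar>W w\<bar> \<le> \<bar>r1\<bar> + \<bar>r2\<bar>" for w
 proof -
  have "\<bar>r1 * cos (x * l j - T j w) + r2 * cos (y * l j - T j w)\<bar> \<le> \<bar>r1\<bar> * 1 + \<bar>r2\<bar> * 1"
   by (rule order_trans[OF abs_triangle_ineq]) (auto simp: abs_mult intro!: add_mono mult_left_le)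
  hence "a j * \<bar>r1 * cos (x * l j - T j w) + r2 * cos (y * l j - T j w)\<bar> \<le> 1 * (\<bar>r1\<bar> + \<bar>r2\<bar>)"
   using a_le_1[of j] a_nonneg[of j] by (intro mult_mono) auto
  thus ?thesis using a_nonneg[of j] by (simp add: W_def abs_mult)
 qed
 have ci: "integrable M (\<lambda>w. cos (x * l j - T j w))" for x by (rule integrable_const_bound[of _ 1]) auto
 have Wi: "integrable M W" unfolding W_def using ci by auto
 have EW: "expectation W = 0" unfolding W_def using ci by (simp add: expectation_cos[OF j])
 have "expectation (\<lambda>w. 1 + W w) \<le> expectation (\<lambda>w. exp (W w))"
 proof (rule integral_mono)
  show "integrable M (\<lambda>w. exp (W w))"
   by (rule integrable_const_bound[of _ "exp (\<bar>r1\<bar> + \<bar>r2\<bar>)"]) (use Wb in \<open>auto simp: abs_le_iff\<close>)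
 qed (use Wi exp_ge_add_one_self in auto)
 hence "1 \<le> expectation (\<lambda>w. exp (W w))" using Wi EW by (simp add: prob_space)
 thus "expectation (\<lambda>w. exp (a j * (r1 * cos (x * l j - T j w) + r2 * cos (y * l j - T j w)))) \<ge> 1"
  by (simp only: W_def)
qed

lemma Q_of_real:
 "Q j t (of_real r1) (of_real r2) = of_real ((a j)^2 / 4 * (r1^2 + r2^2 + 2 * r1 * r2 * cos (t * l j)))"
 by (simp add: Q_def)

text \<open>Since the transform is at least 1, the additive error C a^3 is at most C a^3 times the
  transform itself and turns into a factor exp(C a^3).\<close>

lemma F_real_lower:
 assumes B: "B \<ge> 0"
 obtains C where "C \<ge> 0" "\<And>j x y r1 r2. j \<ge> 1 ==> 0 \<le> r1 ==> r1 \<le> B ==> 0 \<le> r2 ==> r2 \<le> B ==>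
  Re (F j x y (of_real r1) (of_real r2)) \<ge> exp (Re (Q j (x - y) (of_real r1) (of_real r2)) - C * a j ^ 3)"
proof -
 define K where "K = 2 * B * taylor_const B"
 define C where "C = K + B ^ 4 * exp (B^2)"
 have K0: "K \<ge> 0" using B by (simp add: K_def taylor_const_nonneg)
 have C0: "C \<ge> 0" using K0 by (simp add: C_def)
 have "Re (F j x y (of_real r1) (of_real r2)) \<ge> exp (Re (Q j (x - y) (of_real r1) (of_real r2)) - C * a j ^ 3)"
  if j: "j \<ge> 1" and r: "0 \<le> r1" "r1 \<le> B" "0 \<le> r2" "r2 \<le> B" for j x y r1 r2
 proof -
  define q where "q = Re (Q j (x - y) (of_real r1) (of_real r2))"
  define f where "f = Re (F j x y (of_real r1) (of_real r2))"
  have f1: "f \<ge> 1" unfolding f_def F_of_real(1)[OF j] using F_of_real(2)[OF j] by simp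
  have a3: "a j ^ 3 \<ge> 0" using a_nonneg[of j] by simp
  have nz: "norm (complex_of_real r1) \<le> B" "norm (complex_of_real r2) \<le> B" using r by auto
  have "\<bar>Re (F j x y (of_real r1) (of_real r2) - 1 - Q j (x - y) (of_real r1) (of_real r2))\<bar> \<le> K * a j ^ 3"
   unfolding K_def by (rule order_trans[OF abs_Re_le_cmod F_approx[OF j nz]])
  hence fq: "1 + q \<le> f + K * a j ^ 3" by (simp add: f_def q_def)
  have "norm (complex_of_real q) \<le> (a j)^2 * B^2"
   unfolding q_def using norm_Q_le[OF nz, of j "x - y"] by (simp add: Q_of_real norm_mult abs_mult del: of_real_mult of_real_divide of_real_power of_real_add)
  hence qb: "\<bar>q\<bar> \<le> (a j)^2 * B^2" by simp
  also have "... \<le> 1 * B^2" using a_le_1[of j] a_nonneg[of j] by (intro mult_right_mono power_le_one) auto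
  finally have qb1: "\<bar>q\<bar> \<le> B^2" by simp
  have "norm (exp (complex_of_real q) - 1 - of_real q) \<le> (norm (complex_of_real q))^2 * exp (norm (complex_of_real q))"
   by (rule norm_exp_minus_linear_le)
  also have "exp (complex_of_real q) - 1 - of_real q = of_real (exp q - 1 - q)" by (simp add: exp_of_real)
  finally have "\<bar>exp q - 1 - q\<bar> \<le> \<bar>q\<bar>^2 * exp \<bar>q\<bar>" by (simp only: norm_of_real)
  also have "... \<le> ((a j)^2 * B^2)^2 * exp (B^2)" using qb qb1 by (intro mult_mono power_mono) auto
  also have "... = ((a j)^2 * (a j)^2) * (B ^ 4 * exp (B^2))" by (simp add: power2_eq_square power4_eq_xxxx mult_ac)
  also have "... \<le> a j ^ 3 * (B ^ 4 * exp (B^2))" by (intro mult_right_mono a_pow4_le) auto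
  finally have "exp q \<le> f + C * a j ^ 3" using fq by (simp add: C_def algebra_simps)
  also have "... \<le> f * (1 + C * a j ^ 3)" using mult_right_mono[OF f1, of "C * a j ^ 3"] C0 a3 by (simp add: algebra_simps)
  also have "... \<le> f * exp (C * a j ^ 3)" using f1 by (intro mult_left_mono exp_ge_add_one_self) auto
  finally have "exp q * exp (- (C * a j ^ 3)) \<le> f * exp (C * a j ^ 3) * exp (- (C * a j ^ 3))" by (intro mult_right_mono) auto
  also have "... = f" by (simp add: mult.assoc flip: exp_add)
  finally show ?thesis by (simp add: f_def q_def exp_diff exp_minus divide_inverse)
 qed
 thus ?thesis using C0 by (rule that[rotated])
qed

lemma cube_sum_le: "(\<Sum>j\<in>{K<..N}. a j ^ 3) \<le> (\<Sum>j. a j ^ 3)"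
 by (rule sum_le_suminf[OF a_cube]) (auto simp: a_nonneg)

lemma sum_Suc_diff_gen:
 fixes f :: "nat => real"
 shows "K \<le> N ==> (\<Sum>j\<in>{K<..N}. f j) = (\<Sum>j=1..N. f j) - (\<Sum>j=1..K. f j)"
proof -
 assume K: "K \<le> N"
 have "{1..N} = {1..K} \<union> {K<..N}" "{1..K} \<inter> {K<..N} = {}" using K by auto
 thus ?thesis by (simp add: sum.union_disjoint)
qed

lemma S_diff: "K \<le> N ==> (\<Sum>j\<in>{K<..N}. (a j)^2) = S N - S K"
 unfolding S_def by (rule sum_Suc_diff_gen)

lemma D_diff: "K \<le> N ==> (\<Sum>j\<in>{K<..N}. (a j)^2 * cos (t * l j)) = D N t - D K t"
 unfolding D_def by (rule sum_Suc_diff_gen)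

lemma S_mono: "K \<le> N ==> S K \<le> S N"
 using S_diff[of K N] sum_nonneg[of "{K<..N}" "\<lambda>j. (a j)^2"] by simp

lemma S_nonneg: "S N \<ge> 0" unfolding S_def by (intro sum_nonneg) auto

lemma D_diff_le_S: "K \<le> N ==> D N t - D K t \<le> S N - S K"
proof -
 assume K: "K \<le> N"
 have "(\<Sum>j\<in>{K<..N}. (a j)^2 * cos (t * l j)) \<le> (\<Sum>j\<in>{K<..N}. (a j)^2 * 1)"
  by (intro sum_mono mult_left_mono) auto
 thus ?thesis by (simp add: S_diff[OF K] D_diff[OF K])
qed

lemma D_minus: "D N (- t) = D N t" by (simp add: D_def)

text \<open>
 The decay in \<open>u, v\<close> uses \<open>1 - \<bar>cos \<tau>\<bar> \<ge> (sin \<tau>)^2 / 2 = (1 - cos (2\<tau>)) / 4\<close>, so that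
 only an upper bound on \<open>D N (2 * t)\<close> is needed to exploit it.
\<close>
lemma Re_Q_le:
 "Re (Q j t (Complex r1 u) (Complex r2 v)) \<le>
   (r1^2 + r2^2) / 4 * (a j)^2 + r1 * r2 / 2 * ((a j)^2 * cos (t * l j))
   - (u^2 + v^2) / 16 * ((a j)^2 - (a j)\<^sup>2 * cos (2 * t * l j))"
proof -
 define c where "c = cos (t * l j)"
 have c: "\<bar>c\<bar> \<le> 1" by (simp add: c_def)
 have c2: "cos (2 * t * l j) = 2 * c^2 - 1" using cos_double_cos[of "t * l j"] by (simp add: c_def mult.assoc)
 have "2 * \<bar>u * v\<bar> \<le> u^2 + v^2" using sum_squares_bound[of "\<bar>u\<bar>" "\<bar>v\<bar>"] by (simp add: abs_mult)
 hence "2 * \<bar>u * v\<bar> * \<bar>c\<bar> \<le> (u^2 + v^2) * \<bar>c\<bar>" by (rule mult_right_mono) simp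
 moreover have "- (2 * u * v * c) \<le> 2 * \<bar>u * v\<bar> * \<bar>c\<bar>" using abs_ge_minus_self[of "u * v * c"] unfolding abs_mult[of "u * v" c] by linarith
 moreover have "\<bar>c\<bar> \<le> 1 - (1 - c\<^sup>2) / 2"
 proof -
  have "0 \<le> (1 - \<bar>c\<bar>)^2" by simp
  hence "2 * \<bar>c\<bar> \<le> 1 + c^2" by (simp add: power2_diff)
  thus ?thesis by (simp add: field_simps)
 qed
 hence "(u^2 + v^2) * \<bar>c\<bar> \<le> (u^2 + v^2) * (1 - (1 - c\<^sup>2) / 2)" by (rule mult_left_mono) simp
 ultimately have "- (2 * u * v * c) \<le> (u^2 + v^2) * (1 - (1 - c\<^sup>2) / 2)" by linarith
 also have "... = (u^2 + v^2) - (u^2 + v^2) * (1 - c\<^sup>2) / 2" by (simp add: algebra_simps)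
 finally have "- (u^2 + v^2 + 2 * u * v * c) \<le> - (u^2 + v^2) * (1 - c\<^sup>2) / 2"
  unfolding minus_mult_left[symmetric] minus_divide_left[symmetric] by linarith
 hence "(a j)^2 / 4 * (- (u^2 + v^2 + 2 * u * v * c)) \<le> (a j)^2 / 4 * (- (u^2 + v^2) * (1 - c\<^sup>2) / 2)"
  by (rule mult_left_mono) simp
 moreover have "Re (Q j t (Complex r1 u) (Complex r2 v)) = (a j)^2 / 4 * (r1^2 + r2^2 + 2 * r1 * r2 * c) + (a j)^2 / 4 * (- (u^2 + v^2 + 2 * u * v * c))"
 proof -
  let ?wt = "(Complex r1 u)^2 + (Complex r2 v)^2 + 2 * Complex r1 u * Complex r2 v * of_real (cos (t * l j))"
  have "Re ?wt = (r1^2 + r2^2 + 2 * r1 * r2 * c) + (- (u^2 + v^2 + 2 * u * v * c))"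
   by (simp add: c_def power2_eq_square algebra_simps)
  moreover have "Re (Q j t (Complex r1 u) (Complex r2 v)) = (a j)^2 / 4 * Re ?wt"
   unfolding Q_def by (simp only: Re_complex_of_real Im_complex_of_real times_complex.sel mult_zero_left diff_zero)
  ultimately show ?thesis by (simp only: distrib_left)
 qed
 ultimately show ?thesis unfolding c2 c_def[symmetric] by (simp add: field_simps)
qed

text \<open>The constant collects the cubic errors and depends on B alone, so the bound is uniform
  in the two points and in the range of primes.\<close>

lemma norm_Fp_le:
 obtains C where "C > 0" "\<And>K N x y r1 r2 u v. K \<le> N ==> norm (Complex r1 u) \<le> B ==> norm (Complex r2 v) \<le> B ==>
  norm (Fp K N x y (Complex r1 u) (Complex r2 v)) \<le>
   C * exp ((r1^2 + r2^2) / 4 * (S N - S K) + r1 * r2 / 2 * (D N (x - y) - D K (x - y))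
    - (u^2 + v^2) / 16 * ((S N - S K) - (D N (2 * (x - y)) - D K (2 * (x - y)))))"
proof -
 obtain C where C: "C \<ge> 0" "\<And>j x y z1 z2. j \<ge> 1 ==> norm z1 \<le> B ==> norm z2 \<le> B ==>
  norm (F j x y z1 z2) \<le> exp (Re (Q j (x - y) z1 z2) + C * a j ^ 3)"
  using norm_F_le[where B = B] by blast
 show ?thesis
 proof (rule that[of "exp (C * (\<Sum>j. a j ^ 3))"])
  fix K N :: nat and x y r1 r2 u v :: real
  assume K: "K \<le> N" and B: "norm (Complex r1 u) \<le> B" "norm (Complex r2 v) \<le> B"
  let ?t = "x - y"
  define e where "e = (\<lambda>j. (r1^2 + r2^2) / 4 * (a j)^2 + r1 * r2 / 2 * ((a j)^2 * cos (?t * l j))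
   - (u^2 + v^2) / 16 * ((a j)^2 - (a j)\<^sup>2 * cos (2 * ?t * l j)))"
  have "norm (Fp K N x y (Complex r1 u) (Complex r2 v)) \<le> (\<Prod>j\<in>{K<..N}. exp (e j + C * a j ^ 3))"
   unfolding Fp_def prod_norm[symmetric]
  proof (rule prod_mono, safe)
   fix j assume j: "j \<in> {K<..N}"
   have "norm (F j x y (Complex r1 u) (Complex r2 v)) \<le> exp (Re (Q j ?t (Complex r1 u) (Complex r2 v)) + C * a j ^ 3)"
    by (rule C(2)) (use j B in auto)
   also have "... \<le> exp (e j + C * a j ^ 3)" using Re_Q_le[of j ?t r1 u r2 v] by (simp add: e_def)
   finally show "norm (F j x y (Complex r1 u) (Complex r2 v)) \<le> exp (e j + C * a j ^ 3)" .
  qed auto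
  also have "... = exp ((\<Sum>j\<in>{K<..N}. e j) + C * (\<Sum>j\<in>{K<..N}. a j ^ 3))"
   by (simp add: exp_sum[symmetric] sum.distrib sum_distrib_left)
  also have "(\<Sum>j\<in>{K<..N}. e j) = (r1^2 + r2^2) / 4 * (S N - S K) + r1 * r2 / 2 * (D N ?t - D K ?t)
    - (u^2 + v^2) / 16 * ((S N - S K) - (D N (2 * ?t) - D K (2 * ?t)))"
   unfolding S_diff[OF K, symmetric] D_diff[OF K, symmetric] e_def
   by (simp only: sum.distrib sum_subtractf sum_distrib_left[symmetric])
  also have "exp (... + C * (\<Sum>j\<in>{K<..N}. a j ^ 3)) \<le> exp (... + C * (\<Sum>j. a j ^ 3))"
   using mult_left_mono[OF cube_sum_le C(1)] by simp
  finally show "norm (Fp K N x y (Complex r1 u) (Complex r2 v)) \<le>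
   exp (C * (\<Sum>j. a j ^ 3)) * exp ((r1^2 + r2^2) / 4 * (S N - S K) + r1 * r2 / 2 * (D N (x - y) - D K (x - y))
    - (u^2 + v^2) / 16 * ((S N - S K) - (D N (2 * (x - y)) - D K (2 * (x - y)))))"
   by (simp add: exp_add mult.commute)
 qed simp
qed

lemma Fp_of_real:
 "Im (Fp K N x y (of_real r1) (of_real r2)) = 0" "Re (Fp K N x y (of_real r1) (of_real r2)) \<ge> 1"
proof -
 define f where "f = (\<lambda>j. expectation (\<lambda>w. exp (a j * (r1 * cos (x * l j - T j w) + r2 * cos (y * l j - T j w)))))"
 have "Fp K N x y (of_real r1) (of_real r2) = (\<Prod>j\<in>{K<..N}. of_real (f j))"
  unfolding Fp_def f_def by (intro prod.cong refl F_of_real(1)) auto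
 hence eq: "Fp K N x y (of_real r1) (of_real r2) = of_real (\<Prod>j\<in>{K<..N}. f j)" by simp
 have "(\<Prod>j\<in>{K<..N}. f j) \<ge> 1" unfolding f_def by (intro prod_ge_1 F_of_real(2)) auto
 thus "Im (Fp K N x y (of_real r1) (of_real r2)) = 0" "Re (Fp K N x y (of_real r1) (of_real r2)) \<ge> 1" unfolding eq Im_complex_of_real Re_complex_of_real by simp_all
qed

text \<open>The exponent matches that of \<open>norm_Fp_le\<close> at frequency 0, so the ratio of
  tilted transforms is bounded up to the Gaussian decay in the frequencies.\<close>

lemma Fp_real_lower:
 assumes B: "B \<ge> 0"
 obtains c where "c > 0" "\<And>K N x y r1 r2. K \<le> N ==> 0 \<le> r1 ==> r1 \<le> B ==> 0 \<le> r2 ==> r2 \<le> B ==>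
  Re (Fp K N x y (of_real r1) (of_real r2)) \<ge>
   c * exp ((r1^2 + r2^2) / 4 * (S N - S K) + r1 * r2 / 2 * (D N (x - y) - D K (x - y)))"
proof -
 obtain C where C: "C \<ge> 0" "\<And>j x y r1 r2. j \<ge> 1 ==> 0 \<le> r1 ==> r1 \<le> B ==> 0 \<le> r2 ==> r2 \<le> B ==>
  Re (F j x y (of_real r1) (of_real r2)) \<ge> exp (Re (Q j (x - y) (of_real r1) (of_real r2)) - C * a j ^ 3)"
  using F_real_lower[OF B] by blast
 show ?thesis
 proof (rule that[of "exp (- C * (\<Sum>j. a j ^ 3))"])
  fix K N :: nat and x y r1 r2 :: real
  assume K: "K \<le> N" and r: "0 \<le> r1" "r1 \<le> B" "0 \<le> r2" "r2 \<le> B"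
  let ?t = "x - y"
  define q where "q = (\<lambda>j. Re (Q j ?t (of_real r1) (of_real r2)))"
  have "exp (- C * (\<Sum>j. a j ^ 3)) * exp (\<Sum>j\<in>{K<..N}. q j) \<le> exp (- C * (\<Sum>j\<in>{K<..N}. a j ^ 3)) * exp (\<Sum>j\<in>{K<..N}. q j)"
   using mult_left_mono[OF cube_sum_le C(1)] by (intro mult_right_mono) auto
  also have "... = (\<Prod>j\<in>{K<..N}. exp (q j - C * a j ^ 3))"
   by (simp only: exp_sum[OF finite_greaterThanAtMost, symmetric] sum_subtractf sum_distrib_left[symmetric])
     (simp add: exp_diff exp_minus divide_inverse mult.commute)
  also have "... \<le> (\<Prod>j\<in>{K<..N}. Re (F j x y (of_real r1) (of_real r2)))"
   unfolding q_def by (intro prod_mono conjI C(2)) (use r in auto)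
  also have "... = (\<Prod>j\<in>{K<..N}. expectation (\<lambda>w. exp (a j * (r1 * cos (x * l j - T j w) + r2 * cos (y * l j - T j w)))))"
   by (intro prod.cong refl) (simp add: F_of_real(1))
  also have "... = Re (of_real ...)" by (simp only: Re_complex_of_real)
  also have "complex_of_real (\<Prod>j\<in>{K<..N}. expectation (\<lambda>w. exp (a j * (r1 * cos (x * l j - T j w) + r2 * cos (y * l j - T j w))))) = Fp K N x y (of_real r1) (of_real r2)"
   unfolding Fp_def of_real_prod by (intro prod.cong refl F_of_real(1)[symmetric]) auto
  finally have "exp (- C * (\<Sum>j. a j ^ 3)) * exp (\<Sum>j\<in>{K<..N}. q j) \<le> Re (Fp K N x y (of_real r1) (of_real r2))" .
  moreover have "(\<Sum>j\<in>{K<..N}. q j) = (r1^2 + r2^2) / 4 * (S N - S K) + r1 * r2 / 2 * (D N ?t - D K ?t)"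
   unfolding S_diff[OF K, symmetric] D_diff[OF K, symmetric] q_def Q_of_real Re_complex_of_real
   by (simp add: sum.distrib[symmetric] sum_distrib_left) (intro sum.cong refl, simp add: field_simps)
  ultimately show "exp (- C * (\<Sum>j. a j ^ 3)) * exp ((r1^2 + r2^2) / 4 * (S N - S K) + r1 * r2 / 2 * (D N ?t - D K ?t)) \<le> Re (Fp K N x y (of_real r1) (of_real r2))"
   by simp
 qed simp
qed

end

section \<open>Increments of the field, and moments against the kernel\<close>

context log_field
begin

lemma X_measurable_Fs: "X K x \<in> borel_measurable (Fs K)"
proof -
 have [measurable]: "T j \<in> borel_measurable (Fs K)" if "j \<in> {1..K}" for j using that T_measurable_Fs by auto
 show ?thesis unfolding X_def by (intro borel_measurable_sum) measurable
qed

lemma X_measurable [measurable]: "X K x \<in> borel_measurable M"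
 using X_measurable_Fs by (rule measurable_Fs_M)

lemma X_diff: "K \<le> N ==> X N x w - X K x w = (\<Sum>j\<in>{K<..N}. a j * cos (x * l j - T j w))"
proof -
 assume K: "K \<le> N"
 have "{1..N} = {1..K} \<union> {K<..N}" "{1..K} \<inter> {K<..N} = {}" using K by auto
 thus ?thesis by (simp add: X_def sum.union_disjoint)
qed

lemma X_bounded: "\<bar>X N x w\<bar> \<le> real N"
proof -
 have "\<bar>X N x w\<bar> \<le> (\<Sum>j=1..N. \<bar>a j * cos (x * l j - T j w)\<bar>)" unfolding X_def by (rule sum_abs)
 also have "... \<le> (\<Sum>j=1..N. 1)"
  unfolding abs_mult using a_le_1 a_nonneg by (intro sum_mono mult_le_one) auto
 finally show ?thesis by simp
qed

text \<open>The exponential of the increment is a product of functions of the phases after K,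
  independent of \<open>Fs K\<close>.\<close>

lemma expectation_exp_increment:
 fixes f :: "'a => complex"
 assumes K: "K \<le> N" and f: "f \<in> borel_measurable (Fs K)" "integrable M f"
 shows "(CLINT w|M. f w * exp (z1 * of_real (X N x w - X K x w) + z2 * of_real (X N y w - X K y w))) = (CLINT w|M. f w) * Fp K N x y z1 z2"
  and "integrable M (\<lambda>w. f w * exp (z1 * of_real (X N x w - X K x w) + z2 * of_real (X N y w - X K y w)))"
proof -
 define g where "g = (\<lambda>j t. exp (of_real (a j) * (z1 * of_real (cos (x * l j - t)) + z2 * of_real (cos (y * l j - t)))))"
 have gm: "g j \<in> borel_measurable borel" for j unfolding g_def by measurable
 have gB: "norm (g j t) \<le> exp (norm z1 + norm z2)" for j t
 proof -
  have "norm (z1 * of_real (cos (x * l j - t)) + z2 * of_real (cos (y * l j - t))) \<le> norm z1 * 1 + norm z2 * 1"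
   by (rule order_trans[OF norm_triangle_ineq]) (auto simp: norm_mult intro!: add_mono mult_left_le)
  hence "a j * norm (z1 * of_real (cos (x * l j - t)) + z2 * of_real (cos (y * l j - t))) \<le> 1 * (norm z1 + norm z2)"
   using a_le_1[of j] a_nonneg[of j] by (intro mult_mono) auto
  moreover have "Re (of_real (a j) * (z1 * of_real (cos (x * l j - t)) + z2 * of_real (cos (y * l j - t)))) \<le> a j * norm (z1 * of_real (cos (x * l j - t)) + z2 * of_real (cos (y * l j - t)))"
   using complex_Re_le_cmod[of "of_real (a j) * (z1 * of_real (cos (x * l j - t)) + z2 * of_real (cos (y * l j - t)))"] a_nonneg[of j] by (simp only: norm_mult norm_of_real abs_of_nonneg)
  ultimately show ?thesis unfolding g_def norm_exp_eq_Re by simp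
 qed
 have eq: "exp (z1 * of_real (X N x w - X K x w) + z2 * of_real (X N y w - X K y w)) = (\<Prod>j\<in>{K<..N}. g j (T j w))" for w
  unfolding X_diff[OF K] g_def of_real_sum sum_distrib_left
  by (simp add: exp_sum[symmetric] sum.distrib[symmetric] algebra_simps)
 show "(CLINT w|M. f w * exp (z1 * of_real (X N x w - X K x w) + z2 * of_real (X N y w - X K y w))) = (CLINT w|M. f w) * Fp K N x y z1 z2"
  unfolding eq Fp_def F_def using indep_prod_T(1)[OF f gm gB] by (simp add: g_def)
 show "integrable M (\<lambda>w. f w * exp (z1 * of_real (X N x w - X K x w) + z2 * of_real (X N y w - X K y w)))"
  unfolding eq by (rule indep_prod_T(2)[OF f gm gB])
qed

text \<open>\<open>h\<close> is the Fourier transform of the complex measure with density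
  \<open>r\<close> against \<open>\<mu>\<close>, carried by [-1, 1]. A general reference measure
  covers both \<open>kern\<close>, with Lebesgue measure, and the constant 1, with a point mass at
  0.\<close>

definition kern_rep :: "real measure => (real => complex) => (real => real) => bool" where
 "kern_rep \<mu> r h \<longleftrightarrow> sigma_finite_measure \<mu> \<and> sets \<mu> = sets borel \<and> integrable \<mu> r \<and> r \<in> borel_measurable borel
   \<and> (\<forall>u. \<bar>u\<bar> > 1 \<longrightarrow> r u = 0) \<and> (\<forall>y. (CLINT u|\<mu>. r u * iexp (u * y)) = of_real (h y))
   \<and> h \<in> borel_measurable borel"

lemma kern_rep_kern: "kern_rep lborel kern_ft kern"
 unfolding kern_rep_def
proof (intro conjI allI impI)
 show "sigma_finite_measure (lborel :: real measure)" by (rule sigma_finite_lborel)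
 show "integrable lborel kern_ft" using kern_ft_integrable_bounded[of "\<lambda>_. 1" 1] by simp
 show "(CLBINT u. kern_ft u * iexp (u * y)) = of_real (kern y)" for y
  using kern_fourier by (rule has_bochner_integral_integral_eq)
qed (auto simp: kern_ft_eq_0)

lemma kern_rep_1: "kern_rep (return borel 0) (indicator {0}) (\<lambda>_. 1)"
 unfolding kern_rep_def
proof (intro conjI allI impI)
 have "prob_space (return borel (0::real))" by (rule prob_space_return) simp
 then interpret R: prob_space "return borel (0::real)" .
 show "sigma_finite_measure (return borel (0::real))" by unfold_locales
 show "integrable (return borel (0::real)) (indicator {0} :: real => complex)"
  by (rule R.integrable_const_bound[of _ 1]) (auto simp: indicator_def)
 show "(CLINT u|return borel (0::real). indicator {0} u * iexp (u * y)) = of_real 1" for y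
  by (subst integral_return) auto
qed auto

lemma integral_kern_rep:
 fixes H :: "'a => complex"
 assumes r: "kern_rep \<mu> r h" and H: "integrable M H" and [measurable]: "Y \<in> borel_measurable M"
 shows "(CLINT w|M. H w * of_real (h (Y w))) = (CLINT u|\<mu>. r u * (CLINT w|M. H w * iexp (u * Y w)))"
  and "integrable M (\<lambda>w. H w * of_real (h (Y w)))"
proof -
 interpret mu: sigma_finite_measure \<mu> using r by (simp add: kern_rep_def)
 interpret P: pair_sigma_finite M \<mu> ..
 have [measurable_cong]: "sets \<mu> = sets borel" and [measurable]: "r \<in> borel_measurable borel" "h \<in> borel_measurable borel" and ri: "integrable \<mu> r"
  and rh: "\<And>y. (CLINT u|\<mu>. r u * iexp (u * y)) = of_real (h y)" using r by (auto simp: kern_rep_def)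
 have [measurable]: "H \<in> borel_measurable M" using H by simp
 define f where "f = (\<lambda>w u. H w * (r u * iexp (u * Y w)))"
 have nf: "norm (f w u) = norm (H w) * norm (r u)" for w u by (simp add: f_def norm_mult)
 have fm: "(\<lambda>(w, u). f w u) \<in> borel_measurable (M \<Otimes>\<^sub>M \<mu>)" unfolding f_def by measurable
 have int: "integrable (M \<Otimes>\<^sub>M \<mu>) (\<lambda>(w, u). f w u)"
 proof (rule P.Fubini_integrable[OF fm])
  show "integrable M (\<lambda>w. LINT u|\<mu>. norm (case (w, u) of (w, u) => f w u))"
   using H by (simp add: nf)
  show "AE w in M. integrable \<mu> (\<lambda>u. case (w, u) of (w, u) => f w u)"
  proof (intro AE_I2)
   fix w
   have [measurable]: "f w \<in> borel_measurable \<mu>" unfolding f_def by measurable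
   have "integrable \<mu> (\<lambda>u. norm (H w) * norm (r u))" using ri by simp
   thus "integrable \<mu> (\<lambda>u. case (w, u) of (w, u) => f w u)"
    unfolding prod.case by (rule Bochner_Integration.integrable_bound) (auto simp: nf abs_mult)
  qed
 qed
 have fh: "(CLINT u|\<mu>. f w u) = H w * of_real (h (Y w))" for w
  unfolding f_def by (simp only: integral_mult_right_zero rh)
 have "(CLINT w|M. H w * of_real (h (Y w))) = (CLINT w|M. CLINT u|\<mu>. f w u)" by (simp only: fh)
 also have "... = (CLINT u|\<mu>. CLINT w|M. f w u)" by (rule P.Fubini_integral[OF int, symmetric])
 also have "... = (CLINT u|\<mu>. r u * (CLINT w|M. H w * iexp (u * Y w)))"
 proof -
  have "f w u = r u * (H w * iexp (u * Y w))" for w u by (simp add: f_def mult_ac)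
  thus ?thesis by (simp only: integral_mult_right_zero)
 qed
 finally show "(CLINT w|M. H w * of_real (h (Y w))) = (CLINT u|\<mu>. r u * (CLINT w|M. H w * iexp (u * Y w)))" .
 show "integrable M (\<lambda>w. H w * of_real (h (Y w)))"
  using P.integrable_fst'[OF int] by (simp only: prod.case fh)
qed

text \<open>Both functions are written as Fourier integrals, so only the joint transform at
  frequencies in [-1, 1] enters. Its Gaussian bound factorises over the two variables.\<close>

lemma two_frequency_le:
 fixes e X1 X2 :: "'a => real"
 assumes e: "integrable M e" and [measurable]: "X1 \<in> borel_measurable M" "X2 \<in> borel_measurable M"
  and Psi0: "\<And>u v. \<bar>u\<bar> \<le> 1 ==> \<bar>v\<bar> \<le> 1 ==>
   norm (CLINT w|M. of_real (e w) * iexp (u * X1 w) * iexp (v * X2 w)) \<le> B * exp (- \<kappa> * (u^2 + v^2))"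
  and rep1: "kern_rep \<mu>1 \<rho>1 h1" and rep2: "kern_rep \<mu>2 \<rho>2 h2" and kap: "\<kappa> \<ge> 0" and B0: "B \<ge> 0"
 shows "\<bar>expectation (\<lambda>w. e w * h1 (X1 w) * h2 (X2 w))\<bar>
  \<le> B * ((LINT u|\<mu>1. norm (\<rho>1 u) * exp (- \<kappa> * u^2)) * (LINT v|\<mu>2. norm (\<rho>2 v) * exp (- \<kappa> * v^2)))"
proof -
 have em [measurable]: "e \<in> borel_measurable M" using e by (rule borel_measurable_integrable)
 have ei: "integrable M (\<lambda>w. complex_of_real (e w))" using e by (rule integrable_of_real)
 have m1: "sets \<mu>1 = sets borel" "integrable \<mu>1 \<rho>1" "\<And>u. \<bar>u\<bar> > 1 ==> \<rho>1 u = 0" and m2: "sets \<mu>2 = sets borel" "integrable \<mu>2 \<rho>2" "\<And>u. \<bar>u\<bar> > 1 ==> \<rho>2 u = 0"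
  and [measurable]: "\<rho>1 \<in> borel_measurable borel" "\<rho>2 \<in> borel_measurable borel"
  using rep1 rep2 by (auto simp: kern_rep_def)
 note [measurable_cong] = m1(1) m2(1)
 define \<Psi> where "\<Psi> = (\<lambda>u v. CLINT w|M. of_real (e w) * iexp (u * X1 w) * iexp (v * X2 w))"
 have int_u: "integrable M (\<lambda>w. of_real (e w) * iexp (u * X1 w))" for u
  by (rule Bochner_Integration.integrable_bound[OF ei]) (auto simp: norm_mult)
 have inth: "integrable M (\<lambda>w. complex_of_real (e w) * of_real (h2 (X2 w)))" by (rule integral_kern_rep(2)[OF rep2 ei]) measurable
 have inner: "(CLINT w|M. of_real (e w) * of_real (h2 (X2 w)) * iexp (u * X1 w)) = (CLINT v|\<mu>2. \<rho>2 v * \<Psi> u v)" for u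
 proof -
  have "(CLINT w|M. of_real (e w) * of_real (h2 (X2 w)) * iexp (u * X1 w)) = (CLINT w|M. (of_real (e w) * iexp (u * X1 w)) * of_real (h2 (X2 w)))"
   by (simp add: mult_ac)
  also have "... = (CLINT v|\<mu>2. \<rho>2 v * \<Psi> u v)"
   unfolding \<Psi>_def by (rule integral_kern_rep(1)[OF rep2 int_u]) measurable
  finally show ?thesis .
 qed
 have "(CLINT w|M. of_real (e w) * of_real (h2 (X2 w)) * of_real (h1 (X1 w))) = (CLINT u|\<mu>1. \<rho>1 u * (CLINT w|M. of_real (e w) * of_real (h2 (X2 w)) * iexp (u * X1 w)))"
  by (rule integral_kern_rep(1)[OF rep1 inth]) measurable
 also have "... = (CLINT u|\<mu>1. \<rho>1 u * (CLINT v|\<mu>2. \<rho>2 v * \<Psi> u v))" by (simp only: inner)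
 finally have eq: "(CLINT w|M. of_real (e w) * of_real (h2 (X2 w)) * of_real (h1 (X1 w))) = (CLINT u|\<mu>1. \<rho>1 u * (CLINT v|\<mu>2. \<rho>2 v * \<Psi> u v))" .
 have Psi: "norm (\<Psi> u v) \<le> B * exp (- \<kappa> * u^2) * exp (- \<kappa> * v^2)" if "\<bar>u\<bar> \<le> 1" "\<bar>v\<bar> \<le> 1" for u v
 proof -
  have "exp (- \<kappa> * (u^2 + v^2)) = exp (- \<kappa> * u^2) * exp (- \<kappa> * v^2)" by (simp add: distrib_left flip: exp_add)
  with Psi0[OF that] show ?thesis by (simp add: \<Psi>_def mult_ac)
 qed
 have b2: "integrable \<mu>2 (\<lambda>v. norm (\<rho>2 v) * exp (- \<kappa> * v^2))"
  by (rule Bochner_Integration.integrable_bound[OF m2(2)]) (use kap in \<open>auto simp: abs_mult intro!: mult_left_le\<close>)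
 have b1: "integrable \<mu>1 (\<lambda>v. norm (\<rho>1 v) * exp (- \<kappa> * v^2))"
  by (rule Bochner_Integration.integrable_bound[OF m1(2)]) (use kap in \<open>auto simp: abs_mult intro!: mult_left_le\<close>)
 define J2 where "J2 = (LINT v|\<mu>2. norm (\<rho>2 v) * exp (- \<kappa> * v^2))"
 have J2: "J2 \<ge> 0" unfolding J2_def by (intro integral_nonneg_AE) auto
 \<comment> \<open>The integral of a non-integrable function is 0 by convention, so pointwise
   domination alone gives the bound.\<close>
 have norm_integral_le: "norm (LINT wt|\<mu>. k wt) \<le> (LINT wt|\<mu>. b wt)"
  if "integrable \<mu> b" "\<And>wt. norm (k wt) \<le> b wt" for \<mu> :: "real measure" and k :: "real => complex" and b
 proof (cases "integrable \<mu> k")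
  case True
  show ?thesis by (rule order_trans[OF integral_norm_bound integral_mono]) (use True that in auto)
 next
  case False
  have "0 \<le> b wt" for wt using that(2)[of wt] norm_ge_zero order_trans by blast
  hence "0 \<le> (LINT wt|\<mu>. b wt)" by (intro integral_nonneg_AE) auto
  thus ?thesis using False by (simp add: not_integrable_integral_eq)
 qed
 have in2: "norm (CLINT v|\<mu>2. \<rho>2 v * \<Psi> u v) \<le> B * exp (- \<kappa> * u^2) * J2" if u: "\<bar>u\<bar> \<le> 1" for u
 proof -
  have "norm (CLINT v|\<mu>2. \<rho>2 v * \<Psi> u v) \<le> (LINT v|\<mu>2. (B * exp (- \<kappa> * u^2)) * (norm (\<rho>2 v) * exp (- \<kappa> * v^2)))"
  proof (rule norm_integral_le)
   show "integrable \<mu>2 (\<lambda>v. (B * exp (- \<kappa> * u^2)) * (norm (\<rho>2 v) * exp (- \<kappa> * v^2)))" using b2 by (rule integrable_mult_right)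
   fix v
   show "norm (\<rho>2 v * \<Psi> u v) \<le> (B * exp (- \<kappa> * u^2)) * (norm (\<rho>2 v) * exp (- \<kappa> * v^2))"
   proof (cases "\<bar>v\<bar> \<le> 1")
    case True
    have "norm (\<rho>2 v) * norm (\<Psi> u v) \<le> norm (\<rho>2 v) * (B * exp (- \<kappa> * u^2) * exp (- \<kappa> * v^2))"
     by (intro mult_left_mono Psi u True) auto
    thus ?thesis by (simp add: norm_mult mult_ac)
   qed (use m2(3)[of v] in simp)
  qed
  also have "... = B * exp (- \<kappa> * u^2) * J2" unfolding J2_def by (rule integral_mult_right_zero)
  finally show ?thesis .
 qed
 have "norm (CLINT u|\<mu>1. \<rho>1 u * (CLINT v|\<mu>2. \<rho>2 v * \<Psi> u v)) \<le> (LINT u|\<mu>1. (B * J2) * (norm (\<rho>1 u) * exp (- \<kappa> * u^2)))"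
 proof (rule norm_integral_le)
  show "integrable \<mu>1 (\<lambda>u. (B * J2) * (norm (\<rho>1 u) * exp (- \<kappa> * u^2)))" using b1 by (rule integrable_mult_right)
  fix u
  show "norm (\<rho>1 u * (CLINT v|\<mu>2. \<rho>2 v * \<Psi> u v)) \<le> (B * J2) * (norm (\<rho>1 u) * exp (- \<kappa> * u^2))"
  proof (cases "\<bar>u\<bar> \<le> 1")
   case True
   have "norm (\<rho>1 u) * norm (CLINT v|\<mu>2. \<rho>2 v * \<Psi> u v) \<le> norm (\<rho>1 u) * (B * exp (- \<kappa> * u^2) * J2)"
    by (intro mult_left_mono in2 True) auto
   thus ?thesis by (simp add: norm_mult mult_ac)
  qed (use m1(3)[of u] in simp)
 qed
 also have "... = (B * J2) * (LINT u|\<mu>1. norm (\<rho>1 u) * exp (- \<kappa> * u^2))" by (rule integral_mult_right_zero)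
 finally have fin: "norm (CLINT w|M. of_real (e w) * of_real (h2 (X2 w)) * of_real (h1 (X1 w))) \<le> (B * J2) * (LINT u|\<mu>1. norm (\<rho>1 u) * exp (- \<kappa> * u^2))"
  by (simp only: eq)
 have "(CLINT w|M. of_real (e w) * of_real (h2 (X2 w)) * of_real (h1 (X1 w))) = of_real (expectation (\<lambda>w. e w * h1 (X1 w) * h2 (X2 w)))"
  unfolding integral_complex_of_real[symmetric] by (simp add: mult_ac)
 with fin have "\<bar>expectation (\<lambda>w. e w * h1 (X1 w) * h2 (X2 w))\<bar> \<le> (B * J2) * (LINT u|\<mu>1. norm (\<rho>1 u) * exp (- \<kappa> * u^2))"
  by (simp only: norm_of_real)
 thus ?thesis by (simp add: J2_def mult_ac)
qed

end

lemma integral_gauss_scaled: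
 assumes "\<kappa> > 0"
 shows "(LBINT u::real. exp (- \<kappa> * u^2)) = sqrt (pi / \<kappa>)"
proof -
 define s where "s = sqrt (2 * \<kappa>)"
 have s: "s > 0" "s^2 = 2 * \<kappa>" using assms by (auto simp: s_def)
 have "s *\<^sub>R (LBINT u. exp (- \<kappa> * u^2)) = (LBINT u. exp (- \<kappa> * (u / s)^2))" by (rule integral_scale[OF s(1)])
 also have "... = (LBINT u. exp (- (u^2 / 2)))" using s assms by (simp add: power_divide)
 also have "... = sqrt (2 * pi)" by (rule integral_gauss_half)
 finally have "(LBINT u. exp (- \<kappa> * u^2)) = sqrt (2 * pi) / s" using s by (simp add: field_simps)
 also have "... = sqrt (pi / \<kappa>)" by (simp add: s_def real_sqrt_divide[symmetric])
 finally show ?thesis .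
qed

definition kern_mass :: "real => real" where
 "kern_mass \<kappa> = (LBINT u. norm (kern_ft u) * exp (- \<kappa> * u^2))"

text \<open>The bound 2 is the length of the support and serves small \<kappa>; the full Gaussian
  integral serves large \<kappa>.\<close>

lemma kern_mass_bounds:
 assumes "\<kappa> \<ge> 0"
 shows "0 \<le> kern_mass \<kappa>" "kern_mass \<kappa> \<le> 2" "\<kappa> > 0 ==> kern_mass \<kappa> \<le> sqrt (pi / \<kappa>)"
proof -
 show "0 \<le> kern_mass \<kappa>" unfolding kern_mass_def by (intro integral_nonneg_AE) auto
 have kin: "integrable lborel (\<lambda>u. norm (kern_ft u))"
  using kern_ft_integrable_bounded[of "\<lambda>_. 1" 1] by (intro integrable_norm) simp
 have int: "integrable lborel (\<lambda>u. norm (kern_ft u) * exp (- \<kappa> * u^2))"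
  by (rule Bochner_Integration.integrable_bound[OF kin]) (use assms in \<open>auto simp: abs_mult intro!: mult_left_le\<close>)
 have "kern_mass \<kappa> \<le> (LBINT u. indicator {-1..1::real} u)"
  unfolding kern_mass_def
 proof (rule integral_mono[OF int])
  show "integrable lborel (indicator {-1..1::real} :: real => real)" by (rule integrable_real_indicator) auto
  fix u :: real
  have "norm (kern_ft u) * exp (- \<kappa> * u^2) \<le> 1 * 1" using norm_kern_ft_le assms by (intro mult_mono) auto
  thus "norm (kern_ft u) * exp (- \<kappa> * u^2) \<le> indicator {-1..1} u"
   using kern_ft_eq_0[of u] by (auto simp: indicator_def)
 qed
 thus "kern_mass \<kappa> \<le> 2" by simp
 assume k: "\<kappa> > 0"
 have "kern_mass \<kappa> \<le> (LBINT u. exp (- \<kappa> * u^2))"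
  unfolding kern_mass_def
 proof (rule integral_mono[OF int integrable_gauss[OF k]])
  show "norm (kern_ft u) * exp (- \<kappa> * u^2) \<le> exp (- \<kappa> * u^2)" for u
   using mult_right_mono[OF norm_kern_ft_le[of u], of "exp (- \<kappa> * u^2)"] by simp
 qed
 thus "kern_mass \<kappa> \<le> sqrt (pi / \<kappa>)" by (simp only: integral_gauss_scaled[OF k])
qed

context log_field
begin

definition sd :: "nat => real" where "sd N = sqrt (S N / 2)"
definition lev :: "nat => real" where "lev N = \<alpha> / 2 * ln (ln (real N))"
text \<open>Up to a constant this dominates the level-set factor \<open>gtail y / gam N\<close> plus
  1, because \<open>gam N\<close> is of order 1 / \<open>sd N\<close> and \<open>gtail\<close> is at
  most a multiple of \<open>kern\<close>.\<close>

definition bnd :: "nat => real => real" where "bnd N y = 1 + sd N * kern y"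

lemma sd_nonneg: "sd N \<ge> 0" by (simp add: sd_def S_nonneg)

lemma sd_sq: "(sd N)^2 = S N / 2" by (simp add: sd_def S_nonneg)

lemma bnd_ge_1: "bnd N y \<ge> 1" using kern_pos[of y] sd_nonneg[of N] by (simp add: bnd_def less_imp_le)

lemma bnd_le: "bnd N y \<le> 1 + sd N"
 using kern_le[of y] sd_nonneg[of N] mult_left_mono[of "kern y" 1 "sd N"] by (simp add: bnd_def)

lemma bnd_measurable [measurable]: "bnd N \<in> borel_measurable borel" unfolding bnd_def by measurable

lemma norm_Complex_le: "norm (Complex r u) \<le> \<bar>r\<bar> + \<bar>u\<bar>"
 using cmod_le[of "Complex r u"] by simp

text \<open>With \<xi> = \<open>S N - S K\<close>, the Gaussian integral has square at most 16 pi /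
  \<xi>. It compensates (sd N)^2 = (S K + \<xi>) / 2 up to a factor 1 + \<open>S K\<close>; for
  \<xi> <= 1 the support bound 2 is used. As 8 pi <= 30, the constant is 2 + 2 * 30.\<close>

lemma kern_mass_scale:
 assumes "K \<le> N"
 shows "(1 + sd N * kern_mass ((S N - S K) / 16))^2 \<le> 62 * (1 + S K)"
proof -
 define \<xi> where "\<xi> = S N - S K"
 define J where "J = kern_mass (\<xi> / 16)"
 have sg: "\<xi> \<ge> 0" using S_mono[OF assms] by (simp add: \<xi>_def)
 have J: "0 \<le> J" "J \<le> 2" using kern_mass_bounds[of "\<xi> / 16"] sg by (auto simp: J_def)
 have SK: "S K \<ge> 0" by (rule S_nonneg)
 have "(sd N * J)^2 \<le> 30 * (1 + S K)"
 proof (cases "\<xi> \<le> 1")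
  case True
  have "(sd N * J)^2 = (S K + \<xi>) / 2 * J^2" by (simp add: power_mult_distrib sd_sq \<xi>_def)
  also have "... \<le> (S K + 1) / 2 * 2^2" using J True SK sg by (intro mult_mono power_mono) auto
  also have "... \<le> 30 * (1 + S K)" using SK by simp
  finally show ?thesis .
 next
  case False
  hence "J \<le> sqrt (pi / (\<xi> / 16))" using kern_mass_bounds(3)[of "\<xi> / 16"] by (simp add: J_def)
  hence "J^2 \<le> (sqrt (pi / (\<xi> / 16)))^2" using J by (intro power_mono) auto
  hence J2: "J^2 \<le> 16 * pi / \<xi>" using False by (simp add: mult.commute)
  have "(sd N * J)^2 = (S K + \<xi>) / 2 * J^2" by (simp add: power_mult_distrib sd_sq \<xi>_def)
  also have "... \<le> (S K + \<xi>) / 2 * (16 * pi / \<xi>)" using J2 SK sg by (intro mult_left_mono) auto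
  also have "... = 8 * pi * (S K / \<xi> + 1)" using False by (simp add: field_simps)
  also have "... \<le> 8 * pi * (S K + 1)"
  proof (intro mult_left_mono add_mono)
   have "S K / \<xi> \<le> S K / 1" using False SK by (intro divide_left_mono) auto
   thus "S K / \<xi> \<le> S K" by simp
  qed auto
  also have "... \<le> 30 * (S K + 1)"
  proof (intro mult_right_mono)
   show "8 * pi \<le> 30" using pi_approx by simp
  qed (use SK in simp)
  finally show ?thesis by (simp add: add.commute)
 qed
 moreover have "(1 + sd N * J)^2 \<le> 2 + 2 * (sd N * J)^2"
 proof -
  have "0 \<le> (1 - sd N * J)^2" by simp
  thus ?thesis by (simp add: power2_sum power2_diff)
 qed
 ultimately show ?thesis using SK by (simp add: J_def \<xi>_def)
qed

text \<open>Expanding the two factors 1 + sd * kern gives four terms, each bounded by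
  \<open>two_frequency_le\<close>. They recombine into the square of
  \<open>kern_mass_scale\<close>.\<close>

lemma bnd_moment_le:
 fixes e X1 X2 :: "'a => real"
 assumes e: "integrable M e" and [measurable]: "X1 \<in> borel_measurable M" "X2 \<in> borel_measurable M"
  and Psi: "\<And>u v. \<bar>u\<bar> \<le> 1 ==> \<bar>v\<bar> \<le> 1 ==>
   norm (CLINT w|M. of_real (e w) * iexp (u * X1 w) * iexp (v * X2 w)) \<le> B * exp (- ((S N - S K) / 16) * (u^2 + v^2))"
  and K: "K \<le> N" and B: "B \<ge> 0"
 shows "expectation (\<lambda>w. e w * bnd N (X1 w) * bnd N (X2 w)) \<le> B * (62 * (1 + S K))"
proof -
 define \<kappa> where "\<kappa> = (S N - S K) / 16"
 have kap: "\<kappa> \<ge> 0" using S_mono[OF K] by (simp add: \<kappa>_def)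
 define J where "J = kern_mass \<kappa>"
 have [measurable]: "e \<in> borel_measurable M" using e by (rule borel_measurable_integrable)
 have ei: "integrable M (\<lambda>w. e w * h1 w * h2 w)"
  if [measurable]: "h1 \<in> borel_measurable M" "h2 \<in> borel_measurable M" and h: "\<And>w. 0 \<le> h1 w \<and> h1 w \<le> 1" "\<And>w. 0 \<le> h2 w \<and> h2 w \<le> 1" for h1 h2
 proof (rule Bochner_Integration.integrable_bound[OF e])
  have "norm (e w * h1 w * h2 w) \<le> norm (e w)" for w
  proof -
   have "\<bar>e w\<bar> * \<bar>h1 w\<bar> * \<bar>h2 w\<bar> \<le> \<bar>e w\<bar> * 1 * 1" using h[of w] by (intro mult_mono) auto
   thus ?thesis by (simp add: abs_mult)
  qed
  thus "AE w in M. norm (e w * h1 w * h2 w) \<le> norm (e w)" by simp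
 qed measurable
 note kr = kern_rep_kern and k1 = kern_rep_1
 have I1: "(LINT u|return borel (0::real). norm (indicator {0} u :: complex) * exp (- \<kappa> * u^2)) = 1"
  by (subst integral_return) auto
 have kk: "0 \<le> kern z \<and> kern z \<le> 1" for z using kern_pos[of z] kern_le[of z] by simp
 have NT: "\<bar>expectation (\<lambda>w. e w * h1 (X1 w) * h2 (X2 w))\<bar> \<le> B * ((LINT u|\<mu>1. norm (\<rho>1 u) * exp (- \<kappa> * u^2)) * (LINT v|\<mu>2. norm (\<rho>2 v) * exp (- \<kappa> * v^2)))"
  if h: "kern_rep \<mu>1 \<rho>1 h1" "kern_rep \<mu>2 \<rho>2 h2" for \<mu>1 \<rho>1 h1 \<mu>2 \<rho>2 h2
  by (rule two_frequency_le[OF e assms(2,3) _ h kap B]) (unfold \<kappa>_def, rule Psi)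
 have t11: "expectation (\<lambda>w. e w * 1 * 1) \<le> B * (1 * 1)"
  using NT[OF k1 k1] unfolding I1 by linarith
 have tk1: "expectation (\<lambda>w. e w * kern (X1 w) * 1) \<le> B * (J * 1)"
  using NT[OF kr k1] unfolding I1 J_def kern_mass_def by linarith
 have t1k: "expectation (\<lambda>w. e w * 1 * kern (X2 w)) \<le> B * (1 * J)"
  using NT[OF k1 kr] unfolding I1 J_def kern_mass_def by linarith
 have tkk: "expectation (\<lambda>w. e w * kern (X1 w) * kern (X2 w)) \<le> B * (J * J)"
  using NT[OF kr kr] unfolding J_def kern_mass_def by linarith
 have i11: "integrable M (\<lambda>w. e w * 1 * 1)" by (rule ei) auto
 have ik1: "integrable M (\<lambda>w. e w * kern (X1 w) * 1)" by (rule ei) (use kk in auto)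
 have i1k: "integrable M (\<lambda>w. e w * 1 * kern (X2 w))" by (rule ei) (use kk in auto)
 have ikk: "integrable M (\<lambda>w. e w * kern (X1 w) * kern (X2 w))" by (rule ei) (use kk in auto)
 have "expectation (\<lambda>w. e w * bnd N (X1 w) * bnd N (X2 w)) =
  expectation (\<lambda>w. e w * 1 * 1 + sd N * (e w * kern (X1 w) * 1) + sd N * (e w * 1 * kern (X2 w)) + (sd N)^2 * (e w * kern (X1 w) * kern (X2 w)))"
  by (intro Bochner_Integration.integral_cong refl) (simp add: bnd_def power2_eq_square algebra_simps)
 also have "... = expectation (\<lambda>w. e w * 1 * 1) + sd N * expectation (\<lambda>w. e w * kern (X1 w) * 1) + sd N * expectation (\<lambda>w. e w * 1 * kern (X2 w)) + (sd N)^2 * expectation (\<lambda>w. e w * kern (X1 w) * kern (X2 w))"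
  using i11 ik1 i1k ikk by (simp only: Bochner_Integration.integral_add Bochner_Integration.integrable_add integrable_mult_right integral_mult_right_zero)
 also have "... \<le> B * (1 * 1) + sd N * (B * (J * 1)) + sd N * (B * (1 * J)) + (sd N)^2 * (B * (J * J))"
  using t11 tk1 t1k tkk sd_nonneg[of N] by (intro add_mono mult_left_mono) auto
 also have "... = B * (1 + sd N * J)^2" by (simp add: power2_eq_square algebra_simps)
 also have "... \<le> B * (62 * (1 + S K))"
  unfolding J_def \<kappa>_def by (intro mult_left_mono kern_mass_scale K B)
 finally show ?thesis .
qed

lemma X_0 [simp]: "X 0 x w = 0" by (simp add: X_def)
lemma S_0 [simp]: "S 0 = 0" by (simp add: S_def)
lemma D_0 [simp]: "D 0 t = 0" by (simp add: D_def)

text \<open>Two indices play different parts. At K the exponent at x changes from p to \<alpha>,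
  which encodes conditions on the field at that scale. Up to K' no decay in the frequencies is
  claimed: the hypothesis lets \<open>D N (2 * (x - y))\<close> be as large as
  \<open>S K' + C1\<close>, and the price is the factor 1 + \<open>S K'\<close>.\<close>

lemma exp_moment_le:
 assumes r2: "0 \<le> r2" "r2 \<le> \<alpha>" and B: "B \<ge> 0"
 obtains C where "C > 0" "\<And>K K' N x y p L. K \<le> N ==> K' \<le> N ==> \<bar>p\<bar> \<le> B ==> D N (2 * (x - y)) \<le> S K' + C1 ==>
   expectation (\<lambda>w. exp (p * X K x w + \<alpha> * (X N x w - X K x w) + r2 * X N y w) * bnd N (X N x w - L) * bnd N (X N y w - L))
    \<le> C * (1 + S K') * exp ((p^2 + r2^2) / 4 * S K + p * r2 / 2 * D K (x - y)
      + (\<alpha>^2 + r2^2) / 4 * (S N - S K) + \<alpha> * r2 / 2 * (D N (x - y) - D K (x - y)))"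
proof -
 obtain C where C: "C > 0" and Cb: "\<And>K N x y r1 r2 u v. K \<le> N ==> norm (Complex r1 u) \<le> \<alpha> + B + 1 ==> norm (Complex r2 v) \<le> \<alpha> + B + 1 ==>
  norm (Fp K N x y (Complex r1 u) (Complex r2 v)) \<le>
   C * exp ((r1^2 + r2^2) / 4 * (S N - S K) + r1 * r2 / 2 * (D N (x - y) - D K (x - y))
    - (u^2 + v^2) / 16 * ((S N - S K) - (D N (2 * (x - y)) - D K (2 * (x - y)))))"
  using norm_Fp_le[where B = "\<alpha> + B + 1"] by blast
 define C2 where "C2 = exp (\<bar>C1\<bar> / 8)"
 show ?thesis
 proof (rule that[of "C * C * C2 * 62"])
  show "C * C * C2 * 62 > 0" using C by (simp add: C2_def)
  fix K K' N :: nat and x y p L :: real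
  assume K: "K \<le> N" and K': "K' \<le> N" and p: "\<bar>p\<bar> \<le> B" and D: "D N (2 * (x - y)) \<le> S K' + C1"
  define E1 where "E1 = (p^2 + r2^2) / 4 * S K + p * r2 / 2 * D K (x - y)"
  define E2 where "E2 = (\<alpha>^2 + r2^2) / 4 * (S N - S K) + \<alpha> * r2 / 2 * (D N (x - y) - D K (x - y))"
  define e where "e = (\<lambda>w. exp (p * X K x w + \<alpha> * (X N x w - X K x w) + r2 * X N y w))"
  define Q where "Q = (\<lambda>z1 z2 w. exp (z1 * complex_of_real (X K x w) + z2 * complex_of_real (X K y w)))"
  have Qm: "Q z1 z2 \<in> borel_measurable (Fs K)" for z1 z2
  proof -
   note [measurable] = X_measurable_Fs
   show ?thesis unfolding Q_def by measurable
  qed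
  have one: "(\<lambda>_. 1 :: complex) \<in> borel_measurable (Fs 0)" "integrable M (\<lambda>_. 1 :: complex)" by simp_all
  have Qi: "integrable M (Q z1 z2)" for z1 z2
   using expectation_exp_increment(2)[OF le0 one, of z1 K x z2 y] by (simp only: Q_def X_0 diff_zero mult_1_left)
  have QE: "(CLINT w|M. Q z1 z2 w) = Fp 0 K x y z1 z2" for z1 z2
   using expectation_exp_increment(1)[OF le0 one, of z1 K x z2 y] by (simp add: Q_def prob_space)
  \<comment> \<open>The level L enters only through a factor of modulus 1, so the bound is uniform
    in L.\<close>
  have conv: "complex_of_real (e w) * iexp (u * (X N x w - L)) * iexp (v * (X N y w - L))
   = iexp (- (u + v) * L) * (Q (Complex p u) (Complex r2 v) w * exp (Complex \<alpha> u * of_real (X N x w - X K x w) + Complex r2 v * of_real (X N y w - X K y w)))" for u v w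
   unfolding e_def Q_def exp_of_real[symmetric] exp_add[symmetric] Complex_eq by (rule arg_cong[where f = exp]) (simp add: algebra_simps)
  have char: "(CLINT w|M. complex_of_real (e w) * iexp (u * (X N x w - L)) * iexp (v * (X N y w - L)))
   = iexp (- (u + v) * L) * (Fp 0 K x y (Complex p u) (Complex r2 v) * Fp K N x y (Complex \<alpha> u) (Complex r2 v))" for u v
   unfolding conv integral_mult_right_zero expectation_exp_increment(1)[OF K Qm Qi] QE ..
  have ei: "integrable M e"
  proof -
   have "integrable M (\<lambda>w. complex_of_real (e w) * iexp (0 * (X N x w - L)) * iexp (0 * (X N y w - L)))"
    unfolding conv by (intro integrable_mult_right expectation_exp_increment(2)[OF K Qm Qi])
   hence "integrable M (\<lambda>w. complex_of_real (e w))" by simp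
   from integrable_Re[OF this] show ?thesis by simp
  qed
  have "expectation (\<lambda>w. e w * bnd N (X N x w - L) * bnd N (X N y w - L)) \<le> (C * C * C2 * exp (E1 + E2)) * (62 * (1 + S K'))"
  proof (rule bnd_moment_le[OF ei _ _ _ K'])
   fix u v :: real assume uv: "\<bar>u\<bar> \<le> 1" "\<bar>v\<bar> \<le> 1"
   have nB: "norm (Complex p u) \<le> \<alpha> + B + 1" "norm (Complex \<alpha> u) \<le> \<alpha> + B + 1" "norm (Complex r2 v) \<le> \<alpha> + B + 1"
    using norm_Complex_le[of p u] norm_Complex_le[of \<alpha> u] norm_Complex_le[of r2 v] uv p r2 alpha B by auto
   let ?q = "(u^2 + v^2) / 16"
   let ?d = "D N (2 * (x - y))" and ?dK = "D K (2 * (x - y))"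
   have n1: "norm (Fp 0 K x y (Complex p u) (Complex r2 v)) \<le> C * exp (E1 - ?q * (S K - ?dK))"
    using Cb[of 0 K "p" u r2 v x y] nB by (simp add: E1_def)
   have n2: "norm (Fp K N x y (Complex \<alpha> u) (Complex r2 v)) \<le> C * exp (E2 - ?q * ((S N - S K) - (?d - ?dK)))"
    using Cb[OF K nB(2,3), of x y] by (simp add: E2_def)
   have "norm (CLINT w|M. complex_of_real (e w) * iexp (u * (X N x w - L)) * iexp (v * (X N y w - L)))
    = norm (Fp 0 K x y (Complex p u) (Complex r2 v)) * norm (Fp K N x y (Complex \<alpha> u) (Complex r2 v))"
    unfolding char norm_mult norm_exp_i_times by simp
   also have "... \<le> (C * exp (E1 - ?q * (S K - ?dK))) * (C * exp (E2 - ?q * ((S N - S K) - (?d - ?dK))))"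
    using n1 n2 C by (intro mult_mono) auto
   also have "... = C * C * exp (E1 + E2 + - ((S N - S K') / 16) * (u^2 + v^2) + ?q * (?d - S K'))"
   proof -
    have id: "(E1 - q / 16 * (s - dk)) + (E2 - q / 16 * ((n - s) - (d - dk))) = E1 + E2 + - ((n - k) / 16) * q + q / 16 * (d - k)"
     for q s dk n d k :: real by (simp add: field_simps)
    have "(C * exp P) * (C * exp R) = C * C * exp (P + R)" for P R by (simp add: exp_add)
    thus ?thesis unfolding id[of "u^2 + v^2" "S K" ?dK "S N" ?d "S K'", symmetric] by (simp only:)
   qed
   \<comment> \<open>For frequencies in [-1, 1] the quantity (u^2 + v^2) / 16 is at most 1/8, which
     is where \<open>C2\<close> comes from.\<close>
   also have "... \<le> C * C * exp (E1 + E2 + - ((S N - S K') / 16) * (u^2 + v^2) + \<bar>C1\<bar> / 8)"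
   proof -
    have "u^2 + v^2 \<le> 2" using uv by (simp add: abs_square_le_1[symmetric])
    have "?q * (?d - S K') \<le> ?q * \<bar>C1\<bar>" using D by (intro mult_left_mono) auto
    also have "... \<le> 2 / 16 * \<bar>C1\<bar>" using \<open>u^2 + v^2 \<le> 2\<close> by (intro mult_right_mono) auto
    finally have "?q * (?d - S K') \<le> \<bar>C1\<bar> / 8" by simp
    thus ?thesis using C by (intro mult_left_mono) auto
   qed
   also have "... = (C * C * C2 * exp (E1 + E2)) * exp (- ((S N - S K') / 16) * (u^2 + v^2))"
    unfolding C2_def exp_add by (simp only: mult_ac)
   finally show "norm (CLINT w|M. complex_of_real (e w) * iexp (u * (X N x w - L)) * iexp (v * (X N y w - L)))
    \<le> (C * C * C2 * exp (E1 + E2)) * exp (- ((S N - S K') / 16) * (u^2 + v^2))" .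
  qed (use C in \<open>auto simp: C2_def\<close>)
  thus "expectation (\<lambda>w. exp (p * X K x w + \<alpha> * (X N x w - X K x w) + r2 * X N y w) * bnd N (X N x w - L) * bnd N (X N y w - L))
    \<le> C * C * C2 * 62 * (1 + S K') * exp ((p^2 + r2^2) / 4 * S K + p * r2 / 2 * D K (x - y)
      + (\<alpha>^2 + r2^2) / 4 * (S N - S K) + \<alpha> * r2 / 2 * (D N (x - y) - D K (x - y)))"
   unfolding e_def E1_def E2_def by (simp only: mult_ac add.assoc)
 qed
qed

lemma F_rotate: "j \<ge> 1 ==> F j x y z 0 = F j 0 0 z 0"
proof -
 assume j: "j \<ge> 1"
 have "F j x y z 0 = (CLINT w|M. exp ((of_real (a j) * z) * of_real (cos (T j w))))" for x y
  unfolding F_def using expectation_exp_cos_rotate[OF j, of "of_real (a j) * z" "x * l j"] by (simp add: mult.assoc)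
 thus ?thesis by simp
qed

lemma Fp_rotate: "Fp K N x y z 0 = Fp K N 0 0 z 0"
 unfolding Fp_def by (intro prod.cong refl F_rotate) auto

text \<open>By \<open>F_rotate\<close> this is the mean of exp(\<alpha> * X N x) at every point x,
  not only at 0.\<close>

definition phi :: "nat => real" where "phi N = Re (Fp 0 N 0 0 (of_real \<alpha>) 0)"

lemma phi_ge_1: "phi N \<ge> 1" unfolding phi_def using Fp_of_real(2)[of 0 N 0 0 \<alpha> 0] by simp


lemma expectation_exp_two:
 "expectation (\<lambda>w. exp (r1 * X N x w + r2 * X N y w)) = Re (Fp 0 N x y (of_real r1) (of_real r2))"
proof -
 have "(CLINT w|M. 1 * exp (of_real r1 * of_real (X N x w - X 0 x w) + of_real r2 * of_real (X N y w - X 0 y w))) = (CLINT w|M. 1) * Fp 0 N x y (of_real r1) (of_real r2)"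
  by (rule expectation_exp_increment(1)) auto
 hence "(CLINT w|M. of_real (exp (r1 * X N x w + r2 * X N y w))) = Fp 0 N x y (of_real r1) (of_real r2)"
  by (simp add: prob_space exp_of_real[symmetric])
 thus ?thesis by (metis integral_complex_of_real Re_complex_of_real)
qed

lemma expectation_exp_one: "expectation (\<lambda>w. exp (\<alpha> * X N x w)) = phi N"
 using expectation_exp_two[of \<alpha> N x 0 0] by (simp add: phi_def Fp_rotate[of 0 N x])

text \<open>Rotating each phase shows that the characteristic function does not depend on the
  point.\<close>

lemma distr_X: "distr M borel (X N x) = distr M borel (X N y)"
proof -
 have rd: "real_distribution (distr M borel (X N x))" for x by (rule real_distribution_distr) simp
 have "char (distr M borel (X N x)) t = Fp 0 N 0 0 (\<i> * of_real t) 0" for x t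
 proof -
  have "char (distr M borel (X N x)) t = (CLINT w|M. iexp (t * X N x w))" unfolding char_def by (rule integral_distr) auto
  also have "... = (CLINT w|M. 1 * exp ((\<i> * of_real t) * of_real (X N x w - X 0 x w) + 0 * of_real (X N 0 w - X 0 0 w)))"
   by (simp add: mult.assoc)
  also have "... = (CLINT w|M. 1) * Fp 0 N x 0 (\<i> * of_real t) 0" by (rule expectation_exp_increment(1)) auto
  finally show ?thesis by (simp add: prob_space Fp_rotate[of 0 N x])
 qed
 hence "char (distr M borel (X N x)) = char (distr M borel (X N y))" by (auto simp: fun_eq_iff)
 thus ?thesis by (rule Levy_uniqueness[OF rd rd])
qed

end

context log_field
begin

section \<open>Local limits under exponential tilting\<close>

lemma S_tendsto: "filterlim S at_top sequentially"
proof (rule filterlim_at_top_mono)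
 have "filterlim (\<lambda>N. ln (ln (real N))) at_top sequentially"
  by (intro filterlim_compose[OF ln_at_top] filterlim_real_sequentially)
 thus "filterlim (\<lambda>N. - C\<^sub>0 + ln (ln (real N))) at_top sequentially"
  by (intro filterlim_tendsto_add_at_top[OF tendsto_const])
 show "eventually (\<lambda>N. - C\<^sub>0 + ln (ln (real N)) \<le> S N) sequentially"
  using eventually_ge_at_top[of 3]
 proof eventually_elim
  case (elim N)
  show ?case using S_approx[OF elim] by (simp add: S_def abs_le_iff)
 qed
qed

lemma sd_tendsto: "filterlim sd at_top sequentially"
proof -
 have "filterlim (\<lambda>N. 1 / 2 * S N) at_top sequentially"
  by (rule filterlim_tendsto_pos_mult_at_top[OF tendsto_const _ S_tendsto]) simp
 from filterlim_compose[OF sqrt_at_top this] show ?thesis unfolding sd_def[abs_def] by simp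
qed

definition Z :: "nat => real => real => real => real" where
 "Z N x y r = Re (Fp 0 N x y (of_real \<alpha>) (of_real r))"

text \<open>The density of the tilted probability: \<open>r = 0\<close> tilts at x alone,
  \<open>r = \<alpha>\<close> at both points.\<close>

definition tilt :: "nat => real => real => real => 'a => real" where
 "tilt N x y r w = exp (\<alpha> * X N x w + r * X N y w) / Z N x y r"

lemma Z_ge_1: "Z N x y r \<ge> 1" unfolding Z_def by (rule Fp_of_real)

lemma of_real_Z: "of_real (Z N x y r) = Fp 0 N x y (of_real \<alpha>) (of_real r)"
 unfolding Z_def using Fp_of_real(1)[of 0 N x y \<alpha> r] by (simp add: complex_eq_iff)

lemma tilt_pos: "tilt N x y r w > 0" unfolding tilt_def using Z_ge_1[of N x y r] by (intro divide_pos_pos) auto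

lemma tilt_measurable_Fs: "tilt N x y r \<in> borel_measurable (Fs N)"
proof -
 note [measurable] = X_measurable_Fs
 show ?thesis unfolding tilt_def by measurable
qed

lemma tilt_measurable [measurable]: "tilt N x y r \<in> borel_measurable M"
 using tilt_measurable_Fs by (rule measurable_Fs_M)

lemma tilt_le: "tilt N x y r w \<le> exp ((\<alpha> + \<bar>r\<bar>) * real N)"
proof -
 have "\<alpha> * X N x w \<le> \<alpha> * real N" using X_bounded[of N x w] alpha by (intro mult_left_mono) auto
 moreover have "r * X N y w \<le> \<bar>r\<bar> * real N"
 proof -
  have "r * X N y w \<le> \<bar>r\<bar> * \<bar>X N y w\<bar>" by (metis abs_ge_self abs_mult)
  also have "... \<le> \<bar>r\<bar> * real N" using X_bounded by (intro mult_left_mono) auto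
  finally show ?thesis .
 qed
 ultimately have e: "exp (\<alpha> * X N x w + r * X N y w) \<le> exp ((\<alpha> + \<bar>r\<bar>) * real N)" by (simp add: distrib_right)
 moreover have "exp (\<alpha> * X N x w + r * X N y w) / Z N x y r \<le> exp (\<alpha> * X N x w + r * X N y w) / 1"
  using Z_ge_1[of N x y r] by (intro divide_left_mono) auto
 ultimately show ?thesis unfolding tilt_def using e by linarith
qed

lemma integrable_tilt_mult:
 assumes [measurable]: "wt \<in> borel_measurable M" and B: "\<And>w. \<bar>wt w\<bar> \<le> B"
 shows "integrable M (\<lambda>w. wt w * tilt N x y r w)"
proof (rule integrable_const_bound)
 have "\<bar>wt w\<bar> * \<bar>tilt N x y r w\<bar> \<le> B * exp ((\<alpha> + \<bar>r\<bar>) * real N)" for w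
  using B[of w] tilt_le[of N x y r w] tilt_pos[of N x y r w] by (intro mult_mono) auto
 thus "AE w in M. norm (wt w * tilt N x y r w) \<le> B * exp ((\<alpha> + \<bar>r\<bar>) * real N)"
  by (simp add: abs_mult)
qed measurable

lemma Fp_split: "R \<le> N ==> Fp 0 N x y z1 z2 = Fp 0 R x y z1 z2 * Fp R N x y z1 z2"
proof -
 assume R: "R \<le> N"
 have "{0<..N} = {0<..R} \<union> {R<..N}" "{0<..R} \<inter> {R<..N} = {}" using R by auto
 thus ?thesis unfolding Fp_def by (simp add: prod.union_disjoint)
qed

text \<open>Under the tilted measure the phases stay independent, so the primes after R contribute a
  product of ratios, each the characteristic function of one tilted summand. A weight known at stage
  R touches only the first factor.\<close>

lemma tilt_char:
 assumes R: "R \<le> N" and wt: "wt \<in> borel_measurable (Fs R)" "\<And>w. \<bar>wt w\<bar> \<le> 1"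
 shows "(CLINT w|M. of_real (wt w * tilt N x y r w) * iexp (u * (X N x w - L)) * iexp (v * (X N y w - L)))
  = (CLINT w|M. of_real (wt w * tilt R x y r w) * iexp (u * X R x w + v * X R y w)) *
   (iexp (- (u + v) * L) * (\<Prod>j\<in>{R<..N}. F j x y (Complex \<alpha> u) (Complex r v) / F j x y (of_real \<alpha>) (of_real r)))"
proof -
 let ?F = "Fp R N x y (Complex \<alpha> u) (Complex r v)" and ?G = "Fp R N x y (of_real \<alpha>) (of_real r)"
 define g where "g = (\<lambda>w. complex_of_real (wt w * tilt R x y r w) * iexp (u * X R x w + v * X R y w))"
 have wM [measurable]: "wt \<in> borel_measurable M" using wt(1) by (rule measurable_Fs_M)
 have gm: "g \<in> borel_measurable (Fs R)"
 proof -
  note [measurable] = X_measurable_Fs tilt_measurable_Fs wt(1)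
  show ?thesis unfolding g_def by measurable
 qed
 have gi: "integrable M g"
  by (rule Bochner_Integration.integrable_bound[OF integrable_tilt_mult[OF wM wt(2), of R x y r]])
    (use measurable_Fs_M[OF gm] in \<open>auto simp: g_def norm_mult\<close>)
 have F0: "?G \<noteq> 0" using Fp_of_real(2)[of R N x y \<alpha> r] by auto
 have "of_real (wt w * tilt N x y r w) * iexp (u * (X N x w - L)) * iexp (v * (X N y w - L))
  = (iexp (- (u + v) * L) / ?G) * (g w * exp (Complex \<alpha> u * of_real (X N x w - X R x w) + Complex r v * of_real (X N y w - X R y w)))" for w
 proof -
  have "complex_of_real (Z N x y r) = of_real (Z R x y r) * ?G" unfolding of_real_Z by (rule Fp_split[OF R])
  hence 1: "complex_of_real (tilt N x y r w) = exp (of_real (\<alpha> * X N x w + r * X N y w)) / (of_real (Z R x y r) * ?G)"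
   by (simp only: tilt_def exp_of_real[symmetric] of_real_divide)
  have 2: "complex_of_real (tilt R x y r w) = exp (of_real (\<alpha> * X R x w + r * X R y w)) / of_real (Z R x y r)"
   by (simp only: tilt_def exp_of_real[symmetric] of_real_divide)
  have 3: "exp (of_real (\<alpha> * X N x w + r * X N y w)) * iexp (u * (X N x w - L)) * iexp (v * (X N y w - L))
   = iexp (- (u + v) * L) * (exp (of_real (\<alpha> * X R x w + r * X R y w)) * iexp (u * X R x w + v * X R y w) * exp (Complex \<alpha> u * of_real (X N x w - X R x w) + Complex r v * of_real (X N y w - X R y w)))"
   unfolding exp_add[symmetric] Complex_eq by (rule arg_cong[where f = exp]) (simp add: algebra_simps)
  show ?thesis unfolding g_def of_real_mult 1 2 using 3 by (simp add: field_simps)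
 qed
 hence "(CLINT w|M. of_real (wt w * tilt N x y r w) * iexp (u * (X N x w - L)) * iexp (v * (X N y w - L)))
  = (iexp (- (u + v) * L) / ?G) * (CLINT w|M. g w * exp (Complex \<alpha> u * of_real (X N x w - X R x w) + Complex r v * of_real (X N y w - X R y w)))"
  by (simp only: integral_mult_right_zero)
 also have "... = (iexp (- (u + v) * L) / ?G) * ((CLINT w|M. g w) * ?F)"
  by (simp only: expectation_exp_increment(1)[OF R gm gi])
 also have "... = (CLINT w|M. g w) * (iexp (- (u + v) * L) * (?F / ?G))" by simp
 also have "?F / ?G = (\<Prod>j\<in>{R<..N}. F j x y (Complex \<alpha> u) (Complex r v) / F j x y (of_real \<alpha>) (of_real r))"
  unfolding Fp_def by (simp only: prod_dividef)
 finally show ?thesis by (simp only: g_def)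
qed

lemma norm_F_le_real:
 fixes j :: nat
 assumes j: "j \<ge> 1"
 shows "norm (F j x y (Complex r1 u) (Complex r2 v)) \<le> norm (F j x y (of_real r1) (of_real r2))"
proof -
 note [measurable] = T_measurable[OF j]
 define W where "W = (\<lambda>w. exp (a j * (r1 * cos (x * l j - T j w) + r2 * cos (y * l j - T j w))))"
 have "norm (F j x y (Complex r1 u) (Complex r2 v)) \<le> (LINT w|M. norm (exp (of_real (a j) * (Complex r1 u * of_real (cos (x * l j - T j w)) + Complex r2 v * of_real (cos (y * l j - T j w))))))"
  unfolding F_def by (rule integral_norm_bound)
 also have "... = expectation W" unfolding W_def norm_exp_eq_Re by simp
 also have "... = norm (F j x y (of_real r1) (of_real r2))"
  using F_of_real(2)[OF j, of r1 x r2 y] unfolding F_of_real(1)[OF j] W_def by simp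
 finally show ?thesis .
qed

text \<open>The ratio is exactly 1 at zero frequency, so the error carries |u| + |v| besides a^3. At
  frequencies of order 1 / \<open>sd N\<close> the sum of all errors tends to 0.\<close>

lemma F_ratio_approx:
 assumes B: "B \<ge> 0"
 obtains C where "C \<ge> 0" "\<And>(j::nat) x y r1 r2 u v. j \<ge> 1 ==> \<bar>r1\<bar> + 1 \<le> B ==> \<bar>r2\<bar> + 1 \<le> B ==> \<bar>u\<bar> \<le> 1 ==> \<bar>v\<bar> \<le> 1 ==>
  norm (F j x y (Complex r1 u) (Complex r2 v) / F j x y (of_real r1) (of_real r2)
   - exp (Q j (x - y) (Complex r1 u) (Complex r2 v) - Q j (x - y) (of_real r1) (of_real r2))) \<le> C * (\<bar>u\<bar> + \<bar>v\<bar>) * a j ^ 3"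
proof -
 define kB where "kB = taylor_const B"
 have kB: "kB \<ge> 0" by (simp add: kB_def taylor_const_nonneg)
 define G where "G = B^2 + 2 * B * kB"
 have G: "G \<ge> 0" using B kB by (simp add: G_def)
 define C where "C = kB + G * B + (1 + G) * (2 * B^2 * exp (2 * B))"
 show ?thesis
 proof (rule that[of C])
  show "C \<ge> 0" using B kB G by (simp add: C_def)
  fix j :: nat and x y r1 r2 u v :: real
  assume j: "j \<ge> 1" and r: "\<bar>r1\<bar> + 1 \<le> B" "\<bar>r2\<bar> + 1 \<le> B" and uv: "\<bar>u\<bar> \<le> 1" "\<bar>v\<bar> \<le> 1"
  let ?z1 = "Complex r1 u" and ?z2 = "Complex r2 v" and ?w1 = "complex_of_real r1" and ?w2 = "complex_of_real r2"
  define Fz where "Fz = F j x y ?z1 ?z2"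
  define F0 where "F0 = F j x y ?w1 ?w2"
  define d where "d = Q j (x - y) ?z1 ?z2 - Q j (x - y) ?w1 ?w2"
  define \<Delta> where "\<Delta> = \<bar>u\<bar> + \<bar>v\<bar>"
  have D: "0 \<le> \<Delta>" "\<Delta> \<le> 2" using uv by (auto simp: \<Delta>_def)
  have nz: "norm ?z1 \<le> B" "norm ?z2 \<le> B" using norm_Complex_le[of r1 u] norm_Complex_le[of r2 v] r uv by linarith+
  have nw: "norm ?w1 \<le> B" "norm ?w2 \<le> B" using r by auto
  have dz: "?z1 - ?w1 = \<i> * of_real u" "?z2 - ?w2 = \<i> * of_real v" by (auto simp: complex_eq_iff)
  have a3: "0 \<le> a j ^ 3" "a j ^ 3 \<le> (a j)^2" "(a j)^2 \<le> 1" using a_le_1[of j] a_nonneg[of j] by (auto intro: power_decreasing power_le_one)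
  have 1: "norm ((Fz - F0) - d) \<le> kB * \<Delta> * a j ^ 3"
   using F_taylor[OF j nz nw, of x y] unfolding dz norm_mult norm_ii norm_of_real Fz_def F0_def d_def kB_def \<Delta>_def by simp
  have 2: "norm d \<le> (a j)^2 * (B * \<Delta>)"
  proof -
   have "?z1^2 - ?w1\<^sup>2 = (?z1 - ?w1) * (?z1 + ?w1)" "?z2^2 - ?w2\<^sup>2 = (?z2 - ?w2) * (?z2 + ?w2)"
    "?z1 * ?z2 - ?w1 * ?w2 = (?z1 - ?w1) * ?z2 + ?w1 * (?z2 - ?w2)"
    by (simp_all add: power2_eq_square algebra_simps)
   moreover have "norm (?z1 + ?w1) \<le> 2 * B" "norm (?z2 + ?w2) \<le> 2 * B"
    using norm_triangle_ineq[of ?z1 ?w1] norm_triangle_ineq[of ?z2 ?w2] nz nw by linarith+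
   ultimately have q: "?z1^2 - ?w1\<^sup>2 = \<i> * of_real u * (?z1 + ?w1)" "?z2^2 - ?w2\<^sup>2 = \<i> * of_real v * (?z2 + ?w2)"
    "?z1 * ?z2 - ?w1 * ?w2 = \<i> * of_real u * ?z2 + ?w1 * (\<i> * of_real v)"
    and s: "norm (?z1 + ?w1) \<le> 2 * B" "norm (?z2 + ?w2) \<le> 2 * B" by (simp_all only: dz)
   have e1: "norm (?z1^2 - ?w1\<^sup>2) \<le> \<bar>u\<bar> * (2 * B)" unfolding q norm_mult norm_ii norm_of_real mult_1_left
    using s by (intro mult_left_mono) auto
   have e2: "norm (?z2^2 - ?w2\<^sup>2) \<le> \<bar>v\<bar> * (2 * B)" unfolding q norm_mult norm_ii norm_of_real mult_1_left
    using s by (intro mult_left_mono) auto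
   have "norm (?z1 * ?z2 - ?w1 * ?w2) \<le> norm (\<i> * of_real u * ?z2) + norm (?w1 * (\<i> * of_real v))"
    unfolding q by (rule norm_triangle_ineq)
   also have "... = \<bar>u\<bar> * norm ?z2 + norm ?w1 * \<bar>v\<bar>" unfolding norm_mult norm_ii norm_of_real mult_1_left ..
   also have "... \<le> \<bar>u\<bar> * B + B * \<bar>v\<bar>" by (intro add_mono mult_left_mono mult_right_mono nz nw) auto
   finally have e3: "norm (?z1 * ?z2 - ?w1 * ?w2) \<le> \<bar>u\<bar> * B + B * \<bar>v\<bar>" .
   have "d = of_real ((a j)^2 / 4) * ((?z1^2 - ?w1\<^sup>2) + (?z2^2 - ?w2\<^sup>2) + 2 * (?z1 * ?z2 - ?w1 * ?w2) * of_real (cos ((x - y) * l j)))"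
    by (simp add: d_def Q_def algebra_simps)
   also have "norm ... \<le> (a j)^2 / 4 * (\<bar>u\<bar> * (2 * B) + \<bar>v\<bar> * (2 * B) + 2 * (\<bar>u\<bar> * B + B * \<bar>v\<bar>) * 1)"
   proof -
    have "norm ((?z1^2 - ?w1\<^sup>2) + (?z2^2 - ?w2\<^sup>2) + 2 * (?z1 * ?z2 - ?w1 * ?w2) * of_real (cos ((x - y) * l j)))
     \<le> norm (?z1^2 - ?w1\<^sup>2) + norm (?z2^2 - ?w2\<^sup>2) + norm (2 * (?z1 * ?z2 - ?w1 * ?w2) * of_real (cos ((x - y) * l j)))"
     by (intro order_trans[OF norm_triangle_ineq] add_mono norm_triangle_ineq order_refl)
    also have "norm (2 * (?z1 * ?z2 - ?w1 * ?w2) * of_real (cos ((x - y) * l j))) = 2 * norm (?z1 * ?z2 - ?w1 * ?w2) * \<bar>cos ((x - y) * l j)\<bar>"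
     by (simp only: norm_mult norm_of_real norm_numeral)
    also have "... \<le> 2 * (\<bar>u\<bar> * B + B * \<bar>v\<bar>) * 1" using e3 B by (intro mult_mono) auto
    finally have m: "norm ((?z1^2 - ?w1\<^sup>2) + (?z2^2 - ?w2\<^sup>2) + 2 * (?z1 * ?z2 - ?w1 * ?w2) * of_real (cos ((x - y) * l j)))
     \<le> \<bar>u\<bar> * (2 * B) + \<bar>v\<bar> * (2 * B) + 2 * (\<bar>u\<bar> * B + B * \<bar>v\<bar>) * 1" using e1 e2 by linarith
    have n: "norm (complex_of_real ((a j)^2 / 4)) = (a j)^2 / 4" by (simp only: norm_of_real) simp
    show ?thesis unfolding norm_mult[of "complex_of_real ((a j)^2 / 4)"] n by (rule mult_left_mono[OF m]) simp
   qed
   also have "... = (a j)^2 * (B * \<Delta>)" by (simp add: \<Delta>_def algebra_simps)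
   finally show ?thesis .
  qed
  have 3: "norm (F0 - 1) \<le> (a j)^2 * G"
  proof -
   have "norm (F0 - 1) \<le> norm (F0 - 1 - Q j (x - y) ?w1 ?w2) + norm (Q j (x - y) ?w1 ?w2)" by (metis diff_add_cancel norm_triangle_ineq)
   also have "... \<le> 2 * B * kB * a j ^ 3 + (a j)^2 * B^2"
    unfolding F0_def kB_def by (intro add_mono F_approx[OF j nw] norm_Q_le[OF nw])
   also have "... \<le> 2 * B * kB * (a j)^2 + (a j)^2 * B^2" using a3 B kB by (intro add_mono mult_left_mono) auto
   also have "... = (a j)^2 * G" by (simp add: G_def algebra_simps)
   finally show ?thesis .
  qed
  have 4: "norm (exp d - 1 - d) \<le> a j ^ 3 * (2 * B^2 * exp (2 * B) * \<Delta>)"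
  proof -
   have "norm d \<le> 1 * (B * 2)" using 2 a3 B D by (intro order_trans[OF 2] mult_mono) auto
   hence ed: "exp (norm d) \<le> exp (2 * B)" by simp
   have "norm (exp d - 1 - d) \<le> (norm d)^2 * exp (norm d)" by (rule norm_exp_minus_linear_le)
   also have "... \<le> ((a j)^2 * (B * \<Delta>))^2 * exp (2 * B)" using 2 ed by (intro mult_mono power_mono) auto
   also have "... = ((a j)^2 * (a j)^2) * (B^2 * exp (2 * B) * (\<Delta> * \<Delta>))" by (simp add: power2_eq_square mult_ac)
   also have "... \<le> a j ^ 3 * (B^2 * exp (2 * B) * (2 * \<Delta>))"
    using D a3 by (intro mult_mono a_pow4_le mult_left_mono mult_right_mono) auto
   finally show ?thesis by (simp add: mult_ac)
  qed
  have 5: "norm F0 \<le> 1 + G"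
  proof -
   have "norm F0 \<le> norm (F0 - 1) + norm (1::complex)" by (metis diff_add_cancel norm_triangle_ineq)
   also have "norm (F0 - 1) \<le> 1 * G" using a3 G by (intro order_trans[OF 3] mult_right_mono) auto
   finally show ?thesis by simp
  qed
  have F01: "norm F0 \<ge> 1" unfolding F0_def F_of_real(1)[OF j] using F_of_real(2)[OF j, of r1 x r2 y] by simp
  hence "F0 \<noteq> 0" by auto
  \<comment> \<open>The three terms of the numerator are a Taylor difference, a product of two
    second-order quantities and an exponential remainder. They correspond to the three summands of
    \<open>C\<close>, and the denominator has norm at least 1.\<close>
  hence "Fz / F0 - exp d = (((Fz - F0) - d) - (F0 - 1) * d - F0 * (exp d - 1 - d)) / F0" by (simp add: field_simps)
  hence "norm (Fz / F0 - exp d) = norm (((Fz - F0) - d) - (F0 - 1) * d - F0 * (exp d - 1 - d)) / norm F0" by (simp only: norm_divide)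
  also have "... \<le> norm (((Fz - F0) - d) - (F0 - 1) * d - F0 * (exp d - 1 - d)) / 1"
   using F01 by (intro divide_left_mono) auto
  also have "... \<le> norm ((Fz - F0) - d) + norm ((F0 - 1) * d) + norm (F0 * (exp d - 1 - d))"
   by (simp only: div_by_1) (intro order_trans[OF norm_triangle_ineq4] add_mono norm_triangle_ineq4 order_refl)
  also have "... \<le> kB * \<Delta> * a j ^ 3 + (G * B) * \<Delta> * a j ^ 3 + ((1 + G) * (2 * B^2 * exp (2 * B))) * \<Delta> * a j ^ 3"
  proof (intro add_mono 1)
   have "norm (F0 - 1) * norm d \<le> ((a j)^2 * G) * ((a j)^2 * (B * \<Delta>))" using 3 2 G by (intro mult_mono) auto
   also have "... = ((a j)^2 * (a j)^2) * (G * B * \<Delta>)" by (simp add: mult_ac)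
   also have "... \<le> a j ^ 3 * (G * B * \<Delta>)" using G B D by (intro mult_right_mono a_pow4_le) auto
   finally show "norm ((F0 - 1) * d) \<le> (G * B) * \<Delta> * a j ^ 3" by (simp add: norm_mult mult_ac)
   have "norm F0 * norm (exp d - 1 - d) \<le> (1 + G) * (a j ^ 3 * (2 * B^2 * exp (2 * B) * \<Delta>))" using 5 4 G by (intro mult_mono) auto
   thus "norm (F0 * (exp d - 1 - d)) \<le> ((1 + G) * (2 * B^2 * exp (2 * B))) * \<Delta> * a j ^ 3" by (simp add: norm_mult mult_ac)
  qed
  also have "... = C * \<Delta> * a j ^ 3" by (simp add: C_def algebra_simps)
  finally show "norm (F j x y ?z1 ?z2 / F j x y ?w1 ?w2 - exp (Q j (x - y) ?z1 ?z2 - Q j (x - y) ?w1 ?w2)) \<le> C * (\<bar>u\<bar> + \<bar>v\<bar>) * a j ^ 3"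
   by (simp only: Fz_def F0_def d_def \<Delta>_def)
 qed
qed

end

text \<open>The one-variable theorem is applied twice: first in Y with weights that still contain
  the kernel in Z, then in Z with weights \<open>W * f (Y)\<close>. It requires nonnegative weights,
  so oscillating factors in Z are first inserted as 1 + cos and then separated by linearity.\<close>

lemma weighted_levy_continuity2:
 fixes W Y Z :: "nat => 'a => real" and f g :: "real => real"
 assumes [measurable]: "\<And>n. W n \<in> borel_measurable M" "\<And>n. Y n \<in> borel_measurable M" "\<And>n. Z n \<in> borel_measurable M"
  and W0: "\<And>n w. W n w \<ge> 0"
  and int: "\<And>n. integrable M (\<lambda>w. W n w * kern (Y n w) * kern (Z n w))"
  and c: "c \<ge> 0"
  and lim: "\<And>a b. (\<lambda>n. CLINT w|M. of_real (W n w * kern (Y n w) * kern (Z n w)) * iexp (a * Y n w) * iexp (b * Z n w))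
    \<longlonglongrightarrow> of_real c * (CLBINT y. of_real (kern y) * iexp (a * y)) * (CLBINT y. of_real (kern y) * iexp (b * y))"
  and f [measurable]: "f \<in> borel_measurable borel" and Bf: "\<And>y. \<bar>f y\<bar> \<le> Bf * kern y" and f0: "\<And>y. f y \<ge> 0"
  and contf: "AE y in lborel. isCont f y"
  and g [measurable]: "g \<in> borel_measurable borel" and Bg: "\<And>y. \<bar>g y\<bar> \<le> Bg * kern y"
  and contg: "AE y in lborel. isCont g y"
 shows "(\<lambda>n. LINT w|M. W n w * f (Y n w) * g (Z n w)) \<longlonglongrightarrow> c * (LBINT y. f y) * (LBINT y. g y)"
proof -
 define K where "K = (\<lambda>b. CLBINT y. of_real (kern y) * iexp (b * y))"
 define G where "G = (\<lambda>a b n. CLINT w|M. of_real (W n w * kern (Y n w) * kern (Z n w)) * iexp (a * Y n w) * iexp (b * Z n w))"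
 have limG: "G a b \<longlonglongrightarrow> of_real c * K a * K b" for a b unfolding G_def K_def by (rule lim)
 \<comment> \<open>The weight 1 + cos is a combination of three pure frequencies, so its limit
   follows from the assumed joint limits.\<close>
 have id: "complex_of_real (1 + cos (b * z + \<theta>)) = iexp (0 * z) + (iexp \<theta> / 2) * iexp (b * z) + (iexp (- \<theta>) / 2) * iexp (- b * z)" for b z \<theta> :: real
 proof -
  have "complex_of_real (cos (b * z + \<theta>)) = (iexp (b * z + \<theta>) + iexp (- (b * z + \<theta>))) / 2"
   unfolding cos_of_real[symmetric] cos_exp_eq by (simp only: of_real_minus mult_minus_left mult_minus_right)
  moreover have "iexp (b * z + \<theta>) = iexp \<theta> * iexp (b * z)" "iexp (- (b * z + \<theta>)) = iexp (- \<theta>) * iexp (- b * z)"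
   unfolding exp_add[symmetric] by (auto intro!: arg_cong[where f = exp] simp: algebra_simps)
  ultimately show ?thesis by (simp add: add_divide_distrib)
 qed
 have Ki: "integrable lborel (\<lambda>y. complex_of_real (kern y) * iexp (b * y))" for b
  by (rule integrable_kern_mult_bounded[where B = 1]) (use kern_pos in \<open>auto simp: norm_mult less_imp_le\<close>)
 have Gi: "integrable M (\<lambda>w. complex_of_real (W n w * kern (Y n w) * kern (Z n w)) * iexp (a * Y n w) * iexp (b * Z n w))" for a b n
  by (rule Bochner_Integration.integrable_bound[OF int[of n]]) (auto simp: norm_mult)
 have kcos: "complex_of_real (LBINT y. kern y * (1 + cos (b * y + \<theta>))) = K 0 + (iexp \<theta> / 2) * K b + (iexp (- \<theta>) / 2) * K (- b)" for b \<theta>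
 proof -
  have "complex_of_real (LBINT y. kern y * (1 + cos (b * y + \<theta>))) = (CLBINT y. of_real (kern y) * of_real (1 + cos (b * y + \<theta>)))"
   by (simp only: integral_complex_of_real of_real_mult[symmetric])
  also have "... = (CLBINT y. of_real (kern y) * iexp (0 * y) + (iexp \<theta> / 2) * (of_real (kern y) * iexp (b * y)) + (iexp (- \<theta>) / 2) * (of_real (kern y) * iexp (- b * y)))"
   unfolding id by (simp only: distrib_left mult_ac)
  also have "... = K 0 + (iexp \<theta> / 2) * K b + (iexp (- \<theta>) / 2) * K (- b)"
   using Ki unfolding K_def by (simp only: Bochner_Integration.integral_add Bochner_Integration.integrable_add integrable_mult_right integral_mult_right_zero)
  finally show ?thesis .
 qed
 have kcos_i: "integrable lborel (\<lambda>y. kern y * cos (b * y + \<theta>))" for b \<theta>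
  by (rule integrable_kern_mult_bounded[where B = 1]) (use kern_pos in \<open>auto simp: abs_mult less_imp_le mult_left_le\<close>)
 have kn: "0 \<le> kern y" "kern y \<le> 1" for y using kern_pos[of y] kern_le[of y] by auto
 have step: "(\<lambda>n. LINT w|M. (W n w * kern (Z n w) * (1 + cos (b * Z n w + \<theta>))) * f (Y n w))
   \<longlonglongrightarrow> (c * (LBINT y. kern y * (1 + cos (b * y + \<theta>)))) * (LBINT y. f y)" for b \<theta>
 proof (rule weighted_levy_continuity[OF _ _ _ _ _ _ f Bf contf])
  have c1: "0 \<le> 1 + cos t" "1 + cos t \<le> 2" for t :: real using cos_ge_minus_one[of t] cos_le_one[of t] by linarith+
  show "0 \<le> W n w * kern (Z n w) * (1 + cos (b * Z n w + \<theta>))" for n w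
   by (intro mult_nonneg_nonneg W0 kn c1)
  show "0 \<le> c * (LBINT y. kern y * (1 + cos (b * y + \<theta>)))"
   by (intro mult_nonneg_nonneg c integral_nonneg_AE AE_I2 kn c1)
  show "integrable M (\<lambda>w. W n w * kern (Z n w) * (1 + cos (b * Z n w + \<theta>)) * kern (Y n w))" for n
  proof (rule Bochner_Integration.integrable_bound)
   show "integrable M (\<lambda>w. 2 * (W n w * kern (Y n w) * kern (Z n w)))" using int by (rule integrable_mult_right)
   have "norm (W n w * kern (Z n w) * (1 + cos (b * Z n w + \<theta>)) * kern (Y n w)) \<le> norm (2 * (W n w * kern (Y n w) * kern (Z n w)))" for w
   proof -
    have "(W n w * kern (Z n w) * kern (Y n w)) * (1 + cos (b * Z n w + \<theta>)) \<le> (W n w * kern (Z n w) * kern (Y n w)) * 2"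
     by (intro mult_left_mono mult_nonneg_nonneg W0 kn c1)
    moreover have "0 \<le> (W n w * kern (Z n w) * kern (Y n w)) * (1 + cos (b * Z n w + \<theta>))"
     by (intro mult_nonneg_nonneg W0 kn c1)
    ultimately show ?thesis by (simp add: mult_ac)
   qed
   thus "AE w in M. norm (W n w * kern (Z n w) * (1 + cos (b * Z n w + \<theta>)) * kern (Y n w)) \<le> norm (2 * (W n w * kern (Y n w) * kern (Z n w)))"
    by simp
  qed measurable
  fix a
  have "(CLINT w|M. of_real (W n w * kern (Z n w) * (1 + cos (b * Z n w + \<theta>)) * kern (Y n w)) * iexp (a * Y n w))
   = G a 0 n + (iexp \<theta> / 2) * G a b n + (iexp (- \<theta>) / 2) * G a (- b) n" for n
  proof -
   have "of_real (W n w * kern (Z n w) * (1 + cos (b * Z n w + \<theta>)) * kern (Y n w)) * iexp (a * Y n w)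
    = of_real (W n w * kern (Y n w) * kern (Z n w)) * iexp (a * Y n w) * iexp (0 * Z n w)
    + (iexp \<theta> / 2) * (of_real (W n w * kern (Y n w) * kern (Z n w)) * iexp (a * Y n w) * iexp (b * Z n w))
    + (iexp (- \<theta>) / 2) * (of_real (W n w * kern (Y n w) * kern (Z n w)) * iexp (a * Y n w) * iexp (- b * Z n w))" for w
    unfolding of_real_mult id by (simp only: distrib_left distrib_right mult_ac)
   thus ?thesis unfolding G_def using Gi
    by (simp only: Bochner_Integration.integral_add Bochner_Integration.integrable_add integrable_mult_right integral_mult_right_zero)
  qed
  moreover have "(\<lambda>n. G a 0 n + (iexp \<theta> / 2) * G a b n + (iexp (- \<theta>) / 2) * G a (- b) n)
   \<longlonglongrightarrow> of_real c * K a * K 0 + (iexp \<theta> / 2) * (of_real c * K a * K b) + (iexp (- \<theta>) / 2) * (of_real c * K a * K (- b))"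
   by (intro tendsto_intros limG)
  moreover have "of_real c * K a * K 0 + (iexp \<theta> / 2) * (of_real c * K a * K b) + (iexp (- \<theta>) / 2) * (of_real c * K a * K (- b))
   = of_real (c * (LBINT y. kern y * (1 + cos (b * y + \<theta>)))) * K a"
   unfolding of_real_mult kcos by (simp add: algebra_simps)
  ultimately show "(\<lambda>n. CLINT w|M. of_real (W n w * kern (Z n w) * (1 + cos (b * Z n w + \<theta>)) * kern (Y n w)) * iexp (a * Y n w))
   \<longlonglongrightarrow> of_real (c * (LBINT y. kern y * (1 + cos (b * y + \<theta>)))) * (CLBINT y. of_real (kern y) * iexp (a * y))"
   by (simp only: K_def)
 qed measurable
 have Bf0: "Bf \<ge> 0" using Bf[of 0] kern_pos[of 0] by (metis abs_ge_zero order_trans zero_le_mult_iff not_less)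
 have fi: "integrable M (\<lambda>w. W n w * f (Y n w) * kern (Z n w) * q w)"
  if [measurable]: "q \<in> borel_measurable M" and q: "\<And>w. \<bar>q w\<bar> \<le> 1" for n q
 proof (rule Bochner_Integration.integrable_bound)
  show "integrable M (\<lambda>w. Bf * (W n w * kern (Y n w) * kern (Z n w)))" using int by (rule integrable_mult_right)
  have "norm (W n w * f (Y n w) * kern (Z n w) * q w) \<le> norm (Bf * (W n w * kern (Y n w) * kern (Z n w)))" for w
  proof -
   have "W n w * \<bar>f (Y n w)\<bar> * kern (Z n w) * \<bar>q w\<bar> \<le> W n w * (Bf * kern (Y n w)) * kern (Z n w) * 1"
    using Bf0 by (intro mult_mono mult_nonneg_nonneg W0 kn Bf q order_refl) auto
   thus ?thesis using W0[of n w] kn[of "Y n w"] kn[of "Z n w"] Bf0 by (simp add: abs_mult mult_ac)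
  qed
  thus "AE w in M. norm (W n w * f (Y n w) * kern (Z n w) * q w) \<le> norm (Bf * (W n w * kern (Y n w) * kern (Z n w)))" by simp
 qed measurable
 define H where "H = (\<lambda>b \<theta> n. LINT w|M. W n w * f (Y n w) * kern (Z n w) * cos (b * Z n w + \<theta>))"
 have limH: "H b \<theta> \<longlonglongrightarrow> (c * (LBINT y. f y)) * (LBINT y. kern y * cos (b * y + \<theta>))" for b \<theta>
 proof -
  have e1: "(LINT w|M. (W n w * kern (Z n w) * (1 + cos (b * Z n w + \<theta>))) * f (Y n w)) = (LINT w|M. W n w * f (Y n w) * kern (Z n w) * 1) + H b \<theta> n" for n b \<theta>
  proof -
   have "(LINT w|M. (W n w * kern (Z n w) * (1 + cos (b * Z n w + \<theta>))) * f (Y n w)) = (LINT w|M. W n w * f (Y n w) * kern (Z n w) * 1 + W n w * f (Y n w) * kern (Z n w) * cos (b * Z n w + \<theta>))"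
    by (intro Bochner_Integration.integral_cong refl) (simp add: algebra_simps)
   also have "... = (LINT w|M. W n w * f (Y n w) * kern (Z n w) * 1) + H b \<theta> n"
    unfolding H_def by (intro Bochner_Integration.integral_add fi) auto
   finally show ?thesis .
  qed
  have e2: "(LBINT y. kern y * (1 + cos (b * y + \<theta>))) = (LBINT y. kern y) + (LBINT y. kern y * cos (b * y + \<theta>))" for b \<theta>
   unfolding distrib_left mult_1_right by (intro Bochner_Integration.integral_add integrable_kern kcos_i)
  \<comment> \<open>At b = 0 and \<theta> = pi / 2 the cosine vanishes. Subtracting this instance
    isolates the cosine part; the phases 0 and -pi / 2 then supply cosine and sine.\<close>
  have "(\<lambda>n. (LINT w|M. (W n w * kern (Z n w) * (1 + cos (b * Z n w + \<theta>))) * f (Y n w)) - (LINT w|M. (W n w * kern (Z n w) * (1 + cos (0 * Z n w + pi / 2))) * f (Y n w)))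
   \<longlonglongrightarrow> (c * (LBINT y. kern y * (1 + cos (b * y + \<theta>)))) * (LBINT y. f y) - (c * (LBINT y. kern y * (1 + cos (0 * y + pi / 2)))) * (LBINT y. f y)"
   by (intro tendsto_diff step)
  moreover have "H 0 (pi / 2) n = 0" for n by (simp add: H_def)
  ultimately show ?thesis unfolding e1 e2 by (simp add: algebra_simps)
 qed
 have "(\<lambda>n. LINT w|M. (W n w * f (Y n w)) * g (Z n w)) \<longlonglongrightarrow> (c * (LBINT y. f y)) * (LBINT y. g y)"
 proof (rule weighted_levy_continuity[OF _ _ _ _ _ _ g Bg contg])
  show "0 \<le> W n w * f (Y n w)" for n w by (intro mult_nonneg_nonneg W0 f0)
  show "0 \<le> c * (LBINT y. f y)" by (intro mult_nonneg_nonneg c integral_nonneg_AE AE_I2 f0)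
  show "integrable M (\<lambda>w. W n w * f (Y n w) * kern (Z n w))" for n using fi[of "\<lambda>_. 1" n] by simp
  fix b
  have euler: "iexp t = of_real (cos (t + 0)) + \<i> * of_real (cos (t + - (pi / 2)))" for t :: real
   using cos_diff[of t "pi / 2"] by (simp add: exp_Euler cos_of_real sin_of_real)
  have 1: "(CLINT w|M. of_real (W n w * f (Y n w) * kern (Z n w)) * iexp (b * Z n w)) = of_real (H b 0 n) + \<i> * of_real (H b (- (pi / 2)) n)" for n
  proof -
   have "(CLINT w|M. of_real (W n w * f (Y n w) * kern (Z n w)) * iexp (b * Z n w))
    = (CLINT w|M. of_real (W n w * f (Y n w) * kern (Z n w) * cos (b * Z n w + 0)) + \<i> * of_real (W n w * f (Y n w) * kern (Z n w) * cos (b * Z n w + - (pi / 2))))"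
    unfolding euler unfolding of_real_mult by (simp only: distrib_left mult_ac)
   also have "... = (CLINT w|M. of_real (W n w * f (Y n w) * kern (Z n w) * cos (b * Z n w + 0))) + (CLINT w|M. \<i> * of_real (W n w * f (Y n w) * kern (Z n w) * cos (b * Z n w + - (pi / 2))))"
    by (intro Bochner_Integration.integral_add integrable_mult_right integrable_of_real fi) auto
   also have "... = of_real (H b 0 n) + \<i> * of_real (H b (- (pi / 2)) n)"
    unfolding H_def integral_mult_right_zero integral_complex_of_real ..
   finally show ?thesis .
  qed
  have 2: "(CLBINT y. of_real (kern y) * iexp (b * y)) = of_real (LBINT y. kern y * cos (b * y + 0)) + \<i> * of_real (LBINT y. kern y * cos (b * y + - (pi / 2)))"
  proof -
   have "(CLBINT y. of_real (kern y) * iexp (b * y)) = (CLBINT y. of_real (kern y * cos (b * y + 0)) + \<i> * of_real (kern y * cos (b * y + - (pi / 2))))"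
    unfolding euler unfolding of_real_mult by (simp only: distrib_left mult_ac)
   also have "... = (CLBINT y. of_real (kern y * cos (b * y + 0))) + (CLBINT y. \<i> * of_real (kern y * cos (b * y + - (pi / 2))))"
    by (intro Bochner_Integration.integral_add integrable_mult_right integrable_of_real kcos_i)
   also have "... = of_real (LBINT y. kern y * cos (b * y + 0)) + \<i> * of_real (LBINT y. kern y * cos (b * y + - (pi / 2)))"
    unfolding integral_mult_right_zero integral_complex_of_real ..
   finally show ?thesis .
  qed
  have "(\<lambda>n. complex_of_real (H b 0 n) + \<i> * of_real (H b (- (pi / 2)) n))
   \<longlonglongrightarrow> of_real ((c * (LBINT y. f y)) * (LBINT y. kern y * cos (b * y + 0))) + \<i> * of_real ((c * (LBINT y. f y)) * (LBINT y. kern y * cos (b * y + - (pi / 2))))"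
   by (intro tendsto_intros limH)
  thus "(\<lambda>n. CLINT w|M. of_real (W n w * f (Y n w) * kern (Z n w)) * iexp (b * Z n w))
   \<longlonglongrightarrow> of_real (c * (LBINT y. f y)) * (CLBINT y. of_real (kern y) * iexp (b * y))"
   unfolding 1 2 by (simp add: distrib_left mult_ac)
 qed measurable
 thus ?thesis .
qed

context log_field
begin

text \<open>The tilt moves the mean at x to about \<alpha> / 2 * \<open>S N\<close>, within O(1) of
  \<open>lev N\<close> and so negligible after division by \<open>sd N\<close>. The covariance adds
  a drift of order \<open>D / sd\<close> and a correlation of order D / sd^2. Both vanish by
  hypothesis if \<open>r = \<alpha>\<close>; if r = v = 0 their coefficients are 0.\<close>

lemma char_prod_tendsto:
 assumes \<xi>: "strict_mono \<xi>"
  and r: "(r = \<alpha> \<and> (\<lambda>n. D (\<xi> n) (x - y) / sd (\<xi> n)) \<longlonglongrightarrow> 0) \<or> (r = 0 \<and> v = 0)"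
 shows "(\<lambda>n. iexp (- (u / sd (\<xi> n) + v / sd (\<xi> n)) * lev (\<xi> n)) *
   (\<Prod>j\<in>{R<..\<xi> n}. F j x y (Complex \<alpha> (u / sd (\<xi> n))) (Complex r (v / sd (\<xi> n))) / F j x y (of_real \<alpha>) (of_real r)))
  \<longlonglongrightarrow> of_real (exp (- ((u^2 + v^2) / 2)))"
proof -
 define s where "s = (\<lambda>n. sd (\<xi> n))"
 have sinf: "filterlim s at_top sequentially"
  unfolding s_def by (rule filterlim_compose[OF sd_tendsto filterlim_subseq[OF \<xi>]])
 have s0: "eventually (\<lambda>n. s n > 0) sequentially" using sinf by (auto simp: filterlim_at_top_dense)
 have inv: "(\<lambda>n. c / s n) \<longlonglongrightarrow> 0" for c by (rule tendsto_divide_0[OF tendsto_const filterlim_at_top_imp_at_infinity[OF sinf]])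
 have ev: "eventually (\<lambda>n. P (\<xi> n)) sequentially" if "eventually P sequentially" for P
  using filterlim_subseq[OF \<xi>] that by (rule eventually_compose_filterlim[rotated])
 define z1 where "z1 = (\<lambda>n. Complex \<alpha> (u / s n))"
 define z2 where "z2 = (\<lambda>n. Complex r (v / s n))"
 define d where "d = (\<lambda>n j. Q j (x - y) (z1 n) (z2 n) - Q j (x - y) (of_real \<alpha>) (of_real r))"
 define q where "q = (\<lambda>n j. F j x y (z1 n) (z2 n) / F j x y (of_real \<alpha>) (of_real r))"
 define e where "e = (\<lambda>n. iexp (- (u / s n + v / s n) * lev (\<xi> n)))"
 define B where "B = \<alpha> + \<bar>r\<bar> + 1"
 have B: "B \<ge> 0" "\<bar>\<alpha>\<bar> + 1 \<le> B" "\<bar>r\<bar> + 1 \<le> B" using alpha by (auto simp: B_def)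
 obtain C where C: "C \<ge> 0" and Cb: "\<And>(j::nat) x y r1 r2 u v. j \<ge> 1 ==> \<bar>r1\<bar> + 1 \<le> B ==> \<bar>r2\<bar> + 1 \<le> B ==> \<bar>u\<bar> \<le> 1 ==> \<bar>v\<bar> \<le> 1 ==>
  norm (F j x y (Complex r1 u) (Complex r2 v) / F j x y (of_real r1) (of_real r2)
   - exp (Q j (x - y) (Complex r1 u) (Complex r2 v) - Q j (x - y) (of_real r1) (of_real r2))) \<le> C * (\<bar>u\<bar> + \<bar>v\<bar>) * a j ^ 3"
  using F_ratio_approx[OF B(1)] by blast
 have dval: "d n j = of_real ((a j)^2) * ((\<i> * of_real (2 * (\<alpha> * u + r * v) / s n) - of_real ((u^2 + v^2) / (s n)^2)) / 4)
   + of_real ((a j)^2 * cos ((x - y) * l j)) * ((\<i> * of_real ((\<alpha> * v + r * u) / s n) - of_real (u * v / (s n)^2)) / 2)" for n j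
  unfolding d_def Q_def z1_def z2_def
  by (simp add: complex_eq_iff power2_eq_square algebra_simps add_divide_distrib diff_divide_distrib)
 have nd: "norm (exp (d n j)) \<le> 1" for n j
 proof -
  have "Re (d n j) = - ((a j)^2 * ((u^2 + v^2 + 2 * (u * v) * cos ((x - y) * l j)) / (4 * (s n)^2)))"
  proof -
   have "Re (d n j) = (a j)^2 * (- ((u^2 + v^2) / (s n)^2) / 4) + (a j)^2 * cos ((x - y) * l j) * (- (u * v / (s n)^2) / 2)"
    unfolding dval by simp
   moreover have "A * (- (b / q) / 4) + A * c * (- (wt / q) / 2) = - (A * ((b + 2 * wt * c) / (4 * q)))" for A b c wt q :: real
    by (cases "q = 0") (simp_all add: field_simps)
   ultimately show ?thesis by simp
  qed
  moreover have "u^2 + v^2 + 2 * (u * v) * cos ((x - y) * l j) \<ge> 0"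
  proof -
   have "\<bar>2 * (u * v) * cos ((x - y) * l j)\<bar> \<le> \<bar>2 * (u * v)\<bar> * 1" unfolding abs_mult[of "2 * (u * v)"] by (intro mult_left_mono) auto
   moreover have "\<bar>2 * (u * v)\<bar> \<le> u^2 + v^2"
    using sum_squares_bound[of u v] sum_squares_bound[of u "- v"] by (auto simp: abs_le_iff)
   ultimately show ?thesis by linarith
  qed
  ultimately have "Re (d n j) \<le> 0" by simp
  thus ?thesis by simp
 qed
 have nq: "norm (q n j) \<le> 1" if "j \<ge> 1" for n j
  unfolding q_def norm_divide z1_def z2_def
  using norm_F_le_real[OF that, of x y \<alpha> "u / s n" r "v / s n"] unfolding divide_le_eq_1 by (metis norm_ge_zero less_le)
 \<comment> \<open>All factors have norm at most 1, so a difference of products is at most the sum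
   of the differences of the factors.\<close>
 have diff: "(\<lambda>n. e n * (\<Prod>j\<in>{R<..\<xi> n}. q n j) - e n * (\<Prod>j\<in>{R<..\<xi> n}. exp (d n j))) \<longlonglongrightarrow> 0"
 proof (rule Lim_null_comparison)
  have "eventually (\<lambda>n. \<bar>u / s n\<bar> < 1) sequentially" "eventually (\<lambda>n. \<bar>v / s n\<bar> < 1) sequentially"
   using inv[of u] inv[of v] by (auto dest!: tendstoD[where e = 1] simp: dist_real_def)
  thus "eventually (\<lambda>n. norm (e n * (\<Prod>j\<in>{R<..\<xi> n}. q n j) - e n * (\<Prod>j\<in>{R<..\<xi> n}. exp (d n j)))
    \<le> C * (\<bar>u / s n\<bar> + \<bar>v / s n\<bar>) * (\<Sum>j. a j ^ 3)) sequentially"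
  proof eventually_elim
   case (elim n)
   have "norm (e n * (\<Prod>j\<in>{R<..\<xi> n}. q n j) - e n * (\<Prod>j\<in>{R<..\<xi> n}. exp (d n j)))
    = norm ((\<Prod>j\<in>{R<..\<xi> n}. q n j) - (\<Prod>j\<in>{R<..\<xi> n}. exp (d n j)))"
    unfolding right_diff_distrib[symmetric] norm_mult by (simp add: e_def)
   also have "... \<le> (\<Sum>j\<in>{R<..\<xi> n}. norm (q n j - exp (d n j)))"
    by (intro norm_prod_diff nq nd) auto
   also have "... \<le> (\<Sum>j\<in>{R<..\<xi> n}. C * (\<bar>u / s n\<bar> + \<bar>v / s n\<bar>) * a j ^ 3)"
    unfolding q_def d_def z1_def z2_def using elim B by (intro sum_mono Cb) auto
   also have "... = C * (\<bar>u / s n\<bar> + \<bar>v / s n\<bar>) * (\<Sum>j\<in>{R<..\<xi> n}. a j ^ 3)" by (simp only: sum_distrib_left)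
   also have "... \<le> C * (\<bar>u / s n\<bar> + \<bar>v / s n\<bar>) * (\<Sum>j. a j ^ 3)"
    using C by (intro mult_left_mono cube_sum_le) auto
   finally show ?case .
  qed
  have "(\<lambda>n. C * (\<bar>u / s n\<bar> + \<bar>v / s n\<bar>) * (\<Sum>j. a j ^ 3)) \<longlonglongrightarrow> C * (\<bar>0\<bar> + \<bar>0\<bar>) * (\<Sum>j. a j ^ 3)"
   by (intro tendsto_intros inv)
  thus "(\<lambda>n. C * (\<bar>u / s n\<bar> + \<bar>v / s n\<bar>) * (\<Sum>j. a j ^ 3)) \<longlonglongrightarrow> 0" by simp
 qed
 define A1 where "A1 = (\<lambda>n. (S (\<xi> n) - S R) / S (\<xi> n))"
 define A2 where "A2 = (\<lambda>n. (S (\<xi> n) - S R - ln (ln (real (\<xi> n)))) / s n)"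
 define A3 where "A3 = (\<lambda>n. (D (\<xi> n) (x - y) - D R (x - y)) / s n)"
 have S\<xi>: "filterlim (\<lambda>n. S (\<xi> n)) at_top sequentially" by (rule filterlim_compose[OF S_tendsto filterlim_subseq[OF \<xi>]])
 have limA1: "A1 \<longlonglongrightarrow> 1"
 proof -
  have A: "(\<lambda>n. 1 - S R / S (\<xi> n)) \<longlonglongrightarrow> 1 - 0"
   by (intro tendsto_intros tendsto_divide_0[OF tendsto_const filterlim_at_top_imp_at_infinity[OF S\<xi>]])
  have "eventually (\<lambda>n. S (\<xi> n) > 0) sequentially" using S\<xi> by (auto simp: filterlim_at_top_dense)
  hence ev1: "eventually (\<lambda>n. 1 - S R / S (\<xi> n) = A1 n) sequentially"
   by eventually_elim (simp add: A1_def diff_divide_distrib)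
  from A[unfolded tendsto_cong[OF ev1]] show ?thesis by simp
 qed
 have limA2: "A2 \<longlonglongrightarrow> 0"
 proof (rule Lim_null_comparison)
  have "eventually (\<lambda>n. \<xi> n \<ge> 3) sequentially" by (rule ev) (rule eventually_ge_at_top)
  thus "eventually (\<lambda>n. norm (A2 n) \<le> (C\<^sub>0 + S R) / s n) sequentially"
   using s0
  proof eventually_elim
   case (elim n)
   have "\<bar>S (\<xi> n) - S R - ln (ln (real (\<xi> n)))\<bar> \<le> C\<^sub>0 + S R"
    using S_approx[OF elim(1)] S_nonneg[of R] by (simp add: S_def abs_le_iff)
   thus ?case using elim by (simp add: A2_def divide_right_mono)
  qed
 qed (rule inv)
 have lim3: "(\<lambda>n. (\<alpha> * v + r * u) * A3 n) \<longlonglongrightarrow> 0" "(\<lambda>n. (u * v / s n) * A3 n) \<longlonglongrightarrow> 0"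
 proof -
  have "(\<lambda>n. c * A3 n) \<longlonglongrightarrow> 0" "(\<lambda>n. c / s n * A3 n) \<longlonglongrightarrow> 0" if "r = \<alpha>" for c
  proof -
   have "(\<lambda>n. D (\<xi> n) (x - y) / s n - D R (x - y) / s n) \<longlonglongrightarrow> 0 - 0"
    using r that alpha by (intro tendsto_diff inv) (auto simp: s_def)
   hence "A3 \<longlonglongrightarrow> 0" by (simp add: A3_def[abs_def] diff_divide_distrib)
   from tendsto_mult[OF tendsto_const[of c] this] tendsto_mult[OF inv[of c] this]
   show "(\<lambda>n. c * A3 n) \<longlonglongrightarrow> 0" "(\<lambda>n. c / s n * A3 n) \<longlonglongrightarrow> 0" by simp_all
  qed
  thus "(\<lambda>n. (\<alpha> * v + r * u) * A3 n) \<longlonglongrightarrow> 0" "(\<lambda>n. (u * v / s n) * A3 n) \<longlonglongrightarrow> 0" using r by (auto simp: s_def)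
 qed
 define E where "E = (\<lambda>n. of_real (- ((u^2 + v^2) / 2) * A1 n) + \<i> * of_real (\<alpha> * (u + v) / 2 * A2 n)
   + \<i> * of_real ((\<alpha> * v + r * u) * A3 n / 2) - of_real (u * v / s n * A3 n / 2))"
 have limE: "E \<longlonglongrightarrow> of_real (- ((u^2 + v^2) / 2) * 1) + \<i> * of_real (\<alpha> * (u + v) / 2 * 0) + \<i> * of_real (0 / 2) - of_real (0 / 2)"
  unfolding E_def by (intro tendsto_intros limA1 limA2 lim3) auto
 have rv: "\<alpha> * u + r * v = \<alpha> * (u + v)" using r by (auto simp: distrib_left)
 have "eventually (\<lambda>n. R \<le> \<xi> n) sequentially" by (rule ev) (rule eventually_ge_at_top)
 hence eq: "eventually (\<lambda>n. e n * (\<Prod>j\<in>{R<..\<xi> n}. exp (d n j)) = exp (E n)) sequentially"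
  using s0
 proof eventually_elim
  case (elim n)
  have S2: "S (\<xi> n) = 2 * (s n)^2" by (simp add: s_def sd_sq)
  have "(\<Sum>j\<in>{R<..\<xi> n}. d n j) = of_real (S (\<xi> n) - S R) * ((\<i> * of_real (2 * (\<alpha> * u + r * v) / s n) - of_real ((u^2 + v^2) / (s n)^2)) / 4)
   + of_real (D (\<xi> n) (x - y) - D R (x - y)) * ((\<i> * of_real ((\<alpha> * v + r * u) / s n) - of_real (u * v / (s n)^2)) / 2)"
   unfolding dval sum.distrib sum_distrib_right[symmetric] of_real_sum[symmetric] S_diff[OF elim(1)] D_diff[OF elim(1)] ..
  moreover have "\<i> * of_real (- (u / s n + v / s n) * lev (\<xi> n)) + ... = E n"
   unfolding E_def A1_def A2_def A3_def rv lev_def using elim(2)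
   by (simp add: complex_eq_iff S2 power2_eq_square field_simps)
  ultimately show ?case
   unfolding e_def exp_sum[OF finite_greaterThanAtMost, symmetric] exp_add[symmetric] by simp
 qed
 have "(\<lambda>n. exp (E n)) \<longlonglongrightarrow> exp (of_real (- ((u^2 + v^2) / 2)))"
  using tendsto_exp[OF limE] by simp
 hence "(\<lambda>n. e n * (\<Prod>j\<in>{R<..\<xi> n}. exp (d n j))) \<longlonglongrightarrow> of_real (exp (- ((u^2 + v^2) / 2)))"
  unfolding tendsto_cong[OF eq] by (simp only: exp_of_real)
 from tendsto_add[OF this diff] have "(\<lambda>n. e n * (\<Prod>j\<in>{R<..\<xi> n}. q n j)) \<longlonglongrightarrow> of_real (exp (- ((u^2 + v^2) / 2)))"
  by simp
 thus ?thesis unfolding e_def q_def z1_def z2_def s_def .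
qed

definition tilt_ft :: "('a => real) => nat => real => real => real => real => real => complex" where
 "tilt_ft wt N x y r u v = (CLINT w|M. of_real (wt w * tilt N x y r w) * iexp (u * (X N x w - lev N)) * iexp (v * (X N y w - lev N)))"

text \<open>Frequencies scaled by 1 / \<open>sd\<close> no longer see the first R phases. Those
  phases and the weight leave only the factor of their tilted mean.\<close>

lemma tilt_ft_tendsto:
 assumes wt: "wt \<in> borel_measurable (Fs R)" "\<And>w. \<bar>wt w\<bar> \<le> 1" and \<xi>: "strict_mono \<xi>"
  and r: "(r = \<alpha> \<and> (\<lambda>n. D (\<xi> n) (x - y) / sd (\<xi> n)) \<longlonglongrightarrow> 0) \<or> (r = 0 \<and> v = 0)"
 shows "(\<lambda>n. tilt_ft wt (\<xi> n) x y r (u / sd (\<xi> n)) (v / sd (\<xi> n)))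
  \<longlonglongrightarrow> of_real (expectation (\<lambda>w. wt w * tilt R x y r w)) * of_real (exp (- ((u^2 + v^2) / 2)))"
proof -
 have wM [measurable]: "wt \<in> borel_measurable M" using wt(1) by (rule measurable_Fs_M)
 have sinf: "filterlim (\<lambda>n. sd (\<xi> n)) at_top sequentially"
  by (rule filterlim_compose[OF sd_tendsto filterlim_subseq[OF \<xi>]])
 have inv: "(\<lambda>n. c / sd (\<xi> n)) \<longlonglongrightarrow> 0" for c by (rule tendsto_divide_0[OF tendsto_const filterlim_at_top_imp_at_infinity[OF sinf]])
 define g where "g = (\<lambda>n w. complex_of_real (wt w * tilt R x y r w) * iexp (u / sd (\<xi> n) * X R x w + v / sd (\<xi> n) * X R y w))"
 have "(\<lambda>n. CLINT w|M. g n w) \<longlonglongrightarrow> (CLINT w|M. complex_of_real (wt w * tilt R x y r w))"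
 proof (rule integral_dominated_convergence)
  show "integrable M (\<lambda>w. \<bar>wt w * tilt R x y r w\<bar>)" by (intro integrable_abs integrable_tilt_mult[OF wM wt(2)])
  have "(\<lambda>n. g n w) \<longlonglongrightarrow> complex_of_real (wt w * tilt R x y r w) * iexp (0 * X R x w + 0 * X R y w)" for w
   unfolding g_def by (intro tendsto_intros inv)
  thus "AE w in M. (\<lambda>n. g n w) \<longlonglongrightarrow> complex_of_real (wt w * tilt R x y r w)" by simp
  show "AE w in M. norm (g n w) \<le> \<bar>wt w * tilt R x y r w\<bar>" for n by (simp add: g_def norm_mult abs_mult)
  show "g n \<in> borel_measurable M" for n unfolding g_def by measurable
 qed measurable
 hence "(\<lambda>n. CLINT w|M. g n w) \<longlonglongrightarrow> of_real (expectation (\<lambda>w. wt w * tilt R x y r w))" by (simp only: integral_complex_of_real)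
 from tendsto_mult[OF this char_prod_tendsto[OF \<xi> r, of u R]]
 have lim: "(\<lambda>n. (CLINT w|M. g n w) * (iexp (- (u / sd (\<xi> n) + v / sd (\<xi> n)) * lev (\<xi> n)) *
   (\<Prod>j\<in>{R<..\<xi> n}. F j x y (Complex \<alpha> (u / sd (\<xi> n))) (Complex r (v / sd (\<xi> n))) / F j x y (of_real \<alpha>) (of_real r))))
  \<longlonglongrightarrow> of_real (expectation (\<lambda>w. wt w * tilt R x y r w)) * of_real (exp (- ((u^2 + v^2) / 2)))" .
 have "eventually (\<lambda>n. R \<le> \<xi> n) sequentially"
  using filterlim_subseq[OF \<xi>] by (rule eventually_compose_filterlim[rotated]) (rule eventually_ge_at_top)
 hence "eventually (\<lambda>n. (CLINT w|M. g n w) * (iexp (- (u / sd (\<xi> n) + v / sd (\<xi> n)) * lev (\<xi> n)) *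
   (\<Prod>j\<in>{R<..\<xi> n}. F j x y (Complex \<alpha> (u / sd (\<xi> n))) (Complex r (v / sd (\<xi> n))) / F j x y (of_real \<alpha>) (of_real r)))
   = tilt_ft wt (\<xi> n) x y r (u / sd (\<xi> n)) (v / sd (\<xi> n))) sequentially"
 proof eventually_elim
  case (elim n)
  show ?case unfolding tilt_ft_def g_def by (rule tilt_char[OF elim wt, symmetric])
 qed
 from lim[unfolded tendsto_cong[OF this]] show ?thesis .
qed

text \<open>For fixed distinct points \<open>D N (2 * (x - y))\<close> stays bounded in N, so the
  decay is governed by the full variance: (1/8) (sd N)^2 = \<open>S N / 16\<close>. The constant may
  depend on the points, on R and on the frequency window.\<close>

lemma norm_tilt_ft_le:
 assumes wt: "wt \<in> borel_measurable (Fs R)" "\<And>w. \<bar>wt w\<bar> \<le> 1" and r: "0 \<le> r" and xy: "x \<noteq> y" "\<bar>x - y\<bar> \<le> 1" and B: "B \<ge> 0"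
 obtains K where "\<And>N u v. R \<le> N ==> \<bar>u\<bar> \<le> B ==> \<bar>v\<bar> \<le> B ==> norm (tilt_ft wt N x y r u v) \<le> K * exp (- (1 / 8) * (sd N)^2 * (u^2 + v^2))"
proof -
 have wM [measurable]: "wt \<in> borel_measurable M" using wt(1) by (rule measurable_Fs_M)
 define B' where "B' = \<alpha> + r + B"
 obtain C where C: "C > 0" and Cb: "\<And>K N x y r1 r2 u v. K \<le> N ==> norm (Complex r1 u) \<le> B' ==> norm (Complex r2 v) \<le> B' ==>
  norm (Fp K N x y (Complex r1 u) (Complex r2 v)) \<le>
   C * exp ((r1^2 + r2^2) / 4 * (S N - S K) + r1 * r2 / 2 * (D N (x - y) - D K (x - y))
    - (u^2 + v^2) / 16 * ((S N - S K) - (D N (2 * (x - y)) - D K (2 * (x - y)))))"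
  using norm_Fp_le[where B = B'] by blast
 have "B' \<ge> 0" using alpha r B by (simp add: B'_def)
 then obtain c where c: "c > 0" and cb: "\<And>K N x y r1 r2. K \<le> N ==> 0 \<le> r1 ==> r1 \<le> B' ==> 0 \<le> r2 ==> r2 \<le> B' ==>
   Re (Fp K N x y (of_real r1) (of_real r2)) \<ge>
   c * exp ((r1^2 + r2^2) / 4 * (S N - S K) + r1 * r2 / 2 * (D N (x - y) - D K (x - y)))"
  using Fp_real_lower[where B = B'] by blast
 define C1 where "C1 = \<bar>ln (1 / (2 * \<bar>x - y\<bar>)) + C\<^sub>0\<bar>"
 have DN: "D N (2 * (x - y)) \<le> C1" for N
 proof -
  have "D N (2 * (x - y)) = D N (2 * \<bar>x - y\<bar>)"
   using D_minus[of N "2 * (x - y)"] by (cases "x - y \<ge> 0") auto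
  also have "... \<le> ln (1 / (2 * \<bar>x - y\<bar>)) + C\<^sub>0" unfolding D_def using xy by (intro D_upper) auto
  finally show ?thesis unfolding C1_def by linarith
 qed
 define G where "G = exp ((B^2 + B^2) / 16 * (S R + C1 + S R))"
 define K where "K = exp ((\<alpha> + \<bar>r\<bar>) * real R) * (C / c * G)"
 show ?thesis
 proof (rule that[of K])
  fix N u v assume N: "R \<le> N" and u: "\<bar>u\<bar> \<le> B" and v: "\<bar>v\<bar> \<le> B"
  let ?E = "exp ((\<alpha>^2 + r^2) / 4 * (S N - S R) + \<alpha> * r / 2 * (D N (x - y) - D R (x - y)))"
  define g where "g = (\<lambda>w. complex_of_real (wt w * tilt R x y r w) * iexp (u * X R x w + v * X R y w))"
  let ?P = "\<Prod>j\<in>{R<..N}. F j x y (Complex \<alpha> u) (Complex r v) / F j x y (of_real \<alpha>) (of_real r)"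
  have eq: "tilt_ft wt N x y r u v = (CLINT w|M. g w) * (iexp (- (u + v) * lev N) * ?P)"
   unfolding tilt_ft_def g_def by (rule tilt_char[OF N wt])
  have n1: "norm (CLINT w|M. g w) \<le> exp ((\<alpha> + \<bar>r\<bar>) * real R)"
  proof -
   have gb: "norm (g w) \<le> exp ((\<alpha> + \<bar>r\<bar>) * real R)" for w
   proof -
    have "\<bar>wt w\<bar> * tilt R x y r w \<le> 1 * exp ((\<alpha> + \<bar>r\<bar>) * real R)"
     using wt(2)[of w] tilt_pos[of R x y r w] by (intro mult_mono tilt_le) auto
    thus ?thesis unfolding g_def using tilt_pos[of R x y r w] by (simp add: norm_mult)
   qed
   have "g \<in> borel_measurable M" unfolding g_def by measurable
   hence "integrable M g" by (intro integrable_const_bound[OF AE_I2[OF gb]])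
   have "norm (CLINT w|M. g w) \<le> (LINT w|M. norm (g w))" by (rule integral_norm_bound)
   also have "... \<le> (LINT w|M. exp ((\<alpha> + \<bar>r\<bar>) * real R))"
    using \<open>integrable M g\<close> gb by (intro integral_mono integrable_norm) auto
   finally show ?thesis by (simp add: prob_space)
  qed
  have Peq: "?P = Fp R N x y (Complex \<alpha> u) (Complex r v) / Fp R N x y (of_real \<alpha>) (of_real r)"
   unfolding Fp_def by (simp only: prod_dividef)
  have up: "norm (Fp R N x y (Complex \<alpha> u) (Complex r v)) \<le> C * (?E * (G * exp (- (1 / 8) * (sd N)^2 * (u^2 + v^2))))"
  proof -
   have n: "norm (Complex \<alpha> u) \<le> B'" "norm (Complex r v) \<le> B'"
    using norm_Complex_le[of \<alpha> u] norm_Complex_le[of r v] alpha r u v by (auto simp: B'_def)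
   have "norm (Fp R N x y (Complex \<alpha> u) (Complex r v)) \<le> C * exp ((\<alpha>^2 + r^2) / 4 * (S N - S R) + \<alpha> * r / 2 * (D N (x - y) - D R (x - y))
    - (u^2 + v^2) / 16 * ((S N - S R) - (D N (2 * (x - y)) - D R (2 * (x - y)))))" by (rule Cb[OF N n])
   also have "... \<le> C * (?E * (G * exp (- (1 / 8) * (sd N)^2 * (u^2 + v^2))))"
   proof -
    have "- S R \<le> D R (2 * (x - y))"
    proof -
     have "(\<Sum>j=1..R. - ((a j)^2)) \<le> (\<Sum>j=1..R. (a j)^2 * cos (2 * (x - y) * l j))"
     proof (rule sum_mono)
      fix j
      have "(a j)^2 * (- 1) \<le> (a j)^2 * cos (2 * (x - y) * l j)" by (intro mult_left_mono) auto
      thus "- ((a j)^2) \<le> (a j)^2 * cos (2 * (x - y) * l j)" by simp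
     qed
     thus ?thesis by (simp add: S_def D_def sum_negf)
    qed
    hence "(S N - S R) - (D N (2 * (x - y)) - D R (2 * (x - y))) \<ge> S N - (S R + C1 + S R)"
     using DN[of N] by linarith
    hence f1: "- ((u^2 + v^2) / 16 * ((S N - S R) - (D N (2 * (x - y)) - D R (2 * (x - y))))) \<le> - ((u^2 + v^2) / 16 * (S N - (S R + C1 + S R)))"
     by (intro le_imp_neg_le mult_left_mono) auto
    have f2: "(u^2 + v^2) / 16 * (S R + C1 + S R) \<le> (B^2 + B^2) / 16 * (S R + C1 + S R)"
    proof -
     have "u^2 \<le> B^2" "v^2 \<le> B^2" using u v by (auto simp: abs_le_square_iff[symmetric])
     thus ?thesis using S_nonneg[of R] by (intro mult_right_mono) (auto simp: C1_def)
    qed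
    have f3: "(u^2 + v^2) / 16 * S N = (1 / 8) * (sd N)^2 * (u^2 + v^2)" unfolding sd_sq by simp
    have f4: "k * (S N - c) = k * S N - k * c" for k c :: real by (rule right_diff_distrib)
    have "- ((u^2 + v^2) / 16 * ((S N - S R) - (D N (2 * (x - y)) - D R (2 * (x - y)))))
     \<le> (B^2 + B^2) / 16 * (S R + C1 + S R) + - (1 / 8) * (sd N)^2 * (u^2 + v^2)" using f1 f2 f3 f4[of "(u^2 + v^2) / 16" "S R + C1 + S R"] by (simp only: minus_mult_left[symmetric])
    thus ?thesis using C unfolding G_def exp_add[symmetric] by (intro mult_left_mono) auto
   qed
   finally show ?thesis .
  qed
  have low: "norm (Fp R N x y (of_real \<alpha>) (of_real r)) \<ge> c * ?E"
   using cb[OF N, of \<alpha> r x y] alpha r B complex_Re_le_cmod[of "Fp R N x y (of_real \<alpha>) (of_real r)"] by (auto simp: B'_def)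
  have "norm ?P \<le> (C * (?E * (G * exp (- (1 / 8) * (sd N)^2 * (u^2 + v^2))))) / (c * ?E)"
   unfolding Peq norm_divide using up low c order_trans[OF norm_ge_zero up] by (intro frac_le) auto
  also have "... = C / c * G * exp (- (1 / 8) * (sd N)^2 * (u^2 + v^2))" using c by simp
  finally have n2: "norm ?P \<le> C / c * G * exp (- (1 / 8) * (sd N)^2 * (u^2 + v^2))" .
  have "norm (tilt_ft wt N x y r u v) = norm (CLINT w|M. g w) * norm ?P" unfolding eq by (simp add: norm_mult)
  also have "... \<le> exp ((\<alpha> + \<bar>r\<bar>) * real R) * (C / c * G * exp (- (1 / 8) * (sd N)^2 * (u^2 + v^2)))"
   using n1 n2 by (intro mult_mono) auto
  finally show "norm (tilt_ft wt N x y r u v) \<le> K * exp (- (1 / 8) * (sd N)^2 * (u^2 + v^2))" by (simp add: K_def)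
 qed
qed

end

context log_field
begin

lemma sd_pos: "N \<ge> 1 ==> sd N > 0"
proof -
 assume N: "N \<ge> 1"
 have "0 < (\<Sum>j=1..N. (a j)^2)" using N by (intro sum_pos zero_less_power a_pos) auto
 thus ?thesis by (simp add: sd_def S_def)
qed

lemma tilt_ft_measurable:
 assumes [measurable]: "wt \<in> borel_measurable M"
 shows "(\<lambda>(u, v). tilt_ft wt N x y r u v) \<in> borel_measurable (borel \<Otimes>\<^sub>M borel)"
 unfolding tilt_ft_def by measurable

lemma integrable_tilt_kern:
 assumes wt: "wt \<in> borel_measurable M" "\<And>w. \<bar>wt w\<bar> \<le> 1" and [measurable]: "p \<in> borel_measurable M"
 shows "integrable M (\<lambda>w. complex_of_real (wt w * tilt N x y r w) * iexp (p w))"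
 by (rule Bochner_Integration.integrable_bound[OF integrable_tilt_mult[OF wt, of N x y r]]) (use wt in \<open>auto simp: norm_mult abs_mult\<close>)

text \<open>A local limit theorem at density scale: mass near the level is 1 / \<open>sd\<close>
  times the value of the standard normal density at 0. The limit is found for the kernel modulated
  by arbitrary frequencies and passed to f by \<open>weighted_levy_continuity\<close>;
  \<open>integral_kern_iexp\<close> identifies the constant.\<close>

lemma tilt_local_limit:
 assumes wt: "wt \<in> borel_measurable (Fs R)" "\<And>w. 0 \<le> wt w" "\<And>w. wt w \<le> 1"
  and \<xi>: "strict_mono \<xi>" "\<And>n. \<xi> n \<ge> 1"
  and r: "(r = \<alpha> \<and> (\<lambda>n. D (\<xi> n) (x - y) / sd (\<xi> n)) \<longlonglongrightarrow> 0) \<or> r = 0"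
  and xy: "x \<noteq> y" "\<bar>x - y\<bar> \<le> 1"
  and f [measurable]: "f \<in> borel_measurable borel" and Bf: "\<And>y. \<bar>f y\<bar> \<le> Bf * kern y" and cont: "AE y in lborel. isCont f y"
 shows "(\<lambda>n. sd (\<xi> n) * expectation (\<lambda>w. wt w * tilt (\<xi> n) x y r w * f (X (\<xi> n) x w - lev (\<xi> n))))
  \<longlonglongrightarrow> expectation (\<lambda>w. wt w * tilt R x y r w) / sqrt (2 * pi) * (LBINT y. f y)"
proof -
 have wM [measurable]: "wt \<in> borel_measurable M" using wt(1) by (rule measurable_Fs_M)
 have w1: "\<bar>wt w\<bar> \<le> 1" for w using wt(2)[of w] wt(3)[of w] by simp
 have kn: "0 \<le> kern y" "kern y \<le> 1" for y using kern_pos[of y] kern_le[of y] by auto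
 have s0: "sd (\<xi> n) > 0" for n using \<xi>(2) by (rule sd_pos)
 define E where "E = expectation (\<lambda>w. wt w * tilt R x y r w)"
 have E0: "E \<ge> 0" unfolding E_def using wt(2) tilt_pos by (intro integral_nonneg_AE AE_I2 mult_nonneg_nonneg) (auto simp: less_imp_le)
 define Y where "Y = (\<lambda>n w. X (\<xi> n) x w - lev (\<xi> n))"
 have [measurable]: "Y n \<in> borel_measurable M" for n unfolding Y_def by measurable
 have r': "(r = \<alpha> \<and> (\<lambda>n. D (\<xi> n) (x - y) / sd (\<xi> n)) \<longlonglongrightarrow> 0) \<or> (r = 0 \<and> (0::real) = 0)" using r by simp
 have r0: "r \<ge> 0" using r alpha by auto
 have "(\<lambda>n. LINT w|M. (sd (\<xi> n) * (wt w * tilt (\<xi> n) x y r w)) * f (Y n w)) \<longlonglongrightarrow> E / sqrt (2 * pi) * (LBINT y. f y)"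
 proof (rule weighted_levy_continuity[OF _ _ _ _ _ _ f Bf cont])
  show "0 \<le> sd (\<xi> n) * (wt w * tilt (\<xi> n) x y r w)" for n w
   by (intro mult_nonneg_nonneg sd_nonneg wt less_imp_le[OF tilt_pos])
  show "0 \<le> E / sqrt (2 * pi)" using E0 by simp
  show "integrable M (\<lambda>w. sd (\<xi> n) * (wt w * tilt (\<xi> n) x y r w) * kern (Y n w))" for n
  proof -
   have "\<bar>wt w * kern (Y n w)\<bar> \<le> 1" for w using w1[of w] kn[of "Y n w"] by (simp add: abs_mult mult_le_one)
   hence "integrable M (\<lambda>w. sd (\<xi> n) * ((wt w * kern (Y n w)) * tilt (\<xi> n) x y r w))"
    by (intro integrable_mult_right integrable_tilt_mult) auto
   thus ?thesis by (simp only: mult_ac)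
  qed
  fix a
  define \<Psi> where "\<Psi> = (\<lambda>n u. tilt_ft wt (\<xi> n) x y r u 0)"
  \<comment> \<open>Multiplication by the kernel is convolution with \<open>kern_ft\<close> on the
    Fourier side, so only frequencies within distance 1 of a are involved.\<close>
  have eq: "(CLINT w|M. of_real (sd (\<xi> n) * (wt w * tilt (\<xi> n) x y r w) * kern (Y n w)) * iexp (a * Y n w))
   = of_real (sd (\<xi> n)) * (CLBINT u. kern_ft u * \<Psi> n (u + a))" for n
  proof -
   have "(CLINT w|M. of_real (sd (\<xi> n) * (wt w * tilt (\<xi> n) x y r w) * kern (Y n w)) * iexp (a * Y n w))
    = (CLINT w|M. of_real (sd (\<xi> n)) * ((of_real (wt w * tilt (\<xi> n) x y r w) * iexp (a * Y n w)) * of_real (kern (Y n w))))"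
    by (simp only: of_real_mult mult_ac)
   also have "... = of_real (sd (\<xi> n)) * (CLINT w|M. (of_real (wt w * tilt (\<xi> n) x y r w) * iexp (a * Y n w)) * of_real (kern (Y n w)))"
    by (rule integral_mult_right_zero)
   also have "(CLINT w|M. (of_real (wt w * tilt (\<xi> n) x y r w) * iexp (a * Y n w)) * of_real (kern (Y n w)))
    = (CLBINT u. kern_ft u * (CLINT w|M. (of_real (wt w * tilt (\<xi> n) x y r w) * iexp (a * Y n w)) * iexp (u * Y n w)))"
    by (rule integral_kern_rep(1)[OF kern_rep_kern integrable_tilt_kern[OF wM w1]]) measurable
   also have "... = (CLBINT u. kern_ft u * \<Psi> n (u + a))"
   proof -
    have shift: "iexp ((u + a) * z) = iexp (a * z) * iexp (u * z)" for u z
     unfolding exp_add[symmetric] by (rule arg_cong[where f = exp]) (simp add: algebra_simps)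
    show ?thesis unfolding \<Psi>_def tilt_ft_def Y_def shift by (simp only: mult.assoc mult_zero_left of_real_0 mult_zero_right exp_zero mult_1_right)
   qed
   finally show ?thesis .
  qed
  have "1 + \<bar>a\<bar> \<ge> 0" by simp
  then obtain K where K: "\<And>N u v. R \<le> N ==> \<bar>u\<bar> \<le> 1 + \<bar>a\<bar> ==> \<bar>v\<bar> \<le> 1 + \<bar>a\<bar> ==> norm (tilt_ft wt N x y r u v) \<le> K * exp (- (1 / 8) * (sd N)^2 * (u^2 + v^2))"
   using norm_tilt_ft_le[OF wt(1) w1 r0 xy, of "1 + \<bar>a\<bar>"] by blast
  have "(\<lambda>n. of_real (sd (\<xi> n)) * (CLBINT u. kern_ft u * \<Psi> n (u + a))) \<longlonglongrightarrow> of_real E * kern_ft (- a) * of_real (sqrt (2 * pi))"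
  proof (rule kern_scaling_limit[where c = "1 / 8" and K = K])
   have "(\<lambda>u. case (u, 0) of (u, v) => tilt_ft wt (\<xi> n) x y r u v) \<in> borel_measurable borel" for n
    by (rule measurable_compose[OF _ tilt_ft_measurable[OF wM]]) measurable
   thus "\<Psi> n \<in> borel_measurable borel" for n by (simp add: \<Psi>_def)
   show "filterlim (\<lambda>n. sd (\<xi> n)) at_top sequentially" by (rule filterlim_compose[OF sd_tendsto filterlim_subseq[OF \<xi>(1)]])
   have "eventually (\<lambda>n. R \<le> \<xi> n) sequentially"
    using filterlim_subseq[OF \<xi>(1)] by (rule eventually_compose_filterlim[rotated]) (rule eventually_ge_at_top)
   thus "\<forall>\<^sub>F n in sequentially. \<forall>u. \<bar>u\<bar> \<le> 1 + \<bar>a\<bar> \<longrightarrow> norm (\<Psi> n u) \<le> K * exp (- (1 / 8) * (sd (\<xi> n))^2 * u^2)"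
   proof eventually_elim
    case (elim n)
    show ?case using K[OF elim, of _ 0] by (simp add: \<Psi>_def)
   qed
   show "(\<lambda>n. \<Psi> n (u / sd (\<xi> n))) \<longlonglongrightarrow> of_real E * of_real (exp (- (u^2 / 2)))" for u
    using tilt_ft_tendsto[OF wt(1) w1 \<xi>(1) r', of u] by (simp add: \<Psi>_def E_def)
  qed (use s0 in auto)
  moreover have "of_real E * kern_ft (- a) * of_real (sqrt (2 * pi)) = of_real (E / sqrt (2 * pi)) * (of_real (2 * pi) * kern_ft (- a))"
  proof -
   have "2 * pi = sqrt (2 * pi) * sqrt (2 * pi)" by simp
   hence "E * sqrt (2 * pi) = E / sqrt (2 * pi) * (2 * pi)" by (simp add: field_simps)
   hence "complex_of_real E * of_real (sqrt (2 * pi)) = of_real (E / sqrt (2 * pi)) * of_real (2 * pi)"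
    unfolding of_real_mult[symmetric] by (simp only:)
   thus ?thesis by (metis mult.assoc mult.commute)
  qed
  ultimately show "(\<lambda>n. CLINT w|M. of_real (sd (\<xi> n) * (wt w * tilt (\<xi> n) x y r w) * kern (Y n w)) * iexp (a * Y n w))
   \<longlonglongrightarrow> of_real (E / sqrt (2 * pi)) * (CLBINT y. of_real (kern y) * iexp (a * y))"
   unfolding eq integral_kern_iexp by (simp only:)
 qed measurable
 moreover have "(LINT w|M. (sd (\<xi> n) * (wt w * tilt (\<xi> n) x y r w)) * f (Y n w)) = sd (\<xi> n) * expectation (\<lambda>w. wt w * tilt (\<xi> n) x y r w * f (X (\<xi> n) x w - lev (\<xi> n)))" for n
  unfolding Y_def mult.assoc by (rule integral_mult_right_zero)
 ultimately show ?thesis by (simp only: E_def)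
qed

text \<open>As the normalised covariance vanishes, the two fields behave as independent Gaussians
  near the level, and the limit is a product.\<close>

lemma tilt_local_limit2:
 assumes wt: "wt \<in> borel_measurable (Fs R)" "\<And>w. 0 \<le> wt w" "\<And>w. wt w \<le> 1"
  and \<xi>: "strict_mono \<xi>" "\<And>n. \<xi> n \<ge> 1"
  and D: "(\<lambda>n. D (\<xi> n) (x - y) / sd (\<xi> n)) \<longlonglongrightarrow> 0"
  and xy: "x \<noteq> y" "\<bar>x - y\<bar> \<le> 1"
  and f [measurable]: "f \<in> borel_measurable borel" and Bf: "\<And>y. \<bar>f y\<bar> \<le> Bf * kern y" and f0: "\<And>y. f y \<ge> 0" and cont: "AE y in lborel. isCont f y"
 shows "(\<lambda>n. (sd (\<xi> n))^2 * expectation (\<lambda>w. wt w * tilt (\<xi> n) x y \<alpha> w * f (X (\<xi> n) x w - lev (\<xi> n)) * f (X (\<xi> n) y w - lev (\<xi> n))))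
  \<longlonglongrightarrow> expectation (\<lambda>w. wt w * tilt R x y \<alpha> w) / (2 * pi) * (LBINT y. f y)^2"
proof -
 have wM [measurable]: "wt \<in> borel_measurable M" using wt(1) by (rule measurable_Fs_M)
 have w1: "\<bar>wt w\<bar> \<le> 1" for w using wt(2)[of w] wt(3)[of w] by simp
 have kn: "0 \<le> kern y" "kern y \<le> 1" for y using kern_pos[of y] kern_le[of y] by auto
 have s0: "sd (\<xi> n) > 0" for n using \<xi>(2) by (rule sd_pos)
 define E where "E = expectation (\<lambda>w. wt w * tilt R x y \<alpha> w)"
 have E0: "E \<ge> 0" unfolding E_def using wt(2) tilt_pos by (intro integral_nonneg_AE AE_I2 mult_nonneg_nonneg) (auto simp: less_imp_le)
 define Y where "Y = (\<lambda>n w. X (\<xi> n) x w - lev (\<xi> n))"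
 define Z where "Z = (\<lambda>n w. X (\<xi> n) y w - lev (\<xi> n))"
 have [measurable]: "Y n \<in> borel_measurable M" "Z n \<in> borel_measurable M" for n unfolding Y_def Z_def by measurable
 have r': "(\<alpha> = \<alpha> \<and> (\<lambda>n. D (\<xi> n) (x - y) / sd (\<xi> n)) \<longlonglongrightarrow> 0) \<or> (\<alpha> = 0 \<and> v = 0)" for v :: real using D by simp
 have a0: "\<alpha> \<ge> 0" using alpha by simp
 have "(\<lambda>n. LINT w|M. ((sd (\<xi> n))^2 * (wt w * tilt (\<xi> n) x y \<alpha> w)) * f (Y n w) * f (Z n w)) \<longlonglongrightarrow> E / (2 * pi) * (LBINT y. f y) * (LBINT y. f y)"
 proof (rule weighted_levy_continuity2[OF _ _ _ _ _ _ _ f Bf f0 cont f Bf cont])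
  show "0 \<le> (sd (\<xi> n))^2 * (wt w * tilt (\<xi> n) x y \<alpha> w)" for n w
   by (intro mult_nonneg_nonneg zero_le_power2 wt less_imp_le[OF tilt_pos])
  show "0 \<le> E / (2 * pi)" using E0 by simp
  show "integrable M (\<lambda>w. (sd (\<xi> n))^2 * (wt w * tilt (\<xi> n) x y \<alpha> w) * kern (Y n w) * kern (Z n w))" for n
  proof -
   have "\<bar>wt w * (kern (Y n w) * kern (Z n w))\<bar> \<le> 1" for w
   proof -
    have "kern (Y n w) * kern (Z n w) \<le> 1" by (intro mult_le_one kn)
    thus ?thesis using w1[of w] kn[of "Y n w"] kn[of "Z n w"] by (simp add: abs_mult mult_le_one)
   qed
   hence "integrable M (\<lambda>w. (sd (\<xi> n))^2 * ((wt w * (kern (Y n w) * kern (Z n w))) * tilt (\<xi> n) x y \<alpha> w))"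
    by (intro integrable_mult_right integrable_tilt_mult) auto
   thus ?thesis by (simp only: mult_ac)
  qed
  fix a b
  define \<Psi> where "\<Psi> = (\<lambda>n u v. tilt_ft wt (\<xi> n) x y \<alpha> u v)"
  have shift: "iexp ((u + c) * z) = iexp (c * z) * iexp (u * z)" for u c z
   unfolding exp_add[symmetric] by (rule arg_cong[where f = exp]) (simp add: algebra_simps)
  have eq: "(CLINT w|M. of_real ((sd (\<xi> n))^2 * (wt w * tilt (\<xi> n) x y \<alpha> w) * kern (Y n w) * kern (Z n w)) * iexp (a * Y n w) * iexp (b * Z n w))
   = of_real ((sd (\<xi> n))^2) * (CLBINT u. kern_ft u * (CLBINT v. kern_ft v * \<Psi> n (u + a) (v + b)))" for n
  proof -
   define h where "h = (\<lambda>w. complex_of_real (wt w * tilt (\<xi> n) x y \<alpha> w))"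
   have split: "iexp (p * Y n w) * iexp (q * Z n w) = iexp (p * Y n w + q * Z n w)" for p q w
    unfolding exp_add[symmetric] of_real_add distrib_left ..
   have hi: "integrable M (\<lambda>w. h w * iexp (p * Y n w) * iexp (q * Z n w))" for p q
    unfolding h_def mult.assoc split by (rule integrable_tilt_kern[OF wM w1]) measurable
   have inner: "(CLINT w|M. (h w * iexp (p * Y n w) * iexp (b * Z n w)) * of_real (kern (Z n w))) = (CLBINT v. kern_ft v * \<Psi> n p (v + b))" for p
   proof -
    have "(CLINT w|M. (h w * iexp (p * Y n w) * iexp (b * Z n w)) * of_real (kern (Z n w)))
     = (CLBINT v. kern_ft v * (CLINT w|M. (h w * iexp (p * Y n w) * iexp (b * Z n w)) * iexp (v * Z n w)))"
     by (rule integral_kern_rep(1)[OF kern_rep_kern hi]) measurable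
    also have "... = (CLBINT v. kern_ft v * \<Psi> n p (v + b))"
     unfolding \<Psi>_def tilt_ft_def h_def Y_def Z_def shift by (simp only: mult.assoc)
    finally show ?thesis .
   qed
   have i2: "integrable M (\<lambda>w. (h w * iexp (a * Y n w) * iexp (b * Z n w)) * of_real (kern (Z n w)))"
    by (rule integral_kern_rep(2)[OF kern_rep_kern hi]) measurable
   have "(CLINT w|M. of_real ((sd (\<xi> n))^2 * (wt w * tilt (\<xi> n) x y \<alpha> w) * kern (Y n w) * kern (Z n w)) * iexp (a * Y n w) * iexp (b * Z n w))
    = (CLINT w|M. of_real ((sd (\<xi> n))^2) * (((h w * iexp (a * Y n w) * iexp (b * Z n w)) * of_real (kern (Z n w))) * of_real (kern (Y n w))))"
    unfolding h_def by (simp only: of_real_mult mult_ac)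
   also have "... = of_real ((sd (\<xi> n))^2) * (CLINT w|M. ((h w * iexp (a * Y n w) * iexp (b * Z n w)) * of_real (kern (Z n w))) * of_real (kern (Y n w)))"
    by (rule integral_mult_right_zero)
   also have "(CLINT w|M. ((h w * iexp (a * Y n w) * iexp (b * Z n w)) * of_real (kern (Z n w))) * of_real (kern (Y n w)))
    = (CLBINT u. kern_ft u * (CLINT w|M. ((h w * iexp (a * Y n w) * iexp (b * Z n w)) * of_real (kern (Z n w))) * iexp (u * Y n w)))"
    by (rule integral_kern_rep(1)[OF kern_rep_kern i2]) measurable
   also have "... = (CLBINT u. kern_ft u * (CLINT w|M. (h w * iexp ((u + a) * Y n w) * iexp (b * Z n w)) * of_real (kern (Z n w))))"
    unfolding shift by (simp only: mult_ac)
   finally show ?thesis by (simp only: inner)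
  qed
  have "1 + \<bar>a\<bar> + \<bar>b\<bar> \<ge> 0" by simp
  then obtain K where K: "\<And>N u v. R \<le> N ==> \<bar>u\<bar> \<le> 1 + \<bar>a\<bar> + \<bar>b\<bar> ==> \<bar>v\<bar> \<le> 1 + \<bar>a\<bar> + \<bar>b\<bar> ==> norm (tilt_ft wt N x y \<alpha> u v) \<le> K * exp (- (1 / 8) * (sd N)^2 * (u^2 + v^2))"
   using norm_tilt_ft_le[OF wt(1) w1 a0 xy, of "1 + \<bar>a\<bar> + \<bar>b\<bar>"] by blast
  have "(\<lambda>n. of_real ((sd (\<xi> n))^2) * (CLBINT u. kern_ft u * (CLBINT v. kern_ft v * \<Psi> n (u + a) (v + b)))) \<longlonglongrightarrow> of_real E * kern_ft (- a) * kern_ft (- b) * of_real (2 * pi)"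
  proof (rule kern_scaling_limit2[where c = "1 / 8" and K = K])
   show "(\<lambda>(u, v). \<Psi> n u v) \<in> borel_measurable (borel \<Otimes>\<^sub>M borel)" for n
    unfolding \<Psi>_def by (rule tilt_ft_measurable[OF wM])
   show "filterlim (\<lambda>n. sd (\<xi> n)) at_top sequentially" by (rule filterlim_compose[OF sd_tendsto filterlim_subseq[OF \<xi>(1)]])
   have "eventually (\<lambda>n. R \<le> \<xi> n) sequentially"
    using filterlim_subseq[OF \<xi>(1)] by (rule eventually_compose_filterlim[rotated]) (rule eventually_ge_at_top)
   thus "\<forall>\<^sub>F n in sequentially. \<forall>u v. \<bar>u\<bar> \<le> 1 + \<bar>a\<bar> \<longrightarrow> \<bar>v\<bar> \<le> 1 + \<bar>b\<bar> \<longrightarrow> norm (\<Psi> n u v) \<le> K * exp (- (1 / 8) * (sd (\<xi> n))^2 * (u^2 + v^2))"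
   proof eventually_elim
    case (elim n)
    show ?case unfolding \<Psi>_def by (intro allI impI K[OF elim]) auto
   qed
   show "(\<lambda>n. \<Psi> n (u / sd (\<xi> n)) (v / sd (\<xi> n))) \<longlonglongrightarrow> of_real E * of_real (exp (- ((u^2 + v^2) / 2)))" for u v
    using tilt_ft_tendsto[OF wt(1) w1 \<xi>(1) r', of u v] by (simp only: \<Psi>_def E_def)
  qed (use s0 in auto)
  moreover have "of_real E * kern_ft (- a) * kern_ft (- b) * of_real (2 * pi) = of_real (E / (2 * pi)) * (of_real (2 * pi) * kern_ft (- a)) * (of_real (2 * pi) * kern_ft (- b))"
  proof -
   have "E = E / (2 * pi) * (2 * pi)" by simp
   hence "complex_of_real E = of_real (E / (2 * pi)) * of_real (2 * pi)" by (simp only: of_real_mult[symmetric])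
   thus ?thesis by (simp only: mult_ac)
  qed
  ultimately show "(\<lambda>n. CLINT w|M. of_real ((sd (\<xi> n))^2 * (wt w * tilt (\<xi> n) x y \<alpha> w) * kern (Y n w) * kern (Z n w)) * iexp (a * Y n w) * iexp (b * Z n w))
   \<longlonglongrightarrow> of_real (E / (2 * pi)) * (CLBINT y. of_real (kern y) * iexp (a * y)) * (CLBINT y. of_real (kern y) * iexp (b * y))"
   unfolding eq integral_kern_iexp by (simp only:)
 qed measurable
 moreover have "(LINT w|M. ((sd (\<xi> n))^2 * (wt w * tilt (\<xi> n) x y \<alpha> w)) * f (Y n w) * f (Z n w)) = (sd (\<xi> n))^2 * expectation (\<lambda>w. wt w * tilt (\<xi> n) x y \<alpha> w * f (X (\<xi> n) x w - lev (\<xi> n)) * f (X (\<xi> n) y w - lev (\<xi> n)))" for n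
  unfolding Y_def Z_def mult.assoc by (rule integral_mult_right_zero)
 ultimately show ?thesis by (simp only: E_def power2_eq_square mult.assoc)
qed

end

context log_field
begin

section \<open>Moment bounds\<close>

lemma phi_bounds:
 obtains c C where "c > 0" "C > 0" "\<And>N. c * exp (\<alpha>^2 / 4 * S N) \<le> phi N" "\<And>N. phi N \<le> C * exp (\<alpha>^2 / 4 * S N)"
proof -
 obtain C where C: "C > 0" and Cb: "\<And>K N x y r1 r2 u v. K \<le> N ==> norm (Complex r1 u) \<le> \<alpha> ==> norm (Complex r2 v) \<le> \<alpha> ==>
  norm (Fp K N x y (Complex r1 u) (Complex r2 v)) \<le>
   C * exp ((r1^2 + r2^2) / 4 * (S N - S K) + r1 * r2 / 2 * (D N (x - y) - D K (x - y))
    - (u^2 + v^2) / 16 * ((S N - S K) - (D N (2 * (x - y)) - D K (2 * (x - y)))))"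
  using norm_Fp_le[where B = \<alpha>] by blast
 have "\<alpha> \<ge> 0" using alpha by simp
 then obtain c where c: "c > 0" and cb: "\<And>K N x y r1 r2. K \<le> N ==> 0 \<le> r1 ==> r1 \<le> \<alpha> ==> 0 \<le> r2 ==> r2 \<le> \<alpha> ==>
   Re (Fp K N x y (of_real r1) (of_real r2)) \<ge>
   c * exp ((r1^2 + r2^2) / 4 * (S N - S K) + r1 * r2 / 2 * (D N (x - y) - D K (x - y)))"
  using Fp_real_lower[where B = \<alpha>] by blast
 show ?thesis
 proof (rule that[OF c C])
  fix N
  show "c * exp (\<alpha>^2 / 4 * S N) \<le> phi N"
   using cb[of 0 N \<alpha> 0 0 0] alpha by (simp add: phi_def)
  have z: "Complex \<alpha> 0 = of_real \<alpha>" "Complex 0 0 = 0" by (auto simp: complex_eq_iff)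
  have "phi N \<le> norm (Fp 0 N 0 0 (Complex \<alpha> 0) (Complex 0 0))" unfolding phi_def z by (rule complex_Re_le_cmod)
  also have "... \<le> C * exp (\<alpha>^2 / 4 * S N)"
   using Cb[of 0 N \<alpha> 0 0 0 0 0] alpha unfolding z by simp
  finally show "phi N \<le> C * exp (\<alpha>^2 / 4 * S N)" .
 qed
qed

lemma D_abs: "D N \<bar>t\<bar> = D N t"
 by (cases "t \<ge> 0") (auto simp: D_minus)

text \<open>On the truncated event the two-point function grows with exponent \<alpha> * \<beta> -
  \<alpha>^2 / 4 = \<alpha>^2 / 4 + \<alpha> * \<eta> per unit of \<open>S\<close>. This must be
  below 1, that is \<eta> < (1 - \<alpha>^2 / 4) / \<alpha>; the choice is half of this, and it is
  positive exactly because \<alpha> < 2.\<close>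

definition \<eta> :: real where "\<eta> = (1 - \<alpha>\<^sup>2 / 4) / (2 * \<alpha>)"
definition \<beta> :: real where "\<beta> = \<alpha> / 2 + \<eta>"
definition amp :: "nat => real => 'a => real" where "amp N x w = exp (\<alpha> * X N x w) / phi N"
text \<open>The majorant shared by the density of the chaos and the normalised level
  indicator.\<close>

definition amp_bnd :: "nat => real => 'a => real" where "amp_bnd N x w = amp N x w * bnd N (X N x w - lev N)"

lemma alpha_sq: "\<alpha>^2 < 4"
 using alpha power_strict_mono[of \<alpha> 2 2] by simp

lemma eta_pos: "\<eta> > 0"
 using alpha alpha_sq by (simp add: \<eta>_def)

lemma amp_pos: "amp N x w > 0"
 using phi_ge_1[of N] by (simp add: amp_def)

lemma amp_measurable [measurable]: "amp N x \<in> borel_measurable M"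
 unfolding amp_def by measurable

lemma amp_bnd_measurable [measurable]: "amp_bnd N x \<in> borel_measurable M"
 unfolding amp_bnd_def by measurable

lemma amp_le: "amp N x w \<le> exp (\<alpha> * real N)"
proof -
 have "\<alpha> * X N x w \<le> \<alpha> * real N" using X_bounded[of N x w] alpha by (intro mult_left_mono) auto
 hence "exp (\<alpha> * X N x w) / phi N \<le> exp (\<alpha> * real N) / 1"
  using phi_ge_1[of N] by (intro frac_le) auto
 thus ?thesis by (simp add: amp_def)
qed

lemma amp_bnd_pos: "amp_bnd N x w > 0"
 unfolding amp_bnd_def using amp_pos[of N x w] bnd_ge_1[of N "X N x w - lev N"] by (intro mult_pos_pos) auto

lemma amp_le_amp_bnd: "amp N x w \<le> amp_bnd N x w"
 unfolding amp_bnd_def using amp_pos[of N x w] bnd_ge_1[of N "X N x w - lev N"] by simp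

lemma amp_bnd_le: "amp_bnd N x w \<le> exp (\<alpha> * real N) * (1 + sd N)"
 unfolding amp_bnd_def using amp_le[of N x w] amp_pos[of N x w] bnd_ge_1[of N "X N x w - lev N"] bnd_le[of N "X N x w - lev N"]
 by (intro mult_mono) auto

lemma integrable_exp_bnd:
 "integrable M (\<lambda>w. exp (p * X K x w + \<alpha> * (X N x w - X K x w) + r2 * X N y w) * bnd N (X N x w - L) * bnd N (X N y w - L))"
proof (rule integrable_const_bound)
 let ?B = "\<bar>p\<bar> * real K + \<alpha> * (real N + real K) + \<bar>r2\<bar> * real N"
 have m: "c * z \<le> \<bar>c\<bar> * B" if "\<bar>z\<bar> \<le> B" for c z B :: real
 proof -
  have "c * z \<le> \<bar>c\<bar> * \<bar>z\<bar>" by (metis abs_ge_self abs_mult)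
  also have "... \<le> \<bar>c\<bar> * B" using that by (intro mult_left_mono) auto
  finally show ?thesis .
 qed
 have "\<bar>X N x w - X K x w\<bar> \<le> real N + real K" for w using X_bounded[of N x w] X_bounded[of K x w] by linarith
 hence e: "exp (p * X K x w + \<alpha> * (X N x w - X K x w) + r2 * X N y w) \<le> exp ?B" for w
  using m[OF X_bounded, of p K x w] m[of "X N x w - X K x w" "real N + real K" \<alpha>] m[OF X_bounded, of r2 N y w] alpha by (simp add: add_mono)
 have "norm (exp (p * X K x w + \<alpha> * (X N x w - X K x w) + r2 * X N y w) * bnd N (X N x w - L) * bnd N (X N y w - L)) \<le> exp ?B * (1 + sd N) * (1 + sd N)" for w
  unfolding norm_mult using e[of w] bnd_ge_1[of N "X N x w - L"] bnd_ge_1[of N "X N y w - L"] bnd_le[of N "X N x w - L"] bnd_le[of N "X N y w - L"]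
  by (intro mult_mono) auto
 thus "AE w in M. norm (exp (p * X K x w + \<alpha> * (X N x w - X K x w) + r2 * X N y w) * bnd N (X N x w - L) * bnd N (X N y w - L)) \<le> exp ?B * (1 + sd N) * (1 + sd N)"
  by simp
qed measurable

lemma amp_bnd_mono_expectation:
 assumes f: "\<And>w. f w \<le> d * (exp (p * X K x w + \<alpha> * (X N x w - X K x w) + r2 * X N y w) * bnd N (X N x w - L) * bnd N (X N y w - L))"
  and d: "d \<ge> 0"
 shows "expectation f \<le> d * expectation (\<lambda>w. exp (p * X K x w + \<alpha> * (X N x w - X K x w) + r2 * X N y w) * bnd N (X N x w - L) * bnd N (X N y w - L))"
proof -
 have b: "bnd N z \<ge> 0" for z using bnd_ge_1[of N z] by simp
 have "expectation f \<le> expectation (\<lambda>w. d * (exp (p * X K x w + \<alpha> * (X N x w - X K x w) + r2 * X N y w) * bnd N (X N x w - L) * bnd N (X N y w - L)))"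
  by (intro integral_mono' integrable_mult_right integrable_exp_bnd f mult_nonneg_nonneg d b) auto
 thus ?thesis by simp
qed

text \<open>
 Chernoff's inequality with parameter \<open>\<mu>\<close>: the exponent \<open>\<mu> \<eta> - \<mu>\<^sup>2 / 4\<close> is the cost of the
 field exceeding, under the tilted measure, its typical value \<open>\<alpha> / 2 * S K\<close> by \<open>\<eta> * S K\<close>.
\<close>
lemma tail_moment:
 assumes r2: "r2 = 0 \<or> r2 = \<alpha>"
 obtains C where "C > 0" "\<And>K N x y \<mu> f. K \<le> N ==> x \<noteq> y ==> \<bar>x - y\<bar> \<le> 1 ==> ln (1 / \<bar>x - y\<bar>) \<le> L ==> 0 \<le> \<mu> ==> \<mu> \<le> 2 * \<eta> ==>
   (\<And>w. f w \<le> exp (\<mu> * (X K x w - \<beta> * S K)) * amp_bnd N x w * (exp (r2 * X N y w) * bnd N (X N y w - lev N))) ==>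
   expectation f \<le> C * exp (r2^2 / 4 * S N - (\<mu> * \<eta> - \<mu>\<^sup>2 / 4) * S K)"
proof -
 obtain c where c: "c > 0" "\<And>N. c * exp (\<alpha>^2 / 4 * S N) \<le> phi N" using phi_bounds by metis
 define L' where "L' = \<bar>L\<bar> + \<bar>C\<^sub>0\<bar>"
 have r2a: "0 \<le> r2" "r2 \<le> \<alpha>" using r2 alpha by auto
 have B: "\<alpha> + 2 * \<eta> \<ge> 0" using alpha eta_pos by simp
 obtain C where C: "C > 0" and Cb: "\<And>K K' N x y p l. K \<le> N ==> K' \<le> N ==> \<bar>p\<bar> \<le> \<alpha> + 2 * \<eta> ==> D N (2 * (x - y)) \<le> S K' + L' ==>
   expectation (\<lambda>w. exp (p * X K x w + \<alpha> * (X N x w - X K x w) + r2 * X N y w) * bnd N (X N x w - l) * bnd N (X N y w - l))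
    \<le> C * (1 + S K') * exp ((p^2 + r2^2) / 4 * S K + p * r2 / 2 * D K (x - y)
      + (\<alpha>^2 + r2^2) / 4 * (S N - S K) + \<alpha> * r2 / 2 * (D N (x - y) - D K (x - y)))"
  using exp_moment_le[OF r2a B, where ?C1.0 = L'] by blast
 define C2 where "C2 = exp ((\<alpha> * \<alpha> / 2 + 2 * \<eta> * \<alpha> / 2) * L')"
 show ?thesis
 proof (rule that[of "C / c * C2"])
  show "C / c * C2 > 0" using C c by (simp add: C2_def)
  fix K N :: nat and x y \<mu> :: real and f :: "'a => real"
  assume K: "K \<le> N" and xy: "x \<noteq> y" "\<bar>x - y\<bar> \<le> 1" "ln (1 / \<bar>x - y\<bar>) \<le> L" and lam: "0 \<le> \<mu>" "\<mu> \<le> 2 * \<eta>"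
   and f: "\<And>w. f w \<le> exp (\<mu> * (X K x w - \<beta> * S K)) * amp_bnd N x w * (exp (r2 * X N y w) * bnd N (X N y w - lev N))"
  have DL: "D n (z * (x - y)) \<le> L'" if "z = 1 \<or> z = 2" for n z
  proof -
   have "D n (z * (x - y)) = D n (z * \<bar>x - y\<bar>)"
    using D_abs[of n "z * (x - y)"] that by (auto simp: abs_mult)
   also have "... \<le> ln (1 / (z * \<bar>x - y\<bar>)) + C\<^sub>0" unfolding D_def using xy that by (intro D_upper) auto
   also have "ln (1 / (z * \<bar>x - y\<bar>)) \<le> ln (1 / \<bar>x - y\<bar>)" using xy that by (subst ln_le_cancel_iff) (auto simp: divide_simps)
   finally show ?thesis using xy(3) unfolding L'_def by linarith
  qed
  let ?d = "exp (- (\<mu> * \<beta> * S K)) / phi N"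
  let ?T = "((\<alpha> + \<mu>)^2 + r2^2) / 4 * S K + (\<alpha> + \<mu>) * r2 / 2 * D K (x - y)
      + (\<alpha>^2 + r2^2) / 4 * (S N - S K) + \<alpha> * r2 / 2 * (D N (x - y) - D K (x - y))"
  have d0: "?d \<ge> 0" using phi_ge_1[of N] by simp
  have "exp (\<mu> * (X K x w - \<beta> * S K)) * amp_bnd N x w * (exp (r2 * X N y w) * bnd N (X N y w - lev N))
   = ?d * (exp ((\<alpha> + \<mu>) * X K x w + \<alpha> * (X N x w - X K x w) + r2 * X N y w) * bnd N (X N x w - lev N) * bnd N (X N y w - lev N))" for w
  proof -
   have "exp (\<mu> * (X K x w - \<beta> * S K)) * exp (\<alpha> * X N x w) * exp (r2 * X N y w)
    = exp (- (\<mu> * \<beta> * S K)) * exp ((\<alpha> + \<mu>) * X K x w + \<alpha> * (X N x w - X K x w) + r2 * X N y w)"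
    unfolding exp_add[symmetric] by (rule arg_cong[where f = exp]) (simp add: algebra_simps)
   thus ?thesis unfolding amp_bnd_def amp_def by (simp add: field_simps)
  qed
  hence "expectation f \<le> ?d * expectation (\<lambda>w. exp ((\<alpha> + \<mu>) * X K x w + \<alpha> * (X N x w - X K x w) + r2 * X N y w) * bnd N (X N x w - lev N) * bnd N (X N y w - lev N))"
   using f by (intro amp_bnd_mono_expectation d0) simp
  \<comment> \<open>Here K' = 0: the distance is bounded below through L, so
    \<open>D N (2 * (x - y))\<close> is bounded and the frequencies decay from the first prime
    on.\<close>
  also have "... \<le> ?d * (C * (1 + S 0) * exp (?T))"
   using lam alpha DL[of 2 N] d0 by (intro mult_left_mono Cb K) auto
  also have "... \<le> (exp (- (\<mu> * \<beta> * S K)) / (c * exp (\<alpha>^2 / 4 * S N))) * (C * (1 + S 0) * exp (?T))"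
   using c(1) c(2)[of N] C phi_ge_1[of N] by (intro mult_right_mono divide_left_mono mult_pos_pos) auto
  also have "... = C / c * exp (- (\<mu> * \<beta> * S K) + - (\<alpha>^2 / 4 * S N) + (?T))"
  proof -
   have "(exp A / (c * exp P)) * (C * (1 + S 0) * exp R) = C / c * exp (A + - P + R)" for A P R
    unfolding exp_add exp_minus S_0 by (simp add: divide_inverse mult_ac)
   thus ?thesis by (simp only:)
  qed
  also have "... = C / c * exp (r2^2 / 4 * S N - (\<mu> * \<eta> - \<mu>\<^sup>2 / 4) * S K + (\<alpha> * r2 / 2 * D N (x - y) + \<mu> * r2 / 2 * D K (x - y)))"
  proof -
   have "- (\<mu> * (\<alpha> / 2 + h) * s) + - (\<alpha>^2 / 4 * n) + (((\<alpha> + \<mu>)^2 + r2^2) / 4 * s + (\<alpha> + \<mu>) * r2 / 2 * d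
      + (\<alpha>^2 + r2^2) / 4 * (n - s) + \<alpha> * r2 / 2 * (e - d)) = r2^2 / 4 * n - (\<mu> * h - \<mu>\<^sup>2 / 4) * s + (\<alpha> * r2 / 2 * e + \<mu> * r2 / 2 * d)"
    for s n d e h :: real by (simp add: field_simps power2_eq_square)
   thus ?thesis by (simp only: \<beta>_def)
  qed
  also have "... \<le> C / c * exp (r2^2 / 4 * S N - (\<mu> * \<eta> - \<mu>\<^sup>2 / 4) * S K + (\<alpha> * \<alpha> / 2 + 2 * \<eta> * \<alpha> / 2) * L')"
  proof -
   have L': "L' \<ge> 0" by (simp add: L'_def)
   have "\<alpha> * r2 / 2 * D N (x - y) \<le> \<alpha> * r2 / 2 * L'" using DL[of 1 N] alpha r2a by (intro mult_left_mono) auto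
   also have "... \<le> \<alpha> * \<alpha> / 2 * L'" using alpha r2a L' by (intro mult_right_mono divide_right_mono mult_left_mono) auto
   finally have 1: "\<alpha> * r2 / 2 * D N (x - y) \<le> \<alpha> * \<alpha> / 2 * L'" .
   have "\<mu> * r2 / 2 * D K (x - y) \<le> \<mu> * r2 / 2 * L'" using DL[of 1 K] lam r2a by (intro mult_left_mono) auto
   also have "... \<le> 2 * \<eta> * \<alpha> / 2 * L'" using lam r2a L' by (intro mult_right_mono divide_right_mono mult_mono) auto
   finally have 2: "\<mu> * r2 / 2 * D K (x - y) \<le> 2 * \<eta> * \<alpha> / 2 * L'" .
   from add_mono[OF 1 2] have "\<alpha> * r2 / 2 * D N (x - y) + \<mu> * r2 / 2 * D K (x - y) \<le> (\<alpha> * \<alpha> / 2 + 2 * \<eta> * \<alpha> / 2) * L'"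
    by (simp only: distrib_right)
   thus ?thesis using C c by (intro mult_left_mono) auto
  qed
  also have "... = C / c * C2 * exp (r2^2 / 4 * S N - (\<mu> * \<eta> - \<mu>\<^sup>2 / 4) * S K)"
   unfolding C2_def exp_add by (simp only: mult_ac)
  finally show "expectation f \<le> C / c * C2 * exp (r2^2 / 4 * S N - (\<mu> * \<eta> - \<mu>\<^sup>2 / 4) * S K)" .
 qed
qed

lemma integrable_bounded:
 "f \<in> borel_measurable M ==> (\<And>w. \<bar>f w\<bar> \<le> B) ==> integrable M f" for f :: "'a => real"
 by (rule integrable_const_bound[of _ B]) auto

lemma integrable_amp_bnd_pair: "integrable M (\<lambda>w. amp_bnd N x w * amp_bnd N y w)"
proof (rule integrable_bounded)
 show "\<bar>amp_bnd N x w * amp_bnd N y w\<bar> \<le> (exp (\<alpha> * real N) * (1 + sd N)) * (exp (\<alpha> * real N) * (1 + sd N))" for w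
  unfolding abs_mult abs_of_pos[OF amp_bnd_pos] using sd_nonneg[of N]
  by (intro mult_mono amp_bnd_le less_imp_le[OF amp_bnd_pos]) (auto intro!: mult_nonneg_nonneg)
qed measurable

text \<open>The case \<open>r2 = 0\<close> of \<open>tail_moment\<close>, with x + 1 as a dummy
  second point whose factor \<open>bnd\<close> is at least 1. The choice \<mu> = 2\<eta> maximises
  \<mu> \<eta> - \<mu>^2 / 4 and gives \<eta>^2.\<close>

lemma tail_one_point:
 obtains C where "C > 0" "\<And>K N x. K \<le> N ==>
  expectation (\<lambda>w. of_bool (X K x w > \<beta> * S K) * amp_bnd N x w) \<le> C * exp (- \<eta>\<^sup>2 * S K)"
proof -
 obtain C where C: "C > 0" and Cb: "\<And>K N x y \<mu> f. K \<le> N ==> x \<noteq> y ==> \<bar>x - y\<bar> \<le> 1 ==> ln (1 / \<bar>x - y\<bar>) \<le> 0 ==> 0 \<le> \<mu> ==> \<mu> \<le> 2 * \<eta> ==>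
   (\<And>w. f w \<le> exp (\<mu> * (X K x w - \<beta> * S K)) * amp_bnd N x w * (exp (0 * X N y w) * bnd N (X N y w - lev N))) ==>
   expectation f \<le> C * exp (0^2 / 4 * S N - (\<mu> * \<eta> - \<mu>\<^sup>2 / 4) * S K)"
  using tail_moment[of 0 0] by blast
 show ?thesis
 proof (rule that[OF C])
  fix K N :: nat and x :: real assume K: "K \<le> N"
  have "expectation (\<lambda>w. of_bool (X K x w > \<beta> * S K) * amp_bnd N x w) \<le> C * exp (0^2 / 4 * S N - ((2 * \<eta>) * \<eta> - (2 * \<eta>)\<^sup>2 / 4) * S K)"
  proof (rule Cb[OF K, of x "x + 1"])
   fix w
   have "of_bool (X K x w > \<beta> * S K) * amp_bnd N x w * (1 * 1)
    \<le> exp ((2 * \<eta>) * (X K x w - \<beta> * S K)) * amp_bnd N x w * (exp (0 * X N (x + 1) w) * bnd N (X N (x + 1) w - lev N))"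
    using eta_pos bnd_ge_1[of N "X N (x + 1) w - lev N"] amp_bnd_pos[of N x w] by (intro mult_mono) auto
   thus "of_bool (X K x w > \<beta> * S K) * amp_bnd N x w
    \<le> exp ((2 * \<eta>) * (X K x w - \<beta> * S K)) * amp_bnd N x w * (exp (0 * X N (x + 1) w) * bnd N (X N (x + 1) w - lev N))" by simp
  qed (use eta_pos in auto)
  also have "0^2 / 4 * S N - ((2 * \<eta>) * \<eta> - (2 * \<eta>)\<^sup>2 / 4) * S K = - \<eta>\<^sup>2 * S K" by (simp add: power2_eq_square algebra_simps)
  finally show "expectation (\<lambda>w. of_bool (X K x w > \<beta> * S K) * amp_bnd N x w) \<le> C * exp (- \<eta>\<^sup>2 * S K)" .
 qed
qed

text \<open>The case \<open>r2 = \<alpha>\<close> for pairs at distance at least exp(-L), whose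
  covariance is bounded. Taking \<mu> = 2\<eta> gives the tail, and \<mu> = 0 at stage 0 the plain
  bound.\<close>

lemma tail_two_point:
 obtains C where "C > 0"
  "\<And>K N x y. K \<le> N ==> x \<noteq> y ==> \<bar>x - y\<bar> \<le> 1 ==> ln (1 / \<bar>x - y\<bar>) \<le> L ==>
   expectation (\<lambda>w. of_bool (X K x w > \<beta> * S K) * (amp_bnd N x w * amp_bnd N y w)) \<le> C * exp (- \<eta>\<^sup>2 * S K)"
  "\<And>N x y. x \<noteq> y ==> \<bar>x - y\<bar> \<le> 1 ==> ln (1 / \<bar>x - y\<bar>) \<le> L ==> expectation (\<lambda>w. amp_bnd N x w * amp_bnd N y w) \<le> C"
proof -
 obtain C where C: "C > 0" and Cb: "\<And>K N x y \<mu> f. K \<le> N ==> x \<noteq> y ==> \<bar>x - y\<bar> \<le> 1 ==> ln (1 / \<bar>x - y\<bar>) \<le> L ==> 0 \<le> \<mu> ==> \<mu> \<le> 2 * \<eta> ==>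
   (\<And>w. f w \<le> exp (\<mu> * (X K x w - \<beta> * S K)) * amp_bnd N x w * (exp (\<alpha> * X N y w) * bnd N (X N y w - lev N))) ==>
   expectation f \<le> C * exp (\<alpha>^2 / 4 * S N - (\<mu> * \<eta> - \<mu>\<^sup>2 / 4) * S K)"
  using tail_moment[of \<alpha> L] by blast
 obtain c where c: "c > 0" "\<And>N. c * exp (\<alpha>^2 / 4 * S N) \<le> phi N" using phi_bounds by metis
 have main: "expectation (\<lambda>w. p w * (amp_bnd N x w * amp_bnd N y w)) \<le> C / c * exp (- (\<mu> * \<eta> - \<mu>\<^sup>2 / 4) * S K)"
  if K: "K \<le> N" and xy: "x \<noteq> y" "\<bar>x - y\<bar> \<le> 1" "ln (1 / \<bar>x - y\<bar>) \<le> L" and mu: "0 \<le> \<mu>" "\<mu> \<le> 2 * \<eta>"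
   and p: "\<And>w. p w \<le> exp (\<mu> * (X K x w - \<beta> * S K))" for K N x y \<mu> p
 proof -
  have p0: "phi N > 0" using phi_ge_1[of N] by simp
  have "phi N * expectation (\<lambda>w. p w * (amp_bnd N x w * amp_bnd N y w)) = expectation (\<lambda>w. phi N * (p w * (amp_bnd N x w * amp_bnd N y w)))"
   by simp
  also have "... \<le> C * exp (\<alpha>^2 / 4 * S N - (\<mu> * \<eta> - \<mu>\<^sup>2 / 4) * S K)"
  proof (rule Cb[OF K xy mu])
   fix w
   have "p w * (amp_bnd N x w * (phi N * amp_bnd N y w)) \<le> exp (\<mu> * (X K x w - \<beta> * S K)) * (amp_bnd N x w * (phi N * amp_bnd N y w))"
    using p0 by (intro mult_right_mono p mult_nonneg_nonneg less_imp_le[OF amp_bnd_pos]) auto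
   moreover have "phi N * amp_bnd N y w = exp (\<alpha> * X N y w) * bnd N (X N y w - lev N)"
    using p0 by (simp add: amp_bnd_def amp_def)
   moreover have "phi N * (p w * (amp_bnd N x w * amp_bnd N y w)) = p w * (amp_bnd N x w * (phi N * amp_bnd N y w))"
    by (simp only: mult_ac)
   ultimately show "phi N * (p w * (amp_bnd N x w * amp_bnd N y w))
    \<le> exp (\<mu> * (X K x w - \<beta> * S K)) * amp_bnd N x w * (exp (\<alpha> * X N y w) * bnd N (X N y w - lev N))" by (simp only: mult.assoc)
  qed
  finally have "expectation (\<lambda>w. p w * (amp_bnd N x w * amp_bnd N y w)) \<le> C * exp (\<alpha>^2 / 4 * S N - (\<mu> * \<eta> - \<mu>\<^sup>2 / 4) * S K) / phi N"
   using p0 by (simp add: pos_le_divide_eq mult.commute)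
  also have "... \<le> C * exp (\<alpha>^2 / 4 * S N - (\<mu> * \<eta> - \<mu>\<^sup>2 / 4) * S K) / (c * exp (\<alpha>^2 / 4 * S N))"
   using c(1) c(2)[of N] C p0 by (intro divide_left_mono mult_pos_pos) auto
  also have "... = C / c * exp (- (\<mu> * \<eta> - \<mu>\<^sup>2 / 4) * S K)"
  proof -
   have "C * exp (P - R * s) / (c * exp P) = C / c * exp (- R * s)" for P R s :: real
    by (simp add: exp_diff exp_minus field_simps)
   thus ?thesis .
  qed
  finally show ?thesis .
 qed
 show ?thesis
 proof (rule that[of "C / c"])
  show "C / c > 0" using C c by simp
  fix N :: nat and x y :: real
  assume xy: "x \<noteq> y" "\<bar>x - y\<bar> \<le> 1" "ln (1 / \<bar>x - y\<bar>) \<le> L"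
  show "expectation (\<lambda>w. amp_bnd N x w * amp_bnd N y w) \<le> C / c"
   using main[of 0 N x y 0 "\<lambda>_. 1"] xy eta_pos by simp
  fix K assume K: "K \<le> N"
  have "expectation (\<lambda>w. of_bool (X K x w > \<beta> * S K) * (amp_bnd N x w * amp_bnd N y w)) \<le> C / c * exp (- ((2 * \<eta>) * \<eta> - (2 * \<eta>)\<^sup>2 / 4) * S K)"
   using eta_pos by (intro main K xy) auto
  also have "- ((2 * \<eta>) * \<eta> - (2 * \<eta>)\<^sup>2 / 4) * S K = - \<eta>\<^sup>2 * S K" by (simp add: power2_eq_square algebra_simps)
  finally show "expectation (\<lambda>w. of_bool (X K x w > \<beta> * S K) * (amp_bnd N x w * amp_bnd N y w)) \<le> C / c * exp (- \<eta>\<^sup>2 * S K)" .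
 qed
qed

text \<open>Equal to \<alpha>^2 / 4 + \<alpha> * \<eta>, the growth exponent of the truncated
  two-point function.\<close>

definition \<rho> :: real where "\<rho> = (1 + \<alpha>^2 / 4) / 2"

text \<open>K is the stage after which the two points decorrelate. The truncation indicator is at
  most exp(\<alpha> (\<beta> S K - X K x)), which cancels the field at x up to stage K (p = 0 in
  \<open>exp_moment_le\<close>). What would be a double exponential moment of the common part
  becomes a single one.\<close>

lemma near_moment:
 obtains C where "C > 0" "\<And>K N x y. K \<le> N ==> D N (2 * (x - y)) \<le> S K + C1 ==> D N (x - y) - D K (x - y) \<le> C1 ==>
   expectation (\<lambda>w. of_bool (X K x w \<le> \<beta> * S K) * (amp_bnd N x w * amp_bnd N y w)) \<le> C * (1 + S K) * exp (\<rho> * S K)"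
proof -
 obtain c where c: "c > 0" "\<And>N. c * exp (\<alpha>^2 / 4 * S N) \<le> phi N" using phi_bounds by metis
 have B: "0 \<le> \<alpha>" "\<alpha> \<le> \<alpha>" "(0::real) \<le> 0" using alpha by auto
 obtain C where C: "C > 0" and Cb: "\<And>K K' N x y p l. K \<le> N ==> K' \<le> N ==> \<bar>p\<bar> \<le> 0 ==> D N (2 * (x - y)) \<le> S K' + C1 ==>
   expectation (\<lambda>w. exp (p * X K x w + \<alpha> * (X N x w - X K x w) + \<alpha> * X N y w) * bnd N (X N x w - l) * bnd N (X N y w - l))
    \<le> C * (1 + S K') * exp ((p^2 + \<alpha>^2) / 4 * S K + p * \<alpha> / 2 * D K (x - y)
      + (\<alpha>^2 + \<alpha>^2) / 4 * (S N - S K) + \<alpha> * \<alpha> / 2 * (D N (x - y) - D K (x - y)))"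
  using exp_moment_le[OF B, where ?C1.0 = C1] by blast
 define C2 where "C2 = C / (c * c) * exp (\<alpha> * \<alpha> / 2 * C1)"
 show ?thesis
 proof (rule that[of C2])
  show "C2 > 0" using C c by (simp add: C2_def)
  fix K N :: nat and x y :: real
  assume K: "K \<le> N" and D2: "D N (2 * (x - y)) \<le> S K + C1" and D1: "D N (x - y) - D K (x - y) \<le> C1"
  let ?d = "exp (\<alpha> * (\<beta> * S K)) / (phi N * phi N)"
  have p0: "phi N > 0" using phi_ge_1[of N] by simp
  have d0: "?d \<ge> 0" using p0 by simp
  have "of_bool (X K x w \<le> \<beta> * S K) * (amp_bnd N x w * amp_bnd N y w)
   \<le> ?d * (exp (0 * X K x w + \<alpha> * (X N x w - X K x w) + \<alpha> * X N y w) * bnd N (X N x w - lev N) * bnd N (X N y w - lev N))" for w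
  proof -
   have "of_bool (X K x w \<le> \<beta> * S K) * (amp_bnd N x w * amp_bnd N y w) \<le> exp (\<alpha> * (\<beta> * S K - X K x w)) * (amp_bnd N x w * amp_bnd N y w)"
    using alpha by (intro mult_right_mono mult_nonneg_nonneg less_imp_le[OF amp_bnd_pos]) auto
   also have "... = ?d * (exp (0 * X K x w + \<alpha> * (X N x w - X K x w) + \<alpha> * X N y w) * bnd N (X N x w - lev N) * bnd N (X N y w - lev N))"
   proof -
    have "exp (\<alpha> * (\<beta> * S K - X K x w)) * exp (\<alpha> * X N x w) * exp (\<alpha> * X N y w)
     = exp (\<alpha> * (\<beta> * S K)) * exp (0 * X K x w + \<alpha> * (X N x w - X K x w) + \<alpha> * X N y w)"
     unfolding exp_add[symmetric] by (rule arg_cong[where f = exp]) (simp add: algebra_simps)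
    thus ?thesis unfolding amp_bnd_def amp_def using p0 by (simp add: field_simps)
   qed
   finally show ?thesis .
  qed
  hence "expectation (\<lambda>w. of_bool (X K x w \<le> \<beta> * S K) * (amp_bnd N x w * amp_bnd N y w))
   \<le> ?d * expectation (\<lambda>w. exp (0 * X K x w + \<alpha> * (X N x w - X K x w) + \<alpha> * X N y w) * bnd N (X N x w - lev N) * bnd N (X N y w - lev N))"
   by (intro amp_bnd_mono_expectation d0)
  also have "... \<le> ?d * (C * (1 + S K) * exp ((0^2 + \<alpha>^2) / 4 * S K + 0 * \<alpha> / 2 * D K (x - y)
      + (\<alpha>^2 + \<alpha>^2) / 4 * (S N - S K) + \<alpha> * \<alpha> / 2 * (D N (x - y) - D K (x - y))))"
   using D2 d0 by (intro mult_left_mono Cb K) auto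
  also have "... \<le> (exp (\<alpha> * (\<beta> * S K)) / ((c * exp (\<alpha>^2 / 4 * S N)) * (c * exp (\<alpha>^2 / 4 * S N)))) * (C * (1 + S K) * exp ((0^2 + \<alpha>^2) / 4 * S K + 0 * \<alpha> / 2 * D K (x - y)
      + (\<alpha>^2 + \<alpha>^2) / 4 * (S N - S K) + \<alpha> * \<alpha> / 2 * C1))"
  proof (intro mult_mono)
   show "?d \<le> exp (\<alpha> * (\<beta> * S K)) / ((c * exp (\<alpha>^2 / 4 * S N)) * (c * exp (\<alpha>^2 / 4 * S N)))"
    using c(1) c(2)[of N] p0 by (intro divide_left_mono mult_mono mult_pos_pos) auto
   show "exp ((0^2 + \<alpha>^2) / 4 * S K + 0 * \<alpha> / 2 * D K (x - y) + (\<alpha>^2 + \<alpha>^2) / 4 * (S N - S K) + \<alpha> * \<alpha> / 2 * (D N (x - y) - D K (x - y)))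
    \<le> exp ((0^2 + \<alpha>^2) / 4 * S K + 0 * \<alpha> / 2 * D K (x - y) + (\<alpha>^2 + \<alpha>^2) / 4 * (S N - S K) + \<alpha> * \<alpha> / 2 * C1)"
    unfolding exp_le_cancel_iff using alpha D1 by (intro add_left_mono mult_left_mono) auto
  qed (use C S_nonneg[of K] in auto)
  also have "... = C2 * (1 + S K) * exp (\<rho> * S K)"
  proof -
   have "(exp A / ((c * exp P) * (c * exp P))) * (C * (1 + S K) * exp (R + U)) = C / (c * c) * exp U * (1 + S K) * exp (A + - P + - P + R)" for A P R U
   proof -
    have "exp (A + - P + - P + R) = exp A * inverse (exp P) * inverse (exp P) * exp R" by (simp only: exp_add exp_minus)
    thus ?thesis unfolding exp_add[of R U] using c(1) by (simp only:) (simp add: divide_inverse mult_ac)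
   qed
   moreover have "\<alpha> * (\<beta> * S K) + - (\<alpha>^2 / 4 * S N) + - (\<alpha>^2 / 4 * S N) + ((0^2 + \<alpha>^2) / 4 * S K + 0 * \<alpha> / 2 * D K (x - y)
      + (\<alpha>^2 + \<alpha>^2) / 4 * (S N - S K)) = \<rho> * S K"
   proof -
    have "\<alpha> * \<beta> = \<alpha>^2 / 2 + (1 - \<alpha>\<^sup>2 / 4) / 2" using alpha by (simp add: \<beta>_def \<eta>_def field_simps power2_eq_square)
    hence "\<alpha> * (\<beta> * S K) = (\<alpha>^2 / 2 + (1 - \<alpha>\<^sup>2 / 4) / 2) * S K" by (simp only: mult.assoc[symmetric])
    thus ?thesis by (simp only:) (simp add: \<rho>_def field_simps)
   qed
   ultimately show ?thesis unfolding C2_def by (simp only:)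
  qed
  finally show "expectation (\<lambda>w. of_bool (X K x w \<le> \<beta> * S K) * (amp_bnd N x w * amp_bnd N y w)) \<le> C2 * (1 + S K) * exp (\<rho> * S K)" .
 qed
qed

end

context log_field
begin

section \<open>Truncation\<close>

lemma exp_minus_one_ge: "z \<ge> 1 ==> exp z - 1 \<ge> exp (z - 1)" for z :: real
proof -
 assume z: "z \<ge> 1"
 have "exp (z - 1) \<ge> 1" using z by simp
 moreover have "exp z = exp 1 * exp (z - 1)" by (simp flip: exp_add)
 moreover have "exp (1::real) \<ge> 2" using exp_ge_add_one_self[of 1] by simp
 hence "exp 1 * exp (z - 1) \<ge> 2 * exp (z - 1)" by (intro mult_right_mono) auto
 ultimately show ?thesis by linarith
qed

text \<open>Scales chosen so that \<open>S (H m)\<close> is m up to a constant, since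
  \<open>S N\<close> is about ln ln N.\<close>

definition H :: "nat => nat" where "H m = nat \<lfloor>exp (exp (real m))\<rfloor>"

lemma H_mono: "m \<le> n ==> H m \<le> H n"
 unfolding H_def by (intro nat_mono floor_mono) auto

lemma H_bounds: "real (H m) \<le> exp (exp (real m))" "real (H m) \<ge> exp (exp (real m)) - 1"
proof -
 have "\<lfloor>exp (exp (real m))\<rfloor> \<ge> 0" by simp
 hence "real (H m) = of_int \<lfloor>exp (exp (real m))\<rfloor>" unfolding H_def by simp
 thus "real (H m) \<le> exp (exp (real m))" "real (H m) \<ge> exp (exp (real m)) - 1" by linarith+
qed

lemma H_ge_3: "m \<ge> 1 ==> H m \<ge> 3"
proof -
 assume m: "m \<ge> 1"
 have "exp (real m) \<ge> 2" using m exp_ge_add_one_self[of "real m"] by linarith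
 hence "exp (exp (real m)) \<ge> 3" using exp_ge_add_one_self[of "exp (real m)"] by linarith
 hence "\<lfloor>exp (exp (real m))\<rfloor> \<ge> 3" by (simp add: le_floor_iff)
 thus ?thesis unfolding H_def by linarith
qed

lemma ln_H_le: "m \<ge> 1 ==> ln (real (H m)) \<le> exp (real m)"
 using H_bounds(1)[of m] H_ge_3[of m] ln_mono[of "real (H m)" "exp (exp (real m))"] by simp

lemma C0_nonneg: "C\<^sub>0 \<ge> 0"
 using S_approx[of 3] by linarith

lemma S_H: "m \<ge> 1 ==> \<bar>S (H m) - real m\<bar> \<le> C\<^sub>0 + 1"
proof -
 assume m: "m \<ge> 1"
 have e1: "exp (real m) \<ge> 1" by simp
 have "exp (exp (real m) - 1) \<le> real (H m)" using exp_minus_one_ge[OF e1] H_bounds(2)[of m] by linarith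
 hence "exp (real m) - 1 \<le> ln (real (H m))" using H_ge_3[OF m] by (subst ln_ge_iff) auto
 moreover have "exp (real m - 1) \<le> exp (real m) - 1" using m by (intro exp_minus_one_ge) simp
 ultimately have l: "exp (real m - 1) \<le> ln (real (H m))" by linarith
 have l0: "ln (real (H m)) > 0" using H_ge_3[OF m] by simp
 have "real m - 1 \<le> ln (ln (real (H m)))" using l l0 by (subst ln_ge_iff) auto
 moreover have "ln (ln (real (H m))) \<le> real m"
 proof -
  have "ln (ln (real (H m))) \<le> ln (exp (real m))" using ln_H_le[OF m] l0 by (intro ln_mono) auto
  thus ?thesis by simp
 qed
 ultimately show ?thesis using S_approx[OF H_ge_3[OF m]] unfolding S_def by linarith
qed

text \<open>All scales from 1 to \<open>lv N\<close> lie below N by \<open>H_le\<close>, and by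
  \<open>S_lv\<close> only a bounded amount of \<open>S\<close> remains after the last of
  them.\<close>

definition lv :: "nat => nat" where "lv N = nat \<lfloor>ln (ln (real N))\<rfloor>"

lemma H_le: "N \<ge> 3 ==> 1 \<le> m ==> m \<le> lv N ==> H m \<le> N"
proof -
 assume N: "N \<ge> 3" and m: "1 \<le> m" "m \<le> lv N"
 have "real m \<le> ln (ln (real N))" using m unfolding lv_def by linarith
 moreover have "ln (real N) > 0" using N by simp
 ultimately have "exp (real m) \<le> ln (real N)" by (subst (asm) ln_ge_iff) auto
 hence "exp (exp (real m)) \<le> real N" using N by (subst (asm) ln_ge_iff) auto
 hence "real (H m) \<le> real N" using H_bounds(1)[of m] by linarith
 thus ?thesis by simp
qed

lemma S_lv: "N \<ge> 3 ==> 1 \<le> lv N ==> S N - S (H (lv N)) \<le> 2 * C\<^sub>0 + 2"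
proof -
 assume N: "N \<ge> 3" and m: "1 \<le> lv N"
 have "ln (ln (real N)) \<le> real (lv N) + 1" using m unfolding lv_def by linarith
 thus ?thesis using S_H[OF m] S_approx[OF N] unfolding S_def by linarith
qed

lemma lv_tendsto: "filterlim lv at_top sequentially"
proof -
 have "filterlim (\<lambda>N. ln (ln (real N))) at_top sequentially"
  by (intro filterlim_compose[OF ln_at_top] filterlim_real_sequentially)
 hence *: "eventually (\<lambda>N. real Z \<le> ln (ln (real N))) sequentially" for Z by (auto simp: filterlim_at_top)
 have "eventually (\<lambda>N. Z \<le> lv N) sequentially" for Z
  using *[of Z] by eventually_elim (simp add: lv_def le_nat_floor)
 thus ?thesis by (auto simp: filterlim_at_top)
qed

text \<open>The first q scales are left unconstrained. The mass discarded is then a geometric tail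
  starting at q, which can be made small before N grows.\<close>

definition tr :: "nat => nat => real => 'a => real" where
 "tr q r x w = of_bool (\<forall>m\<in>{q<..r}. X (H m) x w \<le> \<beta> * S (H m))"

lemma tr_bounds: "0 \<le> tr q r x w" "tr q r x w \<le> 1"
 by (auto simp: tr_def)

lemma tr_measurable_Fs: "tr q r x \<in> borel_measurable (Fs (H r))"
proof -
 have [measurable]: "X (H m) x \<in> borel_measurable (Fs (H r))" if "m \<le> r" for m
  using that by (intro measurable_Fs_mono[OF X_measurable_Fs] H_mono)
 have "tr q r x = (\<lambda>w. \<Prod>m\<in>{q<..r}. of_bool (X (H m) x w \<le> \<beta> * S (H m)))"
  unfolding tr_def by (rule ext) (auto simp: prod_zero_iff)
 moreover have "(\<lambda>w. of_bool (X (H m) x w \<le> \<beta> * S (H m)) :: real) \<in> borel_measurable (Fs (H r))" if "m \<le> r" for m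
  using that by measurable
 hence "(\<lambda>w. \<Prod>m\<in>{q<..r}. of_bool (X (H m) x w \<le> \<beta> * S (H m)) :: real) \<in> borel_measurable (Fs (H r))"
  by (intro borel_measurable_prod) auto
 ultimately show ?thesis by simp
qed

lemma tr_measurable [measurable]: "tr q r x \<in> borel_measurable M"
 using tr_measurable_Fs by (rule measurable_Fs_M)

lemma tr_diff:
 assumes "q \<le> r" "r \<le> s"
 shows "0 \<le> tr q r x w - tr q s x w" "tr q r x w - tr q s x w \<le> (\<Sum>m\<in>{r<..s}. of_bool (X (H m) x w > \<beta> * S (H m)))"
proof -
 show "0 \<le> tr q r x w - tr q s x w" using assms by (auto simp: tr_def)
 show "tr q r x w - tr q s x w \<le> (\<Sum>m\<in>{r<..s}. of_bool (X (H m) x w > \<beta> * S (H m)))"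
 proof (cases "\<exists>m\<in>{r<..s}. X (H m) x w > \<beta> * S (H m)")
  case True
  then obtain m where m: "m \<in> {r<..s}" "X (H m) x w > \<beta> * S (H m)" by blast
  have "(1::real) \<le> (\<Sum>m\<in>{m}. of_bool (X (H m) x w > \<beta> * S (H m)))" using m by simp
  also have "... \<le> (\<Sum>m\<in>{r<..s}. of_bool (X (H m) x w > \<beta> * S (H m)))"
   using m by (intro sum_mono2) auto
  finally show ?thesis using tr_bounds[of q r x w] tr_bounds[of q s x w] by linarith
 next
  case False
  have "tr q r x w = tr q s x w"
  proof -
   have "(\<forall>m\<in>{q<..r}. X (H m) x w \<le> \<beta> * S (H m)) = (\<forall>m\<in>{q<..s}. X (H m) x w \<le> \<beta> * S (H m))"
    using False assms by (meson greaterThanAtMost_iff linorder_not_less order_trans)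
   thus ?thesis by (simp add: tr_def)
  qed
  thus ?thesis by (simp add: sum_nonneg)
 qed
qed

text \<open>As \<open>S (H m)\<close> is m up to a constant, the exceedance bounds at successive
  scales form a geometric series.\<close>

lemma exceed_sum_le:
 obtains C where "C > 0" "\<And>r s. (\<Sum>m\<in>{r<..s}. exp (- \<eta>\<^sup>2 * S (H m))) \<le> C * exp (- \<eta>\<^sup>2) ^ r"
proof -
 define b where "b = exp (- \<eta>\<^sup>2)"
 have b: "0 < b" "b < 1" using eta_pos by (auto simp: b_def)
 define C where "C = exp (\<eta>^2 * (C\<^sub>0 + 1)) * (1 / (1 - b))"
 show ?thesis
 proof (rule that[of C])
  show "C > 0" using b by (simp add: C_def)
  fix r s
  have "exp (- \<eta>\<^sup>2 * S (H m)) \<le> exp (\<eta>^2 * (C\<^sub>0 + 1)) * b ^ m" if "m \<in> {r<..s}" for m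
  proof -
   have "S (H m) \<ge> real m - (C\<^sub>0 + 1)" using S_H[of m] that by auto
   hence "\<eta>^2 * S (H m) \<ge> \<eta>^2 * (real m - (C\<^sub>0 + 1))" by (intro mult_left_mono) auto
   hence "exp (- \<eta>\<^sup>2 * S (H m)) \<le> exp (\<eta>^2 * (C\<^sub>0 + 1) + real m * (- \<eta>\<^sup>2))" by (simp add: algebra_simps)
   also have "... = exp (\<eta>^2 * (C\<^sub>0 + 1)) * b ^ m" unfolding b_def by (simp only: exp_add exp_of_nat_mult)
   finally show ?thesis .
  qed
  hence "(\<Sum>m\<in>{r<..s}. exp (- \<eta>\<^sup>2 * S (H m))) \<le> (\<Sum>m\<in>{r<..s}. exp (\<eta>^2 * (C\<^sub>0 + 1)) * b ^ m)" by (rule sum_mono)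
  also have "... = exp (\<eta>^2 * (C\<^sub>0 + 1)) * (\<Sum>m\<in>{r<..s}. b ^ m)" by (simp only: sum_distrib_left)
  also have "(\<Sum>m\<in>{r<..s}. b ^ m) \<le> 1 / (1 - b) * b ^ r"
  proof (cases "r \<le> s")
   case True
   hence "(1 - b) * (\<Sum>m\<in>{r<..s}. b ^ m) \<le> b ^ r - b ^ s"
   proof (induction s rule: dec_induct)
    case (step n)
    have "{r<..Suc n} = insert (Suc n) {r<..n}" using step by auto
    hence "(1 - b) * (\<Sum>m\<in>{r<..Suc n}. b ^ m) = (1 - b) * (\<Sum>m\<in>{r<..n}. b ^ m) + (1 - b) * b ^ Suc n"
     by (simp add: distrib_left)
    moreover have "(1 - b) * b ^ Suc n \<le> (1 - b) * b ^ n" using b by (intro mult_left_mono power_decreasing) auto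
    moreover have "(1 - b) * b ^ n = b ^ n - b ^ Suc n" by (simp add: left_diff_distrib)
    ultimately show ?case using step by linarith
   qed simp
   also have "... \<le> b ^ r" using b by simp
   finally show ?thesis using b by (simp add: field_simps)
  qed (use b in auto)
  finally show "(\<Sum>m\<in>{r<..s}. exp (- \<eta>\<^sup>2 * S (H m))) \<le> C * exp (- \<eta>\<^sup>2) ^ r"
   unfolding C_def b_def by (simp add: mult_ac)
 qed
qed

section \<open>The deviation of the normalised level set from the chaos\<close>

definition gtail :: "real => real" where "gtail y = indicator {0<..} y * exp (- \<alpha> * y)"
definition gam :: "nat => real" where "gam N = expectation (\<lambda>w. amp N 0 w * gtail (X N 0 w - lev N))"
text \<open>\<open>amp * gtail\<close> is a constant multiple of the indicator that the field
  exceeds the level, so this is the normalised indicator minus the density of the chaos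
  (\<open>dev_eq\<close>). The form as a tilt times a function of the distance to the level is the
  one the local limit theorems handle.\<close>

definition dev :: "nat => real => 'a => real" where "dev N x w = amp N x w * (gtail (X N x w - lev N) / gam N - 1)"

lemma gtail_measurable [measurable]: "gtail \<in> borel_measurable borel"
 unfolding gtail_def by measurable

lemma gtail_nonneg: "gtail y \<ge> 0" by (simp add: gtail_def)

lemma dev_measurable [measurable]: "dev N x \<in> borel_measurable M"
 unfolding dev_def by measurable

lemma AE_isCont_gtail: "AE y in lborel. isCont gtail y"
proof -
 have "isCont gtail y" if "y \<noteq> 0" for y
 proof (cases "y > 0")
  case True
  have "eventually (\<lambda>z. z \<in> {0<..}) (nhds y)" using True by (intro eventually_nhds_in_open) auto
  hence "eventually (\<lambda>z. gtail z = exp (- \<alpha> * z)) (nhds y)" by eventually_elim (simp add: gtail_def)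
  hence "isCont gtail y \<longleftrightarrow> isCont (\<lambda>z. exp (- \<alpha> * z)) y" by (rule isCont_cong)
  thus ?thesis by simp
 next
  case False
  have "eventually (\<lambda>z. z \<in> {..<0}) (nhds y)" using False that by (intro eventually_nhds_in_open) auto
  hence "eventually (\<lambda>z. gtail z = 0) (nhds y)" by eventually_elim (simp add: gtail_def)
  hence "isCont gtail y \<longleftrightarrow> isCont (\<lambda>z. 0 :: real) y" by (rule isCont_cong)
  thus ?thesis by simp
 qed
 thus ?thesis using AE_lborel_singleton[of "0::real"] by auto
qed

lemma gtail_le_kern:
 obtains B where "B > 0" "\<And>y. \<bar>gtail y\<bar> \<le> B * kern y"
proof -
 obtain C where C: "C > 0" "\<And>y. indicator {0<..} y * exp (- \<alpha> * y) \<le> C * kern y"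
  using exp_tail_le_kern[OF alpha(1)] by blast
 show ?thesis by (rule that[OF C(1)]) (use C(2) in \<open>auto simp: gtail_def abs_mult\<close>)
qed

lemma integral_gtail_pos: "(LBINT y. gtail y) > 0"
proof -
 obtain B where B: "\<And>y. \<bar>gtail y\<bar> \<le> B * kern y" using gtail_le_kern by blast
 have "exp (- \<alpha>) = (LBINT y. indicator {0<..1::real} y * exp (- \<alpha>))" by (simp add: measure_def)
 also have "... \<le> (LBINT y. gtail y)"
 proof (rule integral_mono')
  show "integrable lborel gtail" by (rule integrable_kern_mult_bounded[where B = B]) (use B in auto)
  show "indicator {0<..1} y * exp (- \<alpha>) \<le> gtail y" for y
  proof (cases "y \<in> {0<..1}")
   case True
   hence "\<alpha> * y \<le> \<alpha> * 1" using alpha by (intro mult_left_mono) auto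
   thus ?thesis using True by (simp add: gtail_def)
  qed (simp add: gtail_nonneg)
 qed (rule gtail_nonneg)
 finally show ?thesis using exp_gt_zero[of "- \<alpha>"] by linarith
qed

lemma amp_eq_tilt: "amp N x w = tilt N x y 0 w"
 unfolding amp_def tilt_def Z_def phi_def using Fp_rotate[of 0 N x y "of_real \<alpha>"] by simp

definition \<kappa> :: real where "\<kappa> = (LBINT y. gtail y) / sqrt (2 * pi)"

lemma kappa_pos: "\<kappa> > 0"
 unfolding \<kappa>_def using integral_gtail_pos by simp

text \<open>The normalisation of the level set is of order 1 / \<open>sd N\<close>: this is the
  local limit at a single point with trivial weight.\<close>

lemma gam_tendsto: "(\<lambda>N. sd N * gam N) \<longlonglongrightarrow> \<kappa>"
proof -
 obtain B where B: "\<And>y. \<bar>gtail y\<bar> \<le> B * kern y" using gtail_le_kern by blast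
 \<comment> \<open>The second point 1 is a dummy, since r = 0; the shift by \<open>Suc\<close>
   provides the indices at least 1 required by the limit theorem.\<close>
 have "(\<lambda>n. sd (Suc n) * expectation (\<lambda>w. 1 * tilt (Suc n) 0 1 0 w * gtail (X (Suc n) 0 w - lev (Suc n))))
  \<longlonglongrightarrow> expectation (\<lambda>w. 1 * tilt 0 0 1 0 w) / sqrt (2 * pi) * (LBINT y. gtail y)"
  by (rule tilt_local_limit[OF _ _ _ _ _ _ _ _ gtail_measurable B AE_isCont_gtail]) (auto simp: strict_mono_Suc_iff)
 moreover have "tilt 0 0 1 0 w = 1" for w by (simp add: tilt_def Z_def Fp_def)
 ultimately have "(\<lambda>n. sd (Suc n) * gam (Suc n)) \<longlonglongrightarrow> \<kappa>"
  by (simp add: gam_def \<kappa>_def amp_eq_tilt[of _ 0 _ 1] prob_space)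
 thus ?thesis by (rule LIMSEQ_imp_Suc)
qed

text \<open>Once \<open>sd N * gam N\<close> exceeds half of its limit, division by
  \<open>gam N\<close> costs at most a multiple of \<open>sd N\<close>, which is exactly the weight
  of \<open>kern\<close> in \<open>bnd\<close>.\<close>

lemma dev_le_amp_bnd:
 obtains C N0 where "C > 0" "\<And>N. N \<ge> N0 ==> gam N > 0" "\<And>N x w. N \<ge> N0 ==> \<bar>dev N x w\<bar> \<le> C * amp_bnd N x w"
proof -
 obtain B where B: "B > 0" "\<And>y. \<bar>gtail y\<bar> \<le> B * kern y" using gtail_le_kern by blast
 have "eventually (\<lambda>N. sd N * gam N > \<kappa> / 2) sequentially"
  using order_tendstoD(1)[OF gam_tendsto, of "\<kappa> / 2"] kappa_pos by simp
 then obtain N0 where N0: "\<And>N. N \<ge> N0 ==> sd N * gam N > \<kappa> / 2" by (auto simp: eventually_sequentially)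
 define C where "C = 1 + 2 * B / \<kappa>"
 show ?thesis
 proof (rule that[of C N0])
  show "C > 0" using B kappa_pos by (simp add: C_def add_pos_pos)
  fix N assume "N \<ge> N0"
  hence sg: "sd N * gam N > \<kappa> / 2" by (rule N0)
  hence "sd N * gam N > 0" using kappa_pos by linarith
  thus g: "gam N > 0" using sd_nonneg[of N] by (simp add: zero_less_mult_iff)
  fix x w
  let ?y = "X N x w - lev N"
  have "\<bar>gtail ?y / gam N - 1\<bar> \<le> gtail ?y / gam N + 1" using gtail_nonneg[of ?y] g by (auto simp: abs_le_iff)
  also have "gtail ?y / gam N \<le> (B * kern ?y) / gam N" using B(2)[of ?y] g by (intro divide_right_mono) auto
  also have "... \<le> (2 * B / \<kappa>) * (sd N * kern ?y)"
  proof -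
   have "1 / gam N \<le> 2 / \<kappa> * sd N" using sg g kappa_pos by (simp add: field_simps)
   hence "(B * kern ?y) * (1 / gam N) \<le> (B * kern ?y) * (2 / \<kappa> * sd N)"
    using B kern_pos[of ?y] by (intro mult_left_mono) auto
   thus ?thesis by (simp add: mult_ac)
  qed
  also have "(2 * B / \<kappa>) * (sd N * kern ?y) + 1 \<le> C * bnd N ?y"
  proof -
   have "sd N * kern ?y \<ge> 0" using sd_nonneg[of N] kern_pos[of ?y] by simp
   moreover have "2 * B / \<kappa> \<ge> 0" using B kappa_pos by simp
   ultimately show ?thesis by (simp add: C_def bnd_def algebra_simps)
  qed
  finally have "\<bar>gtail ?y / gam N - 1\<bar> \<le> C * bnd N ?y" by simp
  hence "amp N x w * \<bar>gtail ?y / gam N - 1\<bar> \<le> amp N x w * (C * bnd N ?y)"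
   using amp_pos[of N x w] by (intro mult_left_mono) auto
  thus "\<bar>dev N x w\<bar> \<le> C * amp_bnd N x w"
   unfolding dev_def amp_bnd_def abs_mult using amp_pos[of N x w] by (simp add: mult_ac)
 qed
qed

end

section \<open>Two-point asymptotics of the deviation\<close>

context log_field
begin

lemma tilt_swap: "tilt N x y \<alpha> w = tilt N y x \<alpha> w"
proof -
 have "F j x y z z = F j y x z z" for j z unfolding F_def by (simp only: add.commute)
 thus ?thesis unfolding tilt_def Z_def Fp_def by (simp add: add.commute)
qed

text \<open>The martingale property of the tilting density: each ratio after stage R equals 1 at
  frequency 0.\<close>

lemma expectation_tilt:
 assumes wt: "wt \<in> borel_measurable (Fs R)" "\<And>w. \<bar>wt w\<bar> \<le> 1" and R: "R \<le> N"
 shows "expectation (\<lambda>w. wt w * tilt N x y r w) = expectation (\<lambda>w. wt w * tilt R x y r w)"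
proof -
 have z: "Complex \<alpha> 0 = of_real \<alpha>" "Complex r 0 = of_real r" by (auto simp: complex_eq_iff)
 have nz: "F j x y (of_real \<alpha>) (of_real r) \<noteq> 0" if "j \<ge> 1" for j
  unfolding F_of_real(1)[OF that] using F_of_real(2)[OF that, of \<alpha> x r y] by simp
 have "(\<Prod>j\<in>{R<..N}. F j x y (of_real \<alpha>) (of_real r) / F j x y (of_real \<alpha>) (of_real r)) = 1"
  using nz by (intro prod.neutral) auto
 hence "(CLINT w|M. complex_of_real (wt w * tilt N x y r w)) = (CLINT w|M. complex_of_real (wt w * tilt R x y r w))"
  using tilt_char[OF R wt, of x y r 0 0 0] unfolding z by simp
 thus ?thesis unfolding integral_complex_of_real of_real_eq_iff .
qed

text \<open>Expanding the product of the two deviations under the measure tilted at both points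
  gives one two-point term, two one-point terms and one plain term. After normalisation each tends
  to the same number e, and e - e - e + e = 0.\<close>

lemma dev_pair_tendsto:
 assumes wt: "wt \<in> borel_measurable (Fs R)" "\<And>w. 0 \<le> wt w" "\<And>w. wt w \<le> 1"
  and \<xi>: "strict_mono \<xi>" "\<And>n. \<xi> n \<ge> 1"
  and D: "(\<lambda>n. D (\<xi> n) (x - y) / sd (\<xi> n)) \<longlonglongrightarrow> 0"
  and xy: "x \<noteq> y" "\<bar>x - y\<bar> \<le> 1"
 shows "(\<lambda>n. expectation (\<lambda>w. wt w * (dev (\<xi> n) x w * dev (\<xi> n) y w))) \<longlonglongrightarrow> 0"
proof -
 have wM [measurable]: "wt \<in> borel_measurable M" using wt(1) by (rule measurable_Fs_M)
 have w1: "\<bar>wt w\<bar> \<le> 1" for w using wt(2)[of w] wt(3)[of w] by simp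
 obtain B where B: "B > 0" "\<And>y. \<bar>gtail y\<bar> \<le> B * kern y" using gtail_le_kern by blast
 have gb: "\<bar>gtail z\<bar> \<le> B" for z using B(2)[of z] B(1) kern_le[of z] kern_pos[of z] mult_left_le[of "kern z" B] by linarith
 define G where "G = (\<lambda>n z w. gtail (X (\<xi> n) z w - lev (\<xi> n)))"
 have [measurable]: "G n z \<in> borel_measurable M" for n z unfolding G_def by measurable
 have Gb: "\<bar>G n z w\<bar> \<le> B" for n z w unfolding G_def by (rule gb)
 define t where "t = (\<lambda>n w. tilt (\<xi> n) x y \<alpha> w)"
 define \<zeta> where "\<zeta> = (\<lambda>n. Z (\<xi> n) x y \<alpha> / (phi (\<xi> n) * phi (\<xi> n)))"
 define e where "e = expectation (\<lambda>w. wt w * tilt R x y \<alpha> w)"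
 define I where "I = (LBINT y. gtail y)"
 define a1 where "a1 = (\<lambda>n. (sd (\<xi> n))^2 * expectation (\<lambda>w. wt w * t n w * G n x w * G n y w))"
 define b1 where "b1 = (\<lambda>n. sd (\<xi> n) * expectation (\<lambda>w. wt w * t n w * G n x w))"
 define b2 where "b2 = (\<lambda>n. sd (\<xi> n) * expectation (\<lambda>w. wt w * t n w * G n y w))"
 define c1 where "c1 = (\<lambda>n. expectation (\<lambda>w. wt w * t n w))"
 define u where "u = (\<lambda>n. sd (\<xi> n) * gam (\<xi> n))"
 have s0: "sd (\<xi> n) > 0" for n using \<xi>(2) by (rule sd_pos)
 have D': "(\<lambda>n. D (\<xi> n) (y - x) / sd (\<xi> n)) \<longlonglongrightarrow> 0"
  using D D_minus[of _ "x - y"] by simp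
 have limu: "u \<longlonglongrightarrow> \<kappa>"
  unfolding u_def by (rule filterlim_compose[OF gam_tendsto filterlim_subseq[OF \<xi>(1)]])
 have lima: "a1 \<longlonglongrightarrow> e / (2 * pi) * I^2"
  unfolding a1_def t_def G_def e_def I_def by (rule tilt_local_limit2[OF wt \<xi> D xy gtail_measurable B(2) gtail_nonneg AE_isCont_gtail])
 have limb1: "b1 \<longlonglongrightarrow> e / sqrt (2 * pi) * I"
  unfolding b1_def t_def G_def e_def I_def
  by (rule tilt_local_limit[OF wt \<xi> _ xy gtail_measurable B(2) AE_isCont_gtail]) (use D in simp)
 have limb2: "b2 \<longlonglongrightarrow> e / sqrt (2 * pi) * I"
  unfolding b2_def t_def G_def e_def I_def tilt_swap[of _ x y]
  by (rule tilt_local_limit[OF wt \<xi> _ _ _ gtail_measurable B(2) AE_isCont_gtail]) (use D' xy in auto)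
 have limc: "c1 \<longlonglongrightarrow> e"
 proof -
  have "eventually (\<lambda>n. R \<le> \<xi> n) sequentially"
   using filterlim_subseq[OF \<xi>(1)] by (rule eventually_compose_filterlim[rotated]) (rule eventually_ge_at_top)
  hence "eventually (\<lambda>n. e = c1 n) sequentially"
  proof eventually_elim
   case (elim n)
   show ?case unfolding c1_def t_def e_def by (rule expectation_tilt[OF wt(1) w1 elim, symmetric])
  qed
  thus ?thesis by (rule Lim_transform_eventually[OF tendsto_const])
 qed
 have ti: "integrable M (\<lambda>w. wt w * t n w * p w)" if [measurable]: "p \<in> borel_measurable M" and p: "\<And>w. \<bar>p w\<bar> \<le> P" for n p P
 proof -
  have "\<bar>wt w * p w\<bar> \<le> 1 * P" for w unfolding abs_mult using w1[of w] p[of w] by (intro mult_mono) auto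
  hence "integrable M (\<lambda>w. (wt w * p w) * tilt (\<xi> n) x y \<alpha> w)" by (intro integrable_tilt_mult) auto
  thus ?thesis by (simp only: t_def mult_ac)
 qed
 have GGb: "\<bar>G n x w * G n y w\<bar> \<le> B * B" for n w unfolding abs_mult using Gb[of n _ w] B(1) by (intro mult_mono) auto
 have iGG: "integrable M (\<lambda>w. wt w * t n w * G n x w * G n y w)" for n
  using ti[of "\<lambda>w. G n x w * G n y w" "B * B" n] GGb by (simp add: mult.assoc)
 have iG: "integrable M (\<lambda>w. wt w * t n w * G n z w)" for n z by (rule ti[OF _ Gb]) measurable
 have it: "integrable M (\<lambda>w. wt w * t n w)" for n using ti[of "\<lambda>_. 1" 1 n] by simp
 have eq: "expectation (\<lambda>w. wt w * (dev (\<xi> n) x w * dev (\<xi> n) y w)) = \<zeta> n * (a1 n / (u n * u n) - b1 n / u n - b2 n / u n + c1 n)" for n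
 proof -
  let ?g = "gam (\<xi> n)"
  have pw: "wt w * (dev (\<xi> n) x w * dev (\<xi> n) y w) = \<zeta> n * (1 / (?g * ?g) * (wt w * t n w * G n x w * G n y w) - 1 / ?g * (wt w * t n w * G n x w) - 1 / ?g * (wt w * t n w * G n y w) + wt w * t n w)" for w
  proof -
   have "amp (\<xi> n) x w * amp (\<xi> n) y w = \<zeta> n * t n w"
    unfolding amp_def \<zeta>_def t_def tilt_def using Z_ge_1[of "\<xi> n" x y \<alpha>] by (simp add: exp_add)
   moreover have "wt w * (dev (\<xi> n) x w * dev (\<xi> n) y w) = wt w * (amp (\<xi> n) x w * amp (\<xi> n) y w) * ((G n x w / ?g - 1) * (G n y w / ?g - 1))"
    unfolding dev_def G_def by (simp only: mult_ac)
   ultimately show ?thesis by (simp add: divide_inverse algebra_simps)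
  qed
  have "expectation (\<lambda>w. wt w * (dev (\<xi> n) x w * dev (\<xi> n) y w)) = \<zeta> n * (1 / (?g * ?g) * expectation (\<lambda>w. wt w * t n w * G n x w * G n y w) - 1 / ?g * expectation (\<lambda>w. wt w * t n w * G n x w) - 1 / ?g * expectation (\<lambda>w. wt w * t n w * G n y w) + expectation (\<lambda>w. wt w * t n w))"
   unfolding pw using iGG iG it
   by (simp only: integral_mult_right_zero Bochner_Integration.integral_add Bochner_Integration.integral_diff Bochner_Integration.integrable_add Bochner_Integration.integrable_diff integrable_mult_right)
  also have "... = \<zeta> n * (a1 n / (u n * u n) - b1 n / u n - b2 n / u n + c1 n)"
   unfolding a1_def b1_def b2_def c1_def u_def using s0[of n] by (simp add: power2_eq_square)
  finally show ?thesis .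
 qed
 have lim1: "(\<lambda>n. a1 n / (u n * u n) - b1 n / u n - b2 n / u n + c1 n) \<longlonglongrightarrow> (e / (2 * pi) * I^2) / (\<kappa> * \<kappa>) - (e / sqrt (2 * pi) * I) / \<kappa> - (e / sqrt (2 * pi) * I) / \<kappa> + e"
  using kappa_pos by (intro tendsto_intros lima limb1 limb2 limc limu) auto
 \<comment> \<open>\<kappa> is itself I / sqrt(2 pi), so the densities and the integrals of
   \<open>gtail\<close> cancel.\<close>
 have q: "(e / (2 * pi) * I^2) / (\<kappa> * \<kappa>) = e" "(e / sqrt (2 * pi) * I) / \<kappa> = e"
 proof -
  have I: "I > 0" unfolding I_def by (rule integral_gtail_pos)
  have k: "\<kappa> = I / sqrt (2 * pi)" by (simp add: \<kappa>_def I_def)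
  show "(e / sqrt (2 * pi) * I) / \<kappa> = e" unfolding k using I by simp
  have "\<kappa> * \<kappa> = I^2 / (2 * pi)" unfolding k by (simp add: power2_eq_square)
  thus "(e / (2 * pi) * I^2) / (\<kappa> * \<kappa>) = e" using I by simp
 qed
 have lim0: "(\<lambda>n. a1 n / (u n * u n) - b1 n / u n - b2 n / u n + c1 n) \<longlonglongrightarrow> 0"
  using lim1 unfolding q by simp
 define L where "L = ln (1 / \<bar>x - y\<bar>)"
 obtain C where C: "C > 0" and Cb1: "\<And>K N x y. K \<le> N ==> x \<noteq> y ==> \<bar>x - y\<bar> \<le> 1 ==> ln (1 / \<bar>x - y\<bar>) \<le> L ==>
   expectation (\<lambda>w. of_bool (X K x w > \<beta> * S K) * (amp_bnd N x w * amp_bnd N y w)) \<le> C * exp (- \<eta>\<^sup>2 * S K)"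
  and Cb2: "\<And>N x y. x \<noteq> y ==> \<bar>x - y\<bar> \<le> 1 ==> ln (1 / \<bar>x - y\<bar>) \<le> L ==> expectation (\<lambda>w. amp_bnd N x w * amp_bnd N y w) \<le> C"
  using tail_two_point[of L] by blast
 \<comment> \<open>This factor is the two-point moment of \<open>amp\<close>. At fixed distinct
   points it is bounded in n, by domination with \<open>amp_bnd\<close>.\<close>
 have zb: "\<bar>\<zeta> n\<bar> \<le> C" for n
 proof -
  have "\<zeta> n = expectation (\<lambda>w. exp (\<alpha> * X (\<xi> n) x w + \<alpha> * X (\<xi> n) y w)) / (phi (\<xi> n) * phi (\<xi> n))"
   unfolding \<zeta>_def Z_def expectation_exp_two ..
  also have "... = expectation (\<lambda>w. amp (\<xi> n) x w * amp (\<xi> n) y w)"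
   unfolding integral_divide_zero[symmetric] amp_def by (simp add: exp_add)
  also have "... \<le> expectation (\<lambda>w. amp_bnd (\<xi> n) x w * amp_bnd (\<xi> n) y w)"
  proof (rule integral_mono')
   show "integrable M (\<lambda>w. amp_bnd (\<xi> n) x w * amp_bnd (\<xi> n) y w)" by (rule integrable_amp_bnd_pair)
   show "amp (\<xi> n) x w * amp (\<xi> n) y w \<le> amp_bnd (\<xi> n) x w * amp_bnd (\<xi> n) y w" for w
    by (intro mult_mono amp_le_amp_bnd less_imp_le[OF amp_pos] less_imp_le[OF amp_bnd_pos])
   show "0 \<le> amp_bnd (\<xi> n) x w * amp_bnd (\<xi> n) y w" for w
    by (intro mult_nonneg_nonneg less_imp_le[OF amp_bnd_pos])
  qed
  also have "... \<le> C" using xy by (intro Cb2) (auto simp: L_def)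
  finally have "\<zeta> n \<le> C" .
  moreover have "\<zeta> n \<ge> 0" unfolding \<zeta>_def using Z_ge_1[of "\<xi> n" x y \<alpha>] phi_ge_1[of "\<xi> n"] by simp
  ultimately show ?thesis by simp
 qed
 show ?thesis
 proof (rule Lim_null_comparison)
  show "\<forall>\<^sub>F n in sequentially. norm (expectation (\<lambda>w. wt w * (dev (\<xi> n) x w * dev (\<xi> n) y w))) \<le> C * \<bar>a1 n / (u n * u n) - b1 n / u n - b2 n / u n + c1 n\<bar>"
   unfolding eq by (intro always_eventually allI) (simp only: real_norm_def abs_mult, intro mult_right_mono zb abs_ge_zero)
  show "(\<lambda>n. C * \<bar>a1 n / (u n * u n) - b1 n / u n - b2 n / u n + c1 n\<bar>) \<longlonglongrightarrow> 0"
   using tendsto_mult[OF tendsto_const[of C] tendsto_rabs_zero[OF lim0]] by simp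
 qed
qed

definition tdev :: "nat => nat => nat => real => 'a => real" where
 "tdev q r N x w = dev N x w * tr q r x w"

lemma tdev_measurable [measurable]: "tdev q r N x \<in> borel_measurable M"
 unfolding tdev_def by measurable

text \<open>Truncation up to a fixed scale r is a weight measurable at stage \<open>H r\<close>, so
  \<open>dev_pair_tendsto\<close> applies. The truncation actually used runs up to
  \<open>lv N\<close>; the scales beyond r change the moment by a geometric tail, uniformly in
  N.\<close>

lemma tdev_pair_tendsto:
 assumes \<xi>: "strict_mono \<xi>" "\<And>n. \<xi> n \<ge> 1"
  and D: "(\<lambda>n. D (\<xi> n) (x - y) / sd (\<xi> n)) \<longlonglongrightarrow> 0"
  and xy: "x \<noteq> y" "\<bar>x - y\<bar> \<le> 1"
 shows "(\<lambda>n. expectation (\<lambda>w. tdev q (lv (\<xi> n)) (\<xi> n) x w * tdev q (lv (\<xi> n)) (\<xi> n) y w)) \<longlonglongrightarrow> 0"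
proof -
 define L where "L = ln (1 / \<bar>x - y\<bar>)"
 obtain C where C: "C > 0" and Cb: "\<And>K N x y. K \<le> N ==> x \<noteq> y ==> \<bar>x - y\<bar> \<le> 1 ==> ln (1 / \<bar>x - y\<bar>) \<le> L ==>
   expectation (\<lambda>w. of_bool (X K x w > \<beta> * S K) * (amp_bnd N x w * amp_bnd N y w)) \<le> C * exp (- \<eta>\<^sup>2 * S K)"
  and Cb2: "\<And>N x y. x \<noteq> y ==> \<bar>x - y\<bar> \<le> 1 ==> ln (1 / \<bar>x - y\<bar>) \<le> L ==> expectation (\<lambda>w. amp_bnd N x w * amp_bnd N y w) \<le> C"
  using tail_two_point[of L] by blast
 obtain C3 N0 where C3: "C3 > 0" and gp: "\<And>N. N \<ge> N0 ==> gam N > 0" and dv: "\<And>N x w. N \<ge> N0 ==> \<bar>dev N x w\<bar> \<le> C3 * amp_bnd N x w"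
  using dev_le_amp_bnd by blast
 obtain C5 where C5: "C5 > 0" and C5b: "\<And>r s. (\<Sum>m\<in>{r<..s}. exp (- \<eta>\<^sup>2 * S (H m))) \<le> C5 * exp (- \<eta>\<^sup>2) ^ r"
  using exceed_sum_le by blast
 define E where "E = 2 * (C3 * C3) * C * C5"
 have E: "E > 0" using C C3 C5 by (simp add: E_def)
 define h where "h = (\<lambda>r n. expectation (\<lambda>w. tdev q r (\<xi> n) x w * tdev q r (\<xi> n) y w))"
 have Ai: "integrable M (\<lambda>w. p w * (amp_bnd N x w * amp_bnd N y w))" if [measurable]: "p \<in> borel_measurable M" and p: "\<And>w. \<bar>p w\<bar> \<le> P" for p N P
 proof (rule integrable_bounded)
  have "P \<ge> 0" using p order_trans[OF abs_ge_zero] by blast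
  thus "\<bar>p w * (amp_bnd N x w * amp_bnd N y w)\<bar> \<le> P * ((exp (\<alpha> * real N) * (1 + sd N)) * (exp (\<alpha> * real N) * (1 + sd N)))" for w
   unfolding abs_mult abs_of_pos[OF amp_bnd_pos] using sd_nonneg[of N]
   by (intro mult_mono p amp_bnd_le less_imp_le[OF amp_bnd_pos]) (auto intro!: mult_nonneg_nonneg less_imp_le[OF amp_bnd_pos])
 qed measurable
 have diff: "\<bar>h r n - h (lv (\<xi> n)) n\<bar> \<le> E * exp (- \<eta>\<^sup>2) ^ r"
  if r: "q \<le> r" "r \<le> lv (\<xi> n)" and n: "\<xi> n \<ge> N0" "\<xi> n \<ge> 3" for r n
 proof -
  define N where "N = \<xi> n"
  define s where "s = lv N"
  have rs: "r \<le> s" using r by (simp add: s_def N_def)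
  define V where "V = (\<lambda>z m w. of_bool (X (H m) z w > \<beta> * S (H m)) :: real)"
  have [measurable]: "V z m \<in> borel_measurable M" for z m unfolding V_def by measurable
  have dd: "\<bar>dev N x w * dev N y w\<bar> \<le> (C3 * C3) * (amp_bnd N x w * amp_bnd N y w)" for w
  proof -
   have "\<bar>dev N x w\<bar> * \<bar>dev N y w\<bar> \<le> (C3 * amp_bnd N x w) * (C3 * amp_bnd N y w)"
    using C3 n by (intro mult_mono dv) (auto simp: N_def intro!: mult_nonneg_nonneg less_imp_le[OF amp_bnd_pos])
   thus ?thesis by (simp add: abs_mult mult_ac)
  qed
  have ddi: "integrable M (\<lambda>w. tdev q k N x w * tdev q k N y w)" for k
  proof (rule Bochner_Integration.integrable_bound)
   show "integrable M (\<lambda>w. (C3 * C3) * (amp_bnd N x w * amp_bnd N y w))" using Ai[of "\<lambda>_. 1" 1 N] by (intro integrable_mult_right) simp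
   have "norm (tdev q k N x w * tdev q k N y w) \<le> norm ((C3 * C3) * (amp_bnd N x w * amp_bnd N y w))" for w
   proof -
    have "\<bar>dev N x w * dev N y w\<bar> * (tr q k x w * tr q k y w) \<le> \<bar>dev N x w * dev N y w\<bar> * 1"
     by (intro mult_left_mono mult_le_one tr_bounds) auto
    hence "norm (tdev q k N x w * tdev q k N y w) \<le> \<bar>dev N x w * dev N y w\<bar>"
     using tr_bounds[of q k _ w] by (simp add: tdev_def abs_mult mult_ac)
    also have "... \<le> norm ((C3 * C3) * (amp_bnd N x w * amp_bnd N y w))" using dd[of w] by simp
    finally show ?thesis .
   qed
   thus "AE w in M. norm (tdev q k N x w * tdev q k N y w) \<le> norm ((C3 * C3) * (amp_bnd N x w * amp_bnd N y w))" by simp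
  qed measurable
  have Vb: "\<bar>V z m w\<bar> \<le> 1" for z m w by (simp add: V_def)
  have AV: "integrable M (\<lambda>w. V z m w * (amp_bnd N x w * amp_bnd N y w))" for z m by (rule Ai[OF _ Vb]) measurable
  let ?R = "\<lambda>w. (C3 * C3) * (\<Sum>m\<in>{r<..s}. V x m w * (amp_bnd N x w * amp_bnd N y w) + V y m w * (amp_bnd N x w * amp_bnd N y w))"
  have Ri: "integrable M ?R"
   by (intro integrable_mult_right Bochner_Integration.integrable_sum Bochner_Integration.integrable_add AV)
  have pw: "\<bar>tdev q r N x w * tdev q r N y w - tdev q s N x w * tdev q s N y w\<bar> \<le> ?R w" for w
  proof -
   have "tr q r x w * tr q r y w - tr q s x w * tr q s y w = (tr q r x w - tr q s x w) * tr q r y w + tr q s x w * (tr q r y w - tr q s y w)"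
    by (simp add: algebra_simps)
   moreover have "(tr q r x w - tr q s x w) * tr q r y w \<le> (\<Sum>m\<in>{r<..s}. V x m w) * 1"
    unfolding V_def by (intro mult_mono tr_diff[OF r(1) rs] tr_bounds sum_nonneg) auto
   moreover have "tr q s x w * (tr q r y w - tr q s y w) \<le> 1 * (\<Sum>m\<in>{r<..s}. V y m w)"
    unfolding V_def by (intro mult_mono tr_diff[OF r(1) rs] tr_bounds sum_nonneg) auto
   moreover have "0 \<le> (tr q r x w - tr q s x w) * tr q r y w + tr q s x w * (tr q r y w - tr q s y w)"
    by (intro add_nonneg_nonneg mult_nonneg_nonneg tr_diff[OF r(1) rs] tr_bounds)
   ultimately have tt: "\<bar>tr q r x w * tr q r y w - tr q s x w * tr q s y w\<bar> \<le> (\<Sum>m\<in>{r<..s}. V x m w) + (\<Sum>m\<in>{r<..s}. V y m w)"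
    by linarith
   have "\<bar>tdev q r N x w * tdev q r N y w - tdev q s N x w * tdev q s N y w\<bar>
    = \<bar>dev N x w * dev N y w\<bar> * \<bar>tr q r x w * tr q r y w - tr q s x w * tr q s y w\<bar>"
    unfolding abs_mult[symmetric] tdev_def by (rule arg_cong[where f = abs]) (simp add: algebra_simps)
   also have "... \<le> ((C3 * C3) * (amp_bnd N x w * amp_bnd N y w)) * ((\<Sum>m\<in>{r<..s}. V x m w) + (\<Sum>m\<in>{r<..s}. V y m w))"
    using dd[of w] C3 by (intro mult_mono tt) (auto intro!: mult_nonneg_nonneg less_imp_le[OF amp_bnd_pos])
   also have "... = ?R w"
    unfolding sum.distrib[symmetric] sum_distrib_left distrib_left by (simp only: mult_ac)
   finally show ?thesis .
  qed
  have hd: "h r n - h s n = expectation (\<lambda>w. tdev q r N x w * tdev q r N y w - tdev q s N x w * tdev q s N y w)"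
   unfolding h_def N_def[symmetric] by (intro Bochner_Integration.integral_diff[symmetric] ddi)
  have "\<bar>h r n - h s n\<bar> \<le> expectation (\<lambda>w. \<bar>tdev q r N x w * tdev q r N y w - tdev q s N x w * tdev q s N y w\<bar>)"
   unfolding hd by (rule integral_abs_bound)
  also have "... \<le> expectation ?R"
  proof (rule integral_mono)
   show "integrable M (\<lambda>w. \<bar>tdev q r N x w * tdev q r N y w - tdev q s N x w * tdev q s N y w\<bar>)"
    using Bochner_Integration.integrable_diff[OF ddi[of r] ddi[of s]] by (rule integrable_abs)
   show "integrable M ?R" by (rule Ri)
   show "\<bar>tdev q r N x w * tdev q r N y w - tdev q s N x w * tdev q s N y w\<bar> \<le> ?R w" for w by (rule pw)
  qed
  also have "... = (C3 * C3) * (\<Sum>m\<in>{r<..s}. expectation (\<lambda>w. V x m w * (amp_bnd N x w * amp_bnd N y w)) + expectation (\<lambda>w. V y m w * (amp_bnd N x w * amp_bnd N y w)))"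
   using AV by (simp only: integral_mult_right_zero Bochner_Integration.integral_sum Bochner_Integration.integral_add Bochner_Integration.integrable_add)
  also have "... \<le> (C3 * C3) * (\<Sum>m\<in>{r<..s}. C * exp (- \<eta>\<^sup>2 * S (H m)) + C * exp (- \<eta>\<^sup>2 * S (H m)))"
  proof (intro mult_left_mono sum_mono add_mono)
   fix m assume m: "m \<in> {r<..s}"
   have HN: "H m \<le> N" using m n by (intro H_le) (auto simp: N_def s_def)
   show "expectation (\<lambda>w. V x m w * (amp_bnd N x w * amp_bnd N y w)) \<le> C * exp (- \<eta>\<^sup>2 * S (H m))"
    unfolding V_def by (intro Cb HN xy) (simp add: L_def)
   have "expectation (\<lambda>w. V y m w * (amp_bnd N y w * amp_bnd N x w)) \<le> C * exp (- \<eta>\<^sup>2 * S (H m))"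
    unfolding V_def using xy by (intro Cb HN) (auto simp: L_def abs_minus_commute)
   thus "expectation (\<lambda>w. V y m w * (amp_bnd N x w * amp_bnd N y w)) \<le> C * exp (- \<eta>\<^sup>2 * S (H m))"
    by (simp only: mult.commute)
  qed (use C3 in auto)
  also have "... = 2 * (C3 * C3) * C * (\<Sum>m\<in>{r<..s}. exp (- \<eta>\<^sup>2 * S (H m)))"
   unfolding sum_distrib_left by (intro sum.cong refl) simp
  also have "... \<le> 2 * (C3 * C3) * C * (C5 * exp (- \<eta>\<^sup>2) ^ r)"
   using C C3 by (intro mult_left_mono C5b) auto
  finally show ?thesis by (simp add: E_def s_def N_def mult_ac)
 qed
 have limr: "(\<lambda>n. h r n) \<longlonglongrightarrow> 0" for r
 proof -
  have wt: "(\<lambda>w. tr q r x w * tr q r y w) \<in> borel_measurable (Fs (H r))"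
   by (intro borel_measurable_times tr_measurable_Fs)
  have "(\<lambda>n. expectation (\<lambda>w. (tr q r x w * tr q r y w) * (dev (\<xi> n) x w * dev (\<xi> n) y w))) \<longlonglongrightarrow> 0"
   by (rule dev_pair_tendsto[OF wt _ _ \<xi> D xy]) (auto intro: mult_nonneg_nonneg mult_le_one tr_bounds)
  thus ?thesis unfolding h_def tdev_def by (simp only: mult_ac)
 qed
 have "(\<lambda>n. h (lv (\<xi> n)) n) \<longlonglongrightarrow> 0"
 proof (rule LIMSEQ_I)
  fix \<epsilon> :: real assume e: "\<epsilon> > 0"
  have "(\<lambda>r. E * exp (- \<eta>\<^sup>2) ^ r) \<longlonglongrightarrow> E * 0"
   using eta_pos by (intro tendsto_mult tendsto_const LIMSEQ_realpow_zero) auto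
  hence "eventually (\<lambda>r. E * exp (- \<eta>\<^sup>2) ^ r < \<epsilon> / 2) sequentially"
   using e by (intro order_tendstoD(2)[where y = "E * 0"]) auto
  hence "eventually (\<lambda>r. E * exp (- \<eta>\<^sup>2) ^ r < \<epsilon> / 2 \<and> q \<le> r) sequentially"
   by (intro eventually_conj eventually_ge_at_top)
  then obtain r where r: "E * exp (- \<eta>\<^sup>2) ^ r < \<epsilon> / 2" "q \<le> r" by (auto simp: eventually_sequentially)
  have "eventually (\<lambda>n. \<bar>h r n\<bar> < \<epsilon> / 2) sequentially"
   using tendstoD[OF limr[of r], of "\<epsilon> / 2"] e by (simp add: dist_real_def)
  moreover have "eventually (\<lambda>n. r \<le> lv (\<xi> n)) sequentially"
   using filterlim_compose[OF lv_tendsto filterlim_subseq[OF \<xi>(1)]] by (auto simp: filterlim_at_top)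
  moreover have "eventually (\<lambda>n. max N0 3 \<le> \<xi> n) sequentially"
   using filterlim_subseq[OF \<xi>(1)] unfolding filterlim_at_top by blast
  ultimately have "eventually (\<lambda>n. norm (h (lv (\<xi> n)) n - 0) < \<epsilon>) sequentially"
  proof eventually_elim
   case (elim n)
   have "\<bar>h r n - h (lv (\<xi> n)) n\<bar> \<le> E * exp (- \<eta>\<^sup>2) ^ r" using elim r by (intro diff) auto
   thus ?case using elim(1) r(1) unfolding real_norm_def by linarith
  qed
  thus "\<exists>no. \<forall>n\<ge>no. norm (h (lv (\<xi> n)) n - 0) < \<epsilon>" by (simp add: eventually_sequentially)
 qed
 thus ?thesis by (simp only: h_def)
qed

end

section \<open>Uniform integration over the unit interval\<close>

definition unif :: "real measure" where "unif = uniform_measure lborel {0..1}"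

lemma sets_unif [measurable_cong, simp]: "sets unif = sets borel"
 by (simp add: unif_def)

lemma space_unif [simp]: "space unif = UNIV"
 by (simp add: unif_def)

lemma prob_space_unif: "prob_space unif"
 unfolding unif_def by (rule prob_space_uniform_measure) auto

lemma unif_eq_density: "unif = density lborel (\<lambda>x. ennreal (indicator {0..1} x))"
 unfolding unif_def uniform_measure_def by (simp add: ennreal_indicator divide_ennreal_def)

lemma integral_unif:
 fixes f :: "real => real"
 assumes [measurable]: "f \<in> borel_measurable borel"
 shows "(LINT x|unif. f x) = (LBINT x:{0..1}. f x)"
 unfolding unif_eq_density set_lebesgue_integral_def by (subst integral_density) auto

lemma AE_unif: "(AE x in lborel. x \<in> {0..1} \<longrightarrow> P x) ==> AE x in unif. P x"
 unfolding unif_def by (rule AE_uniform_measureI) auto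

lemma AE_lborel_of_unif: "(AE x in unif. P x) ==> AE x in lborel. x \<in> {0..1} \<longrightarrow> P x"
 unfolding unif_def by (subst (asm) AE_uniform_measure) auto

lemma AE_unif_mem: "AE x in unif. x \<in> {0..1}"
 by (rule AE_unif) simp

lemma AE_unif_neq: "AE y in unif. y \<noteq> x"
 using AE_lborel_singleton[of x] by (intro AE_unif) auto

lemma integrable_abs_powr:
 fixes \<theta> :: real
 assumes "\<theta> < 1"
 shows "integrable lborel (\<lambda>t. indicator {-1..1} t * \<bar>t\<bar> powr (- \<theta>))"
proof -
 have "(\<lambda>t. t powr (- \<theta>)) absolutely_integrable_on {0..1::real}"
  using assms by (intro nonnegative_absolutely_integrable_1 integrable_on_powr_from_0) auto
 hence "integrable lebesgue (\<lambda>t. indicator {0..1::real} t *\<^sub>R t powr (- \<theta>))" by (simp add: set_integrable_def)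
 hence 1: "integrable lborel (\<lambda>t. indicator {0..1::real} t *\<^sub>R t powr (- \<theta>))"
  by (subst (asm) integrable_completion) auto
 have 2: "integrable lborel (\<lambda>t. indicator {0..1::real} (0 + - 1 * t) *\<^sub>R (0 + - 1 * t) powr (- \<theta>))"
  by (rule lborel_integrable_real_affine[OF 1]) simp
 show ?thesis
 proof (rule Bochner_Integration.integrable_bound[OF Bochner_Integration.integrable_add[OF 1 2]])
  show "AE t in lborel. norm (indicator {-1..1} t * \<bar>t\<bar> powr (- \<theta>))
   \<le> norm (indicator {0..1::real} t *\<^sub>R t powr (- \<theta>) + indicator {0..1::real} (0 + - 1 * t) *\<^sub>R (0 + - 1 * t) powr (- \<theta>))"
   by (intro AE_I2) (auto simp: indicator_def)
 qed measurable
qed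

text \<open>After translation and reflection all these integrals are bounded by one integral over
  [-1, 1], hence uniformly in x.\<close>

lemma integral_unif_abs_powr:
 fixes \<theta> :: real
 assumes "\<theta> < 1"
 obtains I where "\<And>x. x \<in> {0..1} ==> integrable unif (\<lambda>y. \<bar>x - y\<bar> powr (- \<theta>))"
  "\<And>x. x \<in> {0..1} ==> (LINT y|unif. \<bar>x - y\<bar> powr (- \<theta>)) \<le> I"
proof -
 define k where "k = (\<lambda>t. indicator {-1..1} t * \<bar>t\<bar> powr (- \<theta>))"
 have k: "integrable lborel k" unfolding k_def by (rule integrable_abs_powr[OF assms])
 have k1: "integrable lborel (\<lambda>y. k (x + - 1 * y))" for x by (rule lborel_integrable_real_affine[OF k]) simp
 have eq: "indicator {0..1} y *\<^sub>R \<bar>x - y\<bar> powr (- \<theta>) = indicator {0..1} y * k (x + - 1 * y)" if "x \<in> {0..1}" for x y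
  using that by (auto simp: k_def indicator_def)
 have int: "integrable lborel (\<lambda>y. indicator {0..1} y *\<^sub>R \<bar>x - y\<bar> powr (- \<theta>))" if "x \<in> {0..1}" for x
  unfolding eq[OF that] by (rule Bochner_Integration.integrable_bound[OF k1[of x]]) (auto simp: indicator_def k_def)
 have val: "(LBINT y. k (x + - 1 * y)) = (LBINT t. k t)" for x
  using lborel_integral_real_affine[of "- 1" k x] by simp
 show ?thesis
 proof (rule that)
  fix x :: real assume x: "x \<in> {0..1}"
  show "integrable unif (\<lambda>y. \<bar>x - y\<bar> powr (- \<theta>))"
   unfolding unif_eq_density by (subst integrable_density) (auto simp: int[OF x, simplified])
  have "(LINT y|unif. \<bar>x - y\<bar> powr (- \<theta>)) = (LBINT y. indicator {0..1} y *\<^sub>R \<bar>x - y\<bar> powr (- \<theta>))"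
   by (subst integral_unif) (auto simp: set_lebesgue_integral_def)
  also have "... \<le> (LBINT y. k (x + - 1 * y))"
  proof (rule integral_mono[OF int[OF x] k1])
   show "indicator {0..1} y *\<^sub>R \<bar>x - y\<bar> powr (- \<theta>) \<le> k (x + - 1 * y)" for y
    unfolding eq[OF x] by (auto simp: k_def indicator_def)
  qed
  finally show "(LINT y|unif. \<bar>x - y\<bar> powr (- \<theta>)) \<le> (LBINT t. k t)" by (simp only: val)
 qed
qed

text \<open>Null sets survive translation and reflection, which turns a statement for almost every
  distance into one for almost every second point.\<close>

lemma AE_unif_abs_diff:
 assumes "AE t in unif. P t" and x: "x \<in> {0..1}"
 shows "AE y in unif. P \<bar>x - y\<bar>"
proof -
 obtain Nl where Nl: "{t \<in> space lborel. \<not> (t \<in> {0..1} \<longrightarrow> P t)} \<subseteq> Nl" "emeasure lborel Nl = 0" "Nl \<in> sets lborel"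
  using AE_lborel_of_unif[OF assms(1)] by (rule AE_E)
 have [measurable]: "Nl \<in> sets borel" using Nl(3) by simp
 have "AE t in lborel. t \<notin> Nl" using Nl(2,3) by (intro AE_not_in) (auto simp: null_sets_def)
 hence "AE y in lborel. x + - 1 * y \<notin> Nl" "AE y in lborel. - x + 1 * y \<notin> Nl"
  by (intro AE_borel_affine; simp)+
 hence "AE y in lborel. y \<in> {0..1} \<longrightarrow> P \<bar>x - y\<bar>"
 proof eventually_elim
  case (elim y)
  show ?case
  proof
   assume y: "y \<in> {0..1}"
   have "P t" if "t \<notin> Nl" "t \<in> {0..1}" for t using Nl(1) that by auto
   thus "P \<bar>x - y\<bar>" using elim x y by (cases "x \<ge> y") auto
  qed
 qed
 thus ?thesis by (rule AE_unif)
qed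

context prob_space
begin

lemma integral_swap_unif:
 fixes f :: "'a => real => real"
 assumes f [measurable]: "(\<lambda>(w, x). f w x) \<in> borel_measurable (M \<Otimes>\<^sub>M borel)" and B: "\<And>w x. \<bar>f w x\<bar> \<le> B"
 shows "expectation (\<lambda>w. LINT x|unif. f w x) = (LINT x|unif. expectation (\<lambda>w. f w x))"
proof -
 interpret U: prob_space unif by (rule prob_space_unif)
 interpret P: pair_prob_space M unif ..
 have "(\<lambda>(w, x). f w x) \<in> borel_measurable (M \<Otimes>\<^sub>M unif)" by measurable
 hence "integrable (M \<Otimes>\<^sub>M unif) (\<lambda>(w, x). f w x)"
  using B by (intro P.P.integrable_const_bound[where B = B]) auto
 from P.Fubini_integral[OF this] show ?thesis by simp
qed

lemma abs_integral_unif_le: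
 fixes g :: "real => real"
 assumes "g \<in> borel_measurable borel" "\<And>x. \<bar>g x\<bar> \<le> B"
 shows "\<bar>LINT x|unif. g x\<bar> \<le> B"
proof -
 interpret U: prob_space unif by (rule prob_space_unif)
 have g: "integrable unif g" using assms by (intro U.integrable_const_bound[where B = B]) auto
 have "\<bar>LINT x|unif. g x\<bar> \<le> (LINT x|unif. \<bar>g x\<bar>)" by (rule integral_abs_bound)
 also have "... \<le> (LINT x|unif. B)" using g assms by (intro integral_mono integrable_abs) auto
 finally show ?thesis using U.prob_space by simp
qed

lemma second_moment_integral:
 fixes f :: "'a => real => real"
 assumes f [measurable]: "(\<lambda>(w, x). f w x) \<in> borel_measurable (M \<Otimes>\<^sub>M borel)" and B: "\<And>w x. \<bar>f w x\<bar> \<le> B"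
 shows "expectation (\<lambda>w. (LINT x|unif. f w x)^2) = (LINT x|unif. LINT y|unif. expectation (\<lambda>w. f w x * f w y))"
proof -
 interpret U: prob_space unif by (rule prob_space_unif)
 define J where "J = (\<lambda>w. LINT x|unif. f w x)"
 have B0: "B \<ge> 0" using B order_trans[OF abs_ge_zero] by blast
 have [measurable]: "(\<lambda>(w, x). f w x) \<in> borel_measurable (M \<Otimes>\<^sub>M unif)" by measurable
 have [measurable]: "J \<in> borel_measurable M" unfolding J_def by (rule U.borel_measurable_lebesgue_integral) measurable
 have Jb: "\<bar>J w\<bar> \<le> B" if "w \<in> space M" for w
  unfolding J_def using that B by (intro abs_integral_unif_le) auto
 \<comment> \<open>Sections of f are known to be measurable only over the space of M. The cutoff to
   0 elsewhere gives the everywhere bound that \<open>integral_swap_unif\<close> requires.\<close>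
 define J' where "J' = (\<lambda>w. if w \<in> space M then J w else 0)"
 have J'm [measurable]: "J' \<in> borel_measurable M" unfolding J'_def by measurable
 have J'b: "\<bar>J' w\<bar> \<le> B" for w using Jb B0 by (simp add: J'_def)
 have "expectation (\<lambda>w. (J w)^2) = expectation (\<lambda>w. LINT x|unif. f w x * J' w)"
  by (intro Bochner_Integration.integral_cong refl) (simp add: power2_eq_square J_def[symmetric] J'_def, simp add: J_def)
 also have "... = (LINT x|unif. expectation (\<lambda>w. f w x * J' w))"
 proof (rule integral_swap_unif)
  show "\<bar>f w x * J' w\<bar> \<le> B * B" for w x unfolding abs_mult using B J'b B0 by (intro mult_mono) auto
 qed measurable
 also have "... = (LINT x|unif. LINT y|unif. expectation (\<lambda>w. f w x * f w y))"
 proof (intro Bochner_Integration.integral_cong refl)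
  fix x
  have "expectation (\<lambda>w. f w x * J' w) = expectation (\<lambda>w. LINT y|unif. f w x * f w y)"
   by (intro Bochner_Integration.integral_cong refl) (simp add: J'_def J_def)
  also have "... = (LINT y|unif. expectation (\<lambda>w. f w x * f w y))"
  proof (rule integral_swap_unif)
   show "\<bar>f w x * f w y\<bar> \<le> B * B" for w y unfolding abs_mult using B B0 by (intro mult_mono) auto
  qed measurable
  finally show "expectation (\<lambda>w. f w x * J' w) = (LINT y|unif. expectation (\<lambda>w. f w x * f w y))" .
 qed
 finally show ?thesis by (simp only: J_def)
qed

end

context log_field
begin

text \<open>Halfway between \<rho> and 1: the gap above \<rho> absorbs the factor 1 +
  \<open>S K\<close> of \<open>near_moment\<close>, and the gap below 1 keeps the singularity
  integrable.\<close>

definition \<theta>' :: real where "\<theta>' = (\<rho> + 1) / 2"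

lemma rho_less: "\<rho> < \<theta>'" "\<theta>' < 1" "0 < \<theta>'"
 using alpha_sq by (auto simp: \<theta>'_def \<rho>_def intro: add_nonneg_pos)

lemma tdev_bound: "\<bar>tdev q r N x w\<bar> \<le> \<bar>dev N x w\<bar>"
 using tr_bounds[of q r x w] by (simp add: tdev_def abs_mult mult_left_le)

text \<open>With l = ln(1 / |x - y|), a pair decorrelates after scale about l. Keeping only the
  truncation at that scale, \<open>near_moment\<close> gives a multiple of (1 + l) exp(\<rho> l), at
  most a multiple of |x - y|^(-\<theta>'). Pairs too far apart for a truncated scale are covered by
  the plain two-point bound.\<close>

lemma tdev_pair_bound:
 obtains C N1 where "C > 0" "\<And>N x y. N \<ge> N1 ==> x \<noteq> y ==> \<bar>x - y\<bar> \<le> 1 ==>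
  \<bar>expectation (\<lambda>w. tdev q (lv N) N x w * tdev q (lv N) N y w)\<bar> \<le> C * \<bar>x - y\<bar> powr (- \<theta>')"
proof -
 \<comment> \<open>The worst case is the increment of \<open>D\<close> after scale m:
   \<open>D_upper\<close>, \<open>D_lower\<close> and \<open>S_H\<close> each cost one C0. The 2 is
   one unit from \<open>S_H\<close> and one from rounding l.\<close>
 define C1 where "C1 = 3 * C\<^sub>0 + 2"
 obtain Cn where Cn: "Cn > 0" and near: "\<And>K N x y. K \<le> N ==> D N (2 * (x - y)) \<le> S K + C1 ==> D N (x - y) - D K (x - y) \<le> C1 ==>
   expectation (\<lambda>w. of_bool (X K x w \<le> \<beta> * S K) * (amp_bnd N x w * amp_bnd N y w)) \<le> Cn * (1 + S K) * exp (\<rho> * S K)"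
  using near_moment[of C1] by blast
 \<comment> \<open>If l exceeds q + 1, its integer part is at least q + 1 and so belongs to the
   truncated scales.\<close>
 define L where "L = real q + 1"
 obtain Cf where Cf: "Cf > 0" and far0: "\<And>K N x y. K \<le> N ==> x \<noteq> y ==> \<bar>x - y\<bar> \<le> 1 ==> ln (1 / \<bar>x - y\<bar>) \<le> L ==>
   expectation (\<lambda>w. of_bool (X K x w > \<beta> * S K) * (amp_bnd N x w * amp_bnd N y w)) \<le> Cf * exp (- \<eta>\<^sup>2 * S K)"
  and far: "\<And>N x y. x \<noteq> y ==> \<bar>x - y\<bar> \<le> 1 ==> ln (1 / \<bar>x - y\<bar>) \<le> L ==> expectation (\<lambda>w. amp_bnd N x w * amp_bnd N y w) \<le> Cf"
  using tail_two_point[of L] by blast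
 obtain C3 N0 where C3: "C3 > 0" and gp: "\<And>N. N \<ge> N0 ==> gam N > 0" and dv: "\<And>N x w. N \<ge> N0 ==> \<bar>dev N x w\<bar> \<le> C3 * amp_bnd N x w"
  using dev_le_amp_bnd by blast
 obtain N2 where N2: "\<And>N. N \<ge> N2 ==> lv N \<ge> q + 1"
  using lv_tendsto unfolding filterlim_at_top eventually_sequentially by blast
 define d where "d = \<theta>' - \<rho>"
 have d: "d > 0" using rho_less by (simp add: d_def)
 define Cg where "Cg = Cn * (1 + 1 / d) * exp (\<theta>' * (C\<^sub>0 + 1))"
 have Cg: "Cg > 0" using Cn d by (simp add: Cg_def add_pos_pos)
 define C where "C = (C3 * C3) * (Cf + Cg)"
 show ?thesis
 proof (rule that[of C "max N0 (max N2 3)"])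
  show "C > 0" using C3 Cf Cg by (simp add: C_def)
  fix N :: nat and x y :: real
  assume N: "N \<ge> max N0 (max N2 3)" and xy: "x \<noteq> y" "\<bar>x - y\<bar> \<le> 1"
  define t where "t = \<bar>x - y\<bar>"
  define l where "l = ln (1 / t)"
  have t: "0 < t" "t \<le> 1" using xy by (auto simp: t_def)
  have l0: "l \<ge> 0" using t by (simp add: l_def)
  have l_alt: "l = - ln t" using t by (simp add: l_def ln_div)
  have tp: "t powr (- \<theta>') = exp (\<theta>' * l)" using t by (simp add: powr_def l_alt)
  have tp1: "t powr (- \<theta>') \<ge> 1" unfolding tp using rho_less l0 by simp
  have DD: "D n (2 * (x - y)) = D n (2 * t)" "D n (x - y) = D n t" for n
   using D_abs[of n "2 * (x - y)"] D_abs[of n "x - y"] unfolding abs_mult t_def by simp_all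
  have D2: "D N (2 * t) \<le> l + C\<^sub>0"
  proof -
   have "D N (2 * t) \<le> ln (1 / (2 * t)) + C\<^sub>0" unfolding D_def using t by (intro D_upper) auto
   also have "ln (1 / (2 * t)) \<le> l" unfolding l_def using t by (intro ln_mono) (auto simp: divide_simps)
   finally show ?thesis by simp
  qed
  have D1: "D N t \<le> l + C\<^sub>0" unfolding D_def l_def using t by (intro D_upper) auto
  let ?E = "expectation (\<lambda>w. tdev q (lv N) N x w * tdev q (lv N) N y w)"
  have red: "\<bar>?E\<bar> \<le> (C3 * C3) * expectation (\<lambda>w. p w * (amp_bnd N x w * amp_bnd N y w))"
   if p: "\<And>w. tr q (lv N) x w \<le> p w" "\<And>w. 0 \<le> p w" "\<And>w. p w \<le> 1" and [measurable]: "p \<in> borel_measurable M" for p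
  proof -
   have "\<bar>?E\<bar> \<le> expectation (\<lambda>w. \<bar>tdev q (lv N) N x w * tdev q (lv N) N y w\<bar>)" by (rule integral_abs_bound)
   also have "... \<le> expectation (\<lambda>w. (C3 * C3) * (p w * (amp_bnd N x w * amp_bnd N y w)))"
   proof (rule integral_mono')
    show "integrable M (\<lambda>w. (C3 * C3) * (p w * (amp_bnd N x w * amp_bnd N y w)))"
    proof (intro integrable_mult_right, rule Bochner_Integration.integrable_bound[OF integrable_amp_bnd_pair[of N x y]])
     show "AE w in M. norm (p w * (amp_bnd N x w * amp_bnd N y w)) \<le> norm (amp_bnd N x w * amp_bnd N y w)"
      using p by (intro AE_I2) (simp add: abs_mult mult_left_le_one_le)
    qed measurable
    fix w
    have a0: "0 \<le> amp_bnd N x w" "0 \<le> amp_bnd N y w" using amp_bnd_pos less_imp_le by blast+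
    have "\<bar>tdev q (lv N) N x w\<bar> \<le> (C3 * amp_bnd N x w) * p w"
     unfolding tdev_def abs_mult abs_of_nonneg[OF tr_bounds(1)] using N C3 a0 by (intro mult_mono dv p tr_bounds) auto
    moreover have "\<bar>tdev q (lv N) N y w\<bar> \<le> C3 * amp_bnd N y w"
     using N by (intro order_trans[OF tdev_bound dv]) auto
    ultimately have "\<bar>tdev q (lv N) N x w\<bar> * \<bar>tdev q (lv N) N y w\<bar> \<le> ((C3 * amp_bnd N x w) * p w) * (C3 * amp_bnd N y w)"
     using C3 a0 p(2)[of w] by (intro mult_mono) auto
    thus "\<bar>tdev q (lv N) N x w * tdev q (lv N) N y w\<bar> \<le> (C3 * C3) * (p w * (amp_bnd N x w * amp_bnd N y w))"
     by (simp add: abs_mult mult_ac)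
    show "0 \<le> (C3 * C3) * (p w * (amp_bnd N x w * amp_bnd N y w))"
     using C3 a0 p(2)[of w] by (intro mult_nonneg_nonneg) auto
   qed
   finally show ?thesis by simp
  qed
  have main: "\<exists>c. c \<le> (Cf + Cg) * t powr (- \<theta>') \<and> \<bar>?E\<bar> \<le> (C3 * C3) * c"
  proof (cases "l \<le> L")
   case True
   have "\<bar>?E\<bar> \<le> (C3 * C3) * expectation (\<lambda>w. 1 * (amp_bnd N x w * amp_bnd N y w))" by (rule red) (auto simp: tr_bounds)
   moreover have "expectation (\<lambda>w. 1 * (amp_bnd N x w * amp_bnd N y w)) \<le> Cf"
    using far[OF xy, of N] True by (simp add: l_def t_def)
   moreover have "Cf \<le> (Cf + Cg) * t powr (- \<theta>')"
    using mult_mono[of Cf "Cf + Cg" 1 "t powr (- \<theta>')"] tp1 Cf Cg by simp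
   ultimately show ?thesis by (intro exI[of _ "expectation (\<lambda>w. 1 * (amp_bnd N x w * amp_bnd N y w))"]) linarith
  next
   case False
   \<comment> \<open>The natural scale of the pair is the integer part of l; it is capped at the
     last scale present at N.\<close>
   define m where "m = min (nat \<lfloor>l\<rfloor>) (lv N)"
   have m1: "q < m"
   proof -
    have "q + 1 \<le> nat \<lfloor>l\<rfloor>" using False unfolding L_def by linarith
    thus ?thesis using N2[of N] N by (simp add: m_def)
   qed
   have ml: "real m \<le> l" using l0 unfolding m_def by linarith
   have mlv: "m \<le> lv N" by (simp add: m_def)
   have HN: "H m \<le> N" using m1 mlv N by (intro H_le) auto
   have SH: "\<bar>S (H m) - real m\<bar> \<le> C\<^sub>0 + 1" using m1 by (intro S_H) auto
   have cond: "D N (2 * (x - y)) \<le> S (H m) + C1 \<and> D N (x - y) - D (H m) (x - y) \<le> C1"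
   \<comment> \<open>If the cap is reached, the field ends before the pair separates, and
     covariances are bounded by the variance, which is within a constant of \<open>S (H m)\<close>.
     Otherwise l <= m + 1, and \<open>D_lower\<close> applies at scale m because ln(H m) <= exp m <=
     1 / t.\<close>
   proof (cases "m = lv N")
    case True
    have sl: "S N - S (H m) \<le> 2 * C\<^sub>0 + 2" unfolding True using m1 True N by (intro S_lv) auto
    moreover have "D N (2 * (x - y)) \<le> S N" using D_diff_le_S[of 0 N] by simp
    moreover have "D N (x - y) - D (H m) (x - y) \<le> S N - S (H m)" by (rule D_diff_le_S[OF HN])
    ultimately show ?thesis unfolding C1_def using C0_nonneg by linarith
   next
    case False
    hence "m = nat \<lfloor>l\<rfloor>" unfolding m_def by linarith
    hence lm: "l \<le> real m + 1" using l0 by linarith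
    have "t * ln (real (H m)) \<le> t * exp l"
     using t ml m1 by (intro mult_left_mono order_trans[OF ln_H_le]) auto
    also have "t * exp l = 1" using t by (simp add: l_def)
    finally have "S (H m) - D (H m) t \<le> C\<^sub>0"
     unfolding S_def D_def using t m1 by (intro D_lower H_ge_3) auto
    thus ?thesis unfolding DD C1_def using D1 D2 SH lm C0_nonneg by linarith
   qed
   have "\<bar>?E\<bar> \<le> (C3 * C3) * expectation (\<lambda>w. of_bool (X (H m) x w \<le> \<beta> * S (H m)) * (amp_bnd N x w * amp_bnd N y w))"
    using m1 mlv by (intro red) (auto simp: tr_def)
   moreover have "expectation (\<lambda>w. of_bool (X (H m) x w \<le> \<beta> * S (H m)) * (amp_bnd N x w * amp_bnd N y w)) \<le> (Cf + Cg) * t powr (- \<theta>')"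
   proof -
    let ?s = "S (H m)"
    have "expectation (\<lambda>w. of_bool (X (H m) x w \<le> \<beta> * ?s) * (amp_bnd N x w * amp_bnd N y w)) \<le> Cn * (1 + ?s) * exp (\<rho> * ?s)"
     using cond by (intro near HN) auto
    also have "... \<le> Cn * ((1 + 1 / d) * exp (d * ?s)) * exp (\<rho> * ?s)"
    proof -
     have e1: "1 + d * ?s \<le> exp (d * ?s)" by (rule exp_ge_add_one_self)
     hence "?s * d \<le> exp (d * ?s)" using mult.commute[of d ?s] by linarith
     hence "?s \<le> exp (d * ?s) / d" using d by (simp add: pos_le_divide_eq)
     moreover have "1 \<le> exp (d * ?s)" using d S_nonneg[of "H m"] by simp
     moreover have "(1 + 1 / d) * exp (d * ?s) = exp (d * ?s) + exp (d * ?s) / d" by (simp add: distrib_right)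
     ultimately have "1 + ?s \<le> (1 + 1 / d) * exp (d * ?s)" by linarith
     thus ?thesis using Cn by (intro mult_right_mono mult_left_mono) auto
    qed
    also have "... = Cn * (1 + 1 / d) * exp (\<theta>' * ?s)"
     by (simp add: d_def left_diff_distrib flip: exp_add)
    also have "... \<le> Cn * (1 + 1 / d) * exp (\<theta>' * (C\<^sub>0 + 1) + \<theta>' * l)"
    proof -
     have "?s \<le> (C\<^sub>0 + 1) + l" using SH ml by linarith
     hence "\<theta>' * ?s \<le> \<theta>' * ((C\<^sub>0 + 1) + l)" using rho_less by (intro mult_left_mono) auto
     thus ?thesis using Cn d by (intro mult_left_mono) (auto simp: distrib_left)
    qed
    also have "... = Cg * t powr (- \<theta>')" unfolding Cg_def tp exp_add by simp
    also have "... \<le> (Cf + Cg) * t powr (- \<theta>')" using Cf by (intro mult_right_mono) auto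
    finally show ?thesis .
   qed
   ultimately show ?thesis by blast
  qed
  then obtain c where c: "c \<le> (Cf + Cg) * t powr (- \<theta>')" "\<bar>?E\<bar> \<le> (C3 * C3) * c" by blast
  have "(C3 * C3) * c \<le> (C3 * C3) * ((Cf + Cg) * t powr (- \<theta>'))" using c C3 by (intro mult_left_mono) auto
  thus "\<bar>?E\<bar> \<le> C * \<bar>x - y\<bar> powr (- \<theta>')" using c(2) by (simp add: C_def t_def mult_ac)
 qed
qed

text \<open>A union bound over the scales with \<open>tail_one_point\<close>. The estimate concerns
  first moments, so no singularity in the distance appears, and it is uniform in N.\<close>

lemma dev_trunc_error:
 obtains C N1 where "C > 0" "\<And>N q x. N \<ge> N1 ==> q \<le> lv N ==>
  expectation (\<lambda>w. \<bar>dev N x w - tdev q (lv N) N x w\<bar>) \<le> C * exp (- \<eta>\<^sup>2) ^ q"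
proof -
 obtain C1 where C1: "C1 > 0" and tail: "\<And>K N x. K \<le> N ==>
  expectation (\<lambda>w. of_bool (X K x w > \<beta> * S K) * amp_bnd N x w) \<le> C1 * exp (- \<eta>\<^sup>2 * S K)"
  using tail_one_point by blast
 obtain C3 N0 where C3: "C3 > 0" and gp: "\<And>N. N \<ge> N0 ==> gam N > 0" and dv: "\<And>N x w. N \<ge> N0 ==> \<bar>dev N x w\<bar> \<le> C3 * amp_bnd N x w"
  using dev_le_amp_bnd by blast
 obtain C5 where C5: "C5 > 0" and C5b: "\<And>r s. (\<Sum>m\<in>{r<..s}. exp (- \<eta>\<^sup>2 * S (H m))) \<le> C5 * exp (- \<eta>\<^sup>2) ^ r"
  using exceed_sum_le by blast
 show ?thesis
 proof (rule that[of "C3 * C1 * C5" "max N0 3"])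
  show "C3 * C1 * C5 > 0" using C1 C3 C5 by simp
  fix N q x assume N: "N \<ge> max N0 3" and q: "q \<le> lv N"
  define V where "V = (\<lambda>m w. of_bool (X (H m) x w > \<beta> * S (H m)) :: real)"
  have [measurable]: "V m \<in> borel_measurable M" for m unfolding V_def by measurable
  have Vi: "integrable M (\<lambda>w. V m w * amp_bnd N x w)" for m
  proof (rule integrable_bounded)
   show "\<bar>V m w * amp_bnd N x w\<bar> \<le> 1 * (exp (\<alpha> * real N) * (1 + sd N))" for w
    unfolding abs_mult abs_of_pos[OF amp_bnd_pos] using amp_bnd_pos[of N x w] by (intro mult_mono amp_bnd_le) (auto simp: V_def)
  qed measurable
  have "expectation (\<lambda>w. \<bar>dev N x w - tdev q (lv N) N x w\<bar>) \<le> expectation (\<lambda>w. C3 * (\<Sum>m\<in>{q<..lv N}. V m w * amp_bnd N x w))"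
  proof (rule integral_mono')
   show "integrable M (\<lambda>w. C3 * (\<Sum>m\<in>{q<..lv N}. V m w * amp_bnd N x w))"
    by (intro integrable_mult_right Bochner_Integration.integrable_sum Vi)
   fix w
   have a0: "0 \<le> amp_bnd N x w" using amp_bnd_pos less_imp_le by blast
   have t1: "tr q q x w = 1" by (simp add: tr_def)
   have "0 \<le> 1 - tr q (lv N) x w" "1 - tr q (lv N) x w \<le> (\<Sum>m\<in>{q<..lv N}. V m w)"
    using tr_diff[OF order_refl q, of x w] unfolding t1 V_def by auto
   moreover have "dev N x w - tdev q (lv N) N x w = dev N x w * (1 - tr q (lv N) x w)" by (simp add: tdev_def right_diff_distrib)
   moreover have "\<bar>dev N x w\<bar> \<le> C3 * amp_bnd N x w" using N by (intro dv) auto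
   ultimately have "\<bar>dev N x w - tdev q (lv N) N x w\<bar> \<le> (C3 * amp_bnd N x w) * (\<Sum>m\<in>{q<..lv N}. V m w)"
    using C3 a0 by (simp only: abs_mult) (intro mult_mono, auto)
   thus "\<bar>dev N x w - tdev q (lv N) N x w\<bar> \<le> C3 * (\<Sum>m\<in>{q<..lv N}. V m w * amp_bnd N x w)"
    unfolding sum_distrib_right[symmetric] by (simp only: mult_ac)
   show "0 \<le> C3 * (\<Sum>m\<in>{q<..lv N}. V m w * amp_bnd N x w)"
    using C3 a0 by (intro mult_nonneg_nonneg sum_nonneg) (auto simp: V_def)
  qed
  also have "... = C3 * (\<Sum>m\<in>{q<..lv N}. expectation (\<lambda>w. V m w * amp_bnd N x w))"
   using Vi by (simp only: integral_mult_right_zero Bochner_Integration.integral_sum)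
  also have "... \<le> C3 * (\<Sum>m\<in>{q<..lv N}. C1 * exp (- \<eta>\<^sup>2 * S (H m)))"
  proof (intro mult_left_mono sum_mono)
   fix m assume m: "m \<in> {q<..lv N}"
   have "H m \<le> N" using m N by (intro H_le) auto
   thus "expectation (\<lambda>w. V m w * amp_bnd N x w) \<le> C1 * exp (- \<eta>\<^sup>2 * S (H m))"
    unfolding V_def by (rule tail)
  qed (use C3 in simp)
  also have "... = C3 * C1 * (\<Sum>m\<in>{q<..lv N}. exp (- \<eta>\<^sup>2 * S (H m)))" by (simp only: sum_distrib_left mult.assoc)
  also have "... \<le> C3 * C1 * (C5 * exp (- \<eta>\<^sup>2) ^ q)" using C3 C1 by (intro mult_left_mono C5b) auto
  finally show "expectation (\<lambda>w. \<bar>dev N x w - tdev q (lv N) N x w\<bar>) \<le> C3 * C1 * C5 * exp (- \<eta>\<^sup>2) ^ q" by (simp only: mult_ac)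
 qed
qed

end

context log_field
begin

section \<open>Second moments of the truncated deviation, and its convergence\<close>

lemma X_measurable_pair:
 assumes T: "\<And>j. 1 \<le> j ==> j \<le> N ==> T j \<in> borel_measurable G"
 shows "(\<lambda>(w, x). X N x w) \<in> borel_measurable (G \<Otimes>\<^sub>M borel)"
proof -
 have "(\<lambda>p. a j * cos (snd p * l j - T j (fst p))) \<in> borel_measurable (G \<Otimes>\<^sub>M borel)" if "j \<in> {1..N}" for j
 proof -
  have [measurable]: "T j \<in> borel_measurable G" using that by (intro T) auto
  show ?thesis by measurable
 qed
 thus ?thesis unfolding X_def split_beta by (intro borel_measurable_sum)
qed

lemma X_pair [measurable]: "(\<lambda>(w, x). X N x w) \<in> borel_measurable (M \<Otimes>\<^sub>M borel)"
 by (rule X_measurable_pair) (rule T_measurable)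

lemma dev_pair [measurable]: "(\<lambda>(w, x). dev N x w) \<in> borel_measurable (M \<Otimes>\<^sub>M borel)"
 unfolding dev_def amp_def by measurable

lemma tdev_pair [measurable]: "(\<lambda>(w, x). tdev q r N x w) \<in> borel_measurable (M \<Otimes>\<^sub>M borel)"
proof -
 have "(\<lambda>(w, x). tdev q r N x w) = (\<lambda>(w, x). dev N x w * (\<Prod>m\<in>{q<..r}. of_bool (X (H m) x w \<le> \<beta> * S (H m))))"
  unfolding tdev_def tr_def by (rule ext) (auto simp: prod_zero_iff)
 moreover have "(\<lambda>(w, x). dev N x w * (\<Prod>m\<in>{q<..r}. of_bool (X (H m) x w \<le> \<beta> * S (H m)))) \<in> borel_measurable (M \<Otimes>\<^sub>M borel)"
  by measurable
 ultimately show ?thesis by simp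
qed

lemma dev_bounded:
 obtains B where "\<And>x w. \<bar>dev N x w\<bar> \<le> B"
proof -
 obtain B where B: "B > 0" "\<And>y. \<bar>gtail y\<bar> \<le> B * kern y" using gtail_le_kern by blast
 have gb: "\<bar>gtail z\<bar> \<le> B" for z using B(2)[of z] B(1) kern_le[of z] kern_pos[of z] mult_left_le[of "kern z" B] by linarith
 show ?thesis
 proof (rule that)
  fix x w
  have "\<bar>gtail (X N x w - lev N) / gam N - 1\<bar> \<le> \<bar>gtail (X N x w - lev N) / gam N\<bar> + 1" by linarith
  also have "\<bar>gtail (X N x w - lev N) / gam N\<bar> \<le> B / \<bar>gam N\<bar>" unfolding abs_divide by (intro divide_right_mono gb) auto
  finally show "\<bar>dev N x w\<bar> \<le> exp (\<alpha> * real N) * (B / \<bar>gam N\<bar> + 1)"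
   unfolding dev_def abs_mult abs_of_pos[OF amp_pos] by (intro mult_mono amp_le) auto
 qed
qed

text \<open>The second moment is a double integral of the two-point function, which tends to 0 for
  almost every pair. Dominated convergence is used in y with the majorant |x - y|^(-\<theta>'), then
  in x with a constant.\<close>

lemma tdev_second_moment_tendsto:
 assumes \<xi>: "strict_mono \<xi>" and D: "AE t in unif. (\<lambda>n. D (\<xi> n) t / sd (\<xi> n)) \<longlonglongrightarrow> 0"
 shows "(\<lambda>n. expectation (\<lambda>w. (LINT x|unif. tdev q (lv (\<xi> n)) (\<xi> n) x w)^2)) \<longlonglongrightarrow> 0"
proof -
 interpret U: prob_space unif by (rule prob_space_unif)
 obtain C N1 where C: "C > 0" and dom: "\<And>N x y. N \<ge> N1 ==> x \<noteq> y ==> \<bar>x - y\<bar> \<le> 1 ==>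
  \<bar>expectation (\<lambda>w. tdev q (lv N) N x w * tdev q (lv N) N y w)\<bar> \<le> C * \<bar>x - y\<bar> powr (- \<theta>')"
  using tdev_pair_bound by blast
 obtain I where Ii: "\<And>x. x \<in> {0..1} ==> integrable unif (\<lambda>y. \<bar>x - y\<bar> powr (- \<theta>'))"
  and Ib: "\<And>x. x \<in> {0..1} ==> (LINT y|unif. \<bar>x - y\<bar> powr (- \<theta>')) \<le> I"
  using integral_unif_abs_powr[OF rho_less(2)] by blast
 \<comment> \<open>The shift by \<open>n0\<close> makes the domination hold for every index and not
   only eventually.\<close>
 define n0 where "n0 = max N1 1"
 define \<tau> where "\<tau> = (\<lambda>n. \<xi> (n + n0))"
 have \<tau>: "strict_mono \<tau>" using \<xi> by (auto simp: \<tau>_def strict_mono_def)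
 have \<tau>n: "\<tau> n \<ge> n0" for n unfolding \<tau>_def using seq_suble[OF \<xi>, of "n + n0"] by linarith
 have \<tau>1: "\<tau> n \<ge> N1" "\<tau> n \<ge> 1" for n using \<tau>n[of n] by (auto simp: n0_def)
 have D': "AE t in unif. (\<lambda>n. D (\<tau> n) t / sd (\<tau> n)) \<longlonglongrightarrow> 0"
  using D by eventually_elim (unfold \<tau>_def, rule LIMSEQ_ignore_initial_segment)
 define f where "f = (\<lambda>n w x. tdev q (lv (\<tau> n)) (\<tau> n) x w)"
 have fm [measurable]: "(\<lambda>(w, x). f n w x) \<in> borel_measurable (M \<Otimes>\<^sub>M borel)" for n unfolding f_def by (rule tdev_pair)
 define h where "h = (\<lambda>n x y. expectation (\<lambda>w. f n w x * f n w y))"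
 have hm: "(\<lambda>(x, y). h n x y) \<in> borel_measurable (borel \<Otimes>\<^sub>M borel)" for n unfolding h_def by measurable
 have hm1 [measurable]: "(\<lambda>y. h n x y) \<in> borel_measurable unif" for n x using hm[of n] by measurable
 have hm2 [measurable]: "(\<lambda>x. LINT y|unif. h n x y) \<in> borel_measurable unif" for n
 proof -
  note [measurable] = hm[of n]
  have "(\<lambda>(x, y). h n x y) \<in> borel_measurable (unif \<Otimes>\<^sub>M unif)" by measurable
  thus ?thesis by (rule U.borel_measurable_lebesgue_integral)
 qed
 have hb: "AE y in unif. norm (h n x y) \<le> C * \<bar>x - y\<bar> powr (- \<theta>')" if x: "x \<in> {0..1}" for n x
  using AE_unif_mem AE_unif_neq[of x]
 proof eventually_elim
  case (elim y)
  have "\<bar>x - y\<bar> \<le> 1" using x elim by (auto simp: abs_le_iff)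
  thus ?case unfolding h_def f_def real_norm_def using elim by (intro dom \<tau>1) auto
 qed
 have inner: "(\<lambda>n. LINT y|unif. h n x y) \<longlonglongrightarrow> 0" if x: "x \<in> {0..1}" for x
 proof -
  have "(\<lambda>n. LINT y|unif. h n x y) \<longlonglongrightarrow> (LINT y|unif. 0)"
  proof (rule integral_dominated_convergence)
   show "integrable unif (\<lambda>y. C * \<bar>x - y\<bar> powr (- \<theta>'))" by (intro integrable_mult_right Ii x)
   show "AE y in unif. (\<lambda>n. h n x y) \<longlonglongrightarrow> 0"
    using AE_unif_abs_diff[OF D' x] AE_unif_mem AE_unif_neq[of x]
   proof eventually_elim
    case (elim y)
    have "\<bar>x - y\<bar> \<le> 1" using x elim by (auto simp: abs_le_iff)
    thus ?case unfolding h_def f_def using elim by (intro tdev_pair_tendsto \<tau> \<tau>1) (auto simp: D_abs)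
   qed
  qed (use hb[OF x] in auto)
  thus ?thesis by simp
 qed
 have outer: "norm (LINT y|unif. h n x y) \<le> C * I" if x: "x \<in> {0..1}" for n x
 proof -
  have Ci: "integrable unif (\<lambda>y. C * \<bar>x - y\<bar> powr (- \<theta>'))" by (intro integrable_mult_right Ii x)
  have hi: "integrable unif (h n x)"
   by (rule Bochner_Integration.integrable_bound[OF Ci]) (use hm1 hb[OF x, of n] in \<open>auto elim!: eventually_mono\<close>)
  have "norm (LINT y|unif. h n x y) \<le> (LINT y|unif. norm (h n x y))" by (rule integral_norm_bound)
  also have "... \<le> (LINT y|unif. C * \<bar>x - y\<bar> powr (- \<theta>'))"
   by (rule integral_mono_AE[OF integrable_norm[OF hi] Ci hb[OF x]])
  also have "... \<le> C * I" using Ib[OF x] C by simp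
  finally show ?thesis .
 qed
 have "(\<lambda>n. LINT x|unif. LINT y|unif. h n x y) \<longlonglongrightarrow> (LINT x|unif. 0)"
 proof (rule integral_dominated_convergence)
  show "AE x in unif. (\<lambda>n. LINT y|unif. h n x y) \<longlonglongrightarrow> 0"
   using AE_unif_mem by eventually_elim (rule inner)
  show "AE x in unif. norm (LINT y|unif. h n x y) \<le> C * I" for n
   using AE_unif_mem by eventually_elim (rule outer)
 qed auto
 moreover have "expectation (\<lambda>w. (LINT x|unif. f n w x)^2) = (LINT x|unif. LINT y|unif. h n x y)" for n
 proof -
  obtain B where B: "\<And>x w. \<bar>dev (\<tau> n) x w\<bar> \<le> B" using dev_bounded by blast
  show ?thesis unfolding h_def
  proof (rule second_moment_integral[OF fm])
   show "\<bar>f n w x\<bar> \<le> B" for w x unfolding f_def by (rule order_trans[OF tdev_bound B])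
  qed
 qed
 ultimately have "(\<lambda>n. expectation (\<lambda>w. (LINT x|unif. f n w x)^2)) \<longlonglongrightarrow> 0" by simp
 thus ?thesis unfolding f_def \<tau>_def by (rule LIMSEQ_offset)
qed

text \<open>
 The triangular weight has a nonnegative Fourier transform, so the weighted integral of \<open>D N\<close> is
 nonnegative and the one-sided bound on \<open>D N\<close> controls its weighted \<open>L\<^sup>1\<close> norm.
\<close>
lemma D_subseq:
 fixes \<xi> :: "nat => nat"
 assumes \<xi>: "strict_mono \<xi>"
 obtains \<tau> where "strict_mono \<tau>" "AE t in unif. (\<lambda>n. D (\<xi> (\<tau> n)) t / sd (\<xi> (\<tau> n))) \<longlonglongrightarrow> 0"
proof -
 define V where "V = (\<lambda>t::real. max 0 (1 - \<bar>t\<bar>) / 2)"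
 have V: "0 \<le> V t" "V t \<le> 1" for t by (auto simp: V_def)
 \<comment> \<open>An integrable majorant of \<open>D N\<close> from above, independent of N:
   ln(1/t) = 2 ln(t^(-1/2)) <= 2 t^(-1/2).\<close>
 define b where "b = (\<lambda>t. 2 * (indicator {-1..1} t * \<bar>t\<bar> powr (- (1 / 2))) + C\<^sub>0 * indicator {-1..1::real} t)"
 have bi: "integrable lborel b"
  unfolding b_def by (intro Bochner_Integration.integrable_add integrable_mult_right integrable_abs_powr integrable_real_indicator) auto
 have VD: "integrable lborel (\<lambda>t. V t * D N t)" "(LBINT t. V t * D N t) \<ge> 0" for N
 proof -
  have "has_bochner_integral lborel (\<lambda>t. V t * cos (t * z)) (fejer z)" for z
   using has_bochner_integral_bounded_linear[OF bounded_linear_Re integral_triangle_iexp[of z]]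
   by (simp add: V_def Re_exp)
  hence "has_bochner_integral lborel (\<lambda>t. \<Sum>j=1..N. (a j)^2 * (V t * cos (t * l j))) (\<Sum>j=1..N. (a j)^2 * fejer (l j))"
   by (intro has_bochner_integral_sum has_bochner_integral_mult_right) auto
  hence hb: "has_bochner_integral lborel (\<lambda>t. V t * D N t) (\<Sum>j=1..N. (a j)^2 * fejer (l j))"
   unfolding D_def sum_distrib_left by (simp only: mult_ac)
  show "integrable lborel (\<lambda>t. V t * D N t)" using hb by (simp add: has_bochner_integral_iff)
  show "(LBINT t. V t * D N t) \<ge> 0" using hb by (simp add: has_bochner_integral_iff sum_nonneg fejer_nonneg)
 qed
 \<comment> \<open>If f <= b and b >= 0, then |f| <= 2b - f. After integration the last term has a
   favourable sign, which turns the one-sided bound into an L^1 bound.\<close>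
 have dom: "\<bar>V t * D N t\<bar> \<le> 2 * b t - V t * D N t" if "t \<noteq> 0" for t N
 proof (cases "\<bar>t\<bar> \<le> 1")
  case True
  let ?z = "\<bar>t\<bar> powr (- (1 / 2))"
  have "ln (1 / \<bar>t\<bar>) = 2 * ln ?z" using that by (simp add: ln_powr ln_div)
  also have "... \<le> 2 * ?z" using that ln_le_minus_one[of ?z] by simp
  finally have "D N \<bar>t\<bar> \<le> 2 * ?z + C\<^sub>0" using D_upper[of "\<bar>t\<bar>" N] that True by (simp add: D_def)
  also have "... = b t" using True by (auto simp: b_def indicator_def abs_le_iff)
  finally have Db: "D N t \<le> b t" by (simp add: D_abs)
  have b0: "b t \<ge> 0" using C0_nonneg by (simp add: b_def)
  have "\<bar>D N t\<bar> + D N t \<le> 2 * b t" using Db b0 by linarith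
  hence "V t * (\<bar>D N t\<bar> + D N t) \<le> 1 * (2 * b t)" using V[of t] by (intro mult_mono) auto
  thus ?thesis using V[of t] by (simp add: abs_mult distrib_left)
 next
  case False
  hence "V t = 0" "b t = 0" by (auto simp: V_def b_def indicator_def abs_le_iff)
  thus ?thesis by simp
 qed
 define u where "u = (\<lambda>n t. V t * D (\<xi> n) t / sd (\<xi> n))"
 have ui: "integrable lborel (u n)" for n unfolding u_def by (intro integrable_divide_zero VD)
 have "(LBINT t. norm (u n t)) \<le> 2 * (LBINT t. b t) / sd (\<xi> n)" for n
 proof -
  have "(LBINT t. norm (u n t)) = (LBINT t. \<bar>V t * D (\<xi> n) t\<bar>) / sd (\<xi> n)"
   unfolding u_def using sd_nonneg[of "\<xi> n"] by simp
  also have "(LBINT t. \<bar>V t * D (\<xi> n) t\<bar>) \<le> (LBINT t. 2 * b t - V t * D (\<xi> n) t)"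
   using AE_lborel_singleton[of "0::real"]
   by (intro integral_mono_AE integrable_abs VD Bochner_Integration.integrable_diff integrable_mult_right bi) (auto elim!: eventually_mono intro: dom)
  also have "... \<le> 2 * (LBINT t. b t)" using VD[of "\<xi> n"] bi by simp
  finally show ?thesis using sd_nonneg[of "\<xi> n"] by (simp add: divide_right_mono)
 qed
 hence le: "norm (LBINT t. norm (u n t)) \<le> 2 * (LBINT t. b t) / sd (\<xi> n)" for n by simp
 have "(\<lambda>n. LBINT t. norm (u n t)) \<longlonglongrightarrow> 0"
 proof (rule Lim_null_comparison)
  show "\<forall>\<^sub>F n in sequentially. norm (LBINT t. norm (u n t)) \<le> 2 * (LBINT t. b t) / sd (\<xi> n)"
   using le by (intro always_eventually allI)
  show "(\<lambda>n. 2 * (LBINT t. b t) / sd (\<xi> n)) \<longlonglongrightarrow> 0"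
   by (rule tendsto_divide_0[OF tendsto_const filterlim_at_top_imp_at_infinity[OF filterlim_compose[OF sd_tendsto filterlim_subseq[OF \<xi>]]]])
 qed
 from tendsto_L1_AE_subseq[OF ui this] obtain \<tau> where \<tau>: "strict_mono \<tau>" "AE t in lborel. (\<lambda>n. u (\<tau> n) t) \<longlonglongrightarrow> 0" by blast
 show ?thesis
 proof (rule that[OF \<tau>(1)], rule AE_unif)
  \<comment> \<open>The weight vanishes at t = 1, so that point is excluded before dividing by the
    weight.\<close>
  show "AE t in lborel. t \<in> {0..1} \<longrightarrow> (\<lambda>n. D (\<xi> (\<tau> n)) t / sd (\<xi> (\<tau> n))) \<longlonglongrightarrow> 0"
   using \<tau>(2) AE_lborel_singleton[of "1::real"]
  proof eventually_elim
   case (elim t)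
   show ?case
   proof
    assume "t \<in> {0..1}"
    hence "V t \<noteq> 0" using elim(2) by (auto simp: V_def max_def)
    thus "(\<lambda>n. D (\<xi> (\<tau> n)) t / sd (\<xi> (\<tau> n))) \<longlonglongrightarrow> 0"
     using tendsto_mult[OF tendsto_const[of "1 / V t"] elim(1)] by (simp add: u_def)
   qed
  qed
 qed
qed

text \<open>Decorrelation is available only along a subsequence of any given sequence. If the
  probabilities did not tend to 0, they would stay above some \<delta> along a sequence, and
  \<open>D_subseq\<close> then extracts a subsequence contradicting this.\<close>

lemma dev_integral_tendsto_prob:
 assumes e: "\<epsilon> > 0"
 shows "(\<lambda>N. prob {w \<in> space M. \<bar>LINT x|unif. dev N x w\<bar> > \<epsilon>}) \<longlonglongrightarrow> 0"
proof (rule ccontr)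
 interpret U: prob_space unif by (rule prob_space_unif)
 define p where "p = (\<lambda>N. prob {w \<in> space M. \<bar>LINT x|unif. dev N x w\<bar> > \<epsilon>})"
 assume "\<not> ?thesis"
 hence "\<not> p \<longlonglongrightarrow> 0" by (simp add: p_def)
 then obtain \<delta> where \<delta>: "\<delta> > 0" "\<forall>no. \<exists>n\<ge>no. \<not> norm (p n - 0) < \<delta>"
  unfolding LIMSEQ_iff by blast
 have p0: "p n \<ge> 0" for n by (simp add: p_def)
 have inf: "infinite {n. p n \<ge> \<delta>}"
  unfolding infinite_nat_iff_unbounded_le using \<delta>(2) p0 by (auto simp: not_less)
 obtain \<xi> :: "nat => nat" where "strict_mono \<xi>" "\<forall>n. \<xi> n \<in> {n. p n \<ge> \<delta>}" using infinite_enumerate[OF inf] by blast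
 hence \<xi>: "strict_mono \<xi>" "\<And>n. p (\<xi> n) \<ge> \<delta>" by auto
 obtain \<tau>0 where \<tau>0: "strict_mono \<tau>0" "AE t in unif. (\<lambda>n. D (\<xi> (\<tau>0 n)) t / sd (\<xi> (\<tau>0 n))) \<longlonglongrightarrow> 0"
  using D_subseq[OF \<xi>(1)] by blast
 define \<tau> where "\<tau> = \<xi> \<circ> \<tau>0"
 have \<tau>: "strict_mono \<tau>" unfolding \<tau>_def using \<xi>(1) \<tau>0(1) by (rule strict_mono_o)
 have \<tau>D: "AE t in unif. (\<lambda>n. D (\<tau> n) t / sd (\<tau> n)) \<longlonglongrightarrow> 0" using \<tau>0(2) by (simp add: \<tau>_def)
 obtain C N1 where C: "C > 0" and err: "\<And>N q x. N \<ge> N1 ==> q \<le> lv N ==>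
  expectation (\<lambda>w. \<bar>dev N x w - tdev q (lv N) N x w\<bar>) \<le> C * exp (- \<eta>\<^sup>2) ^ q"
  using dev_trunc_error by blast
 have "(\<lambda>q. C * exp (- \<eta>\<^sup>2) ^ q / (\<epsilon> / 2)) \<longlonglongrightarrow> C * 0 / (\<epsilon> / 2)"
  using eta_pos e by (intro tendsto_intros LIMSEQ_realpow_zero) auto
 hence "eventually (\<lambda>q. C * exp (- \<eta>\<^sup>2) ^ q / (\<epsilon> / 2) < \<delta> / 2) sequentially"
  using \<delta>(1) by (intro order_tendstoD(2)[where y = "C * 0 / (\<epsilon> / 2)"]) auto
 \<comment> \<open>The starting scale q is fixed first, from the truncation error alone; only
   afterwards does n grow, to make the second moment small for this q.\<close>
 then obtain q where q: "C * exp (- \<eta>\<^sup>2) ^ q / (\<epsilon> / 2) < \<delta> / 2" by (auto simp: eventually_sequentially)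
 define J1 where "J1 = (\<lambda>N w. LINT x|unif. tdev q (lv N) N x w)"
 define J2 where "J2 = (\<lambda>N w. LINT x|unif. \<bar>dev N x w - tdev q (lv N) N x w\<bar>)"
 have split: "p N \<le> expectation (\<lambda>w. (J1 N w)^2) / (\<epsilon> / 2)^2 + C * exp (- \<eta>\<^sup>2) ^ q / (\<epsilon> / 2)"
  if N: "N \<ge> N1" "q \<le> lv N" for N
 proof -
  obtain B where B: "\<And>x w. \<bar>dev N x w\<bar> \<le> B" using dev_bounded by blast
  have B0: "B \<ge> 0" using B order_trans[OF abs_ge_zero] by blast
  have tB: "\<bar>tdev q (lv N) N x w\<bar> \<le> B" for x w by (rule order_trans[OF tdev_bound B])
  have dB: "\<bar>dev N x w - tdev q (lv N) N x w\<bar> \<le> 2 * B" for x w using B[of x w] tB[of x w] by linarith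
  have mt: "(\<lambda>x. tdev q (lv N) N x w) \<in> borel_measurable borel" "(\<lambda>x. dev N x w) \<in> borel_measurable borel" if "w \<in> space M" for w
   using that by measurable
  have it: "integrable unif (\<lambda>x. tdev q (lv N) N x w)" and id: "integrable unif (\<lambda>x. dev N x w)" if "w \<in> space M" for w
   using mt[OF that] B tB by (auto intro!: U.integrable_const_bound[where B = B])
  have [measurable]: "(\<lambda>(w, x). tdev q (lv N) N x w) \<in> borel_measurable (M \<Otimes>\<^sub>M unif)" "(\<lambda>(w, x). dev N x w) \<in> borel_measurable (M \<Otimes>\<^sub>M unif)"
   by measurable
  have J1m [measurable]: "J1 N \<in> borel_measurable M" unfolding J1_def by (rule U.borel_measurable_lebesgue_integral) measurable
  have J2m [measurable]: "J2 N \<in> borel_measurable M" unfolding J2_def by (rule U.borel_measurable_lebesgue_integral) measurable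
  have J1b: "\<bar>J1 N w\<bar> \<le> B" if "w \<in> space M" for w unfolding J1_def using mt[OF that] by (intro abs_integral_unif_le tB)
  have J2b: "\<bar>J2 N w\<bar> \<le> 2 * B" if "w \<in> space M" for w unfolding J2_def using mt[OF that] dB by (intro abs_integral_unif_le) auto
  have i1: "integrable M (\<lambda>w. (J1 N w)^2)"
  proof (rule integrable_const_bound)
   show "AE w in M. norm ((J1 N w)^2) \<le> B^2" using J1b B0 by (intro AE_I2) (auto simp: abs_le_square_iff[symmetric])
  qed measurable
  have i2: "integrable M (J2 N)" using J2b by (intro integrable_const_bound[where B = "2 * B"] AE_I2) auto
  have J20: "J2 N w \<ge> 0" for w unfolding J2_def by (intro integral_nonneg_AE) auto
  have sub: "{w \<in> space M. \<bar>LINT x|unif. dev N x w\<bar> > \<epsilon>} \<subseteq> {w \<in> space M. (J1 N w)^2 \<ge> (\<epsilon> / 2)^2} \<union> {w \<in> space M. J2 N w \<ge> \<epsilon> / 2}"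
  proof (safe, goal_cases)
   case (1 w)
   have "(LINT x|unif. dev N x w) - J1 N w = (LINT x|unif. dev N x w - tdev q (lv N) N x w)"
    unfolding J1_def by (rule Bochner_Integration.integral_diff[symmetric, OF id[OF 1(1)] it[OF 1(1)]])
   moreover have "\<bar>LINT x|unif. dev N x w - tdev q (lv N) N x w\<bar> \<le> J2 N w" unfolding J2_def by (rule integral_abs_bound)
   ultimately have "\<bar>J1 N w\<bar> > \<epsilon> / 2" using 1 by linarith
   hence "(\<epsilon> / 2)^2 \<le> \<bar>J1 N w\<bar>^2" using e by (intro power_mono) auto
   thus ?case by simp
  qed
  have "p N \<le> prob ({w \<in> space M. (J1 N w)^2 \<ge> (\<epsilon> / 2)^2} \<union> {w \<in> space M. J2 N w \<ge> \<epsilon> / 2})"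
   unfolding p_def using sub by (rule finite_measure_mono) measurable
  also have "... \<le> prob {w \<in> space M. (J1 N w)^2 \<ge> (\<epsilon> / 2)^2} + prob {w \<in> space M. J2 N w \<ge> \<epsilon> / 2}"
   by (rule measure_Un_le) measurable
  also have "... \<le> expectation (\<lambda>w. (J1 N w)^2) / (\<epsilon> / 2)^2 + expectation (J2 N) / (\<epsilon> / 2)"
   using e J20 by (intro add_mono integral_Markov_inequality_measure[where A = "{}"] i1 i2) auto
  also have "expectation (J2 N) \<le> C * exp (- \<eta>\<^sup>2) ^ q"
  proof -
   have "expectation (J2 N) = (LINT x|unif. expectation (\<lambda>w. \<bar>dev N x w - tdev q (lv N) N x w\<bar>))"
    unfolding J2_def
   proof (rule integral_swap_unif)
    show "\<bar>\<bar>dev N x w - tdev q (lv N) N x w\<bar>\<bar> \<le> 2 * B" for x w using dB[of x w] by simp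
   qed measurable
   also have "... \<le> C * exp (- \<eta>\<^sup>2) ^ q"
   proof (rule order_trans[OF abs_ge_self abs_integral_unif_le])
    show "(\<lambda>x. expectation (\<lambda>w. \<bar>dev N x w - tdev q (lv N) N x w\<bar>)) \<in> borel_measurable borel" by measurable
    show "\<bar>expectation (\<lambda>w. \<bar>dev N x w - tdev q (lv N) N x w\<bar>)\<bar> \<le> C * exp (- \<eta>\<^sup>2) ^ q" for x
     using err[OF N, of x] by (subst abs_of_nonneg) auto
   qed
   finally show ?thesis .
  qed
  hence "expectation (J2 N) / (\<epsilon> / 2) \<le> C * exp (- \<eta>\<^sup>2) ^ q / (\<epsilon> / 2)" using e by (intro divide_right_mono) auto
  finally show ?thesis by simp
 qed
 have "(\<lambda>n. expectation (\<lambda>w. (J1 (\<tau> n) w)^2) / (\<epsilon> / 2)^2) \<longlonglongrightarrow> 0 / (\<epsilon> / 2)^2"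
  unfolding J1_def using e by (intro tendsto_divide tdev_second_moment_tendsto \<tau> \<tau>D tendsto_const) auto
 hence "eventually (\<lambda>n. expectation (\<lambda>w. (J1 (\<tau> n) w)^2) / (\<epsilon> / 2)^2 < \<delta> / 2) sequentially"
  using \<delta>(1) by (intro order_tendstoD(2)[where y = "0 / (\<epsilon> / 2)^2"]) auto
 moreover have "eventually (\<lambda>n. q \<le> lv (\<tau> n)) sequentially"
  using filterlim_compose[OF lv_tendsto filterlim_subseq[OF \<tau>]] unfolding filterlim_at_top by blast
 moreover have "eventually (\<lambda>n. N1 \<le> \<tau> n) sequentially"
  using filterlim_subseq[OF \<tau>] unfolding filterlim_at_top by blast
 ultimately have "eventually (\<lambda>n. False) sequentially"
 proof eventually_elim
  case (elim n)
  have "p (\<tau> n) < \<delta>" using split[of "\<tau> n"] elim q by linarith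
  moreover have "p (\<tau> n) \<ge> \<delta>" using \<xi>(2) by (simp add: \<tau>_def)
  ultimately show ?case by simp
 qed
 thus False by simp
qed

end

section \<open>Convergence in probability\<close>

text \<open>The phases are given as indexed by primes, while the field sums over positions in the
  sequence of primes.\<close>

lemma (in prob_space) indep_vars_inj_reindex:
 assumes inj: "inj_on f I" and ind: "indep_vars (\<lambda>_. N) X (f ` I)"
 shows "indep_vars (\<lambda>_. N) (\<lambda>i. X (f i)) I"
 unfolding indep_vars_def
proof (intro conjI ballI)
 show "X (f i) \<in> measurable M N" if "i \<in> I" for i using ind that by (auto simp: indep_vars_def)
 have iset: "indep_sets (\<lambda>i. sigma_sets (space M) {X i -` A \<inter> space M | A. A \<in> sets N}) (f ` I)" using ind by (simp add: indep_vars_def)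
 show "indep_sets (\<lambda>i. sigma_sets (space M) {X (f i) -` A \<inter> space M | A. A \<in> sets N}) I"
 proof (rule indep_setsI)
  show "sigma_sets (space M) {X (f i) -` A \<inter> space M | A. A \<in> sets N} \<subseteq> events" if "i \<in> I" for i
   using iset that unfolding indep_sets_def by blast
  fix A J assume J: "J \<noteq> {}" "J \<subseteq> I" "finite J" "\<forall>j\<in>J. A j \<in> sigma_sets (space M) {X (f j) -` A \<inter> space M | A. A \<in> sets N}"
  define A' where "A' = (\<lambda>k. A (the_inv_into J f k))"
  have ij: "inj_on f J" using inj J(2) by (rule inj_on_subset)
  have A': "A' (f j) = A j" if "j \<in> J" for j using the_inv_into_f_f[OF ij that] by (simp add: A'_def)
  have "prob (\<Inter>k\<in>f ` J. A' k) = (\<Prod>k\<in>f ` J. prob (A' k))"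
   using J A' by (intro indep_setsD[OF iset]) auto
  thus "prob (\<Inter>j\<in>J. A j) = (\<Prod>j\<in>J. prob (A j))"
   using A' by (simp add: prod.reindex[OF ij])
 qed
qed

context log_field
begin

lemma X_measurable_frequency [measurable]: "(\<lambda>x. X N x w) \<in> borel_measurable borel"
 unfolding X_def by measurable

definition chaos :: "nat => 'a => real" where "chaos N w = (LINT x|unif. amp N x w)"

lemma integrable_amp: "integrable unif (\<lambda>x. amp N x w)"
proof -
 interpret U: prob_space unif by (rule prob_space_unif)
 show ?thesis
 proof (rule U.integrable_const_bound)
  show "AE x in unif. norm (amp N x w) \<le> exp (\<alpha> * real N)"
   using amp_le[of N _ w] amp_pos[of N _ w] by (intro AE_I2) (simp add: less_imp_le)
 qed (unfold amp_def, measurable)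
qed

lemma chaos_measurable_Fs: "chaos N \<in> borel_measurable (Fs N)"
proof -
 interpret U: prob_space unif by (rule prob_space_unif)
 have [measurable]: "(\<lambda>(w, x). X N x w) \<in> borel_measurable (Fs N \<Otimes>\<^sub>M borel)"
  by (rule X_measurable_pair) (rule T_measurable_Fs)
 have "(\<lambda>(w, x). amp N x w) \<in> borel_measurable (Fs N \<Otimes>\<^sub>M unif)" unfolding amp_def by measurable
 thus ?thesis unfolding chaos_def[abs_def] by (rule U.borel_measurable_lebesgue_integral)
qed

lemma chaos_measurable [measurable]: "chaos N \<in> borel_measurable M"
 using chaos_measurable_Fs by (rule measurable_Fs_M)

lemma phi_mono: "phi N \<le> phi (Suc N)"
proof -
 let ?f = "\<lambda>k n. Fp k n 0 0 (of_real \<alpha>) 0"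
 have f: "Im (?f k n) = 0" "Re (?f k n) \<ge> 1" for k n using Fp_of_real[of k n 0 0 \<alpha> 0] by simp_all
 have "?f 0 (Suc N) = ?f 0 N * ?f N (Suc N)" by (rule Fp_split) simp
 hence "phi (Suc N) = phi N * Re (?f N (Suc N))" using f by (simp add: phi_def)
 thus ?thesis using f(2)[of N "Suc N"] phi_ge_1[of N] by simp
qed

text \<open>This provides the growth condition of \<open>nonneg_martingale_AE_convergent\<close>: a
  summand of the field is at most 1 and \<open>phi\<close> is nondecreasing.\<close>

lemma amp_Suc_le: "amp (Suc N) x w \<le> exp \<alpha> * amp N x w"
proof -
 have "X (Suc N) x w - X N x w = a (Suc N) * cos (x * l (Suc N) - T (Suc N) w)"
  by (simp add: X_def)
 moreover have "a (Suc N) * cos (x * l (Suc N) - T (Suc N) w) \<le> a (Suc N) * 1"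
  using a_pos[of "Suc N"] by (intro mult_left_mono) auto
 ultimately have "X (Suc N) x w \<le> X N x w + 1" using a_le_1[of "Suc N"] by linarith
 hence "\<alpha> * X (Suc N) x w \<le> \<alpha> * (X N x w + 1)" using alpha by (intro mult_left_mono) auto
 hence "exp (\<alpha> * X (Suc N) x w) \<le> exp \<alpha> * exp (\<alpha> * X N x w)" by (simp add: distrib_left flip: exp_add)
 hence "exp (\<alpha> * X (Suc N) x w) / phi (Suc N) \<le> (exp \<alpha> * exp (\<alpha> * X N x w)) / phi N"
  using phi_mono[of N] phi_ge_1[of N] by (intro frac_le) auto
 thus ?thesis by (simp add: amp_def)
qed

lemma chaos_AE_convergent: "AE w in M. convergent (\<lambda>N. chaos N w)"
proof (rule nonneg_martingale_AE_convergent[where F = Fs and C = "exp \<alpha>"])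
 show "subalgebra M (Fs n)" for n by (rule subalgebra_Fs)
 show "sets (Fs n) \<subseteq> sets (Fs (Suc n))" for n by (rule sets_Fs_mono) simp
 show "chaos n \<in> borel_measurable (Fs n)" for n by (rule chaos_measurable_Fs)
 show "0 \<le> chaos n w" for n w unfolding chaos_def by (intro integral_nonneg_AE AE_I2 less_imp_le amp_pos)
 show "exp \<alpha> \<ge> 1" using alpha by simp
 show "chaos 0 w \<le> exp \<alpha>" for w
 proof -
  interpret U: prob_space unif by (rule prob_space_unif)
  have "amp 0 x w = 1" for x by (simp add: amp_def phi_def Fp_def)
  thus ?thesis using alpha U.prob_space by (simp add: chaos_def)
 qed
 show "chaos (Suc n) w \<le> exp \<alpha> * chaos n w" for n w
  unfolding chaos_def integral_mult_right_zero[symmetric]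
  by (rule integral_mono[OF integrable_amp integrable_mult_right[OF integrable_amp]]) (rule amp_Suc_le)
 show "expectation (\<lambda>w. f w * (chaos (Suc n) w - chaos n w)) = 0"
  if f: "f \<in> borel_measurable (Fs n)" "\<exists>B. \<forall>w\<in>space M. \<bar>f w\<bar> \<le> B" for n f
 proof -
  obtain B0 where B0: "\<And>w. w \<in> space M ==> \<bar>f w\<bar> \<le> B0" using f(2) by blast
  define B where "B = \<bar>B0\<bar> + 1"
  have B: "B > 0" "\<And>w. w \<in> space M ==> \<bar>f w\<bar> \<le> B" using B0 unfolding B_def by force+
  \<comment> \<open>Dividing by the bound makes the test function at most 1 in absolute value, as
    \<open>expectation_tilt\<close> requires; the value 0 off the space makes this hold
    everywhere.\<close>
  define wt where "wt = (\<lambda>w. if w \<in> space M then f w / B else 0)"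
  have w1: "\<bar>wt w\<bar> \<le> 1" for w using B by (simp add: wt_def)
  have wF: "wt \<in> borel_measurable (Fs n)"
  proof -
   have "(\<lambda>w. f w / B) \<in> borel_measurable (Fs n)" using f(1) by measurable
   thus ?thesis by (subst measurable_cong[where g = "\<lambda>w. f w / B"]) (auto simp: wt_def)
  qed
  have wM [measurable]: "wt \<in> borel_measurable M" using wF by (rule measurable_Fs_M)
  define k where "k = (\<lambda>w x. wt w * (amp (Suc n) x w - amp n x w))"
  have km [measurable]: "(\<lambda>(w, x). k w x) \<in> borel_measurable (M \<Otimes>\<^sub>M borel)" unfolding k_def amp_def by measurable
  have kb: "\<bar>k w x\<bar> \<le> 1 * (exp (\<alpha> * real (Suc n)) + exp (\<alpha> * real n))" for w x
  proof -
   have "\<bar>amp (Suc n) x w - amp n x w\<bar> \<le> exp (\<alpha> * real (Suc n)) + exp (\<alpha> * real n)"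
    using amp_le[of "Suc n" x w] amp_le[of n x w] amp_pos[of "Suc n" x w] amp_pos[of n x w] by linarith
   thus ?thesis unfolding k_def abs_mult by (intro mult_mono w1) auto
  qed
  have k0: "expectation (\<lambda>w. k w x) = 0" for x
  proof -
   have i: "integrable M (\<lambda>w. wt w * amp m x w)" for m
    unfolding amp_eq_tilt[of m x _ 0] by (rule integrable_tilt_mult[OF wM w1])
   have "expectation (\<lambda>w. k w x) = expectation (\<lambda>w. wt w * amp (Suc n) x w) - expectation (\<lambda>w. wt w * amp n x w)"
    unfolding k_def right_diff_distrib by (rule Bochner_Integration.integral_diff[OF i i])
   also have "... = 0"
    unfolding amp_eq_tilt[of _ x _ 0] using expectation_tilt[OF wF w1, of "Suc n" x 0 0] by simp
   finally show ?thesis .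
  qed
  have "expectation (\<lambda>w. f w * (chaos (Suc n) w - chaos n w)) = expectation (\<lambda>w. B * (LINT x|unif. k w x))"
  proof (intro Bochner_Integration.integral_cong refl)
   fix w assume w: "w \<in> space M"
   have "(LINT x|unif. k w x) = wt w * (chaos (Suc n) w - chaos n w)"
    unfolding k_def integral_mult_right_zero chaos_def
    by (simp only: Bochner_Integration.integral_diff[OF integrable_amp integrable_amp])
   thus "f w * (chaos (Suc n) w - chaos n w) = B * (LINT x|unif. k w x)" using B w by (simp add: wt_def)
  qed
  also have "... = B * expectation (\<lambda>w. LINT x|unif. k w x)" by (rule integral_mult_right_zero)
  also have "expectation (\<lambda>w. LINT x|unif. k w x) = (LINT x|unif. expectation (\<lambda>w. k w x))" by (rule integral_swap_unif[OF km kb])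
  finally show ?thesis by (simp add: k0)
 qed
qed

definition step :: "real => real" where "step y = indicator {0<..} y"

lemma step_measurable [measurable]: "step \<in> borel_measurable borel"
 unfolding step_def[abs_def] by measurable

lemma abs_step_le: "\<bar>step y\<bar> \<le> 1"
 by (simp add: step_def indicator_def)

definition level :: "nat => 'a => real" where
 "level N w = (LINT x|unif. step (X N x w - lev N))"

lemma level_measurable [measurable]: "level N \<in> borel_measurable M"
proof -
 interpret U: prob_space unif by (rule prob_space_unif)
 have "(\<lambda>(w, x). step (X N x w - lev N) :: real) \<in> borel_measurable (M \<Otimes>\<^sub>M unif)" by measurable
 thus ?thesis unfolding level_def[abs_def] by (rule U.borel_measurable_lebesgue_integral)
qed

lemma expectation_X:
 fixes h :: "real => real"
 assumes [measurable]: "h \<in> borel_measurable borel"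
 shows "expectation (\<lambda>w. h (X N x w)) = expectation (\<lambda>w. h (X N y w))"
 using integral_distr[of "X N x" M borel h] integral_distr[of "X N y" M borel h] distr_X[of N x y] by simp

text \<open>By stationarity the mean of the level set is the exceedance probability at a single
  point.\<close>

lemma expectation_level: "expectation (level N) = expectation (\<lambda>w. step (X N 0 w - lev N))"
proof -
 interpret U: prob_space unif by (rule prob_space_unif)
 have "expectation (level N) = (LINT x|unif. expectation (\<lambda>w. step (X N x w - lev N)))"
  unfolding level_def[abs_def]
 proof (rule integral_swap_unif)
  show "\<bar>step (X N x w - lev N)\<bar> \<le> 1" for x w by (rule abs_step_le)
 qed measurable
 also have "... = (LINT x|unif. expectation (\<lambda>w. step (X N 0 w - lev N)))"
  by (intro Bochner_Integration.integral_cong refl expectation_X) measurable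
 finally show ?thesis using U.prob_space by simp
qed

text \<open>Above the level, exp(\<alpha> X) exp(-\<alpha> (X - lev)) is the constant exp(\<alpha>
  lev). The same constant appears in \<open>gam N\<close> and cancels.\<close>

lemma dev_eq: "dev N x w = step (X N x w - lev N) / expectation (level N) - amp N x w"
proof -
 define e where "e = exp (\<alpha> * lev N) / phi N"
 have e: "e > 0" using phi_ge_1[of N] by (simp add: e_def)
 have ag: "amp N x w * gtail (X N x w - lev N) = e * step (X N x w - lev N)" for x w
 proof -
  have "exp (\<alpha> * X N x w) * exp (- \<alpha> * (X N x w - lev N)) = exp (\<alpha> * lev N)"
   unfolding exp_add[symmetric] by (rule arg_cong[where f = exp]) (simp add: algebra_simps)
  thus ?thesis unfolding amp_def gtail_def e_def step_def by (simp add: indicator_def)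
 qed
 have "gam N = e * expectation (level N)"
  unfolding gam_def ag integral_mult_right_zero expectation_level ..
 hence "amp N x w * gtail (X N x w - lev N) / gam N = step (X N x w - lev N) / expectation (level N)"
  unfolding ag using e by simp
 thus ?thesis unfolding dev_def by (simp add: right_diff_distrib)
qed

lemma integral_dev: "(LINT x|unif. dev N x w) = level N w / expectation (level N) - chaos N w"
proof -
 interpret U: prob_space unif by (rule prob_space_unif)
 have i: "integrable unif (\<lambda>x. step (X N x w - lev N) / expectation (level N))"
  by (intro integrable_divide_zero U.integrable_const_bound[where B = 1]) (auto simp: abs_step_le)
 show ?thesis
  unfolding dev_eq level_def chaos_def
  by (subst Bochner_Integration.integral_diff) (use i integrable_amp in \<open>auto simp: level_def[abs_def]\<close>)
qed

lemma chaos_lim_measurable: "(\<lambda>w. lim (\<lambda>N. chaos N w)) \<in> borel_measurable M"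
 by (rule borel_measurable_lim_metric) measurable

text \<open>Almost sure convergence gives convergence in probability by dominated convergence of the
  indicators of the deviation events.\<close>

lemma chaos_tendsto_prob:
 assumes e: "\<epsilon> > 0"
 shows "(\<lambda>N. prob {w \<in> space M. \<bar>chaos N w - lim (\<lambda>N. chaos N w)\<bar> > \<epsilon>}) \<longlonglongrightarrow> 0"
proof -
 note [measurable] = chaos_lim_measurable
 define A where "A = (\<lambda>N. {w \<in> space M. \<bar>chaos N w - lim (\<lambda>N. chaos N w)\<bar> > \<epsilon>})"
 have [measurable]: "A N \<in> sets M" for N unfolding A_def by measurable
 have "(\<lambda>N. expectation (indicator (A N))) \<longlonglongrightarrow> expectation (\<lambda>_. 0 :: real)"
 proof (rule integral_dominated_convergence)
  show "AE w in M. (\<lambda>N. indicator (A N) w) \<longlonglongrightarrow> (0 :: real)"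
   using chaos_AE_convergent
  proof eventually_elim
   case (elim w)
   hence "(\<lambda>N. chaos N w) \<longlonglongrightarrow> lim (\<lambda>N. chaos N w)" by (simp add: convergent_LIMSEQ_iff)
   from tendstoD[OF this e] have "eventually (\<lambda>N. indicator (A N) w = (0::real)) sequentially"
    by eventually_elim (auto simp: A_def dist_real_def indicator_def)
   thus ?case by (rule tendsto_eventually)
  qed
  show "AE w in M. norm (indicator (A N) w :: real) \<le> 1" for N by (auto simp: indicator_def)
 qed auto
 thus ?thesis by (simp add: A_def)
qed

lemma level_tendsto_prob:
 assumes e: "\<epsilon> > 0"
 shows "(\<lambda>N. prob {w \<in> space M. \<bar>level N w / expectation (level N) - lim (\<lambda>N. chaos N w)\<bar> > \<epsilon>}) \<longlonglongrightarrow> 0"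
proof (rule Lim_null_comparison)
 note [measurable] = chaos_lim_measurable
 let ?A = "\<lambda>N. {w \<in> space M. \<bar>LINT x|unif. dev N x w\<bar> > \<epsilon> / 2}"
 let ?B = "\<lambda>N. {w \<in> space M. \<bar>chaos N w - lim (\<lambda>N. chaos N w)\<bar> > \<epsilon> / 2}"
 have "prob {w \<in> space M. \<bar>level N w / expectation (level N) - lim (\<lambda>N. chaos N w)\<bar> > \<epsilon>} \<le> prob (?A N) + prob (?B N)" for N
 proof -
  have tri: "\<bar>d - c\<bar> > \<epsilon> / 2 \<or> \<bar>c - m\<bar> > \<epsilon> / 2" if "\<bar>d - m\<bar> > \<epsilon>" for d c m :: real
   using that by linarith
  have [measurable]: "?A N \<in> sets M" unfolding integral_dev by measurable
  have [measurable]: "?B N \<in> sets M" by measurable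
  have "prob {w \<in> space M. \<bar>level N w / expectation (level N) - lim (\<lambda>N. chaos N w)\<bar> > \<epsilon>} \<le> prob (?A N \<union> ?B N)"
  proof (rule finite_measure_mono)
   show "{w \<in> space M. \<bar>level N w / expectation (level N) - lim (\<lambda>N. chaos N w)\<bar> > \<epsilon>} \<subseteq> ?A N \<union> ?B N"
   proof
    fix w assume w: "w \<in> {w \<in> space M. \<bar>level N w / expectation (level N) - lim (\<lambda>N. chaos N w)\<bar> > \<epsilon>}"
    hence "\<bar>LINT x|unif. dev N x w\<bar> > \<epsilon> / 2 \<or> \<bar>chaos N w - lim (\<lambda>N. chaos N w)\<bar> > \<epsilon> / 2"
     unfolding integral_dev using tri by blast
    thus "w \<in> ?A N \<union> ?B N" using w by blast
   qed
  qed measurable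
  also have "... \<le> prob (?A N) + prob (?B N)" by (rule measure_Un_le) measurable
  finally show ?thesis .
 qed
 thus "\<forall>\<^sub>F N in sequentially. norm (prob {w \<in> space M. \<bar>level N w / expectation (level N) - lim (\<lambda>N. chaos N w)\<bar> > \<epsilon>}) \<le> prob (?A N) + prob (?B N)"
  by (intro always_eventually) simp
 show "(\<lambda>N. prob (?A N) + prob (?B N)) \<longlonglongrightarrow> 0"
  using tendsto_add[OF dev_integral_tendsto_prob[of "\<epsilon> / 2"] chaos_tendsto_prob[of "\<epsilon> / 2"]] e by simp
qed

end

section \<open>Instantiation at the primes\<close>

theorem theorem1p1:
 fixes P :: "'a measure" and \<theta> :: "nat \<Rightarrow> 'a \<Rightarrow> real" and \<alpha> :: real
 assumes "prob_space P"
  and "prob_space.indep_vars P (\<lambda>_. borel) \<theta> {p. prime p}"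
  and "\<And>p. prime p \<Longrightarrow> distr P lborel (\<theta> p) = uniform_measure lborel {0..2 * pi}"
  and "0 < \<alpha>" and "\<alpha> < 2"
 shows "converges_in_probability P
      (\<lambda>N \<omega>. level_W \<theta> \<alpha> N \<omega> / prob_space.expectation P (level_W \<theta> \<alpha> N))
      (chaos_M P \<theta> \<alpha>)"
proof -
 interpret P: prob_space P by fact
 have ind: "P.indep_vars (\<lambda>_. borel) (\<lambda>j. \<theta> (prime_seq j)) {1..}"
 proof (rule P.indep_vars_inj_reindex[OF inj_on_prime_seq])
  show "P.indep_vars (\<lambda>_. borel) \<theta> (prime_seq ` {1..})"
   by (rule P.indep_vars_subset[OF assms(2)]) (use prime_prime_seq in auto)
 qed
 have p0: "real (prime_seq j) \<ge> 2" for j using prime_ge_2_nat[OF prime_prime_seq[of j]] by simp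
 interpret log_field P "\<lambda>j. \<theta> (prime_seq j)" "\<lambda>j. ln (real (prime_seq j))" "\<lambda>j. 1 / sqrt (real (prime_seq j))" 6000 \<alpha>
 proof unfold_locales
  show "P.indep_vars (\<lambda>_. borel) (\<lambda>j. \<theta> (prime_seq j)) {1..}" by (rule ind)
  show "distr P lborel (\<theta> (prime_seq j)) = uniform_measure lborel {0..2 * pi}" for j
   by (rule assms(3)[OF prime_prime_seq])
  show "0 < 1 / sqrt (real (prime_seq j))" "1 / sqrt (real (prime_seq j)) \<le> 1" for j
   using p0[of j] by simp_all
 qed (use assms prime_seq_S_bound prime_seq_D_upper prime_seq_D_lower summable_prime_seq_cube in auto)
 \<comment> \<open>The two products of cosines and sines in the field combine into one cosine of a
   difference.\<close>
 have X_eq: "field_X \<theta> N x w = X N x w" for N x w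
  unfolding field_X_def X_def cos_diff ..
 have W_eq: "level_W \<theta> \<alpha> N w = level N w" for N w
 proof -
  have [measurable]: "{x \<in> {0..1}. X N x w > lev N} \<in> sets borel" by measurable
  have "level N w = (LBINT x:{0..1}. step (X N x w - lev N))"
   unfolding level_def by (rule integral_unif) measurable
  also have "... = (LBINT x. indicator {x \<in> {0..1}. X N x w > lev N} x)"
   unfolding set_lebesgue_integral_def step_def by (intro Bochner_Integration.integral_cong refl) (auto simp: indicator_def)
  also have "... = measure lborel {x \<in> {0..1}. X N x w > lev N}" by simp
  finally show ?thesis by (simp add: level_W_def X_eq lev_def)
 qed
 have M_eq: "chaos_M_approx P \<theta> \<alpha> N w = chaos N w" for N w
 proof -
  have "chaos N w = (LBINT x:{0..1}. amp N x w)"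
   unfolding chaos_def amp_def by (rule integral_unif) measurable
  thus ?thesis by (simp add: chaos_M_approx_def X_eq amp_def expectation_exp_one)
 qed
 have W: "level_W \<theta> \<alpha> = level" by (intro ext W_eq)
 have chM: "chaos_M P \<theta> \<alpha> = (\<lambda>w. lim (\<lambda>N. chaos N w))"
  by (rule ext) (simp add: chaos_M_def M_eq)
 show ?thesis
  unfolding converges_in_probability_def W chM
  using level_tendsto_prob chaos_lim_measurable by auto
qed

end
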